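(* Through each point of $SL(2,\mathbf{O})$ there exists an eight-dimensional family of totally geodesic copies of $SL(2,\mathbf{H})$, parametrized by the quaternionic subalgebras of the octonions. That is, the set of quaternion subalgebras $\mathbf{H}'\subset\mathbf{O}$ is an $8$-dimensional manifold, and for each $\rho\in SL(2,\mathbf{O})$ and each $\mathbf{H}'$ the associated orbit $N_{\mathbf{H}'}(\rho)$ through $\rho$ is a submanifold of $SL(2,\mathbf{O})$ on which the corresponding group $Spin(5,1)\cong SL(2,\mathbf{H})$ acts simply transitively, it is totally geodesic for the invariant pseudo-Riemannian metric of $SL(2,\mathbf{O})$, and distinct $\mathbf{H}'$ give distinct submanifolds.
   Context: Let $S^+,S^-$ be the two real $8$-dimensional half-spin representations of $Spin(8)$, with invariant positive definite inner products $\langle\,,\rangle$, and Clifford multiplication $\mathbf{R}^8\otimes S^\pm\to S^\mp$ satisfying $x\cdot(y\cdot\varphi)+y\cdot(x\cdot\varphi)=-2\langle x,y\rangle\varphi$ and $\langle x\cdot\varphi^-,\varphi^+\rangle=-\langle\varphi^-,x\cdot\varphi^+\rangle$. For $\varphi^\pm\in S^\pm$ define $\varphi^+\cdot\varphi^-=\varphi^-\cdot\varphi^+\in\mathbf{R}^8$ by $\langle x,\varphi^+\cdot\varphi^-\rangle=\langle x\cdot\varphi^-,\varphi^+\rangle$ for all $x\in\mathbf{R}^8$. $\mathbf{T}$ is the real $16$-dimensional space of $S^+$-valued functions $\psi(\mathbf{x})=\mathbf{x}\cdot\varphi^-+\varphi^+$ on $\mathbf{R}^8$, $\mathbf{T}\cong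 S^-\oplus S^+$. The group $Spin(9,1)$ is the subgroup of $GL(\mathbf{T})$ generated by $(\varphi^-,\varphi^+)\mapsto(\varphi^-,\varphi^++a\cdot\varphi^-)$ and $(\varphi^-,\varphi^+)\mapsto(\varphi^-+a\cdot\varphi^+,\varphi^+)$, $a\in\mathbf{R}^8$. Its vector representation $V=\mathbf{R}^{9,1}$ is the space of functions $f(\mathbf{x})=a\Vert\mathbf{x}\Vert^2+\langle\mathbf{x},\mathbf{b}\rangle+c$ with $L(f,f)=\langle\mathbf{b},\mathbf{b}\rangle-4ac$; the action is characterized by $g\langle\psi,\psi\rangle=\langle g\psi,g\psi\rangle$ for $\psi\in\mathbf{T}$, where $\langle\psi,\psi\rangle\in V$ is the function $\mathbf{x}\mapsto\langle\psi(\mathbf{x}),\psi(\mathbf{x})\rangle$. For $\rho=(\psi_1,\psi_2)\in\mathbf{T}\otimes\mathbf{R}^2$, $\psi_a=\mathbf{x}\cdot\varphi_a^-+\varphi_a^+$, put $$\det\rho=\Vert\varphi_1^-\Vert^2\Vert\varphi_2^+\Vert^2+\Vert\varphi_2^-\Vert^2\Vert\varphi_1^+\Vert^2-2\langle\varphi_1^-\cdot\varphi_1^+,\varphi_2^-\cdot\varphi_2^+\rangle .$$ $SL(2,\mathbf{O})$ is the submanifold $\{\det\rho=1\}\subset\mathbf{T}\otimes\mathbf{R}^2$. The group $Spin(9,1)\times SL(2,\mathbf{R})$ ($SL(2,\mathbf{R})$ acting on the $\mathbf{R}^2$ factor) preserves $\det$ and acts transitively on $SL(2,\mathbf{O})$.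 The invariant pseudo-Riemannian metric on $SL(2,\mathbf{O})$ is the restriction to its tangent spaces of the Hessian (on the vector space $\mathbf{T}\otimes\mathbf{R}^2$) of $\log\det\rho$; it is $Spin(9,1)\times SL(2,\mathbf{R})$-invariant and nondegenerate. Totally geodesic is with respect to its Levi-Civita connection. $\mathbf{H}$ denotes the quaternions, and $Spin(5,1)\cong SL(2,\mathbf{H})$ is the group of $2\times 2$ quaternionic matrices whose determinant as $4\times4$ complex matrices is $1$. A copy of $SL(2,\mathbf{H})$ in $SL(2,\mathbf{O})$ means an orbit on which a subgroup $Spin(5,1)\subset Spin(9,1)$ acts freely. The copies associated to quaternion subalgebras are as follows. Let $\rho_0$ be a base point with $\varphi_1^+=0=\varphi_2^-$ and $\varphi_1^-,\varphi_2^+$ unit; let $\mathbf{e}=\varphi_1^-\cdot\varphi_2^+\in\mathbf{R}^8$, a unit vector with $\mathbf{e}\cdot\varphi_1^-=\varphi_2^+$. Identify $S^-$ isometrically with $\mathbf{O}$, with $\varphi_1^-$ corresponding to $1$, equivariantly for the stabilizer $G_2\subset Spin(8)$ of $\varphi_1^-,\varphi_2^+$ (acting on $\mathbf{O}$ by automorphisms). Identify $\mathbf{e}^\perp\subset\mathbf{R}^8$ with $\mathrm{Im}\,\mathbf{O}$ by $v\mapsto\beta$ where $v\cdot\varphi_1^-=\mathbf{e}\cdot\beta$. Then $V=\mathrm{Im}\,\mathbf{O}\oplus\mathbf{R}^{2,1}$, where $\mathrm{Im}\,\mathbf{O}$ consists of the functions $\langle\mathbf{x},\mathbf{b}\rangle$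 with $\mathbf{b}\in\mathbf{e}^\perp$ and $\mathbf{R}^{2,1}$ is spanned by $\Vert\mathbf{x}\Vert^2,\langle\mathbf{x},\mathbf{e}\rangle,1$. For a quaternion subalgebra $\mathbf{H}'\subset\mathbf{O}$ let $\mathbf{R}^{5,1}=\mathrm{Im}\,\mathbf{H}'\oplus\mathbf{R}^{2,1}\subset V$ and let $Spin(5,1)_{\mathbf{H}'}\subset Spin(9,1)$ be the connected subgroup with Lie algebra $\mathfrak{so}(\mathbf{R}^{5,1})\subset\mathfrak{so}(V)$. Set $N_{\mathbf{H}'}(\rho_0)=Spin(5,1)_{\mathbf{H}'}\cdot\rho_0$. For a general point $\rho\in SL(2,\mathbf{O})$ fix $g\in Spin(9,1)\times SL(2,\mathbf{R})$ with $\rho=g\rho_0$ and set $N_{\mathbf{H}'}(\rho)=g\,N_{\mathbf{H}'}(\rho_0)$, an orbit through $\rho$ of a conjugate subgroup. *)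

theory Defs
  imports "HOL-Analysis.Analysis" "HOL-Algebra.Generated_Groups"
begin

section \<open>Smooth maps and embedded submanifolds of finite-dimensional normed spaces\<close>

text \<open>The following two definitions are only used on finite-dimensional domains, where continuity
  of all iterated directional derivatives of order at most \<open>k\<close> is the usual notion of class \<open>C\<^sup>k\<close>.\<close>

primrec Ck_on :: "nat \<Rightarrow> 'a::real_normed_vector set \<Rightarrow> ('a \<Rightarrow> 'b::real_normed_vector) \<Rightarrow> bool" where
  "Ck_on 0 U f = continuous_on U f"
| "Ck_on (Suc k) U f = ((\<forall>x\<in>U. f differentiable at x) \<and>
      (\<forall>v. Ck_on k U (\<lambda>x. frechet_derivative f (at x) v)))"

definition smooth_on :: "'a::real_normed_vector set \<Rightarrow> ('a \<Rightarrow> 'b::real_normed_vector) \<Rightarrow> bool" where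
  "smooth_on U f \<longleftrightarrow> (\<forall>k. Ck_on k U f)"

definition smooth_submanifold :: "nat \<Rightarrow> 'a::real_normed_vector set \<Rightarrow> bool" where
  "smooth_submanifold k S \<longleftrightarrow>
    (\<forall>p\<in>S. \<exists>U V \<Phi> \<Psi> L.
       open U \<and> p \<in> U \<and> open V \<and>
       homeomorphism U V \<Phi> \<Psi> \<and> smooth_on U \<Phi> \<and> smooth_on V \<Psi> \<and>
       subspace (L :: 'a set) \<and> dim L = k \<and> \<Phi> ` (U \<inter> S) = V \<inter> L)"

definition tangent_space :: "'a::real_normed_vector set \<Rightarrow> 'a \<Rightarrow> 'a set" where
  "tangent_space M p = {v. \<exists>\<gamma> \<epsilon>. 0 < \<epsilon> \<and> smooth_on {-\<epsilon><..<\<epsilon>} \<gamma> \<and> \<gamma> ` {-\<epsilon><..<\<epsilon>} \<subseteq> M \<and>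
      \<gamma> (0::real) = p \<and> (\<gamma> has_vector_derivative v) (at 0)}"

definition hessian :: "('a::real_normed_vector \<Rightarrow> real) \<Rightarrow> 'a \<Rightarrow> 'a \<Rightarrow> 'a \<Rightarrow> real" where
  "hessian F p u v = frechet_derivative (\<lambda>q. frechet_derivative F (at q) u) (at p) v"


section \<open>Levi-Civita connection of a submanifold of a vector space\<close>

text \<open>Smooth functions and smooth tangent vector fields on an embedded submanifold \<open>M\<close> are
  represented by functions on the ambient space that are smooth on a neighbourhood of \<open>M\<close>; only
  their values on \<open>M\<close> matter.  The metric is given by a field \<open>B\<close> of bilinear forms on the ambient
  space, of which only the restriction to the tangent spaces of \<open>M\<close> matters.  Directional
  derivatives at \<open>p \<in> M\<close> are only taken along vectors tangent to \<open>M\<close>, so they do not depend on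
  the chosen extensions.\<close>

definition smooth_function :: "'a::real_normed_vector set \<Rightarrow> ('a \<Rightarrow> real) \<Rightarrow> bool" where
  "smooth_function M f \<longleftrightarrow> (\<exists>U. open U \<and> M \<subseteq> U \<and> smooth_on U f)"

definition tangent_field :: "'a::real_normed_vector set \<Rightarrow> ('a \<Rightarrow> 'a) \<Rightarrow> bool" where
  "tangent_field M X \<longleftrightarrow>
    (\<exists>U. open U \<and> M \<subseteq> U \<and> smooth_on U X) \<and> (\<forall>p\<in>M. X p \<in> tangent_space M p)"

definition lie_bracket :: "('a::real_normed_vector \<Rightarrow> 'a) \<Rightarrow> ('a \<Rightarrow> 'a) \<Rightarrow> 'a \<Rightarrow> 'a" where
  "lie_bracket X Y p = frechet_derivative Y (at p) (X p) - frechet_derivative X (at p) (Y p)"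

definition affine_connection ::
    "'a::real_normed_vector set \<Rightarrow> (('a \<Rightarrow> 'a) \<Rightarrow> ('a \<Rightarrow> 'a) \<Rightarrow> 'a \<Rightarrow> 'a) \<Rightarrow> bool" where
  "affine_connection M D \<longleftrightarrow>
    (\<forall>X Y. tangent_field M X \<longrightarrow> tangent_field M Y \<longrightarrow> tangent_field M (D X Y)) \<and>
    (\<forall>X X' Y f f'. tangent_field M X \<longrightarrow> tangent_field M X' \<longrightarrow> tangent_field M Y \<longrightarrow>
       smooth_function M f \<longrightarrow> smooth_function M f' \<longrightarrow>
       (\<forall>p\<in>M. D (\<lambda>q. f q *\<^sub>R X q + f' q *\<^sub>R X' q) Y p = f p *\<^sub>R D X Y p + f' p *\<^sub>R D X' Y p)) \<and>
    (\<forall>X Y Y'. tangent_field M X \<longrightarrow> tangent_field M Y \<longrightarrow> tangent_field M Y' \<longrightarrow>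
       (\<forall>p\<in>M. D X (\<lambda>q. Y q + Y' q) p = D X Y p + D X Y' p)) \<and>
    (\<forall>X Y f. tangent_field M X \<longrightarrow> tangent_field M Y \<longrightarrow> smooth_function M f \<longrightarrow>
       (\<forall>p\<in>M. D X (\<lambda>q. f q *\<^sub>R Y q) p
          = frechet_derivative f (at p) (X p) *\<^sub>R Y p + f p *\<^sub>R D X Y p))"

definition levi_civita_connection ::
    "'a::real_normed_vector set \<Rightarrow> ('a \<Rightarrow> 'a \<Rightarrow> 'a \<Rightarrow> real) \<Rightarrow>
     (('a \<Rightarrow> 'a) \<Rightarrow> ('a \<Rightarrow> 'a) \<Rightarrow> 'a \<Rightarrow> 'a) \<Rightarrow> bool" where
  "levi_civita_connection M B D \<longleftrightarrow>
    affine_connection M D \<and>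
    (\<forall>X Y. tangent_field M X \<longrightarrow> tangent_field M Y \<longrightarrow>
       (\<forall>p\<in>M. D X Y p - D Y X p = lie_bracket X Y p)) \<and>
    (\<forall>X Y Z. tangent_field M X \<longrightarrow> tangent_field M Y \<longrightarrow> tangent_field M Z \<longrightarrow>
       (\<forall>p\<in>M. frechet_derivative (\<lambda>q. B q (Y q) (Z q)) (at p) (X p)
          = B p (D X Y p) (Z p) + B p (Y p) (D X Z p)))"

text \<open>For a nondegenerate metric the values on \<open>M\<close> of the Levi-Civita connection exist and are
  unique; the quantifier over \<open>D\<close> only accounts for the irrelevant values off \<open>M\<close>.\<close>

definition totally_geodesic ::
    "'a::real_normed_vector set \<Rightarrow> ('a \<Rightarrow> 'a \<Rightarrow> 'a \<Rightarrow> real) \<Rightarrow> 'a set \<Rightarrow> bool" where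
  "totally_geodesic M B N \<longleftrightarrow>
    (\<forall>D. levi_civita_connection M B D \<longrightarrow>
      (\<forall>X Y. tangent_field M X \<longrightarrow> tangent_field M Y \<longrightarrow>
         (\<forall>p\<in>N. X p \<in> tangent_space N p \<and> Y p \<in> tangent_space N p) \<longrightarrow>
         (\<forall>p\<in>N. D X Y p \<in> tangent_space N p)))"


section \<open>Quaternions and octonions\<close>

text \<open>Both algebras arise by Cayley-Dickson doubling.  The pair \<open>(a, b)\<close> is the quaternion
  \<open>a + b j\<close>.  The inner product of the product types is the standard one.\<close>

type_synonym quat = "complex \<times> complex"
type_synonym octonion = "quat \<times> quat"

fun qmul :: "quat \<Rightarrow> quat \<Rightarrow> quat" where
  "qmul (a, b) (c, d) = (a * c - cnj d * b, d * a + b * cnj c)"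

fun qcnj :: "quat \<Rightarrow> quat" where
  "qcnj (a, b) = (cnj a, - b)"

definition qone :: quat where
  "qone = (1, 0)"

fun omul :: "octonion \<Rightarrow> octonion \<Rightarrow> octonion" where
  "omul (p, q) (r, s) = (qmul p r - qmul (qcnj s) q, qmul s p + qmul q (qcnj r))"

definition oone :: octonion where
  "oone = (qone, 0)"

definition octonion_automorphism :: "(octonion \<Rightarrow> octonion) \<Rightarrow> bool" where
  "octonion_automorphism \<alpha> \<longleftrightarrow>
    linear \<alpha> \<and> bij \<alpha> \<and> (\<forall>x y. \<alpha> (omul x y) = omul (\<alpha> x) (\<alpha> y))"

definition quaternion_subalgebra :: "octonion set \<Rightarrow> bool" where
  "quaternion_subalgebra H \<longleftrightarrow>
    (\<exists>f :: quat \<Rightarrow> octonion. linear f \<and> inj f \<and> f qone = oone \<and>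
       (\<forall>x y. f (qmul x y) = omul (f x) (f y)) \<and> H = range f)"

definition imaginary_part :: "octonion set \<Rightarrow> octonion set" where
  "imaginary_part H = {h\<in>H. h \<bullet> oone = 0}"

text \<open>A set of linear subspaces is viewed as a subset of the Grassmannian, which is embedded in the
  space of endomorphisms by sending a subspace to the orthogonal projection onto it.\<close>

definition orthogonal_projections ::
    "'a::euclidean_space set set \<Rightarrow> ('a \<Rightarrow>\<^sub>L 'a) set" where
  "orthogonal_projections \<H> =
    {P. \<exists>H\<in>\<H>. \<forall>x. blinfun_apply P x \<in> H \<and> (\<forall>y\<in>H. (x - blinfun_apply P x) \<bullet> y = 0)}"


section \<open>Linear groups\<close>

definition general_linear :: "('a::real_vector \<Rightarrow> 'a) monoid" where
  "general_linear = \<lparr>carrier = {f. linear f \<and> bij f}, monoid.mult = (\<circ>), one = id\<rparr>"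

definition lin_exp :: "('a::real_normed_vector \<Rightarrow> 'a) \<Rightarrow> 'a \<Rightarrow> 'a" where
  "lin_exp X v = (\<Sum>n. (X ^^ n) v /\<^sub>R fact n)"

text \<open>The image of \<open>a + b j\<close> under the standard embedding of the quaternions into the complex
  \<open>2 \<times> 2\<close> matrices.\<close>

definition quat_matrix :: "quat \<Rightarrow> complex^2^2" where
  "quat_matrix q = vector [vector [fst q, snd q], vector [- cnj (snd q), cnj (fst q)]]"

definition complexify :: "quat^2^2 \<Rightarrow> complex^(2 \<times> 2)^(2 \<times> 2)" where
  "complexify A = (\<chi> r s. quat_matrix (A $ fst r $ fst s) $ snd r $ snd s)"

definition SL2H :: "(quat^2^2) monoid" where
  "SL2H = \<lparr>carrier = {A. det (complexify A) = 1},
     monoid.mult = (\<lambda>A B. \<chi> i j. \<Sum>k\<in>UNIV. qmul (A $ i $ k) (B $ k $ j)),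
     one = (\<chi> i j. if i = j then qone else 0)\<rparr>"

text \<open>Isomorphism as topological groups (for Lie groups, equivalently as Lie groups).  On linear
  endomorphisms of a finite-dimensional space the topology of the function type is the usual one.\<close>

definition topological_group_iso ::
    "('a::topological_space) monoid \<Rightarrow> ('b::topological_space) monoid \<Rightarrow> bool" where
  "topological_group_iso G G' \<longleftrightarrow>
    (\<exists>\<Theta> \<Theta>'. \<Theta> \<in> iso G G' \<and> homeomorphism (carrier G) (carrier G') \<Theta> \<Theta>')"


section \<open>Half-spin representations of Spin(8)\<close>

text \<open>Below \<open>'m\<close> and \<open>'p\<close> are the spaces of negative and positive half-spinors, and
  \<open>cp x :: 'm \<Rightarrow> 'p\<close>, \<open>cm x :: 'p \<Rightarrow> 'm\<close> are the two Clifford multiplications by \<open>x\<close>.  By the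
  classification of modules over the Clifford algebra of an 8-dimensional space, the following
  properties determine these data up to isomorphism (and exchange of the two half-spin
  representations).\<close>

definition half_spin_clifford ::
    "(real^8 \<Rightarrow> 'm::euclidean_space \<Rightarrow> 'p::euclidean_space) \<Rightarrow> (real^8 \<Rightarrow> 'p \<Rightarrow> 'm) \<Rightarrow> bool" where
  "half_spin_clifford cp cm \<longleftrightarrow>
    DIM('m) = 8 \<and> DIM('p) = 8 \<and> bilinear cp \<and> bilinear cm \<and>
    (\<forall>x y \<phi>. cp x (cm y \<phi>) + cp y (cm x \<phi>) = (- 2 * (x \<bullet> y)) *\<^sub>R \<phi>) \<and>
    (\<forall>x y \<phi>. cm x (cp y \<phi>) + cm y (cp x \<phi>) = (- 2 * (x \<bullet> y)) *\<^sub>R \<phi>) \<and>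
    (\<forall>x \<phi>m \<phi>p. cp x \<phi>m \<bullet> \<phi>p = - (\<phi>m \<bullet> cm x \<phi>p))"

text \<open>\<open>spinor_product cp \<phi>m \<phi>p\<close> is the vector with
  \<open>x \<bullet> spinor_product cp \<phi>m \<phi>p = cp x \<phi>m \<bullet> \<phi>p\<close> for all \<open>x\<close>.\<close>

definition spinor_product ::
    "(real^8 \<Rightarrow> 'm::euclidean_space \<Rightarrow> 'p::euclidean_space) \<Rightarrow> 'm \<Rightarrow> 'p \<Rightarrow> real^8" where
  "spinor_product cp \<phi>m \<phi>p = adjoint (\<lambda>x. cp x \<phi>m) \<phi>p"

definition Spin8 ::
    "(real^8 \<Rightarrow> 'm::euclidean_space \<Rightarrow> 'p::euclidean_space) \<Rightarrow> (real^8 \<Rightarrow> 'p \<Rightarrow> 'm) \<Rightarrow>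
     ('m \<times> 'p \<Rightarrow> 'm \<times> 'p) set" where
  "Spin8 cp cm = generate general_linear
     {(\<lambda>(\<phi>m, \<phi>p). (cm x (cp y \<phi>m), cp x (cm y \<phi>p))) |x y. norm x = 1 \<and> norm y = 1}"

definition octonion_identification ::
    "(real^8 \<Rightarrow> 'm::euclidean_space \<Rightarrow> 'p::euclidean_space) \<Rightarrow> (real^8 \<Rightarrow> 'p \<Rightarrow> 'm) \<Rightarrow>
     'm \<Rightarrow> 'p \<Rightarrow> ('m \<Rightarrow> octonion) \<Rightarrow> bool" where
  "octonion_identification cp cm \<phi>1m \<phi>2p \<iota> \<longleftrightarrow>
    linear \<iota> \<and> bij \<iota> \<and> (\<forall>\<phi>. norm (\<iota> \<phi>) = norm \<phi>) \<and> \<iota> \<phi>1m = oone \<and>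
    (\<forall>h\<in>Spin8 cp cm. h (\<phi>1m, 0) = (\<phi>1m, 0) \<and> h (0, \<phi>2p) = (0, \<phi>2p) \<longrightarrow>
       (\<exists>\<alpha>. octonion_automorphism \<alpha> \<and> (\<forall>\<phi>. \<iota> (fst (h (\<phi>, 0))) = \<alpha> (\<iota> \<phi>))))"


section \<open>Spin(9,1) and SL(2,O)\<close>

text \<open>The pair \<open>(\<phi>m, \<phi>p) :: 'm \<times> 'p\<close> stands for the function \<open>x \<mapsto> cp x \<phi>m + \<phi>p\<close>, an element of
  the 16-dimensional spinor space of Spin(9,1).\<close>

fun spinor_fun ::
    "(real^8 \<Rightarrow> 'm::euclidean_space \<Rightarrow> 'p::euclidean_space) \<Rightarrow> 'm \<times> 'p \<Rightarrow> real^8 \<Rightarrow> 'p" where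
  "spinor_fun cp (\<phi>m, \<phi>p) x = cp x \<phi>m + \<phi>p"

definition Spin91 ::
    "(real^8 \<Rightarrow> 'm::euclidean_space \<Rightarrow> 'p::euclidean_space) \<Rightarrow> (real^8 \<Rightarrow> 'p \<Rightarrow> 'm) \<Rightarrow>
     ('m \<times> 'p \<Rightarrow> 'm \<times> 'p) set" where
  "Spin91 cp cm = generate general_linear
     ({(\<lambda>(\<phi>m, \<phi>p). (\<phi>m, \<phi>p + cp a \<phi>m)) |a. True} \<union>
      {(\<lambda>(\<phi>m, \<phi>p). (\<phi>m + cm a \<phi>p, \<phi>p)) |a. True})"

text \<open>The vector representation: \<open>(a, b, c)\<close> stands for the function \<open>vec_fun (a, b, c)\<close>.\<close>

type_synonym vec91 = "real \<times> (real^8) \<times> real"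

fun vec_fun :: "vec91 \<Rightarrow> real^8 \<Rightarrow> real" where
  "vec_fun (a, b, c) x = a * (norm x)\<^sup>2 + x \<bullet> b + c"

fun vec_form :: "vec91 \<Rightarrow> vec91 \<Rightarrow> real" where
  "vec_form (a, b, c) (a', b', c') = b \<bullet> b' - 2 * a * c' - 2 * a' * c"

definition spinor_square ::
    "(real^8 \<Rightarrow> 'm::euclidean_space \<Rightarrow> 'p::euclidean_space) \<Rightarrow> 'm \<times> 'p \<Rightarrow> vec91" where
  "spinor_square cp \<psi> = (THE f. \<forall>x. vec_fun f x = spinor_fun cp \<psi> x \<bullet> spinor_fun cp \<psi> x)"

definition vector_rep ::
    "(real^8 \<Rightarrow> 'm::euclidean_space \<Rightarrow> 'p::euclidean_space) \<Rightarrow>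
     ('m \<times> 'p \<Rightarrow> 'm \<times> 'p) \<Rightarrow> vec91 \<Rightarrow> vec91" where
  "vector_rep cp g =
    (THE A. linear A \<and> (\<forall>\<psi>. A (spinor_square cp \<psi>) = spinor_square cp (g \<psi>)))"

text \<open>The Lie algebra of Spin(9,1), and the relation saying that its element \<open>X\<close> acts as \<open>A\<close> in the
  derived vector representation.\<close>

definition spin91_algebra ::
    "(real^8 \<Rightarrow> 'm::euclidean_space \<Rightarrow> 'p::euclidean_space) \<Rightarrow> (real^8 \<Rightarrow> 'p \<Rightarrow> 'm) \<Rightarrow>
     ('m \<times> 'p \<Rightarrow> 'm \<times> 'p) set" where
  "spin91_algebra cp cm =
    {X. linear X \<and> (\<forall>t. lin_exp (\<lambda>\<psi>. t *\<^sub>R X \<psi>) \<in> Spin91 cp cm)}"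

definition derived_vector_rep ::
    "(real^8 \<Rightarrow> 'm::euclidean_space \<Rightarrow> 'p::euclidean_space) \<Rightarrow>
     ('m \<times> 'p \<Rightarrow> 'm \<times> 'p) \<Rightarrow> (vec91 \<Rightarrow> vec91) \<Rightarrow> bool" where
  "derived_vector_rep cp X A \<longleftrightarrow>
    (\<forall>f. ((\<lambda>t. vector_rep cp (lin_exp (\<lambda>\<psi>. t *\<^sub>R X \<psi>)) f) has_vector_derivative A f) (at 0))"

text \<open>\<open>so(W)\<close> for a nondegenerate subspace \<open>W\<close>, extended by zero on the orthogonal complement.\<close>

definition so_algebra :: "vec91 set \<Rightarrow> (vec91 \<Rightarrow> vec91) set" where
  "so_algebra W =
    {A. linear A \<and> (\<forall>f g. vec_form (A f) g + vec_form f (A g) = 0) \<and> A ` W \<subseteq> W \<and>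
        (\<forall>f. (\<forall>w\<in>W. vec_form f w = 0) \<longrightarrow> A f = 0)}"

definition spin_det ::
    "(real^8 \<Rightarrow> 'm::euclidean_space \<Rightarrow> 'p::euclidean_space) \<Rightarrow>
     ('m \<times> 'p) \<times> ('m \<times> 'p) \<Rightarrow> real" where
  "spin_det cp \<rho> = (case \<rho> of ((\<phi>1m, \<phi>1p), (\<phi>2m, \<phi>2p)) \<Rightarrow>
     (norm \<phi>1m)\<^sup>2 * (norm \<phi>2p)\<^sup>2 + (norm \<phi>2m)\<^sup>2 * (norm \<phi>1p)\<^sup>2
       - 2 * (spinor_product cp \<phi>1m \<phi>1p \<bullet> spinor_product cp \<phi>2m \<phi>2p))"

definition SL2O ::
    "(real^8 \<Rightarrow> 'm::euclidean_space \<Rightarrow> 'p::euclidean_space) \<Rightarrow>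
     (('m \<times> 'p) \<times> ('m \<times> 'p)) set" where
  "SL2O cp = {\<rho>. spin_det cp \<rho> = 1}"

definition SL2O_metric ::
    "(real^8 \<Rightarrow> 'm::euclidean_space \<Rightarrow> 'p::euclidean_space) \<Rightarrow>
     ('m \<times> 'p) \<times> ('m \<times> 'p) \<Rightarrow> ('m \<times> 'p) \<times> ('m \<times> 'p) \<Rightarrow> ('m \<times> 'p) \<times> ('m \<times> 'p) \<Rightarrow> real" where
  "SL2O_metric cp = hessian (\<lambda>\<rho>. ln (spin_det cp \<rho>))"

definition act ::
    "('m::euclidean_space \<times> 'p::euclidean_space \<Rightarrow> 'm \<times> 'p) \<Rightarrow> real^2^2 \<Rightarrow>
     ('m \<times> 'p) \<times> ('m \<times> 'p) \<Rightarrow> ('m \<times> 'p) \<times> ('m \<times> 'p)" where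
  "act g A \<rho> = (A $ 1 $ 1 *\<^sub>R g (fst \<rho>) + A $ 1 $ 2 *\<^sub>R g (snd \<rho>),
               A $ 2 $ 1 *\<^sub>R g (fst \<rho>) + A $ 2 $ 2 *\<^sub>R g (snd \<rho>))"


section \<open>Copies of SL(2,H) associated to quaternion subalgebras\<close>

definition base_point :: "'m::euclidean_space \<Rightarrow> 'p::euclidean_space \<Rightarrow> ('m \<times> 'p) \<times> ('m \<times> 'p)" where
  "base_point \<phi>1m \<phi>2p = ((\<phi>1m, 0), (0, \<phi>2p))"

text \<open>The subspace \<open>Im H \<oplus> R\<^sup>2\<^sup>,\<^sup>1\<close> of the vector representation, where \<open>v \<bottom> e\<close> corresponds to
  \<open>\<iota> \<beta>\<close> if \<open>cp v \<phi>1m = cp e \<beta>\<close>.\<close>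

definition R51 ::
    "(real^8 \<Rightarrow> 'm::euclidean_space \<Rightarrow> 'p::euclidean_space) \<Rightarrow>
     'm \<Rightarrow> 'p \<Rightarrow> ('m \<Rightarrow> octonion) \<Rightarrow> octonion set \<Rightarrow> vec91 set" where
  "R51 cp \<phi>1m \<phi>2p \<iota> H = (let e = spinor_product cp \<phi>1m \<phi>2p in
     {(a, v + s *\<^sub>R e, c) |a v s c.
        v \<bullet> e = 0 \<and> (\<exists>\<beta>. cp v \<phi>1m = cp e \<beta> \<and> \<iota> \<beta> \<in> imaginary_part H)})"

text \<open>The connected subgroup of Spin(9,1) with Lie algebra \<open>so(R51)\<close>: a connected Lie subgroup is
  generated by the exponentials of its Lie algebra.\<close>

definition Spin51 ::
    "(real^8 \<Rightarrow> 'm::euclidean_space \<Rightarrow> 'p::euclidean_space) \<Rightarrow> (real^8 \<Rightarrow> 'p \<Rightarrow> 'm) \<Rightarrow>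
     'm \<Rightarrow> 'p \<Rightarrow> ('m \<Rightarrow> octonion) \<Rightarrow> octonion set \<Rightarrow> ('m \<times> 'p \<Rightarrow> 'm \<times> 'p) set" where
  "Spin51 cp cm \<phi>1m \<phi>2p \<iota> H = generate general_linear
     {lin_exp X |X. X \<in> spin91_algebra cp cm \<and>
        (\<exists>A\<in>so_algebra (R51 cp \<phi>1m \<phi>2p \<iota> H). derived_vector_rep cp X A)}"

definition orbit_base ::
    "(real^8 \<Rightarrow> 'm::euclidean_space \<Rightarrow> 'p::euclidean_space) \<Rightarrow> (real^8 \<Rightarrow> 'p \<Rightarrow> 'm) \<Rightarrow>
     'm \<Rightarrow> 'p \<Rightarrow> ('m \<Rightarrow> octonion) \<Rightarrow> octonion set \<Rightarrow> (('m \<times> 'p) \<times> ('m \<times> 'p)) set" where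
  "orbit_base cp cm \<phi>1m \<phi>2p \<iota> H =
    {act h (mat 1) (base_point \<phi>1m \<phi>2p) |h. h \<in> Spin51 cp cm \<phi>1m \<phi>2p \<iota> H}"

definition conjugate_group :: "('a \<Rightarrow> 'a) \<Rightarrow> ('a \<Rightarrow> 'a) set \<Rightarrow> ('a \<Rightarrow> 'a) set" where
  "conjugate_group g K = {g \<circ> h \<circ> inv_into UNIV g |h. h \<in> K}"

text \<open>\<open>N\<close> is a copy of SL(2,H), via the subgroup \<open>K\<close> of Spin(9,1).\<close>

definition SL2H_copy ::
    "(real^8 \<Rightarrow> 'm::euclidean_space \<Rightarrow> 'p::euclidean_space) \<Rightarrow> (real^8 \<Rightarrow> 'p \<Rightarrow> 'm) \<Rightarrow>
     ('m \<times> 'p \<Rightarrow> 'm \<times> 'p) set \<Rightarrow> (('m \<times> 'p) \<times> ('m \<times> 'p)) set \<Rightarrow> bool" where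
  "SL2H_copy cp cm K N \<longleftrightarrow>
    subgroup K general_linear \<and> K \<subseteq> Spin91 cp cm \<and>
    topological_group_iso SL2H (general_linear\<lparr>carrier := K\<rparr>) \<and>
    N \<noteq> {} \<and> N \<subseteq> SL2O cp \<and>
    (\<forall>k\<in>K. \<forall>p\<in>N. act k (mat 1) p \<in> N) \<and>
    (\<forall>p\<in>N. \<forall>q\<in>N. \<exists>!k. k \<in> K \<and> act k (mat 1) p = q)"

end

theory Submission
  imports Defs
begin

text \<open>The determinant is a quartic form that measures two null vectors against each other:
\<open>-2 det \<rho> = L(\<langle>\<psi>\<^sub>1,\<psi>\<^sub>1\<rangle>, \<langle>\<psi>\<^sub>2,\<psi>\<^sub>2\<rangle>)\<close>.  It is therefore invariant under both groups, and
what is needed about its level set \<open>det = 1\<close> follows from homogeneity of degree 4 and from the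
nondegeneracy of the Hessian of its logarithm.

The copies of SL(2,H) are totally geodesic because they are fixed point sets.  In octonionic
coordinates adapted to a quaternion subalgebra, Clifford multiplication is the multiplication of
octonions, a point is a \<open>2 \<times> 2\<close> octonionic matrix, and the orbit of the base point
consists of the matrices of determinant 1 with quaternionic entries (\<open>orbit_eq\<close>).
The automorphism of the octonions that fixes the subalgebra and is \<open>-1\<close> on its complement, applied
to all entries, preserves the determinant.  It is an isometry with the orbit as fixed point set, and
Koszul's formula makes such a set totally geodesic (\<open>totally_geodesic_fixed\<close>).  For the same
reason the orbit is a level set of the determinant in a linear subspace of dimension 16, so its
dimension is 15 (\<open>submanifold_fixed_level\<close>).

The connected subgroup with Lie algebra \<open>so(R\<^sup>5\<^sup>,\<^sup>1)\<close> is the image of an explicit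
representation \<open>\<Theta>\<close> of SL(2,H) on pairs of octonions (\<open>G_eq\<close>).  A matrix acts on the quaternionic
half of the pair from the left, and through its inverse from the right on the other half.  The image contains no more because an
element of the Lie algebra of Spin(9,1) is determined by its action on vectors, and no less because
SL(2,H) is generated by elementary matrices.  On the quaternionic half the base point is the unit
matrix, hence the action on the orbit is simply transitive.

The identification \<open>\<iota>\<close> is only assumed to be compatible with the stabiliser of the two base
spinors.  This is enough, since the automorphism attached to a quaternion subalgebra is
a product of four unit vectors and so belongs to that stabiliser: \<open>\<iota>\<close> carries its fixed space to
a subalgebra (\<open>adapted_coordinates\<close>).

Finally, the octonion automorphisms move any quaternion subalgebra to the standard one, near which a
subspace is the graph of a linear map \<open>T\<close>.  The graph is a subalgebra exactly if \<open>T 1 = 0\<close> and \<open>T k\<close> is a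
certain rational function of \<open>T i\<close> and \<open>T j\<close> (\<open>graph_subalgebra\<close>).  The two free quaternions
\<open>T i\<close> and \<open>T j\<close> are the eight parameters.\<close>

section \<open>Smooth maps\<close>

lemma Ck_on_cong:
  assumes "open U" "\<And>x. x \<in> U \<Longrightarrow> f x = g x" "Ck_on k U f"
  shows "Ck_on k U g"
  using assms
proof (induction k arbitrary: f g)
  case 0
  then show ?case by (metis Ck_on.simps(1) continuous_on_cong)
next
  case (Suc k)
  have d: "f differentiable at x" if "x \<in> U" for x using Suc.prems that by simp
  have gd: "(g has_derivative frechet_derivative f (at x)) (at x)" if "x \<in> U" for x
    using has_derivative_transform_within_open[of f "frechet_derivative f (at x)" x UNIV U g] that Suc.prems
      d[OF that, unfolded frechet_derivative_works] by auto
  then have eq: "frechet_derivative g (at x) = frechet_derivative f (at x)" if "x \<in> U" for x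
    using that frechet_derivative_at by metis
  show ?case
  proof (simp, intro conjI ballI allI)
    show "g differentiable at x" if "x \<in> U" for x using gd[OF that] differentiableI by blast
    show "Ck_on k U (\<lambda>x. frechet_derivative g (at x) v)" for v
      by (rule Suc.IH[of "\<lambda>x. frechet_derivative f (at x) v"]) (use Suc.prems eq in auto)
  qed
qed

lemma Ck_on_SucI:
  assumes "open U" "\<And>x. x \<in> U \<Longrightarrow> (f has_derivative D x) (at x)" "\<And>v. Ck_on k U (\<lambda>x. D x v)"
  shows "Ck_on (Suc k) U f"
proof -
  have e: "frechet_derivative f (at x) = D x" if "x \<in> U" for x
    using frechet_derivative_at[OF assms(2)[OF that]] by simp
  have "Ck_on k U (\<lambda>x. frechet_derivative f (at x) v)" for v
    by (rule Ck_on_cong[OF assms(1) _ assms(3)[of v]]) (simp add: e)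
  then show ?thesis using assms(2) by (auto simp: differentiable_def)
qed

lemma Ck_on_SucD:
  assumes "Ck_on (Suc k) U f"
  shows "\<And>x. x \<in> U \<Longrightarrow> (f has_derivative frechet_derivative f (at x)) (at x)"
    and "\<And>v. Ck_on k U (\<lambda>x. frechet_derivative f (at x) v)"
  using assms by (auto simp: frechet_derivative_works[symmetric])

lemma Ck_on_subset: "Ck_on k U f \<Longrightarrow> V \<subseteq> U \<Longrightarrow> Ck_on k V f"
  by (induction k arbitrary: f) (auto intro: continuous_on_subset)

lemma Ck_on_Suc_imp: "Ck_on (Suc k) U f \<Longrightarrow> Ck_on k U f"
proof (induction k arbitrary: f)
  case 0
  then show ?case
    by (metis Ck_on.simps continuous_at_imp_continuous_on differentiable_imp_continuous_within)
next
  case (Suc k)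
  then show ?case unfolding Ck_on.simps(2)[of "Suc k"] by (subst Ck_on.simps(2)) blast
qed

lemma Ck_on_const [simp]: "Ck_on k U (\<lambda>x. c)"
  by (induction k arbitrary: c) auto

lemma Ck_on_linear:
  assumes "open U" "bounded_linear h" "Ck_on k U f"
  shows "Ck_on k U (\<lambda>x. h (f x))"
  using assms(3)
proof (induction k arbitrary: f)
  case 0
  then show ?case using assms(2) by (simp add: bounded_linear.continuous_on)
next
  case (Suc k)
  show ?case
    by (rule Ck_on_SucI[OF assms(1) bounded_linear.has_derivative[OF assms(2) Ck_on_SucD(1)[OF Suc.prems]]])
      (use Suc.IH Ck_on_SucD(2)[OF Suc.prems] in auto)
qed

lemma Ck_on_bounded_linear:
  assumes "open U" "bounded_linear h"
  shows "Ck_on k U h"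
proof (cases k)
  case 0
  then show ?thesis using assms by (simp add: linear_continuous_on)
next
  case (Suc n)
  then show ?thesis
    using Ck_on_SucI[OF assms(1) bounded_linear_imp_has_derivative[OF assms(2)], of n] by simp
qed

lemma Ck_on_add:
  assumes "open U" "Ck_on k U f" "Ck_on k U g"
  shows "Ck_on k U (\<lambda>x. f x + g x)"
  using assms(2-)
proof (induction k arbitrary: f g)
  case 0
  then show ?case by (auto intro: continuous_intros)
next
  case (Suc k)
  show ?case
    by (rule Ck_on_SucI[OF assms(1) has_derivative_add[OF Ck_on_SucD(1)[OF Suc.prems(1)] Ck_on_SucD(1)[OF Suc.prems(2)]]])
      (use Suc.IH Ck_on_SucD(2)[OF Suc.prems(1)] Ck_on_SucD(2)[OF Suc.prems(2)] in auto)
qed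

lemma Ck_on_bilinear:
  assumes "open U" "bounded_bilinear h" "Ck_on k U f" "Ck_on k U g"
  shows "Ck_on k U (\<lambda>x. h (f x) (g x))"
  using assms(3-)
proof (induction k arbitrary: f g)
  case 0
  then show ?case using assms(2) by (simp add: bounded_bilinear.continuous_on)
next
  case (Suc k)
  note lower = Suc.prems[THEN Ck_on_Suc_imp]
  note D = Ck_on_SucD[OF Suc.prems(1)] Ck_on_SucD[OF Suc.prems(2)]
  show ?case
    by (rule Ck_on_SucI[OF assms(1) bounded_bilinear.FDERIV[OF assms(2) D(1) D(3)]])
      (auto intro!: Ck_on_add assms(1) Suc.IH lower D(2,4) simp del: Ck_on.simps)
qed

lemma Ck_on_precompose:
  assumes "open U" "open V" "bounded_linear h" "\<And>x. x \<in> V \<Longrightarrow> h x \<in> U" "Ck_on k U f"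
  shows "Ck_on k V (\<lambda>x. f (h x))"
  using assms(5)
proof (induction k arbitrary: f)
  case 0
  have "continuous_on V h" by (rule linear_continuous_on[OF assms(3)])
  with 0 assms(4) show ?case by (auto intro: continuous_on_compose2)
next
  case (Suc k)
  have d: "((\<lambda>x. f (h x)) has_derivative (\<lambda>v. frechet_derivative f (at (h x)) (h v))) (at x)" if "x \<in> V" for x
    using has_derivative_compose[OF bounded_linear_imp_has_derivative[OF assms(3)] Ck_on_SucD(1)[OF Suc.prems assms(4)[OF that]]] .
  show ?case
    by (rule Ck_on_SucI[OF assms(2) d]) (use Suc Ck_on_SucD(2)[OF Suc.prems] in auto)
qed

lemma smooth_onI: "(\<And>k. Ck_on k U f) \<Longrightarrow> smooth_on U f"
  and smooth_onD: "smooth_on U f \<Longrightarrow> Ck_on k U f"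
  by (auto simp: smooth_on_def)

lemma smooth_on_cong: "open U \<Longrightarrow> smooth_on U f \<Longrightarrow> (\<And>x. x \<in> U \<Longrightarrow> f x = g x) \<Longrightarrow> smooth_on U g"
  unfolding smooth_on_def using Ck_on_cong by blast

lemma smooth_on_subset: "smooth_on U f \<Longrightarrow> V \<subseteq> U \<Longrightarrow> smooth_on V f"
  unfolding smooth_on_def using Ck_on_subset by blast

lemma smooth_on_const [simp]: "smooth_on U (\<lambda>x. c)" by (simp add: smooth_on_def)

lemma smooth_on_linear: "open U \<Longrightarrow> bounded_linear h \<Longrightarrow> smooth_on U f \<Longrightarrow> smooth_on U (\<lambda>x. h (f x))"
  by (simp add: smooth_on_def Ck_on_linear)

lemma smooth_on_bounded_linear: "open U \<Longrightarrow> bounded_linear h \<Longrightarrow> smooth_on U h"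
  by (simp add: smooth_on_def Ck_on_bounded_linear)

lemma smooth_on_ident: "open U \<Longrightarrow> smooth_on U (\<lambda>x. x)"
  by (simp add: smooth_on_bounded_linear bounded_linear_ident)

lemma smooth_on_add: "open U \<Longrightarrow> smooth_on U f \<Longrightarrow> smooth_on U g \<Longrightarrow> smooth_on U (\<lambda>x. f x + g x)"
  by (simp add: smooth_on_def Ck_on_add)

lemma smooth_on_diff: "open U \<Longrightarrow> smooth_on U f \<Longrightarrow> smooth_on U g \<Longrightarrow> smooth_on U (\<lambda>x. f x - g x)"
  unfolding diff_conv_add_uminus
  by (intro smooth_on_add smooth_on_linear[OF _ bounded_linear_minus[OF bounded_linear_ident]])

lemma smooth_on_bilinear:
  "open U \<Longrightarrow> bounded_bilinear h \<Longrightarrow> smooth_on U f \<Longrightarrow> smooth_on U g \<Longrightarrow> smooth_on U (\<lambda>x. h (f x) (g x))"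
  by (simp add: smooth_on_def Ck_on_bilinear)

lemma smooth_on_scaleR: "open U \<Longrightarrow> smooth_on U f \<Longrightarrow> smooth_on U g \<Longrightarrow> smooth_on U (\<lambda>x. f x *\<^sub>R g x)"
  by (rule smooth_on_bilinear[OF _ bounded_bilinear_scaleR])

lemma smooth_on_mult:
  fixes f g :: "'a::real_normed_vector \<Rightarrow> real"
  shows "open U \<Longrightarrow> smooth_on U f \<Longrightarrow> smooth_on U g \<Longrightarrow> smooth_on U (\<lambda>x. f x * g x)"
  by (rule smooth_on_bilinear[OF _ bounded_bilinear_mult])

lemma smooth_on_precompose:
  "open U \<Longrightarrow> open V \<Longrightarrow> bounded_linear h \<Longrightarrow> (\<And>x. x \<in> V \<Longrightarrow> h x \<in> U) \<Longrightarrow> smooth_on U f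
    \<Longrightarrow> smooth_on V (\<lambda>x. f (h x))"
  unfolding smooth_on_def using Ck_on_precompose by blast

lemma smooth_on_imp_continuous_on: "smooth_on U f \<Longrightarrow> continuous_on U f"
  using smooth_onD[of U f 0] by simp

lemma smooth_on_has_derivative:
  "smooth_on U f \<Longrightarrow> x \<in> U \<Longrightarrow> (f has_derivative frechet_derivative f (at x)) (at x)"
  using Ck_on_SucD(1)[OF smooth_onD[of U f "Suc 0"]] .

lemma Ck_on_powr:
  fixes f :: "'a::real_normed_vector \<Rightarrow> real"
  assumes "open U" "\<And>x. x \<in> U \<Longrightarrow> f x > 0" "Ck_on k U f"
  shows "Ck_on k U (\<lambda>x. f x powr a)"
  using assms(3)
proof (induction k arbitrary: a)
  case 0
  show ?case using 0 assms(2) by (auto intro!: continuous_on_powr' simp: less_imp_le) (use assms(2) in force)+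
next
  case (Suc k)
  have d: "((\<lambda>x. f x powr a) has_derivative (\<lambda>v. (a * f x powr (a - 1)) * frechet_derivative f (at x) v)) (at x)"
    if "x \<in> U" for x
  proof -
    have "((\<lambda>y. y powr a) has_real_derivative a * f x powr (a - 1)) (at (f x))"
      using assms(2)[OF that] by (auto intro!: derivative_eq_intros)
    from has_derivative_compose[OF Ck_on_SucD(1)[OF Suc.prems that] this[unfolded has_field_derivative_def]]
    show ?thesis by simp
  qed
  have "Ck_on k U (\<lambda>x. a * f x powr (a - 1) * frechet_derivative f (at x) v)" for v
    by (intro Ck_on_bilinear[OF assms(1) bounded_bilinear_mult] Ck_on_const Suc.IH
        Ck_on_Suc_imp[OF Suc.prems] Ck_on_SucD(2)[OF Suc.prems])
  with d show ?case by (intro Ck_on_SucI[OF assms(1)])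
qed

lemma smooth_on_powr:
  fixes f :: "'a::real_normed_vector \<Rightarrow> real"
  shows "open U \<Longrightarrow> smooth_on U f \<Longrightarrow> (\<And>x. x \<in> U \<Longrightarrow> f x > 0) \<Longrightarrow> smooth_on U (\<lambda>x. f x powr a)"
  by (simp add: smooth_on_def Ck_on_powr)

lemma smooth_on_divide:
  fixes f g :: "'a::real_normed_vector \<Rightarrow> real"
  assumes "open U" "smooth_on U f" "smooth_on U g" "\<And>x. x \<in> U \<Longrightarrow> g x > 0"
  shows "smooth_on U (\<lambda>x. f x / g x)"
  by (rule smooth_on_cong[OF assms(1) smooth_on_mult[OF assms(1,2) smooth_on_powr[OF assms(1,3,4), of "-1"]]])
    (use assms(4) in \<open>auto simp: powr_minus_divide less_imp_le powr_one\<close>)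

section \<open>Composition algebras\<close>

locale composition_algebra =
  fixes mult :: "'a::euclidean_space \<Rightarrow> 'a \<Rightarrow> 'a" (infixl "\<odot>" 70) and u :: 'a
  assumes bilinear_mult: "bilinear mult"
    and mult_unit_left [simp]: "u \<odot> x = x" and mult_unit_right [simp]: "x \<odot> u = x"
    and norm_mult: "norm (x \<odot> y) = norm x * norm y"
    and unit_nz: "u \<noteq> 0"
begin

lemma mult_add_left: "(x + y) \<odot> z = x \<odot> z + y \<odot> z"
  and mult_add_right: "z \<odot> (x + y) = z \<odot> x + z \<odot> y"
  and mult_diff_left: "(x - y) \<odot> z = x \<odot> z - y \<odot> z"
  and mult_diff_right: "z \<odot> (x - y) = z \<odot> x - z \<odot> y"
  and mult_scaleR_left [simp]: "(c *\<^sub>R x) \<odot> y = c *\<^sub>R (x \<odot> y)"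
  and mult_scaleR_right [simp]: "x \<odot> (c *\<^sub>R y) = c *\<^sub>R (x \<odot> y)"
  and mult_minus_left [simp]: "(- x) \<odot> y = - (x \<odot> y)"
  and mult_minus_right [simp]: "x \<odot> (- y) = - (x \<odot> y)"
  and mult_zero_left [simp]: "0 \<odot> x = 0"
  and mult_zero_right [simp]: "x \<odot> 0 = 0"
  using bilinear_mult
  by (simp_all add: bilinear_ladd bilinear_radd bilinear_lsub bilinear_rsub bilinear_lmul bilinear_rmul
      bilinear_lneg bilinear_rneg bilinear_lzero bilinear_rzero)

lemma norm_unit [simp]: "norm u = 1"
  using norm_mult[of u u] unit_nz by simp

lemma inner_unit_unit [simp]: "u \<bullet> u = 1"
  by (simp add: dot_square_norm)

lemma inner_mult_self: "(x \<odot> y) \<bullet> (x \<odot> y) = (x \<bullet> x) * (y \<bullet> y)"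
  by (simp add: dot_square_norm norm_mult power_mult_distrib)

lemma inner_mult_left_same: "(x \<odot> y) \<bullet> (x \<odot> z) = (x \<bullet> x) * (y \<bullet> z)"
  using inner_mult_self[of x "y + z"]
  by (simp add: mult_add_right inner_add inner_mult_self algebra_simps inner_commute)

lemma inner_mult_right_same: "(x \<odot> y) \<bullet> (z \<odot> y) = (x \<bullet> z) * (y \<bullet> y)"
  using inner_mult_self[of "x + z" y]
  by (simp add: mult_add_left inner_add inner_mult_self algebra_simps inner_commute)

lemma inner_exchange: "(x \<odot> y) \<bullet> (w \<odot> z) + (x \<odot> z) \<bullet> (w \<odot> y) = 2 * (x \<bullet> w) * (y \<bullet> z)"
  using inner_mult_right_same[of x "y + z" w]
  by (simp add: mult_add_right inner_add inner_mult_right_same algebra_simps inner_commute)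

definition conj :: "'a \<Rightarrow> 'a" where "conj x = (2 * (x \<bullet> u)) *\<^sub>R u - x"

lemma inner_mult_conj_left: "(x \<odot> y) \<bullet> z = y \<bullet> (conj x \<odot> z)"
  using inner_exchange[of x y u z]
  by (simp add: conj_def mult_diff_left inner_diff inner_commute algebra_simps)

lemma inner_mult_conj_right: "(x \<odot> y) \<bullet> z = x \<bullet> (z \<odot> conj y)"
  using inner_exchange[of x y z u]
  by (simp add: conj_def mult_diff_right inner_diff inner_commute algebra_simps)

lemma conj_mult_cancel: "conj x \<odot> (x \<odot> y) = (x \<bullet> x) *\<^sub>R y"
proof (rule vector_eq_ldot[THEN iffD1], rule allI)
  fix z
  show "z \<bullet> (conj x \<odot> (x \<odot> y)) = z \<bullet> ((x \<bullet> x) *\<^sub>R y)"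
    using inner_mult_left_same[of x z y] by (simp add: inner_mult_conj_left[symmetric])
qed

text \<open>Imaginary elements anticommute up to their inner product, and left multiplication by them
  squares to a scalar.\<close>

lemma imaginary_square_left: "x \<bullet> u = 0 \<Longrightarrow> x \<odot> (x \<odot> y) = - (x \<bullet> x) *\<^sub>R y"
  using conj_mult_cancel[of x y] by (simp add: conj_def) (metis minus_minus)

lemma imaginary_anticommute_left:
  assumes "x \<bullet> u = 0" "y \<bullet> u = 0"
  shows "x \<odot> (y \<odot> z) + y \<odot> (x \<odot> z) = (- 2 * (x \<bullet> y)) *\<^sub>R z"
proof -
  have "(x + y) \<odot> ((x + y) \<odot> z) = - ((x + y) \<bullet> (x + y)) *\<^sub>R z"
    by (rule imaginary_square_left) (simp add: assms inner_add)
  then have "x \<odot> (x \<odot> z) + y \<odot> (y \<odot> z) + (x \<odot> (y \<odot> z) + y \<odot> (x \<odot> z))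
      = (- (x \<bullet> x) - (y \<bullet> y) - 2 * (x \<bullet> y)) *\<^sub>R z"
    by (simp add: mult_add_left mult_add_right inner_add algebra_simps inner_commute[of y x])
  then have "x \<odot> (y \<odot> z) + y \<odot> (x \<odot> z) + (2 * (x \<bullet> y)) *\<^sub>R z = 0"
    by (simp add: imaginary_square_left assms algebra_simps)
  then show ?thesis by (simp add: eq_neg_iff_add_eq_0)
qed

lemma conj_mult: "conj (x \<odot> y) = conj y \<odot> conj x"
proof (rule vector_eq_ldot[THEN iffD1], rule allI)
  fix z
  have c: "a \<bullet> conj b = conj a \<bullet> b" for a b
    by (simp add: conj_def inner_diff inner_commute)
  have s: "conj (conj a) = a" for a by (simp add: conj_def inner_diff)
  have "z \<bullet> (conj y \<odot> conj x) = (y \<odot> z) \<bullet> conj x" by (simp add: inner_mult_conj_left)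
  also have "\<dots> = u \<bullet> (conj x \<odot> conj (y \<odot> z))"
    using inner_mult_conj_right[of u "y \<odot> z" "conj x"] by (simp add: inner_commute)
  also have "\<dots> = x \<bullet> conj (y \<odot> z)" using inner_mult_conj_left[of x u "conj (y \<odot> z)"] by simp
  also have "\<dots> = conj x \<bullet> (y \<odot> z)" by (simp add: c)
  also have "\<dots> = y \<bullet> (conj x \<odot> conj z)" using inner_mult_conj_right[of y z "conj x"] by (simp add: inner_commute)
  also have "\<dots> = (x \<odot> y) \<bullet> conj z" by (simp add: inner_mult_conj_left)
  also have "\<dots> = z \<bullet> conj (x \<odot> y)" using c[of "x \<odot> y" z] by (simp add: inner_commute)
  finally show "z \<bullet> conj (x \<odot> y) = z \<bullet> (conj y \<odot> conj x)" by simp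
qed

lemma conj_imaginary: "x \<bullet> u = 0 \<Longrightarrow> conj x = - x" by (simp add: conj_def)

text \<open>The Cayley-Dickson multiplication rules hold for any element \<open>e\<close> orthogonal to the products
  involved.  They follow from the exchange law for inner products alone.\<close>

lemma doubling_right:
  assumes "e \<bullet> u = 0" "e \<bullet> b = 0"
  shows "b \<odot> e = e \<odot> conj b"
proof -
  have "conj (b \<odot> e) = conj e \<odot> conj b" by (rule conj_mult)
  moreover have "(b \<odot> e) \<bullet> u = 0"
    using inner_mult_conj_right[of b e u] assms by (simp add: conj_imaginary inner_commute)
  ultimately show ?thesis using assms by (simp add: conj_imaginary)
qed

lemma doubling_1:
  assumes "e \<bullet> u = 0" "e \<bullet> a = 0" "e \<bullet> b = 0" "e \<bullet> (b \<odot> a) = 0"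
  shows "a \<odot> (b \<odot> e) = (b \<odot> a) \<odot> e"
proof (rule vector_eq_ldot[THEN iffD1], rule allI)
  fix z
  have cc: "conj (conj x) = x" for x by (simp add: conj_def inner_diff)
  have eb: "e \<bullet> conj a = 0" "e \<bullet> conj b = 0" using assms by (simp_all add: conj_def inner_diff)
  have "z \<bullet> (a \<odot> (b \<odot> e)) = (conj a \<odot> z) \<bullet> (b \<odot> e)"
    using inner_mult_conj_left[of a "b \<odot> e" z] by (simp add: inner_commute)
  also have "\<dots> = (b \<odot> e) \<bullet> (conj a \<odot> z)" by (simp add: inner_commute)
  also have "\<dots> = - ((b \<odot> z) \<bullet> (conj a \<odot> e)) + 2 * (b \<bullet> conj a) * (e \<bullet> z)"
    using inner_exchange[of b e "conj a" z] by simp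
  also have "(b \<odot> z) \<bullet> (conj a \<odot> e) = (b \<odot> z) \<bullet> (e \<odot> a)"
    using doubling_right[OF assms(1) eb(1)] by (simp add: cc)
  finally have 1: "z \<bullet> (a \<odot> (b \<odot> e)) = 2 * (b \<bullet> conj a) * (e \<bullet> z) - (b \<odot> z) \<bullet> (e \<odot> a)" by simp
  have "(b \<odot> z) \<bullet> (e \<odot> a) + (b \<odot> a) \<bullet> (e \<odot> z) = 2 * (b \<bullet> e) * (z \<bullet> a)" by (rule inner_exchange)
  then have 2: "(b \<odot> z) \<bullet> (e \<odot> a) = - ((b \<odot> a) \<bullet> (e \<odot> z))" using assms by (simp add: inner_commute)
  have 3: "(b \<odot> a) \<bullet> (e \<odot> z) = - ((e \<odot> (b \<odot> a)) \<bullet> z)"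
    using inner_mult_conj_left[of e "b \<odot> a" z] assms by (simp add: conj_imaginary)
  have "e \<odot> (b \<odot> a) = conj (b \<odot> a) \<odot> e"
    using doubling_right[of e "conj (b \<odot> a)"] assms by (simp add: cc) (simp add: conj_def inner_diff)
  moreover have "conj (b \<odot> a) = (2 * (b \<bullet> conj a)) *\<^sub>R u - b \<odot> a"
    using inner_mult_conj_right[of b a u] by (simp add: conj_def)
  ultimately have "e \<odot> (b \<odot> a) = (2 * (b \<bullet> conj a)) *\<^sub>R e - (b \<odot> a) \<odot> e" by (simp add: mult_diff_left)
  then show "z \<bullet> (a \<odot> (b \<odot> e)) = z \<bullet> ((b \<odot> a) \<odot> e)"
    using 1 2 3 by (simp add: inner_diff inner_commute)
qed

lemma conj_conj [simp]: "conj (conj x) = x" by (simp add: conj_def inner_diff)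

lemma conj_add: "conj (x + y) = conj x + conj y" and conj_minus: "conj (- x) = - conj x"
  by (simp_all add: conj_def inner_add algebra_simps)

lemma inner_conj_zero: "e \<bullet> u = 0 \<Longrightarrow> e \<bullet> conj b = 0 \<longleftrightarrow> e \<bullet> b = 0"
  by (simp add: conj_def inner_diff)

lemma mult_e_imaginary: "e \<bullet> u = 0 \<Longrightarrow> e \<bullet> b = 0 \<Longrightarrow> (b \<odot> e) \<bullet> u = 0"
  using inner_mult_conj_right[of b e u] by (simp add: conj_imaginary inner_commute)

lemma doubling_2:
  assumes "e \<bullet> u = 0" "e \<bullet> a = 0" "e \<bullet> b = 0" "e \<bullet> (a \<odot> conj b) = 0"
  shows "(a \<odot> e) \<odot> b = (a \<odot> conj b) \<odot> e"
proof -
  have "conj ((a \<odot> e) \<odot> b) = conj b \<odot> conj (a \<odot> e)" by (rule conj_mult)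
  also have "\<dots> = - (conj b \<odot> (a \<odot> e))" using mult_e_imaginary[OF assms(1,2)] by (simp add: conj_imaginary)
  also have "conj b \<odot> (a \<odot> e) = (a \<odot> conj b) \<odot> e"
    using doubling_1[of e "conj b" a] assms by (simp add: inner_conj_zero)
  finally have "(a \<odot> e) \<odot> b = conj (- ((a \<odot> conj b) \<odot> e))" by (metis conj_conj)
  then show ?thesis using mult_e_imaginary[OF assms(1,4)] by (simp add: conj_imaginary conj_minus)
qed

lemma doubling_3:
  assumes "e \<bullet> u = 0" "norm e = 1" "e \<bullet> a = 0" "e \<bullet> b = 0" "e \<bullet> (b \<odot> a) = 0"
  shows "(a \<odot> e) \<odot> (b \<odot> e) = - (conj b \<odot> a)"
proof (rule vector_eq_ldot[THEN iffD1], rule allI)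
  fix z
  have ee: "e \<bullet> e = 1" using assms by (simp add: dot_square_norm)
  have ez: "e \<bullet> conj b = 0" "e \<bullet> conj a = 0" using assms by (simp_all add: inner_conj_zero)
  have "z \<bullet> ((a \<odot> e) \<odot> (b \<odot> e)) = (a \<odot> e) \<bullet> (z \<odot> conj (b \<odot> e))"
    using inner_mult_conj_right[of "a \<odot> e" "b \<odot> e" z] by (simp add: inner_commute)
  also have "\<dots> = - ((a \<odot> e) \<bullet> (z \<odot> (e \<odot> conj b)))"
    using mult_e_imaginary[OF assms(1,4)] doubling_right[OF assms(1,4)] by (simp add: conj_imaginary)
  also have "\<dots> = (a \<odot> (e \<odot> conj b)) \<bullet> (z \<odot> e) - 2 * (a \<bullet> z) * (e \<bullet> (e \<odot> conj b))"
    using inner_exchange[of a e z "e \<odot> conj b"] by simp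
  also have "e \<bullet> (e \<odot> conj b) = u \<bullet> b"
    using inner_mult_left_same[of e u "conj b"] ee by (simp add: conj_def inner_diff inner_commute)
  also have "a \<odot> (e \<odot> conj b) = (b \<odot> a) \<odot> e"
    using doubling_right[OF assms(1,4)] doubling_1[OF assms(1,3,4,5)] by simp
  finally show "z \<bullet> ((a \<odot> e) \<odot> (b \<odot> e)) = z \<bullet> (- (conj b \<odot> a))"
    using ee by (simp add: inner_mult_right_same conj_def mult_diff_left inner_diff inner_commute)
qed

lemma imaginary_square: "x \<bullet> u = 0 \<Longrightarrow> x \<odot> x = - (x \<bullet> x) *\<^sub>R u"
  using imaginary_square_left[of x u] by simp

lemma imaginary_anticommute: "x \<bullet> u = 0 \<Longrightarrow> y \<bullet> u = 0 \<Longrightarrow> x \<odot> y + y \<odot> x = (- 2 * (x \<bullet> y)) *\<^sub>R u"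
  using imaginary_anticommute_left[of x y u] by simp

definition quat_map :: "'a \<Rightarrow> 'a \<Rightarrow> quat \<Rightarrow> 'a" where
  "quat_map i j p = Re (fst p) *\<^sub>R u + Im (fst p) *\<^sub>R i + Re (snd p) *\<^sub>R j + Im (snd p) *\<^sub>R (i \<odot> j)"

lemma quat_map_linear: "linear (quat_map i j)"
  by (rule linearI) (simp_all add: quat_map_def algebra_simps)

definition quat_frame :: "'a \<Rightarrow> 'a \<Rightarrow> bool" where
  "quat_frame i j \<longleftrightarrow> norm i = 1 \<and> norm j = 1 \<and> i \<bullet> u = 0 \<and> j \<bullet> u = 0 \<and> i \<bullet> j = 0"

context
  fixes i j assumes fr: "quat_frame i j"
begin

lemma frame: "i \<bullet> i = 1" "j \<bullet> j = 1" "i \<bullet> u = 0" "j \<bullet> u = 0" "i \<bullet> j = 0" "u \<bullet> i = 0" "u \<bullet> j = 0" "j \<bullet> i = 0"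
  using fr by (auto simp: quat_frame_def dot_square_norm inner_commute)

lemma frame_k: "(i \<odot> j) \<bullet> u = 0" "(i \<odot> j) \<bullet> i = 0" "(i \<odot> j) \<bullet> j = 0" "(i \<odot> j) \<bullet> (i \<odot> j) = 1"
  using inner_mult_conj_left[of i j u] inner_mult_left_same[of i j u] inner_mult_right_same[of i j u]
    inner_mult_self[of i j]
  by (simp_all add: frame conj_imaginary)

lemma frame_k': "u \<bullet> (i \<odot> j) = 0" "i \<bullet> (i \<odot> j) = 0" "j \<bullet> (i \<odot> j) = 0"
  using frame_k by (simp_all add: inner_commute)

lemma frame_mult:
  "i \<odot> i = - u" "j \<odot> j = - u" "(i \<odot> j) \<odot> (i \<odot> j) = - u" "j \<odot> i = - (i \<odot> j)"
  "i \<odot> (i \<odot> j) = - j" "(i \<odot> j) \<odot> i = j" "j \<odot> (i \<odot> j) = i" "(i \<odot> j) \<odot> j = - i"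
proof -
  show "i \<odot> i = - u" "j \<odot> j = - u" "(i \<odot> j) \<odot> (i \<odot> j) = - u"
    by (simp_all add: imaginary_square frame frame_k)
  show ji: "j \<odot> i = - (i \<odot> j)"
    using imaginary_anticommute[of i j] by (simp add: frame add_eq_0_iff)
  show ik: "i \<odot> (i \<odot> j) = - j" by (simp add: imaginary_square_left frame)
  have "j \<odot> (j \<odot> i) = - i" by (simp add: imaginary_square_left frame del: ji)
  then show jk: "j \<odot> (i \<odot> j) = i" by (simp add: ji)
  show "(i \<odot> j) \<odot> i = j"
    using imaginary_anticommute[of i "i \<odot> j"] by (simp add: frame frame_k frame_k' ik)
  show "(i \<odot> j) \<odot> j = - i"
    using imaginary_anticommute[of j "i \<odot> j"] by (simp add: frame frame_k frame_k' jk add_eq_0_iff)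
qed

lemma quat_map_mult: "quat_map i j (qmul p q) = quat_map i j p \<odot> quat_map i j q"
  by (cases p; cases q)
    (simp add: quat_map_def mult_add_left mult_add_right frame_mult algebra_simps)

lemma quat_map_inner: "quat_map i j p \<bullet> quat_map i j q = p \<bullet> q"
  by (simp add: quat_map_def inner_add frame frame_k frame_k' inner_prod_def inner_complex_def algebra_simps)

end

lemma quat_map_simps [simp]: "quat_map i j qone = u" "quat_map i j (\<i>, 0) = i" "quat_map i j (0, 1) = j"
    "quat_map i j (0, \<i>) = i \<odot> j"
  unfolding quat_map_def qone_def by simp_all

text \<open>Every unital homomorphism from the quaternions is of this form: the images of the generators
  square to \<open>-1\<close> and anticommute, which in a composition algebra makes them orthonormal and imaginary.\<close>

lemma square_minus_unit:
  assumes "x \<odot> x = - u" shows "x \<bullet> u = 0" "norm x = 1"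
proof -
  have n: "norm x * norm x = 1" using norm_mult[of x x] assms by simp
  then show n1: "norm x = 1" using norm_ge_zero[of x] unfolding square_eq_1_iff by linarith
  have "conj x \<odot> x = u" using conj_mult_cancel[of x u] n1 by (simp add: dot_square_norm)
  then have "(2 * (x \<bullet> u)) *\<^sub>R x = 0" using assms by (simp add: conj_def mult_diff_left)
  then show "x \<bullet> u = 0" using n1 by auto
qed

lemma quat_hom_eq_quat_map:
  assumes f: "linear f" "f qone = u" "\<And>x y. f (qmul x y) = f x \<odot> f y"
  shows "quat_frame (f (\<i>, 0)) (f (0, 1)) \<and> f = quat_map (f (\<i>, 0)) (f (0, 1))"
proof -
  let ?i = "f (\<i>, 0)" and ?j = "f (0, 1)"
  have m: "f (- x) = - f x" for x using f(1) by (simp add: linear_neg)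
  have ii: "?i \<odot> ?i = - u" using f(3)[of "(\<i>,0)" "(\<i>,0)"] m[of qone] f(2) by (simp add: qone_def)
  have jj: "?j \<odot> ?j = - u" using f(3)[of "(0,1)" "(0,1)"] m[of qone] f(2) by (simp add: qone_def)
  have k: "f (0, \<i>) = ?i \<odot> ?j" using f(3)[of "(\<i>,0)" "(0,1)"] by simp
  have ji: "?j \<odot> ?i = - (?i \<odot> ?j)" using f(3)[of "(0,1)" "(\<i>,0)"] m[of "(0,\<i>)"] k by simp
  note i = square_minus_unit[OF ii] and j = square_minus_unit[OF jj]
  have "(- 2 * (?i \<bullet> ?j)) *\<^sub>R u = 0" using imaginary_anticommute[of ?i ?j] i j ji by simp
  then have "?i \<bullet> ?j = 0" using unit_nz by simp
  moreover have "f p = quat_map ?i ?j p" for p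
  proof -
    have p: "p = Re (fst p) *\<^sub>R qone + Im (fst p) *\<^sub>R (\<i>, 0) + Re (snd p) *\<^sub>R (0, 1) + Im (snd p) *\<^sub>R (0, \<i>)"
      by (cases p) (simp add: qone_def complex_eq_iff)
    have "f p = Re (fst p) *\<^sub>R f qone + Im (fst p) *\<^sub>R ?i + Re (snd p) *\<^sub>R ?j + Im (snd p) *\<^sub>R f (0, \<i>)"
      using arg_cong[OF p, of f] unfolding linear_add[OF f(1)] linear_cmul[OF f(1)] .
    then show ?thesis unfolding quat_map_def f(2) k .
  qed
  then have "f = quat_map ?i ?j" by (rule ext)
  ultimately show ?thesis unfolding quat_frame_def using i j by (intro conjI)
qed

lemma range_quat_map_subset:
  assumes "subspace V" "u \<in> V" "i \<in> V" "j \<in> V" "i \<odot> j \<in> V"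
  shows "range (quat_map i j) \<subseteq> V"
  unfolding quat_map_def using assms by (auto intro!: subspace_add subspace_scale)

definition oct_map :: "(quat \<Rightarrow> 'a) \<Rightarrow> 'a \<Rightarrow> octonion \<Rightarrow> 'a" where
  "oct_map h e x = h (fst x) + h (snd x) \<odot> e"

context
  fixes i j e
  assumes fr: "quat_frame i j" and e_norm: "norm e = 1" and e_orth: "\<And>p. e \<bullet> quat_map i j p = 0"
begin

lemma quat_map_conj: "conj (quat_map i j p) = quat_map i j (qcnj p)"
  by (cases p) (simp add: quat_map_def conj_def inner_add frame[OF fr] frame_k[OF fr] algebra_simps scaleR_2
      flip: scaleR_add_left)

lemma e_u: "e \<bullet> u = 0" using e_orth[of qone] by simp

lemma oct_map_linear: "linear (oct_map (quat_map i j) e)"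
  by (rule linearI)
    (simp_all add: oct_map_def fst_add snd_add fst_scaleR snd_scaleR linear_add[OF quat_map_linear]
      linear_cmul[OF quat_map_linear] mult_add_left scaleR_add_right)

lemma oct_map_mult: "oct_map (quat_map i j) e (omul x y) = oct_map (quat_map i j) e x \<odot> oct_map (quat_map i j) e y"
proof -
  obtain p q r s where xy: "x = (p, q)" "y = (r, s)" by (cases x; cases y)
  have m: "quat_map i j a \<odot> quat_map i j b = quat_map i j (qmul a b)" for a b by (simp add: quat_map_mult[OF fr])
  have 1: "quat_map i j p \<odot> (quat_map i j s \<odot> e) = quat_map i j (qmul s p) \<odot> e"
    using doubling_1[OF e_u, of "quat_map i j p" "quat_map i j s"] by (simp add: e_orth m)
  have 2: "(quat_map i j q \<odot> e) \<odot> quat_map i j r = quat_map i j (qmul q (qcnj r)) \<odot> e"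
    using doubling_2[OF e_u, of "quat_map i j q" "quat_map i j r"] by (simp add: e_orth m quat_map_conj)
  have 3: "(quat_map i j q \<odot> e) \<odot> (quat_map i j s \<odot> e) = - quat_map i j (qmul (qcnj s) q)"
    using doubling_3[OF e_u e_norm, of "quat_map i j q" "quat_map i j s"] by (simp add: e_orth m quat_map_conj)
  show ?thesis
    using quat_map_linear[of i j]
    by (simp add: xy oct_map_def mult_add_left mult_add_right 1 2 3 m linear_diff linear_add)
qed

lemma oct_map_inner: "oct_map (quat_map i j) e x \<bullet> oct_map (quat_map i j) e y = x \<bullet> y"
proof -
  obtain p q r s where xy: "x = (p, q)" "y = (r, s)" by (cases x; cases y)
  have ee: "e \<bullet> e = 1" using e_norm by (simp add: dot_square_norm)
  have z: "(quat_map i j a \<odot> e) \<bullet> quat_map i j b = 0" for a b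
    using inner_mult_conj_left[of "quat_map i j a" e "quat_map i j b"] by (simp add: quat_map_conj quat_map_mult[OF fr, symmetric] e_orth)
  show ?thesis
    using z[of q r] z[of s p]
    by (simp add: xy oct_map_def inner_add quat_map_inner[OF fr] inner_mult_right_same ee inner_commute)
qed

lemma oct_map_simps: "oct_map (quat_map i j) e oone = u" "oct_map (quat_map i j) e (p, 0) = quat_map i j p"
  using linear_0[OF quat_map_linear[of i j]] by (simp_all add: oct_map_def oone_def)

end

end

lemma inner_preserving_inj:
  fixes f :: "'a::real_inner \<Rightarrow> 'b::real_inner"
  assumes "\<And>x y. f x \<bullet> f y = x \<bullet> y"
  shows "inj f"
proof (rule injI)
  fix x y assume "f x = f y"
  then show "x = y"
    using assms[of x x] assms[of x y] assms[of y y] by (simp add: vector_eq[of x y])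
qed

lemma linear_inner_bij:
  fixes f :: "'a::euclidean_space \<Rightarrow> 'b::euclidean_space"
  assumes "linear f" "\<And>x y. f x \<bullet> f y = x \<bullet> y" "DIM('a) = DIM('b)"
  shows "bij f"
proof -
  have "inj f" using assms(2) by (rule inner_preserving_inj)
  moreover have "dim (range f) = DIM('b)"
    using dim_image_eq[OF assms(1), of UNIV] \<open>inj f\<close> assms(3) by (simp add: inj_on_def)
  then have "range f = UNIV"
    using subspace_UNIV assms(1) by (metis dim_eq_full linear_subspace_image span_eq_iff)
  ultimately show ?thesis by (simp add: bij_def)
qed

lemma exists_unit_orthogonal:
  fixes S :: "'a::euclidean_space set"
  assumes "dim S < DIM('a)"
  shows "\<exists>e. norm e = 1 \<and> (\<forall>x\<in>S. e \<bullet> x = 0)"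
proof -
  obtain x where x: "x \<noteq> 0" "\<And>y. y \<in> span S \<Longrightarrow> orthogonal x y"
    using orthogonal_to_subspace_exists[OF assms] by blast
  have "norm (x /\<^sub>R norm x) = 1" using x by simp
  moreover have "(x /\<^sub>R norm x) \<bullet> y = 0" if "y \<in> S" for y
    using x(2)[OF span_base[OF that]] by (simp add: orthogonal_def)
  ultimately show ?thesis by blast
qed

context composition_algebra
begin

lemma dim_range_quat_map: "quat_frame i j \<Longrightarrow> dim (range (quat_map i j)) = 4"
proof -
  assume fr: "quat_frame i j"
  have "inj (quat_map i j)" using quat_map_inner[OF fr] by (rule inner_preserving_inj)
  then have "dim (range (quat_map i j)) = dim (UNIV :: quat set)"
    by (intro dim_image_eq[OF quat_map_linear]) simp
  then show ?thesis by simp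
qed

text \<open>An orthonormal imaginary pair extends to coordinates in which it spans the standard quaternions.\<close>

lemma oct_map_exists:
  assumes fr: "quat_frame i j" and d: "DIM('a) = 8"
  obtains \<alpha> :: "octonion \<Rightarrow> 'a"
  where "linear \<alpha>" "bij \<alpha>" "\<And>x y. \<alpha> x \<bullet> \<alpha> y = x \<bullet> y" "\<And>x y. \<alpha> (omul x y) = \<alpha> x \<odot> \<alpha> y"
    "\<alpha> oone = u" "\<And>p. \<alpha> (p, 0) = quat_map i j p"
proof -
  have "dim (range (quat_map i j)) < DIM('a)" using dim_range_quat_map[OF fr] d by simp
  from exists_unit_orthogonal[OF this]
  obtain e where e: "norm e = 1" "\<And>p. e \<bullet> quat_map i j p = 0" by blast
  show ?thesis
  proof (rule that)
    show lin: "linear (oct_map (quat_map i j) e)" by (rule oct_map_linear[OF fr e])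
    show "oct_map (quat_map i j) e x \<bullet> oct_map (quat_map i j) e y = x \<bullet> y" for x y
      by (rule oct_map_inner[OF fr e])
    then show "bij (oct_map (quat_map i j) e)" by (rule linear_inner_bij[OF lin]) (simp add: d)
  qed (rule oct_map_mult[OF fr e] oct_map_simps[OF fr e])+
qed

lemma quat_frame_extend:
  assumes d: "DIM('a) = 8" and x: "x \<bullet> u = 0"
  obtains i j where "quat_frame i j" "x = norm x *\<^sub>R i"
proof -
  obtain i where i: "norm i = 1" "i \<bullet> u = 0" "x = norm x *\<^sub>R i"
  proof (cases "x = 0")
    case True
    obtain i where "norm i = 1" "i \<bullet> u = 0"
      using exists_unit_orthogonal[of "{u}"] d dim_le_card'[of "{u}"] by (auto simp: )
    then show ?thesis using that True by simp
  next
    case False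
    then show ?thesis using that[of "x /\<^sub>R norm x"] x by simp
  qed
  have "dim {u, i} \<le> 2" using dim_le_card'[of "{u, i}"] card_insert_le_m1[of 2 "{i}" u] by simp
  then have "dim {u, i} < DIM('a)" using d by simp
  from exists_unit_orthogonal[OF this]
  obtain j where "norm j = 1" "j \<bullet> u = 0" "j \<bullet> i = 0" by blast
  then show ?thesis using that[of i j] i by (auto simp: quat_frame_def inner_commute)
qed

end

section \<open>Quaternions and octonions\<close>

lemma qmul_assoc: "qmul (qmul x y) z = qmul x (qmul y z)"
  by (cases x; cases y; cases z) (simp add: algebra_simps)

lemma qmul_bilinear: "bilinear qmul"
  unfolding bilinear_def
  by (auto intro!: linearI simp: algebra_simps scaleR_conv_of_real split: prod.splits)

lemma qcnj_linear: "linear qcnj"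
  by (rule linearI) (auto simp: scaleR_conv_of_real split: prod.splits)

lemma quat_composition: "composition_algebra qmul qone"
proof
  fix x y :: quat
  show "bilinear qmul" by (rule qmul_bilinear)
  show "qmul qone x = x" "qmul x qone = x" by (cases x; simp add: qone_def)+
  show "qone \<noteq> 0" by (simp add: qone_def zero_prod_def)
  have "(norm (qmul x y))\<^sup>2 = (norm x * norm y)\<^sup>2"
    unfolding power_mult_distrib
    by (cases x; cases y)
      (simp add: power2_norm_eq_inner inner_prod_def inner_complex_def, simp add: algebra_simps)
  then show "norm (qmul x y) = norm x * norm y"
    by (rule power2_eq_imp_eq) auto
qed

interpretation Q: composition_algebra qmul qone by (rule quat_composition)

lemma Q_conj: "Q.conj x = qcnj x"
  unfolding Q.conj_def by (cases x) (simp add: qone_def inner_prod_def inner_complex_def complex_eq_iff)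

lemma qcnj_qone: "qcnj qone = qone" by (simp add: qone_def)

lemma octonion_composition: "composition_algebra omul oone"
proof
  fix x y :: octonion
  note bl = bilinear_ladd[OF qmul_bilinear] bilinear_radd[OF qmul_bilinear]
    bilinear_lmul[OF qmul_bilinear] bilinear_rmul[OF qmul_bilinear]
    linear_add[OF qcnj_linear] linear_cmul[OF qcnj_linear]
  show "bilinear omul"
    unfolding bilinear_def
    by (auto intro!: linearI simp: bl algebra_simps split: prod.splits)
  show "omul oone x = x" "omul x oone = x"
    using linear_0[OF qcnj_linear] Q.mult_unit_right Q.mult_unit_left
    by (cases x; simp add: oone_def qcnj_qone)+
  show "oone \<noteq> 0" using Q.unit_nz by (simp add: oone_def zero_prod_def)
  obtain p q r s where xy: "x = (p, q)" "y = (r, s)" by (cases x; cases y)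
  have cross: "qmul p r \<bullet> qmul (qcnj s) q = qmul s p \<bullet> qmul q (qcnj r)"
    using Q.inner_mult_conj_left[of s "qmul p r" q] Q.inner_mult_conj_right[of "qmul s p" r q]
    unfolding Q_conj qmul_assoc by (rule trans[OF sym])
  have cnj: "norm (qcnj z) = norm z" for z
    by (cases z) (simp add: norm_Pair)
  have pair: "(norm (v, w))\<^sup>2 = (norm v)\<^sup>2 + (norm w)\<^sup>2" for v w :: quat
    by (simp add: norm_Pair)
  have "(norm (omul x y))\<^sup>2 = (norm (qmul p r - qmul (qcnj s) q))\<^sup>2 + (norm (qmul s p + qmul q (qcnj r)))\<^sup>2"
    by (simp only: xy omul.simps pair)
  also have "\<dots> = (norm (qmul p r))\<^sup>2 + (norm (qmul (qcnj s) q))\<^sup>2 + (norm (qmul s p))\<^sup>2 + (norm (qmul q (qcnj r)))\<^sup>2"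
    using cross by (simp only: power2_norm_eq_inner inner_diff_left inner_diff_right inner_add_left inner_add_right
        inner_commute[of "qmul (qcnj s) q" "qmul p r"] inner_commute[of "qmul q (qcnj r)" "qmul s p"])
  also have "\<dots> = ((norm p)\<^sup>2 + (norm q)\<^sup>2) * ((norm r)\<^sup>2 + (norm s)\<^sup>2)"
    by (simp only: Q.norm_mult cnj power_mult_distrib) (simp only: algebra_simps)
  finally have "(norm (omul x y))\<^sup>2 = (norm x * norm y)\<^sup>2"
    by (simp only: power_mult_distrib xy pair)
  then show "norm (omul x y) = norm x * norm y"
    by (rule power2_eq_imp_eq) auto
qed

interpretation O: composition_algebra omul oone by (rule octonion_composition)

definition H0 :: "octonion set" where "H0 = range (\<lambda>p. (p, 0))"

lemma quaternion_subalgebra_iff: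
  "quaternion_subalgebra H \<longleftrightarrow> (\<exists>i j. O.quat_frame i j \<and> H = range (O.quat_map i j))"
proof
  assume "quaternion_subalgebra H"
  then obtain f where f: "linear f" "f qone = oone" "\<And>x y. f (qmul x y) = omul (f x) (f y)" "H = range f"
    unfolding quaternion_subalgebra_def by blast
  from O.quat_hom_eq_quat_map[OF f(1-3)]
  have "O.quat_frame (f (\<i>, 0)) (f (0, 1)) \<and> H = range (O.quat_map (f (\<i>, 0)) (f (0, 1)))"
    unfolding f(4) by (elim conjE, intro conjI arg_cong[of f _ range])
  then show "\<exists>i j. O.quat_frame i j \<and> H = range (O.quat_map i j)" by (intro exI)
next
  assume "\<exists>i j. O.quat_frame i j \<and> H = range (O.quat_map i j)"
  then obtain i j where fr: "O.quat_frame i j" and H: "H = range (O.quat_map i j)" by (elim exE conjE)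
  have "inj (O.quat_map i j)" using O.quat_map_inner[OF fr] by (rule inner_preserving_inj)
  then show "quaternion_subalgebra H"
    unfolding quaternion_subalgebra_def
    by (intro exI[of _ "O.quat_map i j"] conjI allI O.quat_map_linear O.quat_map_mult[OF fr] H O.quat_map_simps(1))
qed

section \<open>Level sets of homogeneous quartic functions\<close>

lemma derivative_zero_on_curve:
  fixes g :: "'a::real_normed_vector \<Rightarrow> 'b::real_normed_vector"
  assumes g: "(g has_derivative g') (at p)" and v: "v \<in> tangent_space N p"
    and zero: "\<And>q. q \<in> N \<Longrightarrow> g q = c"
  shows "g' v = 0"
proof -
  obtain \<gamma> \<epsilon> where \<epsilon>: "0 < \<epsilon>" and \<gamma>: "\<gamma> ` {-\<epsilon><..<\<epsilon>} \<subseteq> N" "\<gamma> (0::real) = p"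
      "(\<gamma> has_vector_derivative v) (at 0)"
    using v unfolding tangent_space_def by blast
  have "(g has_derivative g') (at (\<gamma> 0))" using g \<gamma>(2) by simp
  from has_derivative_compose[OF \<gamma>(3)[unfolded has_vector_derivative_def] this]
  have d: "((\<lambda>t. g (\<gamma> t)) has_derivative (\<lambda>t. g' (t *\<^sub>R v))) (at 0)" .
  have "((\<lambda>t. c) has_derivative (\<lambda>t. g' (t *\<^sub>R v))) (at (0::real))"
    by (rule has_derivative_transform_within_open[OF d, of "{-\<epsilon><..<\<epsilon>}"])
      (use \<epsilon> \<gamma>(1) zero in \<open>auto simp: image_subset_iff\<close>)
  then have "(\<lambda>t. g' (t *\<^sub>R v)) = (\<lambda>t. 0)"
    using has_derivative_unique has_derivative_const by blast
  then have "g' (1 *\<^sub>R v) = 0" by meson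
  then show ?thesis by simp
qed

lemma linear_imp_bounded: "linear h \<Longrightarrow> bounded_linear h"
  for h :: "'a::euclidean_space \<Rightarrow> 'b::real_normed_vector"
  by (simp add: linear_conv_bounded_linear)

locale homogeneous_quartic =
  fixes f :: "'a::euclidean_space \<Rightarrow> real"
  assumes smooth: "smooth_on UNIV f"
    and homogeneous: "f (c *\<^sub>R x) = c ^ 4 * f x"
    and hessian_sym: "hessian f p u v = hessian f p v u"
begin

definition df where "df p v = frechet_derivative f (at p) v"

lemma df: "(f has_derivative df p) (at p)"
  using smooth_on_has_derivative[OF smooth, of p] by (simp add: df_def[abs_def])

lemma df_linear: "linear (df p)" using has_derivative_linear[OF df] .

lemma df_smooth: "smooth_on UNIV (\<lambda>q. df q v)"
  using smooth unfolding df_def smooth_on_def by (metis Ck_on_SucD(2))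

definition pos where "pos = {x. 0 < f x}"

lemma open_pos: "open pos"
  using continuous_on_open_vimage[of UNIV f] smooth_on_imp_continuous_on[OF smooth]
  by (auto simp: pos_def vimage_def intro: open_Collect_less continuous_on_const)

lemma smooth_pos: "smooth_on UNIV g \<Longrightarrow> smooth_on pos g"
  by (rule smooth_on_subset) auto

lemma euler: "df p p = 4 * f p"
proof -
  have ray: "((\<lambda>t. t *\<^sub>R p) has_derivative (\<lambda>t. t *\<^sub>R p)) (at (1::real))"
    by (auto intro!: derivative_eq_intros)
  have "((\<lambda>t. f (t *\<^sub>R p)) has_derivative (\<lambda>t. df p (t *\<^sub>R p))) (at 1)"
    using has_derivative_compose[OF ray, of f "df p"] df[of p] by simp
  moreover have "((\<lambda>t. f (t *\<^sub>R p)) has_derivative (\<lambda>t. t * (4 * f p))) (at 1)"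
    unfolding homogeneous by (auto intro!: derivative_eq_intros)
  ultimately have "(\<lambda>t. df p (t *\<^sub>R p)) = (\<lambda>t. t * (4 * f p))" by (rule has_derivative_unique)
  then have "df p (1 *\<^sub>R p) = 1 * (4 * f p)" by meson
  then show ?thesis by simp
qed

abbreviation fixed_level :: "('a \<Rightarrow> 'a) \<Rightarrow> 'a set" where
  "fixed_level \<sigma> \<equiv> {x. \<sigma> x = x \<and> f x = 1}"

text \<open>A vector in the kernel of the differential is the velocity of a curve in the level set: rescale the
  straight line in its direction to level one.  The scaling factor \<open>f powr (-1/4)\<close> is stationary in
  such a direction.\<close>

lemma tangent_fixed_level:
  assumes \<sigma>: "linear \<sigma>" and p: "p \<in> fixed_level \<sigma>"
  shows "tangent_space (fixed_level \<sigma>) p = {v. \<sigma> v = v \<and> df p v = 0}"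
proof (intro equalityI subsetI)
  fix v assume v: "v \<in> tangent_space (fixed_level \<sigma>) p"
  have "df p v = 0" by (rule derivative_zero_on_curve[OF df v]) simp
  moreover have "(\<lambda>x. \<sigma> x - x) v = 0"
    by (rule derivative_zero_on_curve[OF has_derivative_diff[OF bounded_linear_imp_has_derivative[OF
          linear_imp_bounded[OF \<sigma>]] has_derivative_ident] v, of 0]) simp
  ultimately show "v \<in> {v. \<sigma> v = v \<and> df p v = 0}" by simp
next
  fix v assume "v \<in> {v. \<sigma> v = v \<and> df p v = 0}"
  then have v: "\<sigma> v = v" "df p v = 0" by auto
  have fp: "f p = 1" "\<sigma> p = p" using p by auto
  define L where "L t = p + t *\<^sub>R v" for t :: real
  have Ld: "(L has_derivative (\<lambda>t. t *\<^sub>R v)) (at t)" for t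
    unfolding L_def by (auto intro!: derivative_eq_intros)
  have Ls: "smooth_on UNIV L" unfolding L_def[abs_def]
    by (intro smooth_on_add smooth_on_const smooth_on_scaleR smooth_on_ident open_UNIV)
  have fLs: "smooth_on UNIV (\<lambda>t. f (L t))"
  proof -
    have *: "Ck_on k UNIV (\<lambda>t. g (L t))" if "Ck_on k UNIV g" for k and g :: "'a \<Rightarrow> real"
      using that
    proof (induction k arbitrary: g)
      case 0
      then show ?case using smooth_on_imp_continuous_on[OF Ls]
        by (auto intro: continuous_on_compose2)
    next
      case (Suc k)
      have d: "((\<lambda>t. g (L t)) has_derivative (\<lambda>s. s * frechet_derivative g (at (L t)) v)) (at t)" for t
        using has_derivative_compose[OF Ld[of t] Ck_on_SucD(1)[OF Suc.prems, of "L t"]]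
          linear_cmul[OF has_derivative_linear[OF Ck_on_SucD(1)[OF Suc.prems, of "L t"]]] by simp
      show ?case
        by (rule Ck_on_SucI[OF open_UNIV d])
          (intro Ck_on_bilinear[OF open_UNIV bounded_bilinear_mult] Ck_on_const Suc.IH Ck_on_SucD(2)[OF Suc.prems])
    qed
    show ?thesis using * smooth by (simp add: smooth_on_def)
  qed
  have "open ((\<lambda>t. f (L t)) -` {0<..})"
    by (rule open_vimage) (use smooth_on_imp_continuous_on[OF fLs] in auto)
  moreover have "0 \<in> (\<lambda>t. f (L t)) -` {0<..}" by (simp add: L_def fp)
  ultimately obtain \<epsilon> where \<epsilon>: "0 < \<epsilon>" "ball 0 \<epsilon> \<subseteq> (\<lambda>t. f (L t)) -` {0<..}"
    using open_contains_ball by blast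
  have pos: "0 < f (L t)" if "t \<in> {-\<epsilon><..<\<epsilon>}" for t
    using \<epsilon>(2) that by (auto simp: subset_iff dist_real_def)
  define \<gamma> where "\<gamma> t = (f (L t) powr (-1/4)) *\<^sub>R L t" for t
  have "smooth_on {-\<epsilon><..<\<epsilon>} \<gamma>"
    unfolding \<gamma>_def
    by (intro smooth_on_scaleR smooth_on_powr smooth_on_subset[OF fLs] smooth_on_subset[OF Ls] pos) auto
  moreover have "\<gamma> ` {-\<epsilon><..<\<epsilon>} \<subseteq> fixed_level \<sigma>"
  proof
    fix x assume "x \<in> \<gamma> ` {-\<epsilon><..<\<epsilon>}"
    then obtain t where t: "t \<in> {-\<epsilon><..<\<epsilon>}" "x = \<gamma> t" by blast
    have "(f (L t) powr (-1/4)) ^ 4 * f (L t) = 1"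
      using pos[OF t(1)] powr_power[of "f (L t)" "-1/4" 4] by (simp add: powr_minus)
    then have "f x = 1" by (simp add: t(2) \<gamma>_def homogeneous)
    moreover have "\<sigma> (L t) = L t" by (simp add: L_def linear_add[OF \<sigma>] linear_cmul[OF \<sigma>] fp v)
    then have "\<sigma> x = x" by (simp add: t(2) \<gamma>_def linear_cmul[OF \<sigma>])
    ultimately show "x \<in> fixed_level \<sigma>" by simp
  qed
  moreover have "\<gamma> 0 = p" by (simp add: \<gamma>_def L_def fp)
  moreover have "(\<gamma> has_vector_derivative v) (at 0)"
  proof -
    have L0: "L 0 = p" by (simp add: L_def)
    have 1: "((\<lambda>t. f (L t)) has_derivative (\<lambda>t. 0)) (at 0)"
      using has_derivative_compose[OF Ld[of 0] df[of "L 0"]] v(2) linear_cmul[OF df_linear]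
      by (simp add: L0)
    have "((\<lambda>y. y powr (-1/4)) has_derivative (\<lambda>h. h * (-1/4))) (at (f (L 0)))"
      unfolding L0 fp by (auto intro!: derivative_eq_intros)
    from has_derivative_compose[OF 1 this]
    have "((\<lambda>t. f (L t) powr (-1/4)) has_derivative (\<lambda>t. 0)) (at 0)" by simp
    from has_derivative_scaleR[OF this Ld[of 0]]
    show ?thesis unfolding has_vector_derivative_def \<gamma>_def[abs_def] by (simp add: L0 fp)
  qed
  ultimately show "v \<in> tangent_space (fixed_level \<sigma>) p"
    unfolding tangent_space_def using \<epsilon>(1) by blast
qed

lemma tangent_level:
  assumes "f p = 1"
  shows "tangent_space {x. f x = 1} p = {v. df p v = 0}"
  using tangent_fixed_level[of "\<lambda>x. x" p] assms by (simp add: linear_iff)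

text \<open>Rescaling along rays straightens the level set: it maps the level set to an affine hyperplane and preserves
  every linear subspace through the base point.\<close>

lemma submanifold_fixed_level:
  assumes \<sigma>: "linear \<sigma>" and d: "dim {x. \<sigma> x = x} = Suc k"
  shows "smooth_submanifold k (fixed_level \<sigma>)"
  unfolding smooth_submanifold_def
proof
  fix p assume p: "p \<in> fixed_level \<sigma>"
  then have fp: "f p = 1" "\<sigma> p = p" by auto
  have "p \<noteq> 0" using homogeneous[of 0 p] fp by auto
  define l where "l x = x \<bullet> p / (p \<bullet> p)" for x
  have lp: "l p = 1" using \<open>p \<noteq> 0\<close> by (simp add: l_def)
  have ll: "linear l" by (rule linearI) (simp_all add: l_def inner_add add_divide_distrib)
  note lin = linear_add[OF ll] linear_diff[OF ll] linear_cmul[OF ll] linear_add[OF \<sigma>] linear_diff[OF \<sigma>] linear_cmul[OF \<sigma>]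
  have ls: "smooth_on UNIV l" by (rule smooth_on_bounded_linear[OF open_UNIV linear_imp_bounded[OF ll]])
  define U where "U = {x. 0 < f x \<and> 0 < l x}"
  define V where "V = {y. 0 < f (y + p) \<and> 0 < l (y + p)}"
  define \<Phi> where "\<Phi> x = (f x powr (1/4) / l x) *\<^sub>R x - p" for x
  define \<Psi> where "\<Psi> y = (l (y + p) / f (y + p) powr (1/4)) *\<^sub>R (y + p)" for y
  have cf: "continuous_on UNIV f" "continuous_on UNIV l"
    using smooth ls by (auto intro: smooth_on_imp_continuous_on)
  have oU: "open U" unfolding U_def
    by (intro open_Collect_conj open_Collect_less cf continuous_on_const)
  have oV: "open V" unfolding V_def
    by (intro open_Collect_conj open_Collect_less continuous_on_const
        continuous_on_compose2[OF cf(1)] continuous_on_compose2[OF cf(2)] continuous_intros) auto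
  have r4: "(x powr (1/4)) ^ 4 = x" if "0 < x" for x :: real
    using that by (simp add: powr_power)
  have f_scale: "f (c *\<^sub>R x) powr (1/4) = c * f x powr (1/4)" if "0 < c" "0 < f x" for c x
  proof -
    have "(c ^ 4) powr (1/4) = (c powr 4) powr (1/4)" using that by (simp add: powr_numeral)
    also have "\<dots> = c" using that unfolding powr_powr by simp
    finally show ?thesis using that by (simp add: homogeneous powr_mult)
  qed
  have s\<Phi>: "smooth_on U \<Phi>" unfolding \<Phi>_def
    by (intro smooth_on_diff smooth_on_scaleR smooth_on_divide smooth_on_powr smooth_on_ident smooth_on_const
        smooth_on_subset[OF smooth] smooth_on_subset[OF ls] oU) (auto simp: U_def)
  have add: "smooth_on V (\<lambda>y. g (y + p))" if "smooth_on UNIV g" for g :: "'a \<Rightarrow> real"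
  proof -
    have *: "Ck_on k V (\<lambda>y. g (y + p))" if "Ck_on k UNIV g" for k and g :: "'a \<Rightarrow> real"
      using that
    proof (induction k arbitrary: g)
      case 0
      then show ?case by (auto intro!: continuous_on_compose2[of UNIV g] continuous_intros)
    next
      case (Suc k)
      have d: "((\<lambda>t. g (t + p)) has_derivative (\<lambda>s. frechet_derivative g (at (t + p)) s)) (at t)" for t
        using has_derivative_compose[OF has_derivative_add[OF has_derivative_ident has_derivative_const] Ck_on_SucD(1)[OF Suc.prems, of "t + p"]] by simp
      show ?case by (rule Ck_on_SucI[OF oV d]) (intro Suc.IH Ck_on_SucD(2)[OF Suc.prems])
    qed
    then show ?thesis using that by (simp add: smooth_on_def)
  qed
  have s\<Psi>: "smooth_on V \<Psi>" unfolding \<Psi>_def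
    by (intro smooth_on_diff smooth_on_add smooth_on_scaleR smooth_on_divide smooth_on_powr smooth_on_ident smooth_on_const
        add smooth ls oV) (auto simp: V_def)
  have UV: "\<Phi> x \<in> V \<and> \<Psi> (\<Phi> x) = x" if "x \<in> U" for x
  proof -
    have x: "0 < f x" "0 < l x" using that by (auto simp: U_def)
    define c where "c = f x powr (1/4) / l x"
    have c: "0 < c" using x by (simp add: c_def)
    have e: "\<Phi> x + p = c *\<^sub>R x" by (simp add: \<Phi>_def c_def)
    have "0 < f (c *\<^sub>R x)" "0 < l (c *\<^sub>R x)" using c x by (simp_all add: homogeneous lin)
    moreover have "(l (c *\<^sub>R x) / f (c *\<^sub>R x) powr (1/4)) * c = 1"
      using c x f_scale[OF c x(1)] by (simp add: lin) (simp add: c_def)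
    ultimately show ?thesis using c by (simp add: V_def \<Psi>_def e)
  qed
  have VU: "\<Psi> y \<in> U \<and> \<Phi> (\<Psi> y) = y" if "y \<in> V" for y
  proof -
    have y: "0 < f (y + p)" "0 < l (y + p)" using that by (auto simp: V_def)
    define c where "c = l (y + p) / f (y + p) powr (1/4)"
    have c: "0 < c" using y by (simp add: c_def)
    have e: "\<Psi> y = c *\<^sub>R (y + p)" by (simp add: \<Psi>_def c_def)
    have "\<Psi> y \<in> U" using c y by (simp add: U_def e homogeneous lin(3) del: scaleR_add_right)
    have "(f (c *\<^sub>R (y + p)) powr (1/4) / l (c *\<^sub>R (y + p))) * c = 1"
      using c y f_scale[OF c y(1)] by (simp add: lin(3)) (simp add: c_def)
    then have "\<Phi> (\<Psi> y) = 1 *\<^sub>R (y + p) - p" unfolding \<Phi>_def e scaleR_scaleR by (rule arg_cong)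
    with \<open>\<Psi> y \<in> U\<close> show ?thesis by simp
  qed
  have homeo: "homeomorphism U V \<Phi> \<Psi>"
    by (rule homeomorphismI) (use UV VU s\<Phi> s\<Psi> in \<open>auto intro: smooth_on_imp_continuous_on\<close>)
  define L where "L = {x. \<sigma> x = x \<and> l x = 0}"
  have subL: "subspace L" unfolding L_def subspace_def
    by (auto simp: lin linear_0[OF \<sigma>] linear_0[OF ll])
  have "dim L = k"
  proof -
    let ?W = "{x. \<sigma> x = x}"
    have W: "subspace ?W" unfolding subspace_def by (auto simp: lin linear_0[OF \<sigma>])
    have "p \<notin> span L" using subL lp by (auto simp: L_def span_eq_iff[THEN iffD2])
    then have "dim (insert p L) = Suc (dim L)" by (simp add: dim_insert)
    moreover have "span (insert p L) = ?W"
    proof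
      show "span (insert p L) \<subseteq> ?W" by (rule span_minimal) (use W fp in \<open>auto simp: L_def\<close>)
      show "?W \<subseteq> span (insert p L)"
      proof
        fix x assume "x \<in> ?W"
        then have "x - l x *\<^sub>R p \<in> L" using fp lp by (simp add: L_def lin)
        then have "x - l x *\<^sub>R p \<in> span (insert p L)" "l x *\<^sub>R p \<in> span (insert p L)"
          by (auto intro: span_base span_scale)
        from span_add[OF this] show "x \<in> span (insert p L)" by simp
      qed
    qed
    then have "dim (insert p L) = dim ?W" by (metis dim_span)
    ultimately show ?thesis using d by simp
  qed
  moreover have "\<Phi> ` (U \<inter> fixed_level \<sigma>) = V \<inter> L"
  proof (intro equalityI subsetI)
    fix y assume "y \<in> \<Phi> ` (U \<inter> fixed_level \<sigma>)"
    then obtain x where x: "x \<in> U" "\<sigma> x = x" "f x = 1" "y = \<Phi> x" by auto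
    have "0 < l x" using x by (simp add: U_def)
    then have "y \<in> L" using x fp lp by (simp add: L_def \<Phi>_def lin)
    then show "y \<in> V \<inter> L" using UV[OF x(1)] x by simp
  next
    fix y assume y: "y \<in> V \<inter> L"
    then have yV: "0 < f (y + p)" "l y = 0" "\<sigma> y = y" by (auto simp: V_def L_def)
    have "f (\<Psi> y) = 1"
      using yV r4[OF yV(1)] by (simp add: \<Psi>_def homogeneous lin lp power_divide del: scaleR_add_right)
    moreover have "\<sigma> (\<Psi> y) = \<Psi> y" using yV fp by (simp add: \<Psi>_def lin del: scaleR_add_right)
    ultimately show "y \<in> \<Phi> ` (U \<inter> fixed_level \<sigma>)"
      using VU[of y] y by (auto intro!: image_eqI[of _ _ "\<Psi> y"])
  qed
  moreover have "p \<in> U" using fp lp by (simp add: U_def)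
  ultimately show "\<exists>U V \<Phi> \<Psi> L. open U \<and> p \<in> U \<and> open V \<and> homeomorphism U V \<Phi> \<Psi> \<and> smooth_on U \<Phi> \<and>
      smooth_on V \<Psi> \<and> subspace (L :: 'a set) \<and> dim L = k \<and> \<Phi> ` (U \<inter> fixed_level \<sigma>) = V \<inter> L"
    using oU oV homeo s\<Phi> s\<Psi> subL by blast
qed

end

context homogeneous_quartic
begin

abbreviation "gmetric \<equiv> hessian (\<lambda>x. ln (f x))"

lemma gmetric_on_pos:
  assumes p: "p \<in> pos"
  shows "gmetric p u v = hessian f p u v / f p - df p u * df p v / (f p)\<^sup>2"
    and "((\<lambda>q. ln (f q)) has_derivative (\<lambda>v. df p v / f p)) (at p)"
proof -
  have ln: "((\<lambda>q. ln (f q)) has_derivative (\<lambda>v. df q v / f q)) (at q)" if "q \<in> pos" for q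
    using has_derivative_ln[OF _ df, of q] that by (simp add: pos_def divide_inverse mult.commute)
  show "((\<lambda>q. ln (f q)) has_derivative (\<lambda>v. df p v / f p)) (at p)" by (rule ln[OF p])
  have hf: "((\<lambda>q. df q u) has_derivative hessian f p u) (at p)"
    using smooth_on_has_derivative[OF df_smooth[of u], of p]
    by (simp add: hessian_def[abs_def] df_def)
  have fp: "f p \<noteq> 0" using p by (simp add: pos_def)
  have "((\<lambda>q. df q u / f q) has_derivative (\<lambda>v. hessian f p u v / f p - df p u * df p v / (f p)\<^sup>2)) (at p)"
    by (rule has_derivative_eq_rhs[OF has_derivative_divide'[OF hf df fp]])
      (rule ext, use fp in \<open>simp add: field_simps power2_eq_square\<close>)
  then have "((\<lambda>q. frechet_derivative (\<lambda>x. ln (f x)) (at q) u) has_derivative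
      (\<lambda>v. hessian f p u v / f p - df p u * df p v / (f p)\<^sup>2)) (at p)"
    by (rule has_derivative_transform_within_open[OF _ open_pos p])
      (simp add: frechet_derivative_at[OF ln, symmetric])
  from fun_cong[OF frechet_derivative_at[OF this], of v]
  show "gmetric p u v = hessian f p u v / f p - df p u * df p v / (f p)\<^sup>2"
    unfolding hessian_def[of "\<lambda>x. ln (f x)"] by (rule sym)
qed

lemma hessian_linear: "linear (hessian f p u)"
  using has_derivative_linear[OF smooth_on_has_derivative[OF df_smooth[of u], of p]]
  by (simp add: hessian_def[abs_def] df_def)

lemma gmetric_sym: "p \<in> pos \<Longrightarrow> gmetric p u v = gmetric p v u"
  by (simp add: gmetric_on_pos hessian_sym mult.commute)

lemma gmetric_linear: assumes "p \<in> pos" shows "linear (gmetric p u)"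
  by (rule linearI)
    (simp_all add: gmetric_on_pos[OF assms] linear_add[OF hessian_linear] linear_cmul[OF hessian_linear]
      linear_add[OF df_linear] linear_cmul[OF df_linear] add_divide_distrib algebra_simps)

lemma gmetric_linear_left: assumes "p \<in> pos" shows "linear (\<lambda>u. gmetric p u v)"
  using gmetric_linear[OF assms, of v] by (simp add: gmetric_sym[OF assms, of _ v])

lemma gmetric_smooth: "smooth_on pos (\<lambda>q. gmetric q u v)"
proof (rule smooth_on_cong[OF open_pos])
  have h: "smooth_on UNIV (\<lambda>q. hessian f q u v)"
    using df_smooth[of u] unfolding hessian_def df_def[abs_def] smooth_on_def by (metis Ck_on_SucD(2))
  show "smooth_on pos (\<lambda>q. hessian f q u v / f q - (df q u * df q v) / (f q * f q))"
    by (intro smooth_on_diff smooth_on_divide smooth_on_mult smooth_pos h smooth df_smooth open_pos)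
      (auto simp: pos_def)
qed (simp add: gmetric_on_pos power2_eq_square)

definition dgmetric where "dgmetric p y z v = frechet_derivative (\<lambda>q. gmetric q y z) (at p) v"

lemma dgmetric: "p \<in> pos \<Longrightarrow> ((\<lambda>q. gmetric q y z) has_derivative dgmetric p y z) (at p)"
  using smooth_on_has_derivative[OF gmetric_smooth] by (simp add: dgmetric_def[abs_def])

lemma gmetric_expand:
  assumes "q \<in> pos"
  shows "gmetric q y z = (\<Sum>i\<in>Basis. \<Sum>j\<in>Basis. (y \<bullet> i) * (z \<bullet> j) * gmetric q i j)"
proof -
  have "gmetric q y z = gmetric q (\<Sum>i\<in>Basis. (y \<bullet> i) *\<^sub>R i) z" by (simp add: euclidean_representation)
  also have "\<dots> = (\<Sum>i\<in>Basis. (y \<bullet> i) * gmetric q i z)"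
    by (simp add: linear_sum[OF gmetric_linear_left[OF assms]] linear_cmul[OF gmetric_linear_left[OF assms]])
  also have "\<dots> = (\<Sum>i\<in>Basis. (y \<bullet> i) * gmetric q i (\<Sum>j\<in>Basis. (z \<bullet> j) *\<^sub>R j))"
    by (simp add: euclidean_representation)
  also have "\<dots> = (\<Sum>i\<in>Basis. \<Sum>j\<in>Basis. (y \<bullet> i) * (z \<bullet> j) * gmetric q i j)"
    by (simp add: linear_sum[OF gmetric_linear[OF assms]] linear_cmul[OF gmetric_linear[OF assms]] sum_distrib_left mult.assoc)
  finally show ?thesis .
qed

lemma derivative_gmetric_fields:
  assumes p: "p \<in> pos" and Y: "(Y has_derivative Y') (at p)" and Z: "(Z has_derivative Z') (at p)"
  shows "((\<lambda>q. gmetric q (Y q) (Z q)) has_derivative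
    (\<lambda>v. dgmetric p (Y p) (Z p) v + gmetric p (Y' v) (Z p) + gmetric p (Y p) (Z' v))) (at p)"
proof -
  have Ci: "((\<lambda>q. gmetric q y z) has_derivative
    (\<lambda>v. \<Sum>i\<in>Basis. \<Sum>j\<in>Basis. (y \<bullet> i) * (z \<bullet> j) * dgmetric p i j v)) (at p)" for y z
  proof (rule has_derivative_transform_within_open[OF _ open_pos p])
    show "((\<lambda>q. \<Sum>i\<in>Basis. \<Sum>j\<in>Basis. (y \<bullet> i) * (z \<bullet> j) * gmetric q i j) has_derivative
      (\<lambda>v. \<Sum>i\<in>Basis. \<Sum>j\<in>Basis. (y \<bullet> i) * (z \<bullet> j) * dgmetric p i j v)) (at p)"
      by (intro has_derivative_sum has_derivative_mult_right dgmetric p)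
  qed (simp add: gmetric_expand)
  have Ce: "dgmetric p y z v = (\<Sum>i\<in>Basis. \<Sum>j\<in>Basis. (y \<bullet> i) * (z \<bullet> j) * dgmetric p i j v)" for y z v
    using has_derivative_unique[OF dgmetric[OF p] Ci] by metis
  have "((\<lambda>q. \<Sum>i\<in>Basis. \<Sum>j\<in>Basis. (Y q \<bullet> i) * (Z q \<bullet> j) * gmetric q i j) has_derivative
     (\<lambda>v. \<Sum>i\<in>Basis. \<Sum>j\<in>Basis. (Y p \<bullet> i) * (Z p \<bullet> j) * dgmetric p i j v +
       ((Y p \<bullet> i) * (Z' v \<bullet> j) + (Y' v \<bullet> i) * (Z p \<bullet> j)) * gmetric p i j)) (at p)"
    by (intro has_derivative_sum has_derivative_mult dgmetric p has_derivative_inner_left Y Z)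
  then have "((\<lambda>q. gmetric q (Y q) (Z q)) has_derivative
     (\<lambda>v. \<Sum>i\<in>Basis. \<Sum>j\<in>Basis. (Y p \<bullet> i) * (Z p \<bullet> j) * dgmetric p i j v +
       ((Y p \<bullet> i) * (Z' v \<bullet> j) + (Y' v \<bullet> i) * (Z p \<bullet> j)) * gmetric p i j)) (at p)"
    by (rule has_derivative_transform_within_open[OF _ open_pos p]) (simp add: gmetric_expand[symmetric])
  moreover have "(\<lambda>v. \<Sum>i\<in>Basis. \<Sum>j\<in>Basis. (Y p \<bullet> i) * (Z p \<bullet> j) * dgmetric p i j v +
       ((Y p \<bullet> i) * (Z' v \<bullet> j) + (Y' v \<bullet> i) * (Z p \<bullet> j)) * gmetric p i j) =
     (\<lambda>v. dgmetric p (Y p) (Z p) v + gmetric p (Y' v) (Z p) + gmetric p (Y p) (Z' v))"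
    by (rule ext) (simp add: Ce[of "Y p" "Z p"] gmetric_expand[OF p, of "Y' _" "Z p"] gmetric_expand[OF p, of "Y p" "Z' _"]
        sum.distrib distrib_right add.commute add.left_commute)
  ultimately show ?thesis by simp
qed

context
  fixes T assumes T: "linear T" and f_T: "\<And>x. f (T x) = f x"
begin

lemma df_invariant: "df (T p) (T v) = df p v"
proof -
  have "((\<lambda>q. f (T q)) has_derivative (\<lambda>v. df (T p) (T v))) (at p)"
    by (rule has_derivative_compose[OF bounded_linear_imp_has_derivative[OF linear_imp_bounded[OF T]] df])
  then have "(f has_derivative (\<lambda>v. df (T p) (T v))) (at p)" by (simp add: f_T)
  from fun_cong[OF has_derivative_unique[OF this df], of v] show ?thesis .
qed

lemma hessian_invariant: "hessian f (T p) (T u) (T v) = hessian f p u v"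
proof -
  have h: "((\<lambda>q. df q w) has_derivative hessian f p w) (at p)" for p w
    using smooth_on_has_derivative[OF df_smooth[of w], of p] by (simp add: hessian_def[abs_def] df_def)
  have "((\<lambda>q. df (T q) (T u)) has_derivative (\<lambda>v. hessian f (T p) (T u) (T v))) (at p)"
    by (rule has_derivative_compose[OF bounded_linear_imp_has_derivative[OF linear_imp_bounded[OF T]] h])
  then have "((\<lambda>q. df q u) has_derivative (\<lambda>v. hessian f (T p) (T u) (T v))) (at p)" by (simp add: df_invariant)
  from fun_cong[OF has_derivative_unique[OF this h], of v] show ?thesis .
qed

lemma gmetric_invariant: "p \<in> pos \<Longrightarrow> gmetric (T p) (T u) (T v) = gmetric p u v"
  using gmetric_on_pos(1)[of p] gmetric_on_pos(1)[of "T p"] by (simp add: pos_def f_T df_invariant hessian_invariant)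

end

end

locale symmetric_quartic = homogeneous_quartic f for f :: "'a::euclidean_space \<Rightarrow> real" +
  fixes \<sigma> :: "'a \<Rightarrow> 'a"
  assumes \<sigma>_linear: "linear \<sigma>" and \<sigma>_involution: "\<sigma> (\<sigma> x) = x" and f_\<sigma>: "f (\<sigma> x) = f x"
begin

abbreviation "M \<equiv> {x. f x = 1}"
abbreviation "N \<equiv> fixed_level \<sigma>"

lemma \<sigma>_has_derivative: "(\<sigma> has_derivative \<sigma>) F"
  by (rule bounded_linear_imp_has_derivative[OF linear_imp_bounded[OF \<sigma>_linear]])

lemmas df_\<sigma> = df_invariant[OF \<sigma>_linear f_\<sigma>]
  and gmetric_\<sigma> = gmetric_invariant[OF \<sigma>_linear f_\<sigma>]

lemma dgmetric_\<sigma>: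
  assumes p: "p \<in> pos" "\<sigma> p = p" and y: "\<sigma> y = y" "\<sigma> z = z" and w: "\<sigma> w = - w"
  shows "dgmetric p y z w = 0"
proof -
  have "((\<lambda>q. gmetric (\<sigma> q) y z) has_derivative (\<lambda>v. dgmetric p y z (\<sigma> v))) (at p)"
    using has_derivative_compose[OF \<sigma>_has_derivative, where g = "\<lambda>q. gmetric q y z" and g' = "dgmetric p y z" and x = p] dgmetric[OF p(1), of y z]
    by (simp add: p(2))
  then have "((\<lambda>q. gmetric q y z) has_derivative (\<lambda>v. dgmetric p y z (\<sigma> v))) (at p)"
    by (rule has_derivative_transform_within_open[OF _ open_pos p(1)]) (metis gmetric_\<sigma> y)
  from has_derivative_unique[OF this dgmetric[OF p(1)]] have "dgmetric p y z (\<sigma> w) = dgmetric p y z w" by metis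
  then have "dgmetric p y z (- w) = dgmetric p y z w" by (simp add: w)
  then show ?thesis using linear_neg[OF has_derivative_linear[OF dgmetric[OF p(1)]], of y z w] by simp
qed

text \<open>The involution is an isometry, so its eigenspaces are orthogonal.\<close>

lemma gmetric_fixed_antifixed:
  assumes p: "p \<in> pos" "\<sigma> p = p" and y: "\<sigma> y = y" "\<sigma> z = - z"
  shows "gmetric p y z = 0" "gmetric p z y = 0"
proof -
  have "gmetric p y (- z) = gmetric p y z" using gmetric_\<sigma>[OF p(1), of y z] by (simp add: p y)
  then show "gmetric p y z = 0" using linear_neg[OF gmetric_linear[OF p(1)], of y z] by simp
  then show "gmetric p z y = 0" using gmetric_sym[OF p(1)] by simp
qed

lemma M_pos: "p \<in> M \<Longrightarrow> p \<in> pos" by (simp add: pos_def)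

lemma derivative_fixed:
  assumes Y: "(Y has_derivative Y') (at p)" and inv: "\<And>q. q \<in> N \<Longrightarrow> \<sigma> (Y q) = Y q" and v: "v \<in> tangent_space N p"
  shows "\<sigma> (Y' v) = Y' v"
proof -
  have "((\<lambda>q. \<sigma> (Y q) - Y q) has_derivative (\<lambda>v. \<sigma> (Y' v) - Y' v)) (at p)"
    by (intro has_derivative_diff Y has_derivative_compose[OF Y \<sigma>_has_derivative])
  from derivative_zero_on_curve[OF this v, of 0] inv show ?thesis by simp
qed

text \<open>Constant fields made tangent to the level sets by a radial correction; they are the test fields for
  Koszul's formula.\<close>

definition tangential where "tangential z q = z - (df q z / (4 * f q)) *\<^sub>R q"

lemma tangential_tangent: "tangent_field M (tangential z)"
  unfolding tangent_field_def
proof (intro conjI exI[of _ pos] ballI open_pos)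
  show "M \<subseteq> pos" by (auto simp: pos_def)
  show "smooth_on pos (tangential z)"
    unfolding tangential_def[abs_def]
    by (intro smooth_on_diff smooth_on_scaleR smooth_on_divide smooth_on_mult smooth_on_const smooth_on_ident
        smooth_pos smooth df_smooth open_pos) (auto simp: pos_def)
  fix p assume p: "p \<in> M"
  then show "tangential z p \<in> tangent_space M p"
    by (simp add: tangent_level tangential_def linear_diff[OF df_linear] linear_cmul[OF df_linear] euler)
qed

lemma df_antifixed: "\<sigma> p = p \<Longrightarrow> \<sigma> z = - z \<Longrightarrow> df p z = 0"
  using df_\<sigma>[of p z] linear_neg[OF df_linear, of p z] by simp

lemma tangent_field_derivative:
  assumes "tangent_field M X" "p \<in> M"
  shows "(X has_derivative frechet_derivative X (at p)) (at p)"
  using assms smooth_on_has_derivative unfolding tangent_field_def by blast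

text \<open>In Koszul's formula for \<open>D X Y\<close> with \<open>X\<close> and \<open>Y\<close> tangent to the fixed point set, tested against a
  field that is antifixed at the points of that set, all terms vanish by the orthogonality of the
  two eigenspaces.  As the metric is nondegenerate, \<open>D X Y\<close> is fixed.\<close>

theorem totally_geodesic_fixed:
  assumes nondeg: "\<And>p w. p \<in> N \<Longrightarrow> df p w = 0 \<Longrightarrow> (\<And>z. df p z = 0 \<Longrightarrow> gmetric p w z = 0) \<Longrightarrow> w = 0"
  shows "totally_geodesic M gmetric N"
  unfolding totally_geodesic_def
proof (rule allI, rule impI)
  fix D
  assume D: "levi_civita_connection M gmetric D"
  show "\<forall>X Y. tangent_field M X \<longrightarrow> tangent_field M Y \<longrightarrow>
      (\<forall>p\<in>N. X p \<in> tangent_space N p \<and> Y p \<in> tangent_space N p) \<longrightarrow>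
      (\<forall>p\<in>N. D X Y p \<in> tangent_space N p)"
  proof (intro allI impI ballI)
  fix X Y p
  assume X: "tangent_field M X" and Y: "tangent_field M Y"
    and XY: "\<forall>p\<in>N. X p \<in> tangent_space N p \<and> Y p \<in> tangent_space N p" and p: "p \<in> N"
  have pM: "p \<in> M" "p \<in> pos" "\<sigma> p = p" using p by (auto simp: pos_def)
  have fixed: "\<sigma> (X q) = X q" "\<sigma> (Y q) = Y q" if "q \<in> N" for q
    using XY that tangent_fixed_level[OF \<sigma>_linear that] by auto
  have Xp: "X p \<in> tangent_space N p" "Y p \<in> tangent_space N p" using XY p by auto
  have closed: "tangent_field M (D V W)" if "tangent_field M V" "tangent_field M W" for V W
    by (rule D[unfolded levi_civita_connection_def affine_connection_def, THEN conjunct1, THEN conjunct1,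
          rule_format, OF that])
  have torsion: "D V W p - D W V p = frechet_derivative W (at p) (V p) - frechet_derivative V (at p) (W p)"
    if "tangent_field M V" "tangent_field M W" for V W
    by (rule D[unfolded levi_civita_connection_def lie_bracket_def, THEN conjunct2, THEN conjunct1,
          rule_format, OF that pM(1)])
  have compat: "dgmetric p (V p) (W p) (U p) + gmetric p (frechet_derivative V (at p) (U p)) (W p) + gmetric p (V p) (frechet_derivative W (at p) (U p))
      = gmetric p (D U V p) (W p) + gmetric p (V p) (D U W p)"
    if t: "tangent_field M U" "tangent_field M V" "tangent_field M W" for U V W
  proof -
    have "frechet_derivative (\<lambda>q. gmetric q (V q) (W q)) (at p) (U p) = gmetric p (D U V p) (W p) + gmetric p (V p) (D U W p)"
      by (rule D[unfolded levi_civita_connection_def, THEN conjunct2, THEN conjunct2, rule_format, OF t pM(1)])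
    then show ?thesis
      unfolding fun_cong[OF frechet_derivative_at[OF derivative_gmetric_fields[OF pM(2) tangent_field_derivative[OF t(2) pM(1)]
          tangent_field_derivative[OF t(3) pM(1)]]], of "U p"] .
  qed
  let ?w = "D X Y p"
  have normal: "gmetric p ?w z = 0" if z: "\<sigma> z = - z" for z
  proof -
    define Z where "Z = tangential z"
    have ZN: "Z q = z" if "q \<in> N" for q
      using df_antifixed[of q z] that z by (simp add: Z_def tangential_def)
    note Z = tangential_tangent[of z, folded Z_def]
    let ?X = "frechet_derivative X (at p)" and ?Y = "frechet_derivative Y (at p)" and ?Z = "frechet_derivative Z (at p)"
    note dX = tangent_field_derivative[OF X pM(1)] and dY = tangent_field_derivative[OF Y pM(1)]
      and dZ = tangent_field_derivative[OF Z pM(1)]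
    have Zp: "Z p = z" by (rule ZN[OF p])
    have Z0: "?Z (X p) = 0" "?Z (Y p) = 0"
      using derivative_zero_on_curve[OF dZ _ ZN] Xp by blast+
    have "gmetric q (W q) (Z q) = 0" if "q \<in> N" "\<sigma> (W q) = W q" for q W
      using gmetric_fixed_antifixed(1)[of q "W q" z] that ZN[of q] z M_pos[of q] by simp
    note BZ = this
    have e1: "dgmetric p (Y p) (Z p) (X p) + gmetric p (?Y (X p)) (Z p) + gmetric p (Y p) (?Z (X p)) = 0"
      by (rule derivative_zero_on_curve[OF derivative_gmetric_fields[OF pM(2) dY dZ] Xp(1), of 0])
        (simp add: BZ fixed)
    have e2: "dgmetric p (X p) (Z p) (Y p) + gmetric p (?X (Y p)) (Z p) + gmetric p (X p) (?Z (Y p)) = 0"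
      by (rule derivative_zero_on_curve[OF derivative_gmetric_fields[OF pM(2) dX dZ] Xp(2), of 0])
        (simp add: BZ fixed)
    have fXY: "\<sigma> (?Y (X p)) = ?Y (X p)" "\<sigma> (?X (Y p)) = ?X (Y p)"
      using derivative_fixed[OF dY fixed(2) Xp(1)] derivative_fixed[OF dX fixed(1) Xp(2)] by auto
    have dg0: "dgmetric p (X p) (Y p) (Z p) = 0" using dgmetric_\<sigma>[OF pM(2,3) fixed(1,2)[OF p]] z by (simp add: Zp)
    note lin = linear_diff[OF gmetric_linear[OF pM(2)]] linear_diff[OF gmetric_linear_left[OF pM(2)]]
      linear_0[OF gmetric_linear[OF pM(2)]] linear_0[OF gmetric_linear_left[OF pM(2)]]
      linear_neg[OF gmetric_linear[OF pM(2)]] linear_neg[OF gmetric_linear_left[OF pM(2)]]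
    have c1: "gmetric p (D X Y p) z + gmetric p (Y p) (D X Z p) = 0" using compat[OF X Y Z] e1 by (simp add: Zp)
    have c2: "gmetric p (D Y X p) z + gmetric p (X p) (D Y Z p) = 0" using compat[OF Y X Z] e2 by (simp add: Zp)
    have c3: "gmetric p (D Z X p) (Y p) + gmetric p (X p) (D Z Y p) = gmetric p (?X z) (Y p) + gmetric p (X p) (?Y z)"
      using compat[OF Z X Y] dg0 by (simp add: Zp)
    have t1: "gmetric p (D X Y p) z - gmetric p (D Y X p) z = 0"
      using arg_cong[OF torsion[OF X Y], of "\<lambda>v. gmetric p v z"] gmetric_fixed_antifixed(1)[OF pM(2,3) fXY(1) z]
        gmetric_fixed_antifixed(1)[OF pM(2,3) fXY(2) z] by (simp add: lin)
    have t2: "gmetric p (Y p) (D X Z p) - gmetric p (Y p) (D Z X p) = - gmetric p (Y p) (?X z)"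
      using arg_cong[OF torsion[OF X Z], of "gmetric p (Y p)"] by (simp add: lin Z0 Zp)
    have t3: "gmetric p (X p) (D Y Z p) - gmetric p (X p) (D Z Y p) = - gmetric p (X p) (?Y z)"
      using arg_cong[OF torsion[OF Y Z], of "gmetric p (X p)"] by (simp add: lin Z0 Zp)
    show ?thesis
      using c1 c2 c3 t1 t2 t3 gmetric_sym[OF pM(2), of "D Z X p" "Y p"] gmetric_sym[OF pM(2), of "?X z" "Y p"] by linarith
  qed
  have wM: "df p ?w = 0"
    using closed[OF X Y] pM tangent_level[of p] unfolding tangent_field_def by blast
  note lin = linear_diff[OF \<sigma>_linear] linear_add[OF \<sigma>_linear] linear_cmul[OF \<sigma>_linear]
  let ?a = "?w - \<sigma> ?w" and ?b = "?w + \<sigma> ?w"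
  have dfa: "df p ?a = 0" using df_\<sigma>[of p ?w] wM by (simp add: pM linear_diff[OF df_linear])
  have "?a = 0"
  proof (rule nondeg[OF p dfa])
    fix z assume "df p z = 0"
    have s: "\<sigma> ?a = - ?a" "\<sigma> ?b = ?b" by (simp_all add: lin \<sigma>_involution)
    let ?za = "z - \<sigma> z" and ?zb = "z + \<sigma> z"
    have t: "\<sigma> ?za = - ?za" "\<sigma> ?zb = ?zb" by (simp_all add: lin \<sigma>_involution)
    have "2 *\<^sub>R z = ?za + ?zb" "2 *\<^sub>R ?w = ?a + ?b" by (simp_all add: scaleR_2)
    have "2 * gmetric p ?w ?za = gmetric p ?a ?za + gmetric p ?b ?za"
      using arg_cong[OF \<open>2 *\<^sub>R ?w = ?a + ?b\<close>, of "\<lambda>v. gmetric p v ?za"]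
      unfolding linear_cmul[OF gmetric_linear_left[OF pM(2)]] linear_add[OF gmetric_linear_left[OF pM(2)]] by simp
    then have "gmetric p ?a ?za = 0" using normal[OF t(1)] gmetric_fixed_antifixed(1)[OF pM(2,3) s(2) t(1)] by simp
    moreover have "gmetric p ?a ?zb = 0" by (rule gmetric_fixed_antifixed(2)[OF pM(2,3) t(2) s(1)])
    moreover have "2 * gmetric p ?a z = gmetric p ?a ?za + gmetric p ?a ?zb"
      using arg_cong[OF \<open>2 *\<^sub>R z = ?za + ?zb\<close>, of "gmetric p ?a"]
      unfolding linear_cmul[OF gmetric_linear[OF pM(2)]] linear_add[OF gmetric_linear[OF pM(2)]] by simp
    ultimately show "gmetric p ?a z = 0" by simp
  qed
  then have fix_w: "\<sigma> ?w = ?w" by (metis eq_iff_diff_eq_0)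
  have "?w \<in> {v. \<sigma> v = v \<and> df p v = 0}" by (rule CollectI, rule conjI, rule fix_w, rule wM)
  then show "?w \<in> tangent_space N p" by (simp only: tangent_fixed_level[OF \<sigma>_linear p])
  qed
qed

end

section \<open>Exponentials of linear maps\<close>

lemma linear_funpow: "linear X \<Longrightarrow> linear (X ^^ n)" for X :: "'a::real_vector \<Rightarrow> 'a"
  by (induction n) (auto simp: linear_id intro: linear_compose)

lemma lin_exp_sums:
  fixes X :: "'a::euclidean_space \<Rightarrow> 'a"
  assumes "linear X"
  shows "(\<lambda>n. (X ^^ n) v /\<^sub>R fact n) sums lin_exp X v"
proof -
  obtain K where K: "0 < K" "\<And>v. norm (X v) \<le> norm v * K"
    using bounded_linear.pos_bounded[OF linear_imp_bounded[OF assms]] by blast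
  have n: "norm ((X ^^ n) v) \<le> K ^ n * norm v" for n
  proof (induction n)
    case (Suc n)
    have "norm (X ((X ^^ n) v)) \<le> norm ((X ^^ n) v) * K" by (rule K)
    also have "\<dots> \<le> (K ^ n * norm v) * K" using Suc K(1) by (intro mult_right_mono) auto
    finally show ?case by (simp add: algebra_simps)
  qed simp
  have "summable (\<lambda>n. (K ^ n /\<^sub>R fact n) * norm v)"
    by (rule summable_mult2[OF summable_exp_generic])
  then have "summable (\<lambda>n. (X ^^ n) v /\<^sub>R fact n)"
    by (rule summable_comparison_test'[where N = 0]) (use n in \<open>simp add: divide_right_mono field_simps\<close>)
  then show ?thesis unfolding lin_exp_def by (rule summable_sums)
qed

lemma funpow_scaleR:
  fixes X :: "'a::real_vector \<Rightarrow> 'a"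
  assumes "linear X"
  shows "((\<lambda>v. t *\<^sub>R X v) ^^ n) v = t ^ n *\<^sub>R (X ^^ n) v"
  by (induction n) (simp_all add: linear_cmul[OF assms])

lemma linear_scaled: "linear X \<Longrightarrow> linear (\<lambda>v. t *\<^sub>R X v)"
  by (rule linear_compose_scale_right)

lemma lin_exp_zero [simp]: "lin_exp (\<lambda>v. 0) v = v"
proof -
  have "(\<lambda>n. ((\<lambda>v. 0 :: 'a) ^^ n) v /\<^sub>R fact n) = (\<lambda>n. if n = 0 then v else 0)"
  proof
    fix n show "((\<lambda>v. 0 :: 'a) ^^ n) v /\<^sub>R fact n = (if n = 0 then v else 0)" by (cases n) auto
  qed
  then show ?thesis unfolding lin_exp_def using sums_single[of 0 "\<lambda>_. v"] by (simp add: sums_iff)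
qed

lemma lin_exp_intertwine:
  fixes X :: "'a::euclidean_space \<Rightarrow> 'a" and Y :: "'b::euclidean_space \<Rightarrow> 'b"
  assumes X: "linear X" and R: "linear R" "\<And>v. R (X v) = Y (R v)"
  shows "R (lin_exp X v) = lin_exp Y (R v)"
proof -
  have "R ((X ^^ n) v) = (Y ^^ n) (R v)" for n by (induction n) (simp_all add: R(2))
  then have "(\<lambda>n. R ((X ^^ n) v /\<^sub>R fact n)) = (\<lambda>n. (Y ^^ n) (R v) /\<^sub>R fact n)"
    by (simp add: linear_cmul[OF R(1)])
  then show ?thesis
    using bounded_linear.sums[OF linear_imp_bounded[OF R(1)] lin_exp_sums[OF X, of v]]
    unfolding lin_exp_def by (simp add: sums_iff)
qed

lemma lin_exp_linear:
  fixes X :: "'a::euclidean_space \<Rightarrow> 'a"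
  assumes X: "linear X"
  shows "linear (lin_exp X)"
proof (rule linearI)
  fix v w :: 'a and c :: real
  have "(\<lambda>n. (X ^^ n) (v + w) /\<^sub>R fact n) sums (lin_exp X v + lin_exp X w)"
    using sums_add[OF lin_exp_sums[OF X, of v] lin_exp_sums[OF X, of w]]
    by (simp add: linear_add[OF linear_funpow[OF X]] scaleR_add_right)
  then show "lin_exp X (v + w) = lin_exp X v + lin_exp X w"
    using lin_exp_sums[OF X, of "v + w"] sums_unique2 by blast
  show "lin_exp X (c *\<^sub>R v) = c *\<^sub>R lin_exp X v"
    using lin_exp_intertwine[OF X, of "\<lambda>v. c *\<^sub>R v" X v] by (simp add: linear_cmul[OF X] linear_scale_self)
qed

lemma lin_exp_nilpotent:
  fixes X :: "'a::euclidean_space \<Rightarrow> 'a"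
  assumes X: "linear X" "\<And>v. X (X v) = 0"
  shows "lin_exp X v = v + X v"
proof -
  have "(X ^^ n) v = 0" if "2 \<le> n" for n
  proof -
    obtain m where "n = 2 + m" using le_Suc_ex[OF \<open>2 \<le> n\<close>] by blast
    then show ?thesis by (simp add: X(2) numeral_2_eq_2)
  qed
  then have "(\<lambda>n. (X ^^ n) v /\<^sub>R fact n) sums (\<Sum>n<2. (X ^^ n) v /\<^sub>R fact n)"
    by (intro sums_finite) auto
  then show ?thesis
    using lin_exp_sums[OF X(1), of v] sums_unique2 by (fastforce simp: numeral_2_eq_2)
qed

lemma lin_exp_has_vector_derivative:
  fixes X :: "'a::euclidean_space \<Rightarrow> 'a"
  assumes X: "linear X"
  shows "((\<lambda>t. lin_exp (\<lambda>v. t *\<^sub>R X v) v) has_vector_derivative X (lin_exp (\<lambda>v. t *\<^sub>R X v) v)) (at t)"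
proof -
  have s: "(\<lambda>n. (t ^ n /\<^sub>R fact n) *\<^sub>R (X ^^ n) w) sums lin_exp (\<lambda>v. t *\<^sub>R X v) w" for t w
    using lin_exp_sums[OF linear_scaled[OF X], of t w] by (simp add: funpow_scaleR[OF X] mult.commute)
  have "((\<lambda>t. lin_exp (\<lambda>v. t *\<^sub>R X v) v \<bullet> b) has_derivative (\<lambda>s. (s *\<^sub>R X (lin_exp (\<lambda>v. t *\<^sub>R X v) v)) \<bullet> b)) (at t)"
    if "b \<in> Basis" for b
  proof -
    define c where "c n = ((X ^^ n) v \<bullet> b) / fact n" for n
    have cs: "(\<lambda>n. c n * y ^ n) sums (lin_exp (\<lambda>v. y *\<^sub>R X v) v \<bullet> b)" for y
      using bounded_linear.sums[OF bounded_linear_inner_left s[of y v]]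
      by (simp add: c_def field_simps)
    have "diffs c n = ((X ^^ n) (X v) \<bullet> b) / fact n" for n
      by (simp add: diffs_def c_def funpow_swap1 field_simps del: of_nat_Suc)
    then have "diffs c n * t ^ n = ((t ^ n /\<^sub>R fact n) *\<^sub>R (X ^^ n) (X v)) \<bullet> b" for n
      by (simp add: divide_inverse)
    then have "(\<lambda>n. diffs c n * t ^ n) sums (lin_exp (\<lambda>v. t *\<^sub>R X v) (X v) \<bullet> b)"
      using bounded_linear.sums[OF bounded_linear_inner_left s[of t "X v"], of b] by (simp only:)
    moreover have "lin_exp (\<lambda>v. t *\<^sub>R X v) (X v) = X (lin_exp (\<lambda>v. t *\<^sub>R X v) v)"
      by (rule lin_exp_intertwine[OF linear_scaled[OF X] X, symmetric]) (simp add: linear_cmul[OF X])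
    ultimately have "((\<lambda>y. \<Sum>n. c n * y ^ n) has_field_derivative (X (lin_exp (\<lambda>v. t *\<^sub>R X v) v) \<bullet> b)) (at t)"
      using termdiffs_strong_converges_everywhere[of c t] cs by (metis sums_iff)
    then have "((\<lambda>y. lin_exp (\<lambda>v. y *\<^sub>R X v) v \<bullet> b) has_field_derivative (X (lin_exp (\<lambda>v. t *\<^sub>R X v) v) \<bullet> b)) (at t)"
      using sums_unique[OF cs] by simp
    then show ?thesis unfolding has_field_derivative_def
      by (rule has_derivative_eq_rhs) (simp add: fun_eq_iff mult.commute)
  qed
  then show ?thesis
    unfolding has_vector_derivative_def by (subst has_derivative_componentwise_within) blast
qed

lemma lin_exp_preserves_bilinear:
  fixes X :: "'a::euclidean_space \<Rightarrow> 'a" and \<beta> :: "'a \<Rightarrow> 'a \<Rightarrow> 'b::real_normed_vector"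
  assumes X: "linear X" and \<beta>: "bounded_bilinear \<beta>" and inv: "\<And>v w. \<beta> (X v) w + \<beta> v (X w) = 0"
  shows "\<beta> (lin_exp X v) (lin_exp X w) = \<beta> v w"
proof -
  let ?e = "\<lambda>t. lin_exp (\<lambda>v. t *\<^sub>R X v)"
  have "((\<lambda>t. \<beta> (?e t v) (?e t w)) has_derivative (\<lambda>s. 0)) (at t)" for t
  proof -
    have "((\<lambda>t. \<beta> (?e t v) (?e t w)) has_derivative
        (\<lambda>s. \<beta> (?e t v) (s *\<^sub>R X (?e t w)) + \<beta> (s *\<^sub>R X (?e t v)) (?e t w))) (at t)"
      using lin_exp_has_vector_derivative[OF X] unfolding has_vector_derivative_def
      by (intro bounded_bilinear.FDERIV[OF \<beta>])
    moreover have "\<beta> (?e t v) (s *\<^sub>R X (?e t w)) + \<beta> (s *\<^sub>R X (?e t v)) (?e t w) = 0" for s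
      using inv[of "?e t v" "?e t w"]
      by (simp add: bounded_bilinear.scaleR_left[OF \<beta>] bounded_bilinear.scaleR_right[OF \<beta>] add.commute
          flip: scaleR_add_right)
    ultimately show ?thesis by simp
  qed
  then have "\<beta> (?e 1 v) (?e 1 w) = \<beta> (?e 0 v) (?e 0 w)"
    by (intro has_derivative_zero_unique_connected[of UNIV "\<lambda>t. \<beta> (?e t v) (?e t w)"]) auto
  then show ?thesis by simp
qed

section \<open>Clifford multiplication and the vector representation\<close>

lemma linear_inv_into:
  assumes g: "linear g" "bij g"
  shows "linear (inv_into UNIV g)"
proof -
  note s = surj_f_inv_f[OF bij_is_surj[OF g(2)]]
  have i: "g v = g w \<Longrightarrow> v = w" for v w using g(2) by (auto simp: bij_def inj_def)
  show ?thesis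
    by (rule linearI; rule i) (simp_all add: s linear_add[OF g(1)] linear_cmul[OF g(1)])
qed

lemma general_linear_group: "group (general_linear :: ('a::real_vector \<Rightarrow> 'a) monoid)"
proof (rule groupI)
  fix x y z :: "'a \<Rightarrow> 'a"
  show "\<one>\<^bsub>general_linear\<^esub> \<in> carrier (general_linear :: ('a \<Rightarrow> 'a) monoid)"
    by (simp add: general_linear_def linear_id)
  show "x \<in> carrier general_linear \<Longrightarrow> y \<in> carrier general_linear \<Longrightarrow> x \<otimes>\<^bsub>general_linear\<^esub> y \<in> carrier general_linear"
    by (auto simp: general_linear_def intro: linear_compose bij_comp)
  show "x \<otimes>\<^bsub>general_linear\<^esub> y \<otimes>\<^bsub>general_linear\<^esub> z = x \<otimes>\<^bsub>general_linear\<^esub> (y \<otimes>\<^bsub>general_linear\<^esub> z)"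
    by (simp add: general_linear_def comp_assoc)
  show "\<one>\<^bsub>general_linear\<^esub> \<otimes>\<^bsub>general_linear\<^esub> x = x" by (simp add: general_linear_def)
  assume "x \<in> carrier general_linear"
  then have x: "linear x" "bij x" by (auto simp: general_linear_def)
  then show "\<exists>y\<in>carrier general_linear. y \<otimes>\<^bsub>general_linear\<^esub> x = \<one>\<^bsub>general_linear\<^esub>"
    by (intro bexI[of _ "inv_into UNIV x"])
      (auto simp: general_linear_def bij_imp_bij_inv linear_inv_into bij_is_inj)
qed

interpretation GL: group general_linear by (rule general_linear_group)

lemma general_linear_simps [simp]:
  "g \<otimes>\<^bsub>general_linear\<^esub> h = g \<circ> h" "\<one>\<^bsub>general_linear\<^esub> = id"
  "g \<in> carrier general_linear \<longleftrightarrow> linear g \<and> bij g"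
  by (simp_all add: general_linear_def)

lemma general_linear_inv:
  assumes "linear g" "linear h" "\<And>x. g (h x) = x" "\<And>x. h (g x) = x"
  shows "bij g" "inv\<^bsub>general_linear\<^esub> g = h"
proof -
  show b: "bij g" by (rule o_bij[of h]) (use assms in auto)
  have "bij h" by (rule o_bij[of g]) (use assms in auto)
  then show "inv\<^bsub>general_linear\<^esub> g = h"
    using assms b by (intro GL.inv_equality) (auto simp: fun_eq_iff)
qed

lemma general_linear_inv_apply:
  assumes "linear g" "bij g"
  shows "inv\<^bsub>general_linear\<^esub> g = inv_into UNIV g"
  using assms by (intro general_linear_inv(2)) (auto simp: bij_def linear_inv_into surj_f_inv_f)

locale half_spin =
  fixes cp :: "real^8 \<Rightarrow> 'm::euclidean_space \<Rightarrow> 'p::euclidean_space"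
    and cm :: "real^8 \<Rightarrow> 'p \<Rightarrow> 'm"
  assumes half_spin: "half_spin_clifford cp cm"
begin

lemma dims: "DIM('m) = 8" "DIM('p) = 8"
  and cp_bilinear: "bilinear cp" and cm_bilinear: "bilinear cm"
  and clifford_p: "cp x (cm y \<phi>) + cp y (cm x \<phi>) = (- 2 * (x \<bullet> y)) *\<^sub>R \<phi>"
  and clifford_m: "cm x (cp y \<psi>) + cm y (cp x \<psi>) = (- 2 * (x \<bullet> y)) *\<^sub>R \<psi>"
  and cp_adjoint: "cp x \<psi> \<bullet> \<phi> = - (\<psi> \<bullet> cm x \<phi>)"
  using half_spin by (auto simp: half_spin_clifford_def)

lemmas cp_simps = bilinear_ladd[OF cp_bilinear] bilinear_radd[OF cp_bilinear] bilinear_lmul[OF cp_bilinear]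
  bilinear_rmul[OF cp_bilinear] bilinear_lneg[OF cp_bilinear] bilinear_rneg[OF cp_bilinear]
  bilinear_lzero[OF cp_bilinear] bilinear_rzero[OF cp_bilinear] bilinear_lsub[OF cp_bilinear] bilinear_rsub[OF cp_bilinear]

lemmas cm_simps = bilinear_ladd[OF cm_bilinear] bilinear_radd[OF cm_bilinear] bilinear_lmul[OF cm_bilinear]
  bilinear_rmul[OF cm_bilinear] bilinear_lneg[OF cm_bilinear] bilinear_rneg[OF cm_bilinear]
  bilinear_lzero[OF cm_bilinear] bilinear_rzero[OF cm_bilinear] bilinear_lsub[OF cm_bilinear] bilinear_rsub[OF cm_bilinear]

lemma cp_cm: "cp x (cm x \<phi>) = - (x \<bullet> x) *\<^sub>R \<phi>"
proof -
  have "2 *\<^sub>R cp x (cm x \<phi>) = 2 *\<^sub>R (- (x \<bullet> x) *\<^sub>R \<phi>)"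
    using clifford_p[of x x \<phi>] by (simp add: scaleR_2[symmetric])
  then show ?thesis by (simp only: scaleR_cancel_left) simp
qed

lemma cm_cp: "cm x (cp x \<psi>) = - (x \<bullet> x) *\<^sub>R \<psi>"
proof -
  have "2 *\<^sub>R cm x (cp x \<psi>) = 2 *\<^sub>R (- (x \<bullet> x) *\<^sub>R \<psi>)"
    using clifford_m[of x x \<psi>] by (simp add: scaleR_2[symmetric])
  then show ?thesis by (simp only: scaleR_cancel_left) simp
qed

lemma cm_adjoint: "cm x \<phi> \<bullet> \<psi> = - (\<phi> \<bullet> cp x \<psi>)"
  using cp_adjoint[of x \<psi> \<phi>] by (simp add: inner_commute)

lemma inner_cp_same: "cp x \<psi> \<bullet> cp x \<psi>' = (x \<bullet> x) * (\<psi> \<bullet> \<psi>')"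
  by (simp add: cp_adjoint cm_cp)

lemma inner_cm_same: "cm x \<phi> \<bullet> cm x \<phi>' = (x \<bullet> x) * (\<phi> \<bullet> \<phi>')"
  by (simp add: cm_adjoint cp_cm)

lemma inner_cp_vectors: "cp x \<psi> \<bullet> cp y \<psi> = (x \<bullet> y) * (\<psi> \<bullet> \<psi>)"
  using inner_cp_same[of "x + y" \<psi> \<psi>]
  by (simp add: cp_simps inner_add inner_cp_same inner_commute algebra_simps)

lemma inner_cm_vectors: "cm x \<phi> \<bullet> cm y \<phi> = (x \<bullet> y) * (\<phi> \<bullet> \<phi>)"
  using inner_cm_same[of "x + y" \<phi> \<phi>]
  by (simp add: cm_simps inner_add inner_cm_same inner_commute algebra_simps)

lemma norm_cp: "norm (cp x \<psi>) = norm x * norm \<psi>"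
  by (rule power2_eq_imp_eq) (simp_all add: power_mult_distrib power2_norm_eq_inner inner_cp_same)

lemma norm_cm: "norm (cm x \<phi>) = norm x * norm \<phi>"
  by (rule power2_eq_imp_eq) (simp_all add: power_mult_distrib power2_norm_eq_inner inner_cm_same)

lemma cp_linear: "linear (cp x)" "linear (\<lambda>x. cp x \<psi>)"
  and cm_linear: "linear (cm x)" "linear (\<lambda>x. cm x \<phi>)"
  using cp_bilinear cm_bilinear by (auto simp: bilinear_def)

lemma surj_cp: assumes "\<psi> \<noteq> 0" obtains a where "cp a \<psi> = \<phi>"
proof -
  have "inj (\<lambda>x. cp x \<psi>)"
    unfolding linear_injective_0[OF cp_linear(2)] using norm_cp[of _ \<psi>] assms by (metis mult_eq_0_iff norm_eq_zero)
  then have "dim (range (\<lambda>x. cp x \<psi>)) = DIM(real^8)"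
    using dim_image_eq[OF cp_linear(2)[of \<psi>], of UNIV] by (simp add: inj_on_def)
  then have "range (\<lambda>x. cp x \<psi>) = UNIV"
    using dim_eq_full[of "range (\<lambda>x. cp x \<psi>)"] dims linear_subspace_image[OF cp_linear(2) subspace_UNIV]
    by (simp add: span_eq_iff[THEN iffD2])
  then show ?thesis using that by (metis UNIV_I imageE)
qed

lemma surj_cm: assumes "\<phi> \<noteq> 0" obtains a where "cm a \<phi> = \<psi>"
proof -
  have "inj (\<lambda>x. cm x \<phi>)"
    unfolding linear_injective_0[OF cm_linear(2)] using norm_cm[of _ \<phi>] assms by (metis mult_eq_0_iff norm_eq_zero)
  then have "dim (range (\<lambda>x. cm x \<phi>)) = DIM(real^8)"
    using dim_image_eq[OF cm_linear(2)[of \<phi>], of UNIV] by (simp add: inj_on_def)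
  then have "range (\<lambda>x. cm x \<phi>) = UNIV"
    using dim_eq_full[of "range (\<lambda>x. cm x \<phi>)"] dims linear_subspace_image[OF cm_linear(2) subspace_UNIV]
    by (simp add: span_eq_iff[THEN iffD2])
  then show ?thesis using that by (metis UNIV_I imageE)
qed

abbreviation "sp \<equiv> spinor_product cp"

lemma inner_sp: "x \<bullet> sp \<psi> \<phi> = cp x \<psi> \<bullet> \<phi>"
  unfolding spinor_product_def using adjoint_works[OF cp_linear(2)] .

lemma sp_bilinear: "bilinear sp"
  unfolding bilinear_def
  by (intro conjI allI linearI; rule vector_eq_ldot[THEN iffD1])
    (simp_all add: inner_sp inner_add cp_simps)

lemmas sp_simps = bilinear_ladd[OF sp_bilinear] bilinear_radd[OF sp_bilinear] bilinear_lmul[OF sp_bilinear]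
  bilinear_rmul[OF sp_bilinear] bilinear_lneg[OF sp_bilinear] bilinear_rneg[OF sp_bilinear]
  bilinear_lzero[OF sp_bilinear] bilinear_rzero[OF sp_bilinear] bilinear_lsub[OF sp_bilinear] bilinear_rsub[OF sp_bilinear]

lemma sp_cp: "sp \<psi> (cp a \<psi>) = (\<psi> \<bullet> \<psi>) *\<^sub>R a"
  by (rule vector_eq_ldot[THEN iffD1]) (simp add: inner_sp inner_cp_vectors mult.commute)

lemma sp_cm: "sp (cm a \<phi>) \<phi> = - (\<phi> \<bullet> \<phi>) *\<^sub>R a"
  by (rule vector_eq_ldot[THEN iffD1])
    (simp add: inner_sp cp_adjoint[of _ "cm a \<phi>" \<phi>] inner_cm_vectors inner_commute[of a] mult.commute)

lemma norm_sp: "sp \<psi> \<phi> \<bullet> sp \<psi> \<phi> = (\<psi> \<bullet> \<psi>) * (\<phi> \<bullet> \<phi>)"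
proof (cases "\<psi> = 0")
  case False
  then obtain a where "cp a \<psi> = \<phi>" using surj_cp by blast
  then show ?thesis by (simp add: sp_cp inner_cp_same flip: \<open>cp a \<psi> = \<phi>\<close>)
qed (simp add: sp_simps)

subsection \<open>Squares of spinors\<close>

definition sq :: "'m \<times> 'p \<Rightarrow> vec91" where
  "sq \<psi> = (fst \<psi> \<bullet> fst \<psi>, 2 *\<^sub>R sp (fst \<psi>) (snd \<psi>), snd \<psi> \<bullet> snd \<psi>)"

lemma vec_fun_inj:
  assumes "\<And>x. vec_fun f x = vec_fun g x" shows "f = g"
proof -
  obtain a b c where f: "f = (a, b, c)" by (cases f)
  obtain a' b' c' where g: "g = (a', b', c')" by (cases g)
  have c: "c = c'" using assms[of 0] by (simp add: f g)
  have ab: "a * (norm x)\<^sup>2 + x \<bullet> b = a' * (norm x)\<^sup>2 + x \<bullet> b'" for x using assms[of x] c by (simp add: f g)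
  have "x \<bullet> b = x \<bullet> b'" for x using ab[of x] ab[of "-x"] by simp
  then have b: "b = b'" using vector_eq_ldot by blast
  have "a = a'" using ab[of "axis 1 1"] b by (simp add: norm_axis_1)
  with b c f g show ?thesis by simp
qed

lemma spinor_square: "spinor_square cp \<psi> = sq \<psi>"
  unfolding spinor_square_def
proof (rule the_equality)
  show *: "\<forall>x. vec_fun (sq \<psi>) x = spinor_fun cp \<psi> x \<bullet> spinor_fun cp \<psi> x"
    by (cases \<psi>) (simp add: sq_def inner_add inner_cp_same inner_sp inner_commute power2_norm_eq_inner)
  show "f = sq \<psi>" if "\<forall>x. vec_fun f x = spinor_fun cp \<psi> x \<bullet> spinor_fun cp \<psi> x" for f
    using vec_fun_inj[of f "sq \<psi>"] * that by simp
qed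

lemma sq_determines:
  assumes A: "linear A" "linear A'" and eq: "\<And>\<psi>. A (sq \<psi>) = A' (sq \<psi>)"
  shows "A v = A' v"
proof -
  obtain m :: 'm where m: "norm m = 1" using vector_choose_size[of 1] by (metis zero_le_one)
  obtain p :: 'p where p: "norm p = 1" using vector_choose_size[of 1] by (metis zero_le_one)
  have mm: "m \<bullet> m = 1" "p \<bullet> p = 1" using m p by (simp_all add: dot_square_norm)
  obtain a b c where v: "v = (a, b, c)" by (cases v)
  have "v = (a - 1) *\<^sub>R sq (m, 0) + sq (m, cp ((1/2) *\<^sub>R b) m) + (c - b \<bullet> b / 4) *\<^sub>R sq (0, p)"
    by (simp add: v sq_def sp_simps sp_cp mm cp_simps inner_cp_same)
  then show ?thesis
    using eq by (simp add: linear_add[OF A(1)] linear_add[OF A(2)] linear_cmul[OF A(1)] linear_cmul[OF A(2)])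
qed

lemma vec_form_bilinear: "bilinear vec_form"
  unfolding bilinear_def by (auto intro!: linearI simp: inner_add algebra_simps)

lemma vec_form_sym: "vec_form f g = vec_form g f"
  by (cases f; cases g) (simp add: inner_commute)

lemma spin_det: "spin_det cp \<rho> = - vec_form (sq (fst \<rho>)) (sq (snd \<rho>)) / 2"
  by (cases \<rho>) (auto simp: spin_det_def sq_def power2_norm_eq_inner split: prod.splits)

lemma sq_null: "vec_form (sq \<psi>) (sq \<psi>) = 0"
  by (cases \<psi>) (simp add: sq_def norm_sp)

subsection \<open>The group Spin(9,1)\<close>

definition spE :: "real^8 \<Rightarrow> 'm \<times> 'p \<Rightarrow> 'm \<times> 'p" where "spE a = (\<lambda>(\<phi>m, \<phi>p). (\<phi>m, \<phi>p + cp a \<phi>m))"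
definition spF :: "real^8 \<Rightarrow> 'm \<times> 'p \<Rightarrow> 'm \<times> 'p" where "spF a = (\<lambda>(\<phi>m, \<phi>p). (\<phi>m + cm a \<phi>p, \<phi>p))"

lemma Spin91_eq: "Spin91 cp cm = generate general_linear (range spE \<union> range spF)"
  unfolding Spin91_def spE_def[abs_def] spF_def[abs_def] by (rule arg_cong[of _ _ "generate general_linear"]) auto

lemma spE_linear: "linear (spE a)" and spF_linear: "linear (spF a)"
  by (auto intro!: linearI simp: spE_def spF_def cp_simps cm_simps scaleR_add_right)

lemma spE_inv: "bij (spE a)" "inv\<^bsub>general_linear\<^esub> (spE a) = spE (- a)"
  using general_linear_inv[OF spE_linear[of a] spE_linear[of "-a"]]
  by (auto simp: spE_def cp_simps split: prod.splits)

lemma spF_inv: "bij (spF a)" "inv\<^bsub>general_linear\<^esub> (spF a) = spF (- a)"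
  using general_linear_inv[OF spF_linear[of a] spF_linear[of "-a"]]
  by (auto simp: spF_def cm_simps split: prod.splits)

lemma Spin91_subgroup: "subgroup (Spin91 cp cm) general_linear"
  unfolding Spin91_eq
  by (rule GL.generate_is_subgroup) (auto simp: spE_linear spF_linear spE_inv spF_inv)

lemma spE_Spin91: "spE a \<in> Spin91 cp cm" and spF_Spin91: "spF a \<in> Spin91 cp cm"
  unfolding Spin91_eq by (auto intro: generate.incl)

lemma Spin91_comp: "g \<in> Spin91 cp cm \<Longrightarrow> h \<in> Spin91 cp cm \<Longrightarrow> g \<circ> h \<in> Spin91 cp cm"
  using subgroup.m_closed[OF Spin91_subgroup, of g h] by simp

definition vecE :: "real^8 \<Rightarrow> vec91 \<Rightarrow> vec91" where
  "vecE a = (\<lambda>(\<alpha>, b, \<gamma>). (\<alpha>, b + (2 * \<alpha>) *\<^sub>R a, \<gamma> + a \<bullet> b + (a \<bullet> a) * \<alpha>))"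
definition vecF :: "real^8 \<Rightarrow> vec91 \<Rightarrow> vec91" where
  "vecF a = (\<lambda>(\<alpha>, b, \<gamma>). (\<alpha> - a \<bullet> b + (a \<bullet> a) * \<gamma>, b - (2 * \<gamma>) *\<^sub>R a, \<gamma>))"

lemma vecE_linear: "linear (vecE a)" and vecF_linear: "linear (vecF a)"
  by (auto intro!: linearI simp: vecE_def vecF_def inner_add algebra_simps)

lemma vecE_sq: "vecE a (sq \<psi>) = sq (spE a \<psi>)"
  by (cases \<psi>) (simp add: vecE_def spE_def sq_def sp_simps sp_cp inner_add inner_cp_same inner_sp algebra_simps inner_commute)

lemma vecF_sq: "vecF a (sq \<psi>) = sq (spF a \<psi>)"
  using cm_adjoint[of a "snd \<psi>" "fst \<psi>"] by (cases \<psi>) (simp add: vecF_def spF_def sq_def sp_simps sp_cm inner_add inner_cm_same inner_sp cp_adjoint algebra_simps inner_commute)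

lemma vecE_form: "vec_form (vecE a f) (vecE a g) = vec_form f g"
  by (cases f; cases g) (simp add: vecE_def inner_add algebra_simps inner_commute)

lemma vecF_form: "vec_form (vecF a f) (vecF a g) = vec_form f g"
  by (cases f; cases g) (simp add: vecF_def inner_add inner_diff algebra_simps inner_commute)

definition lifts :: "('m \<times> 'p \<Rightarrow> 'm \<times> 'p) \<Rightarrow> (vec91 \<Rightarrow> vec91) \<Rightarrow> bool" where
  "lifts g A \<longleftrightarrow> linear A \<and> (\<forall>\<psi>. A (sq \<psi>) = sq (g \<psi>)) \<and> (\<forall>f h. vec_form (A f) (A h) = vec_form f h)"

lemma lifts_E: "lifts (spE a) (vecE a)" and lifts_F: "lifts (spF a) (vecF a)"
  by (simp_all only: lifts_def vecE_linear vecE_sq vecE_form vecF_linear vecF_sq vecF_form simp_thms)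

lemma Spin91_lifts: assumes "g \<in> Spin91 cp cm" shows "\<exists>A. lifts g A"
  using assms unfolding Spin91_eq
proof (induction rule: generate.induct)
  case one
  show ?case
    by (rule exI[of _ "\<lambda>v. v"]) (simp add: lifts_def linear_ident)
next
  case (incl h)
  then show ?case using lifts_E lifts_F by blast
next
  case (inv h)
  then consider a where "h = spE a" | a where "h = spF a" by auto
  then show ?case
  proof cases
    case 1 show ?thesis unfolding 1 spE_inv by (rule exI, rule lifts_E)
  next
    case 2 show ?thesis unfolding 2 spF_inv by (rule exI, rule lifts_F)
  qed
next
  case (eng g h)
  then obtain A A' where "lifts g A" "lifts h A'" by blast
  then have "lifts (g \<circ> h) (A \<circ> A')" unfolding lifts_def
    by (simp add: linear_compose del: split_paired_All vec_form.simps)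
  then show ?case unfolding general_linear_simps by blast
qed

lemma vector_rep_eq:
  assumes "linear A" "\<And>\<psi>. A (sq \<psi>) = sq (g \<psi>)" shows "vector_rep cp g = A"
  unfolding vector_rep_def spinor_square
proof (rule the_equality)
  fix A' assume "linear A' \<and> (\<forall>\<psi>. A' (sq \<psi>) = sq (g \<psi>))"
  then show "A' = A" using sq_determines[of A' A] assms by auto
qed (use assms in auto)

lemma vector_rep_sq:
  assumes "g \<in> Spin91 cp cm"
  shows "vector_rep cp g (sq \<psi>) = sq (g \<psi>)"
proof -
  obtain A where A: "linear A" "\<And>\<psi>. A (sq \<psi>) = sq (g \<psi>)"
    using Spin91_lifts[OF assms] unfolding lifts_def by blast
  then show ?thesis using vector_rep_eq[of A g] by simp
qed

lemma Spin91_linear: "g \<in> Spin91 cp cm \<Longrightarrow> linear g" and Spin91_bij: "g \<in> Spin91 cp cm \<Longrightarrow> bij g"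
  using subgroup.mem_carrier[OF Spin91_subgroup] by auto

lemma spin_det_act:
  assumes g: "g \<in> Spin91 cp cm"
  shows "spin_det cp (act g A \<rho>) = (det A)\<^sup>2 * spin_det cp \<rho>"
proof -
  obtain V where V: "lifts g V" using Spin91_lifts[OF g] by blast
  define b where "b = (\<lambda>\<psi> \<theta>. (fst \<psi> \<bullet> fst \<theta>, sp (fst \<psi>) (snd \<theta>) + sp (fst \<theta>) (snd \<psi>), snd \<psi> \<bullet> snd \<theta>))"
  have sq2: "sq (s *\<^sub>R \<psi> + t *\<^sub>R \<theta>) = s\<^sup>2 *\<^sub>R sq \<psi> + (2 * s * t) *\<^sub>R b \<psi> \<theta> + t\<^sup>2 *\<^sub>R sq \<theta>" for s t \<psi> \<theta>
    by (cases \<psi>; cases \<theta>)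
      (simp add: sq_def b_def sp_simps inner_add inner_commute algebra_simps power2_eq_square)
  note form = bilinear_ladd[OF vec_form_bilinear] bilinear_radd[OF vec_form_bilinear]
    bilinear_lmul[OF vec_form_bilinear] bilinear_rmul[OF vec_form_bilinear]
  define \<psi> \<theta> where "\<psi> = g (fst \<rho>)" and "\<theta> = g (snd \<rho>)"
  let ?L = "vec_form (sq \<psi>) (sq \<theta>)"
  have q: "4 * s * vec_form (sq \<psi>) (b \<psi> \<theta>) + s\<^sup>2 * (2 * ?L + 4 * vec_form (b \<psi> \<theta>) (b \<psi> \<theta>))
      + 4 * s ^ 3 * vec_form (sq \<theta>) (b \<psi> \<theta>) = 0" for s
  proof -
    have "vec_form (sq (1 *\<^sub>R \<psi> + s *\<^sub>R \<theta>)) (sq (1 *\<^sub>R \<psi> + s *\<^sub>R \<theta>)) = 0" by (rule sq_null)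
    then show ?thesis
      unfolding sq2 form sq_null vec_form_sym[of "b \<psi> \<theta>" "sq \<psi>"] vec_form_sym[of "b \<psi> \<theta>" "sq \<theta>"]
        vec_form_sym[of "sq \<theta>" "sq \<psi>"]
      by (simp add: algebra_simps power2_eq_square power3_eq_cube)
  qed
  have "vec_form (sq \<psi>) (b \<psi> \<theta>) = 0" "vec_form (sq \<theta>) (b \<psi> \<theta>) = 0" "2 * vec_form (b \<psi> \<theta>) (b \<psi> \<theta>) = - ?L"
    using q[of 1] q[of "-1"] q[of 2] by simp_all
  then have "vec_form (sq (s *\<^sub>R \<psi> + t *\<^sub>R \<theta>)) (sq (c *\<^sub>R \<psi> + d *\<^sub>R \<theta>)) = (s * d - t * c)\<^sup>2 * ?L" for s t c d
    unfolding sq2 form sq_null vec_form_sym[of "b \<psi> \<theta>" "sq \<psi>"] vec_form_sym[of "b \<psi> \<theta>" "sq \<theta>"]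
        vec_form_sym[of "sq \<theta>" "sq \<psi>"]
    by (simp add: algebra_simps power2_eq_square)
  moreover have "?L = vec_form (sq (fst \<rho>)) (sq (snd \<rho>))"
    using V unfolding \<psi>_def \<theta>_def lifts_def by metis
  ultimately show ?thesis
    unfolding spin_det act_def fst_conv snd_conv \<psi>_def[symmetric] \<theta>_def[symmetric] by (simp add: det_2)
qed

end

context half_spin
begin

section \<open>The determinant as a homogeneous quartic\<close>

lemma bounded_bilinear_sp: "bounded_bilinear sp"
  using sp_bilinear by (simp add: bilinear_conv_bounded_bilinear)

lemma spin_det_expand: "spin_det cp \<rho> = (fst (fst \<rho>) \<bullet> fst (fst \<rho>)) * (snd (snd \<rho>) \<bullet> snd (snd \<rho>))
    + (fst (snd \<rho>) \<bullet> fst (snd \<rho>)) * (snd (fst \<rho>) \<bullet> snd (fst \<rho>))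
    - 2 * (sp (fst (fst \<rho>)) (snd (fst \<rho>)) \<bullet> sp (fst (snd \<rho>)) (snd (snd \<rho>)))"
  by (cases \<rho>) (auto simp: spin_det_def power2_norm_eq_inner split: prod.splits)

lemma smooth_components:
  "smooth_on UNIV (\<lambda>\<rho> :: ('a::real_normed_vector \<times> 'b::real_normed_vector) \<times> ('a \<times> 'b). fst (fst \<rho>))"
  "smooth_on UNIV (\<lambda>\<rho> :: ('a \<times> 'b) \<times> ('a \<times> 'b). snd (fst \<rho>))"
  "smooth_on UNIV (\<lambda>\<rho> :: ('a \<times> 'b) \<times> ('a \<times> 'b). fst (snd \<rho>))"
  "smooth_on UNIV (\<lambda>\<rho> :: ('a \<times> 'b) \<times> ('a \<times> 'b). snd (snd \<rho>))"
  by (intro smooth_on_bounded_linear open_UNIV bounded_linear_compose[OF bounded_linear_fst bounded_linear_fst]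
      bounded_linear_compose[OF bounded_linear_fst bounded_linear_snd]
      bounded_linear_compose[OF bounded_linear_snd bounded_linear_fst]
      bounded_linear_compose[OF bounded_linear_snd bounded_linear_snd])+

lemma spin_det_smooth: "smooth_on UNIV (spin_det cp)"
  unfolding spin_det_expand[abs_def]
  by (intro smooth_on_diff smooth_on_add smooth_on_mult smooth_on_const open_UNIV
      smooth_on_bilinear[OF open_UNIV bounded_bilinear_inner] smooth_on_bilinear[OF open_UNIV bounded_bilinear_sp]
      smooth_components)

definition det1 :: "('m \<times> 'p) \<times> ('m \<times> 'p) \<Rightarrow> ('m \<times> 'p) \<times> ('m \<times> 'p) \<Rightarrow> real" where
  "det1 \<rho> u = 2 * (fst (fst \<rho>) \<bullet> fst (fst u)) * (snd (snd \<rho>) \<bullet> snd (snd \<rho>))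
    + 2 * (fst (fst \<rho>) \<bullet> fst (fst \<rho>)) * (snd (snd \<rho>) \<bullet> snd (snd u))
    + 2 * (fst (snd \<rho>) \<bullet> fst (snd u)) * (snd (fst \<rho>) \<bullet> snd (fst \<rho>))
    + 2 * (fst (snd \<rho>) \<bullet> fst (snd \<rho>)) * (snd (fst \<rho>) \<bullet> snd (fst u))
    - 2 * ((sp (fst (fst u)) (snd (fst \<rho>)) + sp (fst (fst \<rho>)) (snd (fst u))) \<bullet> sp (fst (snd \<rho>)) (snd (snd \<rho>)))
    - 2 * (sp (fst (fst \<rho>)) (snd (fst \<rho>)) \<bullet> (sp (fst (snd u)) (snd (snd \<rho>)) + sp (fst (snd \<rho>)) (snd (snd u))))"

definition det2 where
  "det2 \<rho> u v = 2 * (fst (fst v) \<bullet> fst (fst u)) * (snd (snd \<rho>) \<bullet> snd (snd \<rho>))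
    + 4 * (fst (fst \<rho>) \<bullet> fst (fst u)) * (snd (snd \<rho>) \<bullet> snd (snd v))
    + 4 * (fst (fst \<rho>) \<bullet> fst (fst v)) * (snd (snd \<rho>) \<bullet> snd (snd u))
    + 2 * (fst (fst \<rho>) \<bullet> fst (fst \<rho>)) * (snd (snd v) \<bullet> snd (snd u))
    + 2 * (fst (snd v) \<bullet> fst (snd u)) * (snd (fst \<rho>) \<bullet> snd (fst \<rho>))
    + 4 * (fst (snd \<rho>) \<bullet> fst (snd u)) * (snd (fst \<rho>) \<bullet> snd (fst v))
    + 4 * (fst (snd \<rho>) \<bullet> fst (snd v)) * (snd (fst \<rho>) \<bullet> snd (fst u))
    + 2 * (fst (snd \<rho>) \<bullet> fst (snd \<rho>)) * (snd (fst v) \<bullet> snd (fst u))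
    - 2 * ((sp (fst (fst u)) (snd (fst v)) + sp (fst (fst v)) (snd (fst u))) \<bullet> sp (fst (snd \<rho>)) (snd (snd \<rho>)))
    - 2 * ((sp (fst (fst u)) (snd (fst \<rho>)) + sp (fst (fst \<rho>)) (snd (fst u))) \<bullet>
        (sp (fst (snd v)) (snd (snd \<rho>)) + sp (fst (snd \<rho>)) (snd (snd v))))
    - 2 * ((sp (fst (fst v)) (snd (fst \<rho>)) + sp (fst (fst \<rho>)) (snd (fst v))) \<bullet>
        (sp (fst (snd u)) (snd (snd \<rho>)) + sp (fst (snd \<rho>)) (snd (snd u))))
    - 2 * (sp (fst (fst \<rho>)) (snd (fst \<rho>)) \<bullet> (sp (fst (snd u)) (snd (snd v)) + sp (fst (snd v)) (snd (snd u))))"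

lemma spin_det_derivative: "(spin_det cp has_derivative det1 \<rho>) (at \<rho>)"
  unfolding spin_det_expand[abs_def]
  by (rule derivative_eq_intros bounded_bilinear.FDERIV[OF bounded_bilinear_sp] refl)+
    (auto simp: det1_def fun_eq_iff inner_add algebra_simps inner_commute)

lemma det1_derivative: "((\<lambda>\<rho>. det1 \<rho> u) has_derivative det2 \<rho> u) (at \<rho>)"
  unfolding det1_def
  by (rule derivative_eq_intros bounded_bilinear.FDERIV[OF bounded_bilinear_sp] refl)+
    (auto simp: det2_def fun_eq_iff inner_add algebra_simps inner_commute sp_simps)

lemma frechet_spin_det: "frechet_derivative (spin_det cp) (at \<rho>) = det1 \<rho>"
  using frechet_derivative_at[OF spin_det_derivative] by simp

lemma hessian_spin_det: "hessian (spin_det cp) \<rho> u v = det2 \<rho> u v"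
  unfolding hessian_def frechet_spin_det using frechet_derivative_at[OF det1_derivative] by metis

sublocale homogeneous_quartic "spin_det cp"
proof
  show "smooth_on UNIV (spin_det cp)" by (rule spin_det_smooth)
  show "spin_det cp (c *\<^sub>R x) = c ^ 4 * spin_det cp x" for c x
    by (simp add: spin_det_expand sp_simps algebra_simps power4_eq_xxxx)
  show "hessian (spin_det cp) p u v = hessian (spin_det cp) p v u" for p u v
    unfolding hessian_spin_det
    by (simp add: det2_def inner_add algebra_simps inner_commute)
qed

lemma df_spin_det: "df \<rho> v = det1 \<rho> v" by (simp add: df_def frechet_spin_det)

lemma act_linear: "linear g \<Longrightarrow> linear (act g A)"
  by (rule linearI) (simp_all add: act_def linear_add linear_cmul algebra_simps)

lemma act_comp: "linear g \<Longrightarrow> act g A (act h B \<rho>) = act (g \<circ> h) (A ** B) \<rho>"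
  by (simp add: act_def linear_add linear_cmul matrix_matrix_mult_def sum_2 algebra_simps)

lemma act_mat_1 [simp]: "act g (mat 1) \<rho> = (g (fst \<rho>), g (snd \<rho>))"
  by (simp add: act_def mat_def)

lemma act_SL2R:
  assumes g: "g \<in> Spin91 cp cm" and A: "det A = 1"
  shows "spin_det cp (act g A \<rho>) = spin_det cp \<rho>" "linear (act g A)"
    "\<exists>T. \<forall>\<rho>. T (act g A \<rho>) = \<rho> \<and> act g A (T \<rho>) = \<rho>"
proof -
  show "spin_det cp (act g A \<rho>) = spin_det cp \<rho>" using spin_det_act[OF g] A by simp
  show "linear (act g A)" using act_linear Spin91_linear[OF g] .
  obtain B where B: "A ** B = mat 1" "B ** A = mat 1"
    using A invertible_det_nz[of A] by (auto simp: invertible_def)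
  let ?h = "inv_into UNIV g"
  have h: "linear ?h" "g \<circ> ?h = id" "?h \<circ> g = id"
    using linear_inv_into[OF Spin91_linear[OF g] Spin91_bij[OF g]] Spin91_bij[OF g]
    by (auto simp: fun_eq_iff bij_def surj_f_inv_f)
  have "act ?h B (act g A \<rho>) = \<rho> \<and> act g A (act ?h B \<rho>) = \<rho>" for \<rho>
    by (simp add: act_comp h Spin91_linear[OF g] B)
  then show "\<exists>T. \<forall>\<rho>. T (act g A \<rho>) = \<rho> \<and> act g A (T \<rho>) = \<rho>" by blast
qed

lemma nondegenerate_base:
  assumes n: "norm \<phi>m = 1" "norm \<phi>p = 1"
    and w: "df (base_point \<phi>m \<phi>p) w = 0" "\<And>z. df (base_point \<phi>m \<phi>p) z = 0 \<Longrightarrow> gmetric (base_point \<phi>m \<phi>p) w z = 0"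
  shows "w = 0"
proof -
  let ?p = "base_point \<phi>m \<phi>p"
  have nn: "\<phi>m \<bullet> \<phi>m = 1" "\<phi>p \<bullet> \<phi>p = 1" "\<phi>m \<noteq> 0" "\<phi>p \<noteq> 0" using n by (auto simp: dot_square_norm)
  have pos: "?p \<in> pos" by (simp add: pos_def base_point_def spin_det_expand sp_simps nn)
  obtain a c b d where w_eq: "w = ((a, c), (b, d))" by (metis surj_pair)
  have df1: "df ?p ((x, y), (z, t)) = 2 * (\<phi>m \<bullet> x) + 2 * (\<phi>p \<bullet> t)" for x y z t
    by (simp add: df_spin_det det1_def base_point_def sp_simps nn)
  have hess: "2 * (x \<bullet> a) + 4 * (\<phi>m \<bullet> a) * (\<phi>p \<bullet> t) + 4 * (\<phi>m \<bullet> x) * (\<phi>p \<bullet> d) + 2 * (t \<bullet> d)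
      - 2 * (sp \<phi>m c \<bullet> sp z \<phi>p) - 2 * (sp \<phi>m y \<bullet> sp b \<phi>p) = 0"
    if "\<phi>m \<bullet> x + \<phi>p \<bullet> t = 0" for x y z t
  proof -
    have dz: "df ?p ((x, y), (z, t)) = 0" using that by (simp add: df1)
    have "det2 ?p w ((x, y), (z, t)) = 0"
      using w(2)[OF dz] gmetric_on_pos(1)[OF pos] pos w(1) by (simp add: pos_def hessian_spin_det)
    then show ?thesis by (simp add: det2_def base_point_def sp_simps nn w_eq)
  qed
  have "sp b \<phi>p = 0"
  proof -
    obtain y where "sp \<phi>m y = sp b \<phi>p" using sp_cp[of \<phi>m "sp b \<phi>p"] nn by auto
    then show ?thesis using hess[of 0 0 0 y] by (simp add: sp_simps)
  qed
  then have b: "b = 0" using norm_sp[of b \<phi>p] nn by simp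
  have "sp \<phi>m c = 0"
  proof -
    obtain z where "sp z \<phi>p = sp \<phi>m c" using sp_cm[of "- sp \<phi>m c" \<phi>p] nn by auto
    then show ?thesis using hess[of 0 0 z 0] by (simp add: sp_simps)
  qed
  then have c: "c = 0" using norm_sp[of \<phi>m c] nn by simp
  have t: "\<phi>m \<bullet> a + \<phi>p \<bullet> d = 0" using w(1) by (simp add: w_eq df1)
  have ad: "\<phi>m \<bullet> a = 0"
    using hess[of \<phi>m "- \<phi>p" 0 0] t nn by (simp add: sp_simps b c inner_commute)
  have "a \<bullet> a = 0" using hess[of a 0 0 0] ad t by (simp add: sp_simps b c)
  moreover have "d \<bullet> d = 0" using hess[of 0 d 0 0] ad t by (simp add: sp_simps b c)
  ultimately show ?thesis by (simp add: w_eq b c zero_prod_def)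
qed

text \<open>Nondegeneracy spreads from the base point to its whole orbit.\<close>

lemma nondegenerate_orbit:
  assumes n: "norm \<phi>m = 1" "norm \<phi>p = 1" and g: "g \<in> Spin91 cp cm" "det A = 1"
    and p: "p = act g A (base_point \<phi>m \<phi>p)"
    and w: "df p w = 0" "\<And>z. df p z = 0 \<Longrightarrow> gmetric p w z = 0"
  shows "w = 0"
proof -
  note T = act_SL2R[OF g]
  obtain S where S: "\<And>\<rho>. S (act g A \<rho>) = \<rho>" "\<And>\<rho>. act g A (S \<rho>) = \<rho>" using T(3) by blast
  let ?b = "base_point \<phi>m \<phi>p"
  have pos: "?b \<in> pos" using n by (simp add: pos_def base_point_def spin_det_expand sp_simps dot_square_norm)
  have "S w = 0"
  proof (rule nondegenerate_base[OF n])
    show "df ?b (S w) = 0" using df_invariant[OF T(2,1), of ?b "S w"] w(1) by (simp add: S p)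
    show "gmetric ?b (S w) z = 0" if "df ?b z = 0" for z
      using df_invariant[OF T(2,1), of ?b z] gmetric_invariant[OF T(2,1) pos, of "S w" z] w(2)[of "act g A z"] that
      by (simp add: S p)
  qed
  then have "act g A (S w) = 0" by (simp add: linear_0[OF T(2)])
  then show ?thesis by (simp add: S)
qed

end

section \<open>Quaternionic two-by-two matrices\<close>

declare qmul.simps [simp del] qcnj.simps [simp del] omul.simps [simp del]

lemma qcnj_simps [simp]: "qcnj (qcnj x) = x" "qcnj (qmul x y) = qmul (qcnj y) (qcnj x)"
    "qcnj (x + y) = qcnj x + qcnj y" "qcnj (x - y) = qcnj x - qcnj y" "qcnj (- x) = - qcnj x"
    "qcnj (r *\<^sub>R x) = r *\<^sub>R qcnj x" "qcnj 0 = 0" "qcnj qone = qone"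
  using Q.conj_conj[of x] Q.conj_mult[of x y] linear_add[OF qcnj_linear] linear_diff[OF qcnj_linear]
    linear_neg[OF qcnj_linear] linear_cmul[OF qcnj_linear] linear_0[OF qcnj_linear] qcnj_qone
  by (auto simp only: Q_conj)

lemma qmul_cancel [simp]:
  "qmul (qcnj x) (qmul x y) = (x \<bullet> x) *\<^sub>R y" "qmul x (qmul (qcnj x) y) = (x \<bullet> x) *\<^sub>R y"
  "qmul (qcnj x) x = (x \<bullet> x) *\<^sub>R qone" "qmul x (qcnj x) = (x \<bullet> x) *\<^sub>R qone"
proof -
  have n: "qcnj x \<bullet> qcnj x = x \<bullet> x" for x by (cases x) (simp add: inner_prod_def inner_complex_def qcnj.simps)
  show 1: "qmul (qcnj x) (qmul x y) = (x \<bullet> x) *\<^sub>R y" for x y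
    using Q.conj_mult_cancel[of x y] by (simp only: Q_conj)
  show "qmul x (qmul (qcnj x) y) = (x \<bullet> x) *\<^sub>R y" using 1[of "qcnj x" y] by (simp add: n)
  show 2: "qmul (qcnj x) x = (x \<bullet> x) *\<^sub>R qone" for x using 1[of x qone] by simp
  show "qmul x (qcnj x) = (x \<bullet> x) *\<^sub>R qone" using 2[of "qcnj x"] by (simp add: n)
qed

lemmas qmul_distrib = Q.mult_add_left Q.mult_add_right Q.mult_diff_left Q.mult_diff_right

lemma qmul_real_part: "x + qcnj x = (2 * (x \<bullet> qone)) *\<^sub>R qone"
  using Q_conj[of x] by (simp add: Q.conj_def algebra_simps)

lemma qcnj_inner: "qcnj x \<bullet> qcnj y = x \<bullet> y"
  by (cases x; cases y) (simp add: inner_prod_def inner_complex_def qcnj.simps)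

lemma inner_qmul_left: "qmul x y \<bullet> z = y \<bullet> qmul (qcnj x) z"
  and inner_qmul_right: "qmul x y \<bullet> z = x \<bullet> qmul z (qcnj y)"
  using Q.inner_mult_conj_left[of x y z] Q.inner_mult_conj_right[of x y z] by (simp_all only: Q_conj)

definition mat2 :: "'a \<Rightarrow> 'a \<Rightarrow> 'a \<Rightarrow> 'a \<Rightarrow> 'a::zero^2^2" where
  "mat2 a b c d = vector [vector [a, b], vector [c, d]]"

lemma mat2_nth [simp]: "mat2 a b c d $ 1 $ 1 = a" "mat2 a b c d $ 1 $ 2 = b"
    "mat2 a b c d $ 2 $ 1 = c" "mat2 a b c d $ 2 $ 2 = d"
  by (simp_all add: mat2_def)

lemma mat2_eq_iff: "A = B \<longleftrightarrow> A $ 1 $ 1 = B $ 1 $ 1 \<and> A $ 1 $ 2 = B $ 1 $ 2 \<and> A $ 2 $ 1 = B $ 2 $ 1 \<and> A $ 2 $ 2 = B $ 2 $ 2"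
  for A B :: "'a^2^2"
  by (auto simp: vec_eq_iff forall_2)

lemma mat2_exhaust: "\<exists>a b c d. M = mat2 a b c d" for M :: "'a::zero^2^2"
  by (rule exI[of _ "M$1$1"], rule exI[of _ "M$1$2"], rule exI[of _ "M$2$1"], rule exI[of _ "M$2$2"])
    (simp add: mat2_eq_iff)

definition qmat_mult :: "quat^2^2 \<Rightarrow> quat^2^2 \<Rightarrow> quat^2^2" (infixl "\<star>" 70) where
  "M \<star> N = (\<chi> i j. \<Sum>k\<in>UNIV. qmul (M $ i $ k) (N $ k $ j))"

lemma qmat_mult_mat2: "mat2 a b c d \<star> mat2 a' b' c' d' =
    mat2 (qmul a a' + qmul b c') (qmul a b' + qmul b d') (qmul c a' + qmul d c') (qmul c b' + qmul d d')"
  by (simp add: mat2_eq_iff qmat_mult_def sum_2)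

definition qmat_one :: "quat^2^2" where "qmat_one = mat2 qone 0 0 qone"

lemma qmat_assoc: "(L \<star> M) \<star> N = L \<star> (M \<star> N)"
proof -
  obtain a b c d a' b' c' d' x y z w where
    "L = mat2 a b c d" "M = mat2 a' b' c' d'" "N = mat2 x y z w"
    using mat2_exhaust by metis
  then show ?thesis by (simp add: qmat_mult_mat2 qmul_distrib qmul_assoc add_ac)
qed

lemma qmat_one [simp]: "qmat_one \<star> M = M" "M \<star> qmat_one = M"
proof -
  obtain a b c d where "M = mat2 a b c d" using mat2_exhaust by metis
  then show "qmat_one \<star> M = M" "M \<star> qmat_one = M" by (simp_all add: qmat_one_def qmat_mult_mat2)
qed

definition qdet :: "quat^2^2 \<Rightarrow> real" where
  "qdet M = (M$1$1 \<bullet> M$1$1) * (M$2$2 \<bullet> M$2$2) + (M$1$2 \<bullet> M$1$2) * (M$2$1 \<bullet> M$2$1)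
     - 2 * (qmul (M$2$1) (qcnj (M$1$1)) \<bullet> qmul (M$2$2) (qcnj (M$1$2)))"

definition qadj :: "quat^2^2 \<Rightarrow> quat^2^2" where
  "qadj M = (let a = M$1$1; b = M$1$2; c = M$2$1; d = M$2$2 in mat2
     ((d \<bullet> d) *\<^sub>R qcnj a - qmul (qcnj c) (qmul d (qcnj b))) ((b \<bullet> b) *\<^sub>R qcnj c - qmul (qcnj a) (qmul b (qcnj d)))
     ((c \<bullet> c) *\<^sub>R qcnj b - qmul (qcnj d) (qmul c (qcnj a))) ((a \<bullet> a) *\<^sub>R qcnj d - qmul (qcnj b) (qmul a (qcnj c))))"

lemma cross_term:
  fixes a b c d :: quat
  defines "r \<equiv> qmul c (qcnj a) \<bullet> qmul d (qcnj b)"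
  shows "qmul (qcnj c) (qmul d (qmul (qcnj b) a)) + qmul (qcnj a) (qmul b (qmul (qcnj d) c)) = (2 * r) *\<^sub>R qone"
    and "qmul (qcnj d) (qmul c (qmul (qcnj a) b)) + qmul (qcnj b) (qmul a (qmul (qcnj c) d)) = (2 * r) *\<^sub>R qone"
    and "qmul a (qmul (qcnj c) (qmul d (qcnj b))) + qmul b (qmul (qcnj d) (qmul c (qcnj a))) = (2 * r) *\<^sub>R qone"
    and "qmul c (qmul (qcnj a) (qmul b (qcnj d))) + qmul d (qmul (qcnj b) (qmul a (qcnj c))) = (2 * r) *\<^sub>R qone"
proof -
  have 1: "qmul (qcnj c) (qmul d (qmul (qcnj b) a)) \<bullet> qone = r"
    using inner_qmul_left[of "qcnj c" "qmul d (qmul (qcnj b) a)" qone] inner_qmul_right[of "qmul d (qcnj b)" a c]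
    by (simp add: r_def qmul_assoc inner_commute)
  have 2: "qmul (qcnj d) (qmul c (qmul (qcnj a) b)) \<bullet> qone = r"
    using inner_qmul_left[of "qcnj d" "qmul c (qmul (qcnj a) b)" qone] inner_qmul_right[of "qmul c (qcnj a)" b d]
    by (simp add: r_def qmul_assoc)
  have 3: "qmul a (qmul (qcnj c) (qmul d (qcnj b))) \<bullet> qone = r"
    using inner_qmul_left[of a "qmul (qcnj c) (qmul d (qcnj b))" qone] inner_qmul_left[of "qcnj c" "qmul d (qcnj b)" "qcnj a"]
    by (simp add: r_def inner_commute)
  have 4: "qmul c (qmul (qcnj a) (qmul b (qcnj d))) \<bullet> qone = r"
    using inner_qmul_left[of c "qmul (qcnj a) (qmul b (qcnj d))" qone] inner_qmul_left[of "qcnj a" "qmul b (qcnj d)" "qcnj c"]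
      qcnj_inner[of "qmul c (qcnj a)" "qmul d (qcnj b)"]
    by (simp add: r_def inner_commute)
  show "qmul (qcnj c) (qmul d (qmul (qcnj b) a)) + qmul (qcnj a) (qmul b (qmul (qcnj d) c)) = (2 * r) *\<^sub>R qone"
    using qmul_real_part[of "qmul (qcnj c) (qmul d (qmul (qcnj b) a))"] 1 by (simp add: qmul_assoc)
  show "qmul (qcnj d) (qmul c (qmul (qcnj a) b)) + qmul (qcnj b) (qmul a (qmul (qcnj c) d)) = (2 * r) *\<^sub>R qone"
    using qmul_real_part[of "qmul (qcnj d) (qmul c (qmul (qcnj a) b))"] 2 by (simp add: qmul_assoc)
  show "qmul a (qmul (qcnj c) (qmul d (qcnj b))) + qmul b (qmul (qcnj d) (qmul c (qcnj a))) = (2 * r) *\<^sub>R qone"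
    using qmul_real_part[of "qmul a (qmul (qcnj c) (qmul d (qcnj b)))"] 3 by (simp add: qmul_assoc)
  show "qmul c (qmul (qcnj a) (qmul b (qcnj d))) + qmul d (qmul (qcnj b) (qmul a (qcnj c))) = (2 * r) *\<^sub>R qone"
    using qmul_real_part[of "qmul c (qmul (qcnj a) (qmul b (qcnj d)))"] 4 by (simp add: qmul_assoc)
qed

lemma qadj_inverse: "qadj M \<star> M = mat2 (qdet M *\<^sub>R qone) 0 0 (qdet M *\<^sub>R qone)"
    "M \<star> qadj M = mat2 (qdet M *\<^sub>R qone) 0 0 (qdet M *\<^sub>R qone)"
proof -
  obtain a b c d where M: "M = mat2 a b c d" using mat2_exhaust by blast
  note x = cross_term[where a = a and b = b and c = c and d = d]
  show "qadj M \<star> M = mat2 (qdet M *\<^sub>R qone) 0 0 (qdet M *\<^sub>R qone)"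
    unfolding M qadj_def Let_def mat2_nth qmat_mult_mat2
    by (simp add: mat2_eq_iff qmul_distrib qmul_assoc qdet_def scaleR_diff_left scaleR_add_left algebra_simps)
      (use x in \<open>simp add: algebra_simps\<close>)
  show "M \<star> qadj M = mat2 (qdet M *\<^sub>R qone) 0 0 (qdet M *\<^sub>R qone)"
    unfolding M qadj_def Let_def mat2_nth qmat_mult_mat2
    by (simp add: mat2_eq_iff qmul_distrib qmul_assoc qdet_def scaleR_diff_left scaleR_add_left algebra_simps)
      (use x in \<open>simp add: algebra_simps\<close>)
qed

subsection \<open>The Study determinant\<close>

lemma UNIV_2x2: "(UNIV :: (2 \<times> 2) set) = {(1,1), (1,2), (2,1), (2,2)}"
  by (auto simp: UNIV_Times_UNIV[symmetric] UNIV_2 simp del: UNIV_Times_UNIV)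

lemma det_2x2:
  fixes A :: "complex^(2 \<times> 2)^(2 \<times> 2)"
  defines "m i j k l \<equiv> A $ (i, j) $ (k, l)"
  shows "det A =
     m 1 1 1 1 * (m 1 2 1 2 * (m 2 1 2 1 * m 2 2 2 2 - m 2 1 2 2 * m 2 2 2 1)
        - m 1 2 2 1 * (m 2 1 1 2 * m 2 2 2 2 - m 2 1 2 2 * m 2 2 1 2)
        + m 1 2 2 2 * (m 2 1 1 2 * m 2 2 2 1 - m 2 1 2 1 * m 2 2 1 2))
     - m 1 1 1 2 * (m 1 2 1 1 * (m 2 1 2 1 * m 2 2 2 2 - m 2 1 2 2 * m 2 2 2 1)
        - m 1 2 2 1 * (m 2 1 1 1 * m 2 2 2 2 - m 2 1 2 2 * m 2 2 1 1)
        + m 1 2 2 2 * (m 2 1 1 1 * m 2 2 2 1 - m 2 1 2 1 * m 2 2 1 1))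
     + m 1 1 2 1 * (m 1 2 1 1 * (m 2 1 1 2 * m 2 2 2 2 - m 2 1 2 2 * m 2 2 1 2)
        - m 1 2 1 2 * (m 2 1 1 1 * m 2 2 2 2 - m 2 1 2 2 * m 2 2 1 1)
        + m 1 2 2 2 * (m 2 1 1 1 * m 2 2 1 2 - m 2 1 1 2 * m 2 2 1 1))
     - m 1 1 2 2 * (m 1 2 1 1 * (m 2 1 1 2 * m 2 2 2 1 - m 2 1 2 1 * m 2 2 1 2)
        - m 1 2 1 2 * (m 2 1 1 1 * m 2 2 2 1 - m 2 1 2 1 * m 2 2 1 1)
        + m 1 2 2 1 * (m 2 1 1 1 * m 2 2 1 2 - m 2 1 1 2 * m 2 2 1 1))"
proof -
  have f123: "finite {(1::2,2::2), (2,1), (2,2)}" "(1,1) \<notin> {(1::2,2::2), (2,1), (2,2)}" by auto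
  have f23: "finite {(2::2,1::2), (2,2)}" "(1,2) \<notin> {(2::2,1::2), (2,2)}" by auto
  have f3: "finite {(2::2,2::2)}" "(2,1) \<notin> {(2::2,2::2)}" by auto
  show ?thesis
    unfolding det_def UNIV_2x2 m_def
    unfolding sum_over_permutations_insert[OF f123]
    unfolding sum_over_permutations_insert[OF f23]
    unfolding sum_over_permutations_insert[OF f3]
    unfolding permutes_sing
    by (simp add: sign_swap_id permutation_swap_id sign_compose sign_id permutation_compose
        Transposition.transpose_def algebra_simps)
qed

lemma det_complexify: "det (complexify M) = complex_of_real (qdet M)"
proof -
  obtain a b c d where M: "M = mat2 a b c d" using mat2_exhaust by blast
  obtain a1 a2 b1 b2 c1 c2 d1 d2 where q: "a = (a1, a2)" "b = (b1, b2)" "c = (c1, c2)" "d = (d1, d2)"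
    by (metis surj_pair)
  have i: "complex_of_real (x \<bullet> y) = (x * cnj y + cnj x * y) / 2" for x y
    by (simp add: complex_eq_iff inner_complex_def)
  show ?thesis
    unfolding det_2x2
    by (simp add: complexify_def quat_matrix_def M q qdet_def inner_prod_def i qmul.simps qcnj.simps) (simp add: field_simps)
qed

lemma quat_matrix_mult: "quat_matrix (qmul x y) = quat_matrix x ** quat_matrix y"
  by (cases x; cases y) (simp add: quat_matrix_def qmul.simps vec_eq_iff forall_2 matrix_matrix_mult_def sum_2 mult.commute)

lemma quat_matrix_add: "quat_matrix (x + y) = quat_matrix x + quat_matrix y"
  by (simp add: quat_matrix_def vec_eq_iff forall_2)

lemma complexify_mult: "complexify (M \<star> N) = complexify M ** complexify N"
proof -
  have "(\<Sum>k\<in>(UNIV :: (2 \<times> 2) set). f k) = f (1,1) + f (1,2) + f (2,1) + f (2,2)" for f :: "2 \<times> 2 \<Rightarrow> complex"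
    unfolding UNIV_2x2 by (simp add: add.assoc)
  then show ?thesis
    by (simp add: vec_eq_iff forall_2 complexify_def qmat_mult_def sum_2 matrix_matrix_mult_def
        quat_matrix_mult quat_matrix_add split_paired_All)
qed

lemma qdet_mult: "qdet (M \<star> N) = qdet M * qdet N"
proof -
  have "complex_of_real (qdet (M \<star> N)) = complex_of_real (qdet M * qdet N)"
    by (simp only: det_complexify[symmetric] complexify_mult det_mul of_real_mult)
  then show ?thesis by (simp only: of_real_eq_iff)
qed

lemma SL2H_carrier: "carrier SL2H = {M. qdet M = 1}"
  using of_real_eq_iff[of _ 1, where 'a = complex] by (simp add: SL2H_def det_complexify)

lemma SL2H_mult: "M \<otimes>\<^bsub>SL2H\<^esub> N = M \<star> N"
  by (simp add: SL2H_def qmat_mult_def)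

lemma qadj_left_right: assumes "qdet M = 1" shows "qadj M \<star> M = qmat_one" "M \<star> qadj M = qmat_one"
  using qadj_inverse[of M] assms by (simp_all add: qmat_one_def)

lemma qadj_mult: assumes "qdet M = 1" "qdet N = 1" shows "qadj (M \<star> N) = qadj N \<star> qadj M"
proof -
  have "qadj (M \<star> N) = qadj (M \<star> N) \<star> (M \<star> (N \<star> qadj N) \<star> qadj M)"
    by (simp add: qadj_left_right assms)
  also have "\<dots> = (qadj (M \<star> N) \<star> (M \<star> N)) \<star> (qadj N \<star> qadj M)" by (simp only: qmat_assoc)
  also have "\<dots> = qadj N \<star> qadj M" by (simp add: qadj_left_right qdet_mult assms)
  finally show ?thesis .
qed

definition qE :: "quat \<Rightarrow> quat^2^2" where "qE q = mat2 qone 0 q qone"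
definition qF :: "quat \<Rightarrow> quat^2^2" where "qF q = mat2 qone q 0 qone"

lemma qdet_elementary [simp]: "qdet (qE q) = 1" "qdet (qF q) = 1"
  by (simp_all add: qdet_def qE_def qF_def)

lemma qadj_elementary: "qadj (qE q) = qE (- q)" "qadj (qF q) = qF (- q)"
  by (simp_all add: qadj_def qE_def qF_def)

lemma unit_quaternion_commutator:
  assumes u: "norm u = 1"
  shows "\<exists>x y. norm x = 1 \<and> norm y = 1 \<and> u = qmul (qmul (qcnj x) (qcnj y)) (qmul x y)"
proof -
  have uu: "u \<bullet> u = 1" using u by (simp add: dot_square_norm)
  obtain w where w: "norm w = 1" "qmul w w = u"
  proof (cases "u = - qone")
    case True
    have "norm (\<i>, 0 :: complex) = 1" by (simp add: norm_Pair)
    moreover have "qmul (\<i>, 0) (\<i>, 0) = u" by (simp add: True qmul.simps qone_def)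
    ultimately show ?thesis by (rule that)
  next
    case False
    define v where "v = u + qone"
    have v0: "norm v \<noteq> 0" using False by (simp add: v_def eq_neg_iff_add_eq_0)
    have "qmul u (u + qcnj u) = qmul u ((2 * (u \<bullet> qone)) *\<^sub>R qone)" by (simp only: qmul_real_part)
    then have "qmul u u = (2 * (u \<bullet> qone)) *\<^sub>R u - qone"
      by (simp add: Q.mult_add_right uu eq_diff_eq)
    then have "qmul v v = (2 + 2 * (u \<bullet> qone)) *\<^sub>R u"
      by (simp add: v_def qmul_distrib algebra_simps scaleR_2)
    moreover have "2 + 2 * (u \<bullet> qone) = (norm v)\<^sup>2"
      by (simp add: v_def power2_norm_eq_inner inner_add uu inner_commute)
    ultimately have "qmul (v /\<^sub>R norm v) (v /\<^sub>R norm v) = u"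
      using v0 by (simp add: power2_eq_square) (simp add: field_simps)
    moreover have "norm (v /\<^sub>R norm v) = 1" using v0 by simp
    ultimately show ?thesis using that by blast
  qed
  have "dim {qone, w} < DIM(quat)"
    using dim_le_card'[of "{qone, w}"] card_insert_le_m1[of 2 "{w}" qone] by simp
  from exists_unit_orthogonal[OF this]
  obtain y where y: "norm y = 1" "y \<bullet> qone = 0" "y \<bullet> w = 0" by auto
  have yy: "y \<bullet> y = 1" using y by (simp add: dot_square_norm)
  have "qmul w y = qmul y (qcnj w)" using Q.doubling_right[of y w] y by (simp only: Q_conj)
  then have "qmul (qcnj y) (qmul w y) = qcnj w" by (simp add: yy)
  then have "qcnj (qmul (qcnj y) (qmul w y)) = w" by simp
  then have "qmul (qmul (qcnj (qcnj w)) (qcnj y)) (qmul (qcnj w) y) = u" by (simp add: qmul_assoc w)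
  moreover have "norm (qcnj w) = 1" using w(1) qcnj_inner[of w w] by (simp add: norm_eq_sqrt_inner)
  ultimately show ?thesis using y(1) by blast
qed

text \<open>Gaussian elimination reduces to \<open>diag(1, u)\<close> with a unit \<open>u\<close>; as \<open>diag(x, x\<inverse>)\<close> is a product of
  elementary matrices, so is \<open>diag(1, u)\<close> once \<open>u\<close> is a commutator.\<close>

lemma SL2H_elementary_induct:
  assumes M: "qdet M = 1"
    and E: "\<And>q. P (qE q)" and F: "\<And>q. P (qF q)"
    and mult: "\<And>M N. qdet M = 1 \<Longrightarrow> qdet N = 1 \<Longrightarrow> P M \<Longrightarrow> P N \<Longrightarrow> P (M \<star> N)"
  shows "P M"
proof -
  let ?P = "\<lambda>M. qdet M = 1 \<and> P M"
  have m: "?P M \<Longrightarrow> ?P N \<Longrightarrow> ?P (M \<star> N)" for M N using mult by (simp add: qdet_mult)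
  have e: "?P (qE q)" "?P (qF q)" for q using E F by simp_all
  have w: "?P (mat2 0 x (- qcnj x) 0)" if "norm x = 1" for x
  proof -
    have "x \<bullet> x = 1" using that by (simp add: dot_square_norm)
    then have "qF x \<star> qE (- qcnj x) \<star> qF x = mat2 0 x (- qcnj x) 0"
      by (simp add: qE_def qF_def qmat_mult_mat2 qmul_assoc)
    then show ?thesis using m[OF m[OF e(2) e(1)] e(2), of x "- qcnj x" x] by simp
  qed
  have h: "?P (mat2 x 0 0 (qcnj x))" if "norm x = 1" for x
  proof -
    have "mat2 0 x (- qcnj x) 0 \<star> mat2 0 (- qone) (- qcnj (- qone)) 0 = mat2 x 0 0 (qcnj x)"
      by (simp add: qmat_mult_mat2)
    then show ?thesis using m[OF w[OF that] w[of "- qone"]] by simp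
  qed
  have u: "?P (mat2 qone 0 0 u)" if nu: "norm u = 1" for u
  proof -
    obtain x y where xy: "norm x = 1" "norm y = 1" "u = qmul (qmul (qcnj x) (qcnj y)) (qmul x y)"
      using unit_quaternion_commutator[OF nu] by blast
    have n: "norm (qcnj (qmul x y)) = 1"
      using xy qcnj_inner[of "qmul x y" "qmul x y"] by (simp add: norm_eq_sqrt_inner Q.inner_mult_self)
    have "x \<bullet> x = 1" "y \<bullet> y = 1" using xy by (simp_all add: dot_square_norm)
    then have "mat2 x 0 0 (qcnj x) \<star> mat2 y 0 0 (qcnj y) \<star> mat2 (qcnj (qmul x y)) 0 0 (qcnj (qcnj (qmul x y)))
        = mat2 qone 0 0 u"
      unfolding qmat_mult_mat2 by (simp add: xy(3) mat2_eq_iff qmul_assoc)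
    then show ?thesis using m[OF m[OF h[OF xy(1)] h[OF xy(2)]] h[OF n]] by simp
  qed
  have c: "?P (mat2 a b c d)" if det: "qdet (mat2 a b c d) = 1" and c: "c \<noteq> 0" for a b c d
  proof -
    define x where "x = (1 / (c \<bullet> c)) *\<^sub>R qmul (qone - a) (qcnj c)"
    define b' where "b' = b + qmul x d"
    define d' where "d' = d - qmul c b'"
    have xc: "qmul x c = qone - a" using c by (simp add: x_def qmul_assoc)
    have xcz: "qmul x (qmul c z) = z - qmul a z" for z
      using arg_cong[OF xc, of "\<lambda>y. qmul y z"] by (simp add: qmul_assoc Q.mult_diff_left)
    have eq: "mat2 a b c d = qF (- x) \<star> qE c \<star> mat2 qone 0 0 d' \<star> qF b'"
      by (simp add: qE_def qF_def qmat_mult_mat2 mat2_eq_iff b'_def d'_def qmul_distrib qmul_assoc xc xcz)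
    have "qdet (mat2 qone 0 0 d') = 1" using det unfolding eq qdet_mult by simp
    then have "norm d' = 1" by (simp add: qdet_def norm_eq_1)
    then show ?thesis unfolding eq by (intro m e u)
  qed
  obtain a b c' d where abcd: "M = mat2 a b c' d" using mat2_exhaust by metis
  show ?thesis
  proof (cases "c' = 0")
    case False
    then show ?thesis using c[of a b c' d] M abcd by simp
  next
    case True
    have "a \<noteq> 0" using M by (auto simp: abcd True qdet_def)
    have 1: "qE qone \<star> M = mat2 a b a (b + d)" by (simp add: qE_def abcd True qmat_mult_mat2)
    have 2: "qE (- qone) \<star> (qE qone \<star> M) = M"
      by (simp add: qE_def abcd True qmat_mult_mat2)
    have "qdet (mat2 a b a (b + d)) = 1" unfolding 1[symmetric] qdet_mult by (simp add: M)
    then have "?P (qE qone \<star> M)" unfolding 1 using c \<open>a \<noteq> 0\<close> by blast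
    then have "?P (qE (- qone) \<star> (qE qone \<star> M))" by (rule m[OF e(1)])
    then show ?thesis unfolding 2 by simp
  qed
qed

section \<open>The action of quaternionic matrices on pairs of octonions\<close>

text \<open>Left multiplication of an octonion by a quaternion multiplies the first Cayley-Dickson component from the
  left and the second one from the right.  So a quaternionic matrix acts on the first components from the
  left, and on the second components from the right through its adjugate.\<close>

definition theta :: "quat^2^2 \<Rightarrow> octonion \<times> octonion \<Rightarrow> octonion \<times> octonion" where
  "theta M v = (let N = qadj M; m0 = fst (fst v); m1 = snd (fst v); p0 = fst (snd v); p1 = snd (snd v) in
     ((qmul (M$1$1) m0 + qmul (M$1$2) p0, qmul m1 (N$2$2) - qmul p1 (N$1$2)),
      (qmul (M$2$1) m0 + qmul (M$2$2) p0, qmul p1 (N$1$1) - qmul m1 (N$2$1))))"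

lemma theta_mult: assumes "qdet M = 1" "qdet N = 1" shows "theta (M \<star> N) v = theta M (theta N v)"
proof -
  obtain a b c d where M: "qadj M = mat2 a b c d" using mat2_exhaust by blast
  obtain a' b' c' d' where N: "qadj N = mat2 a' b' c' d'" using mat2_exhaust by blast
  obtain x y z w where M': "M = mat2 x y z w" using mat2_exhaust by blast
  obtain x' y' z' w' where N': "N = mat2 x' y' z' w'" using mat2_exhaust by blast
  have "(M \<star> N)$1$1 = qmul x x' + qmul y z'" "(M \<star> N)$1$2 = qmul x y' + qmul y w'"
    "(M \<star> N)$2$1 = qmul z x' + qmul w z'" "(M \<star> N)$2$2 = qmul z y' + qmul w w'"
    by (simp_all add: M' N' qmat_mult_mat2)
  moreover have "M$1$1 = x" "M$1$2 = y" "M$2$1 = z" "M$2$2 = w" "N$1$1 = x'" "N$1$2 = y'" "N$2$1 = z'" "N$2$2 = w'"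
    by (simp_all add: M' N')
  ultimately show ?thesis
    unfolding theta_def Let_def qadj_mult[OF assms] M N
    by (simp add: qmat_mult_mat2 qmul_distrib qmul_assoc algebra_simps)
qed

lemma theta_one: "theta qmat_one v = v"
proof -
  have "qadj qmat_one = qmat_one" using qadj_elementary(1)[of 0] by (simp add: qE_def qmat_one_def)
  then show ?thesis unfolding theta_def by (simp add: qmat_one_def)
qed

lemma theta_elementary:
  "theta (qE q) (m, p) = (m, p + omul (q, 0) m)" "theta (qF q) (m, p) = (m + omul (q, 0) p, p)"
proof -
  obtain m0 m1 where m: "m = (m0, m1)" by (cases m)
  obtain p0 p1 where p: "p = (p0, p1)" by (cases p)
  show "theta (qE q) (m, p) = (m, p + omul (q, 0) m)" "theta (qF q) (m, p) = (m + omul (q, 0) p, p)"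
    unfolding theta_def Let_def qadj_elementary
    by (simp_all add: qE_def qF_def omul.simps m p)
qed

lemma theta_linear: "linear (theta M)"
  by (rule linearI) (simp_all add: theta_def Let_def qmul_distrib algebra_simps scaleR_add_right scaleR_diff_right)

text \<open>The form below pairs the two quaternionic blocks; together with the block structure it characterises the
  action of a unimodular matrix.\<close>

definition pairing :: "octonion \<times> octonion \<Rightarrow> octonion \<times> octonion \<Rightarrow> quat" where
  "pairing v w = qmul (snd (snd v)) (fst (fst w)) - qmul (snd (fst v)) (fst (snd w))"

lemma pairing_bilinear: "bilinear pairing"
  unfolding bilinear_def
  by (intro conjI allI linearI; simp add: pairing_def qmul_distrib algebra_simps fst_add snd_add)

definition right_block :: "quat \<Rightarrow> octonion \<times> octonion \<Rightarrow> octonion \<times> octonion" where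
  "right_block q v = ((qmul (fst (fst v)) q, qmul q (snd (fst v))), (qmul (fst (snd v)) q, qmul q (snd (snd v))))"

definition sign_block :: "octonion \<times> octonion \<Rightarrow> octonion \<times> octonion" where
  "sign_block v = ((fst (fst v), - snd (fst v)), (fst (snd v), - snd (snd v)))"

lemma self_neg_zero: "x = - x \<Longrightarrow> x = 0" for x :: "'a::real_vector"
  by (metis add.right_inverse scaleR_2 scaleR_eq_0_iff zero_neq_numeral)

lemma pair_units: "(oone, 0) = ((qone, 0), (0 :: quat, 0 :: quat))" "(0, oone) = ((0 :: quat, 0 :: quat), (qone, 0))"
  by (simp_all add: oone_def zero_prod_def)

lemma theta_characterisation:
  assumes g: "linear g" "\<And>v. g (sign_block v) = sign_block (g v)" "\<And>q v. g (right_block q v) = right_block q (g v)"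
    "\<And>v w. pairing (g v) (g w) = pairing v w"
  defines "M \<equiv> mat2 (fst (fst (g (oone, 0)))) (fst (fst (g (0, oone)))) (fst (snd (g (oone, 0)))) (fst (snd (g (0, oone))))"
  assumes det: "qdet M = 1"
  shows "g = theta M"
proof
  fix v :: "octonion \<times> octonion"
  have first: "g ((m0, 0), (p0, 0)) = theta M ((m0, 0), (p0, 0))" for m0 p0
  proof -
    have s: "snd (fst (g ((m, 0), (p, 0)))) = 0" "snd (snd (g ((m, 0), (p, 0)))) = 0" for m p
    proof -
      have "sign_block ((m, 0), (p, 0)) = ((m, 0), (p, 0))" by (simp add: sign_block_def)
      then have "sign_block (g ((m, 0), (p, 0))) = g ((m, 0), (p, 0))" using g(2) by metis
      then have n: "- snd (fst (g ((m, 0), (p, 0)))) = snd (fst (g ((m, 0), (p, 0))))"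
        "- snd (snd (g ((m, 0), (p, 0)))) = snd (snd (g ((m, 0), (p, 0))))"
        unfolding sign_block_def by (metis fst_conv snd_conv)+
      show "snd (fst (g ((m, 0), (p, 0)))) = 0" by (rule self_neg_zero[OF n(1)[symmetric]])
      show "snd (snd (g ((m, 0), (p, 0)))) = 0" by (rule self_neg_zero[OF n(2)[symmetric]])
    qed
    have "((m0, 0), (p0, 0)) = right_block m0 (oone, 0) + right_block p0 (0, oone)"
      unfolding pair_units by (simp add: right_block_def)
    then have "g ((m0, 0), (p0, 0)) = right_block m0 (g (oone, 0)) + right_block p0 (g (0, oone))"
      using g(3) linear_add[OF g(1)] by metis
    moreover have "snd (fst (g (oone, 0))) = 0" "snd (snd (g (oone, 0))) = 0"
      "snd (fst (g (0, oone))) = 0" "snd (snd (g (0, oone))) = 0"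
      using s[of qone 0] s[of 0 qone] by (simp_all only: pair_units)
    ultimately show ?thesis
      by (simp add: right_block_def theta_def M_def Let_def)
  qed
  have second: "g ((0, m1), (0, p1)) = theta M ((0, m1), (0, p1))" for m1 p1
  proof -
    obtain x0 x1 y0 y1 where gx: "g ((0, m1), (0, p1)) = ((x0, x1), (y0, y1))" by (metis surj_pair)
    have "sign_block ((0, m1), (0, p1)) = - ((0, m1), (0, p1))" by (simp add: sign_block_def)
    then have "sign_block (g ((0, m1), (0, p1))) = - g ((0, m1), (0, p1))"
      using g(2) linear_neg[OF g(1)] by metis
    then have "x0 = - x0" "y0 = - y0" by (simp_all add: gx sign_block_def)
    then have x0: "x0 = 0" "y0 = 0" by (blast intro: self_neg_zero)+
    obtain a b c d where N: "qadj M = mat2 a b c d" using mat2_exhaust by blast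
    obtain x y z w where M: "M = mat2 x y z w" using mat2_exhaust by blast
    have pair: "qmul y1 (qmul x t + qmul y r) - qmul x1 (qmul z t + qmul w r) = qmul p1 t - qmul m1 r" for t r
      using g(4)[of "((0, m1), (0, p1))" "((t, 0), (r, 0))"]
      by (simp add: gx pairing_def first theta_def Let_def M)
    have "M \<star> qadj M = qmat_one" by (rule qadj_left_right(2)[OF det])
    then have MN: "qmul x a + qmul y c = qone" "qmul z a + qmul w c = 0" "qmul x b + qmul y d = 0" "qmul z b + qmul w d = qone"
      unfolding M[symmetric] N by (simp_all add: M qmat_mult_mat2 qmat_one_def mat2_eq_iff)
    have "y1 = qmul p1 a - qmul m1 c" using pair[of a c] by (simp add: MN)
    moreover have "x1 = qmul m1 d - qmul p1 b" using pair[of b d] by (simp add: MN) (simp add: algebra_simps minus_equation_iff)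
    ultimately show ?thesis by (simp add: gx x0 theta_def Let_def N)
  qed
  obtain m0 m1 p0 p1 where v: "v = ((m0, m1), (p0, p1))" by (metis surj_pair)
  have "v = ((m0, 0), (p0, 0)) + ((0, m1), (0, p1))" by (simp add: v)
  then show "g v = theta M v"
    using first second linear_add[OF g(1)] linear_add[OF theta_linear] by metis
qed

declare qmul.simps [simp] qcnj.simps [simp] omul.simps [simp]

section \<open>Octonionic coordinates\<close>

lemma O_conj: "O.conj (p, q) = (qcnj p, - q)"
  unfolding O.conj_def Q_conj[symmetric] Q.conj_def by (simp add: oone_def inner_prod_def[of "(p, q)"])

locale octonion_coordinates = half_spin cp cm
  for cp :: "real^8 \<Rightarrow> 'm::euclidean_space \<Rightarrow> 'p::euclidean_space" and cm +
  fixes km :: "'m \<Rightarrow> octonion" and kp :: "'p \<Rightarrow> octonion" and kv :: "real^8 \<Rightarrow> octonion"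
    and \<phi>1m :: 'm and \<phi>2p :: 'p
  assumes km_linear: "linear km" and kp_linear: "linear kp" and kv_linear: "linear kv"
    and km_inner: "km m \<bullet> km m' = m \<bullet> m'" and kp_inner: "kp p \<bullet> kp p' = p \<bullet> p'" and kv_inner: "kv x \<bullet> kv y = x \<bullet> y"
    and kp_cp: "kp (cp x m) = omul (kv x) (km m)"
    and km_unit: "km \<phi>1m = oone" and kp_unit: "kp \<phi>2p = oone"
begin

lemma km_bij: "bij km" and kp_bij: "bij kp" and kv_bij: "bij kv"
  using linear_inner_bij[OF km_linear km_inner] linear_inner_bij[OF kp_linear kp_inner]
    linear_inner_bij[OF kv_linear kv_inner] dims by simp_all

lemmas km_simps = linear_add[OF km_linear] linear_diff[OF km_linear] linear_neg[OF km_linear] linear_cmul[OF km_linear] linear_0[OF km_linear]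
lemmas kp_simps = linear_add[OF kp_linear] linear_diff[OF kp_linear] linear_neg[OF kp_linear] linear_cmul[OF kp_linear] linear_0[OF kp_linear]
lemmas kv_simps = linear_add[OF kv_linear] linear_diff[OF kv_linear] linear_neg[OF kv_linear] linear_cmul[OF kv_linear] linear_0[OF kv_linear]

lemma km_cm: "km (cm x p) = - omul (O.conj (kv x)) (kp p)"
proof (rule vector_eq_rdot[THEN iffD1], rule allI)
  fix z
  obtain m where z: "z = km m" using bij_is_surj[OF km_bij] by (metis surjD)
  have "km (cm x p) \<bullet> z = - (kp p \<bullet> omul (kv x) z)"
    by (simp add: z km_inner cm_adjoint kp_inner kp_cp[symmetric])
  also have "\<dots> = (- omul (O.conj (kv x)) (kp p)) \<bullet> z"
    using O.inner_mult_conj_left[of "kv x" z "kp p"] by (simp add: inner_commute)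
  finally show "km (cm x p) \<bullet> z = (- omul (O.conj (kv x)) (kp p)) \<bullet> z" .
qed

lemma kv_sp: "kv (sp m p) = omul (kp p) (O.conj (km m))"
proof (rule vector_eq_ldot[THEN iffD1], rule allI)
  fix z
  obtain x where z: "z = kv x" using bij_is_surj[OF kv_bij] by (metis surjD)
  show "z \<bullet> kv (sp m p) = z \<bullet> omul (kp p) (O.conj (km m))"
    using O.inner_mult_conj_right[of "kv x" "km m" "kp p"]
    by (simp add: z kv_inner inner_sp kp_inner[symmetric] kp_cp)
qed

definition \<zeta> :: "'m \<times> 'p \<Rightarrow> octonion \<times> octonion" where "\<zeta> \<psi> = (km (fst \<psi>), kp (snd \<psi>))"
definition \<zeta>' :: "octonion \<times> octonion \<Rightarrow> 'm \<times> 'p" where "\<zeta>' v = (inv_into UNIV km (fst v), inv_into UNIV kp (snd v))"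

lemma km_inv [simp]: "inv_into UNIV km (km m) = m" "km (inv_into UNIV km x) = x"
  and kp_inv [simp]: "inv_into UNIV kp (kp p) = p" "kp (inv_into UNIV kp x) = x"
  and kv_inv [simp]: "inv_into UNIV kv (kv b) = b" "kv (inv_into UNIV kv x) = x"
  using km_bij kp_bij kv_bij by (simp_all add: bij_is_inj bij_is_surj surj_f_inv_f)

lemma \<zeta>_inv [simp]: "\<zeta>' (\<zeta> \<psi>) = \<psi>" "\<zeta> (\<zeta>' v) = v"
  by (simp_all add: \<zeta>_def \<zeta>'_def)

lemma \<zeta>_linear: "linear \<zeta>"
  by (rule linearI) (simp_all add: \<zeta>_def km_simps kp_simps)

lemma \<zeta>'_linear: "linear \<zeta>'"
  by (rule linearI) (simp_all add: \<zeta>'_def linear_add[OF linear_inv_into[OF km_linear km_bij]] linear_cmul[OF linear_inv_into[OF km_linear km_bij]]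
     linear_add[OF linear_inv_into[OF kp_linear kp_bij]] linear_cmul[OF linear_inv_into[OF kp_linear kp_bij]])

lemma \<zeta>_spE: "\<zeta> (spE a \<psi>) = (fst (\<zeta> \<psi>), snd (\<zeta> \<psi>) + omul (kv a) (fst (\<zeta> \<psi>)))"
  by (cases \<psi>) (simp add: \<zeta>_def spE_def kp_simps kp_cp)

lemma \<zeta>_spF: "\<zeta> (spF a \<psi>) = (fst (\<zeta> \<psi>) - omul (O.conj (kv a)) (snd (\<zeta> \<psi>)), snd (\<zeta> \<psi>))"
  by (cases \<psi>) (simp add: \<zeta>_def spF_def km_simps km_cm)

subsection \<open>Unimodular quaternionic matrices in Spin(9,1)\<close>

definition \<Theta> :: "quat^2^2 \<Rightarrow> 'm \<times> 'p \<Rightarrow> 'm \<times> 'p" where "\<Theta> M = \<zeta>' \<circ> theta M \<circ> \<zeta>"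

lemma \<Theta>_mult: "qdet M = 1 \<Longrightarrow> qdet N = 1 \<Longrightarrow> \<Theta> (M \<star> N) = \<Theta> M \<circ> \<Theta> N"
  by (simp add: \<Theta>_def fun_eq_iff theta_mult del: split_paired_All)

lemma \<Theta>_one: "\<Theta> qmat_one = id"
  by (simp add: \<Theta>_def fun_eq_iff theta_one del: split_paired_All)

lemma \<Theta>_linear: "linear (\<Theta> M)"
  unfolding \<Theta>_def by (intro linear_compose \<zeta>_linear theta_linear \<zeta>'_linear)

lemma \<Theta>_elementary:
  "\<Theta> (qE q) = spE (inv_into UNIV kv (q, 0))" "\<Theta> (qF q) = spF (inv_into UNIV kv (- qcnj q, 0))"
proof -
  have 1: "\<zeta> (\<Theta> M \<psi>) = theta M (\<zeta> \<psi>)" for M \<psi> by (simp add: \<Theta>_def)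
  have i: "\<zeta> \<psi> = \<zeta> \<psi>' \<Longrightarrow> \<psi> = \<psi>'" for \<psi> \<psi>' by (metis \<zeta>_inv(1))
  have "theta (qE q) v = (fst v, snd v + omul (q, 0) (fst v))" "theta (qF q) v = (fst v + omul (q, 0) (snd v), snd v)" for q v
    using theta_elementary[of q "fst v" "snd v"] by simp_all
  note th = this
  have c: "O.conj (- qcnj q, 0) = - (q, 0)" by (simp add: O_conj)
  show "\<Theta> (qE q) = spE (inv_into UNIV kv (q, 0))"
    by (rule ext, rule i) (simp add: 1 th \<zeta>_spE)
  show "\<Theta> (qF q) = spF (inv_into UNIV kv (- qcnj q, 0))"
    by (rule ext, rule i) (simp only: 1 th \<zeta>_spF kv_inv c O.mult_minus_left diff_minus_eq_add)
qed

subsection \<open>The Lie algebra\<close>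

lemma spE_exp: "lin_exp (\<lambda>\<psi>. t *\<^sub>R (0, cp a (fst \<psi>))) = spE (t *\<^sub>R a)"
proof
  fix \<psi> :: "'m \<times> 'p"
  have "linear (\<lambda>\<psi> :: 'm \<times> 'p. t *\<^sub>R (0 :: 'm, cp a (fst \<psi>)))"
    by (rule linearI) (simp_all add: cp_simps algebra_simps)
  then have "lin_exp (\<lambda>\<psi>. t *\<^sub>R (0, cp a (fst \<psi>))) \<psi> = \<psi> + t *\<^sub>R (0, cp a (fst \<psi>))"
    by (rule lin_exp_nilpotent) (simp add: cp_simps zero_prod_def)
  then show "lin_exp (\<lambda>\<psi>. t *\<^sub>R (0, cp a (fst \<psi>))) \<psi> = spE (t *\<^sub>R a) \<psi>"
    by (cases \<psi>) (simp add: spE_def cp_simps)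
qed

lemma spF_exp: "lin_exp (\<lambda>\<psi>. t *\<^sub>R (cm a (snd \<psi>), 0)) = spF (t *\<^sub>R a)"
proof
  fix \<psi> :: "'m \<times> 'p"
  have "linear (\<lambda>\<psi> :: 'm \<times> 'p. t *\<^sub>R (cm a (snd \<psi>), 0 :: 'p))"
    by (rule linearI) (simp_all add: cm_simps algebra_simps)
  then have "lin_exp (\<lambda>\<psi>. t *\<^sub>R (cm a (snd \<psi>), 0)) \<psi> = \<psi> + t *\<^sub>R (cm a (snd \<psi>), 0)"
    by (rule lin_exp_nilpotent) (simp add: cm_simps zero_prod_def)
  then show "lin_exp (\<lambda>\<psi>. t *\<^sub>R (cm a (snd \<psi>), 0)) \<psi> = spF (t *\<^sub>R a) \<psi>"
    by (cases \<psi>) (simp add: spF_def cm_simps)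
qed

lemma vector_rep_E: "vector_rep cp (spE a) = vecE a" and vector_rep_F: "vector_rep cp (spF a) = vecF a"
  by (rule vector_rep_eq[OF vecE_linear vecE_sq], rule vector_rep_eq[OF vecF_linear vecF_sq])

definition W :: "vec91 set" where "W = {(a, b, c) |a b c. kv b \<in> H0}"

lemma H0_iff: "x \<in> H0 \<longleftrightarrow> snd x = 0" by (cases x) (auto simp: H0_def)

lemma W_iff: "(a, b, c) \<in> W \<longleftrightarrow> snd (kv b) = 0" by (auto simp: W_def H0_iff)

definition G :: "('m \<times> 'p \<Rightarrow> 'm \<times> 'p) set" where
  "G = generate general_linear
     {lin_exp X |X. X \<in> spin91_algebra cp cm \<and> (\<exists>A\<in>so_algebra W. derived_vector_rep cp X A)}"

lemma W_orthogonal: "(\<forall>w\<in>W. vec_form (a, b, c) w = 0) \<longleftrightarrow> a = 0 \<and> c = 0 \<and> fst (kv b) = 0"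
proof
  assume *: "\<forall>w\<in>W. vec_form (a, b, c) w = 0"
  have m0: "kv 0 = 0" by (simp add: kv_simps)
  have "(1, 0, 0) \<in> W" "(0, 0, 1) \<in> W" by (simp_all add: W_iff m0)
  then have ac: "a = 0" "c = 0" using * by force+
  let ?v = "inv_into UNIV kv (fst (kv b), 0)"
  have "(0, ?v, 0) \<in> W" by (simp add: W_iff)
  then have "vec_form (a, b, c) (0, ?v, 0) = 0" using * by blast
  then have "kv b \<bullet> (fst (kv b), 0) = 0" using ac kv_inner[of b ?v] by simp
  then have "fst (kv b) \<bullet> fst (kv b) = 0" by (simp add: inner_prod_def[of "kv b"] del: inner_eq_zero_iff)
  then show "a = 0 \<and> c = 0 \<and> fst (kv b) = 0" using ac by simp
next
  assume *: "a = 0 \<and> c = 0 \<and> fst (kv b) = 0"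
  show "\<forall>w\<in>W. vec_form (a, b, c) w = 0"
  proof
    fix w assume "w \<in> W"
    then obtain x y z where w: "w = (x, y, z)" "snd (kv y) = 0" by (cases w) (auto simp: W_iff)
    have "b \<bullet> y = 0" using * w by (simp add: kv_inner[symmetric] inner_prod_def[of "kv b"])
    then show "vec_form (a, b, c) w = 0" using * w by simp
  qed
qed

lemma exp_in_G:
  assumes a: "snd (kv a) = 0"
  shows "spE a \<in> G" "spF a \<in> G"
proof -
  let ?X = "\<lambda>\<psi> :: 'm \<times> 'p. (0 :: 'm, cp a (fst \<psi>))" and ?Y = "\<lambda>\<psi> :: 'm \<times> 'p. (cm a (snd \<psi>), 0 :: 'p)"
  let ?A = "\<lambda>(\<alpha>, b, \<gamma>). (0 :: real, (2 * \<alpha>) *\<^sub>R a, a \<bullet> b)" and ?B = "\<lambda>(\<alpha>, b, \<gamma>). (- (a \<bullet> b), - (2 * \<gamma>) *\<^sub>R a, 0 :: real)"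
  have lin: "linear ?X" "linear ?Y"
    by (auto intro!: linearI simp: cp_simps cm_simps)
  have X: "?X \<in> spin91_algebra cp cm" "?Y \<in> spin91_algebra cp cm"
    using lin by (simp_all only: spin91_algebra_def mem_Collect_eq spE_exp spF_exp spE_Spin91 spF_Spin91 simp_thms)
  have D: "derived_vector_rep cp ?X ?A" "derived_vector_rep cp ?Y ?B"
    unfolding derived_vector_rep_def spE_exp spF_exp vector_rep_E vector_rep_F
  proof (rule_tac [!] allI)
    fix f :: vec91
    obtain \<alpha> b \<gamma> where f: "f = (\<alpha>, b, \<gamma>)" by (cases f)
    show "((\<lambda>t. vecE (t *\<^sub>R a) f) has_vector_derivative ?A f) (at 0)"
      unfolding f vecE_def by (auto intro!: derivative_eq_intros simp: has_vector_derivative_def)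
    show "((\<lambda>t. vecF (t *\<^sub>R a) f) has_vector_derivative ?B f) (at 0)"
      unfolding f vecF_def by (auto intro!: derivative_eq_intros simp: has_vector_derivative_def)
  qed
  have im: "?A ` W \<subseteq> W" "?B ` W \<subseteq> W" using a by (auto simp: W_iff kv_simps)
  have ort: "a \<bullet> b = 0" if "fst (kv b) = 0" for b
    using that a by (simp add: kv_inner[symmetric] inner_prod_def[of "kv a"])
  have "?A \<in> so_algebra W"
    unfolding so_algebra_def
  proof (intro CollectI conjI im allI impI)
    show "linear ?A" by (auto intro!: linearI simp: inner_add algebra_simps)
    show "vec_form (?A f) g + vec_form f (?A g) = 0" for f g
      by (cases f; cases g) (simp add: algebra_simps inner_commute)
    show "?A f = 0" if "\<forall>w\<in>W. vec_form f w = 0" for f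
      using that ort by (cases f) (simp add: W_orthogonal zero_prod_def)
  qed
  moreover have "?B \<in> so_algebra W"
    unfolding so_algebra_def
  proof (intro CollectI conjI im allI impI)
    show "linear ?B" by (auto intro!: linearI simp: inner_add algebra_simps)
    show "vec_form (?B f) g + vec_form f (?B g) = 0" for f g
      by (cases f; cases g) (simp add: algebra_simps inner_commute)
    show "?B f = 0" if "\<forall>w\<in>W. vec_form f w = 0" for f
      using that ort by (cases f) (simp add: W_orthogonal zero_prod_def)
  qed
  ultimately have "lin_exp ?X \<in> G" "lin_exp ?Y \<in> G" using X D unfolding G_def by (blast intro: generate.incl)+
  then show "spE a \<in> G" "spF a \<in> G" using spE_exp[of 1 a] spF_exp[of 1 a] by simp_all
qed

lemma \<Theta>_in_G: assumes "qdet M = 1" shows "\<Theta> M \<in> G"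
  using assms
proof (rule SL2H_elementary_induct)
  show "\<Theta> (qE q) \<in> G" "\<Theta> (qF q) \<in> G" for q
    unfolding \<Theta>_elementary by (rule exp_in_G; simp)+
  show "\<Theta> (M \<star> N) \<in> G" if "qdet M = 1" "qdet N = 1" "\<Theta> M \<in> G" "\<Theta> N \<in> G" for M N
    using generate.eng[OF that(3,4)[unfolded G_def]] \<Theta>_mult[OF that(1,2)] by (simp add: G_def)
qed

end

lemma (in composition_algebra) nucleus_imaginary_zero:
  assumes d: "DIM('a) = 8" and c: "c \<bullet> u = 0" and assoc: "\<And>x y. (x \<odot> c) \<odot> y = x \<odot> (c \<odot> y)"
  shows "c = 0"
proof -
  obtain i j where fr: "quat_frame i j" and ci: "c = norm c *\<^sub>R i" using quat_frame_extend[OF d c] by blast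
  have "dim (range (quat_map i j)) < DIM('a)" using dim_range_quat_map[OF fr] d by simp
  from exists_unit_orthogonal[OF this]
  obtain e where e: "norm e = 1" "\<And>p. e \<bullet> quat_map i j p = 0" by blast
  have o: "e \<bullet> u = 0" "e \<bullet> i = 0" "e \<bullet> j = 0" "e \<bullet> (i \<odot> j) = 0"
    using e(2)[of qone] e(2)[of "(\<i>, 0)"] e(2)[of "(0, 1)"] e(2)[of "(0, \<i>)"] by simp_all
  have "j \<odot> (i \<odot> e) = (i \<odot> j) \<odot> e" by (rule doubling_1) (use o in auto)
  moreover have "(j \<odot> i) \<odot> e = - ((i \<odot> j) \<odot> e)" using frame_mult(4)[OF fr] by simp
  moreover have "norm c *\<^sub>R ((j \<odot> i) \<odot> e) = norm c *\<^sub>R (j \<odot> (i \<odot> e))"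
    using assoc[of j e] by (subst (asm) (1 2) ci) simp
  ultimately have "norm c *\<^sub>R ((i \<odot> j) \<odot> e) = - (norm c *\<^sub>R ((i \<odot> j) \<odot> e))" by simp
  then have "norm c *\<^sub>R ((i \<odot> j) \<odot> e) = 0" by (rule self_neg_zero)
  moreover have "norm ((i \<odot> j) \<odot> e) = 1" using fr e(1) by (simp add: norm_mult quat_frame_def)
  ultimately show ?thesis by auto
qed

lemma quat_expand: "x = (x \<bullet> qone) *\<^sub>R qone + (x \<bullet> (\<i>, 0)) *\<^sub>R (\<i>, 0) + (x \<bullet> (0, 1)) *\<^sub>R (0, 1) + (x \<bullet> (0, \<i>)) *\<^sub>R (0, \<i>)"
  by (cases x) (simp add: qone_def inner_prod_def inner_complex_def complex_eq_iff)

lemma quat_linear_eq: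
  assumes "linear f" "linear g" "f qone = g qone" "f (\<i>, 0) = g (\<i>, 0)" "f (0, 1) = g (0, 1)" "f (0, \<i>) = g (0, \<i>)"
  shows "f x = g x"
  using arg_cong[OF quat_expand[of x], of f] arg_cong[OF quat_expand[of x], of g] assms(3-6)
  unfolding linear_add[OF assms(1)] linear_add[OF assms(2)] linear_cmul[OF assms(1)] linear_cmul[OF assms(2)] by simp

text \<open>Every infinitesimal rotation of the quaternions is a left multiplication minus a right multiplication.\<close>

lemma quaternion_rotation_algebra:
  assumes s: "linear s" and skew: "\<And>x y :: quat. s x \<bullet> y + x \<bullet> s y = 0"
  obtains r q where "r \<bullet> qone = 0" "q \<bullet> qone = 0" "\<And>y. s y = qmul r y - qmul y q"
proof -
  define t where "t = s qone"
  have t: "t \<bullet> qone = 0" using skew[of qone qone] by (simp add: t_def inner_commute)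
  define D where "D y = s y - qmul t y" for y
  have Dlin: "linear D" unfolding D_def by (rule linearI) (simp_all add: linear_add[OF s] linear_cmul[OF s] qmul_distrib algebra_simps)
  have tc: "qcnj t = - t" using t Q.conj_imaginary[of t] by (simp add: Q_conj)
  have Dskew: "D x \<bullet> y + x \<bullet> D y = 0" for x y
    using skew[of x y] inner_qmul_left[of t x y] by (simp add: D_def inner_diff tc)
  have D1: "D qone = 0" by (simp add: D_def t_def)
  define a b c where "a = D (\<i>, 0) \<bullet> (0, 1)" and "b = D (\<i>, 0) \<bullet> (0, \<i>)" and "c = D (0, 1) \<bullet> (0, \<i>)"
  define w :: quat where "w = (Complex 0 (c / 2), Complex (- b / 2) (a / 2))"
  have self: "D x \<bullet> x = 0" for x using Dskew[of x x] by (simp add: inner_commute)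
  have one: "D x \<bullet> qone = 0" for x using Dskew[of x qone] by (simp add: D1)
  have r: "D (0, 1) \<bullet> (\<i>, 0) = - a" "D (0, \<i>) \<bullet> (\<i>, 0) = - b" "D (0, \<i>) \<bullet> (0, 1) = - c"
    using Dskew[of "(\<i>, 0)" "(0, 1)"] Dskew[of "(\<i>, 0)" "(0, \<i>)"] Dskew[of "(0, 1)" "(0, \<i>)"]
    by (simp_all add: a_def b_def c_def inner_commute)
  have "D y = qmul w y - qmul y w" for y
  proof (rule quat_linear_eq[OF Dlin])
    show "linear (\<lambda>y. qmul w y - qmul y w)" by (rule linearI) (simp_all add: qmul_distrib algebra_simps)
    show "D qone = qmul w qone - qmul qone w" by (simp add: D1)
    show "D (\<i>, 0) = qmul w (\<i>, 0) - qmul (\<i>, 0) w"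
      by (subst quat_expand) (simp add: one[unfolded qone_def] self a_def[symmetric] b_def[symmetric] w_def qmul.simps qone_def complex_eq_iff)
    show "D (0, 1) = qmul w (0, 1) - qmul (0, 1) w"
      by (subst quat_expand) (simp add: one[unfolded qone_def] self r c_def[symmetric] w_def qmul.simps qone_def complex_eq_iff)
    show "D (0, \<i>) = qmul w (0, \<i>) - qmul (0, \<i>) w"
      by (subst quat_expand) (simp add: one[unfolded qone_def] self r w_def qmul.simps qone_def complex_eq_iff)
  qed
  then have "s y = qmul (t + w) y - qmul y w" for y by (simp add: D_def qmul_distrib algebra_simps)
  moreover have "w \<bullet> qone = 0" by (simp add: w_def qone_def inner_prod_def inner_complex_def)
  ultimately show ?thesis using that[of "t + w" w] t by (simp add: inner_add)
qed

definition theta_inf :: "quat^2^2 \<Rightarrow> octonion \<times> octonion \<Rightarrow> octonion \<times> octonion" where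
  "theta_inf M v = (let m0 = fst (fst v); m1 = snd (fst v); p0 = fst (snd v); p1 = snd (snd v) in
     ((qmul (M$1$1) m0 + qmul (M$1$2) p0, qmul p1 (M$1$2) - qmul m1 (M$2$2)),
      (qmul (M$2$1) m0 + qmul (M$2$2) p0, qmul m1 (M$2$1) - qmul p1 (M$1$1))))"

lemma theta_inf_linear: "linear (theta_inf M)"
  by (rule linearI) (simp_all add: theta_inf_def Let_def qmul_distrib algebra_simps scaleR_add_right scaleR_diff_right)

lemma theta_inf_commutes:
  "theta_inf M (sign_block v) = sign_block (theta_inf M v)"
  "theta_inf M (right_block q v) = right_block q (theta_inf M v)"
  by (simp_all add: theta_inf_def Let_def sign_block_def right_block_def qmul_distrib qmul_assoc)

lemma theta_inf_pairing: "pairing (theta_inf M v) w + pairing v (theta_inf M w) = 0"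
  by (simp add: theta_inf_def Let_def pairing_def qmul_distrib qmul_assoc)

lemma block_linear: "linear (right_block q)" "linear sign_block"
  by (rule linearI; simp add: right_block_def sign_block_def qmul_distrib)+

lemma lin_exp_theta_inf:
  "lin_exp (theta_inf M) (sign_block v) = sign_block (lin_exp (theta_inf M) v)"
  "lin_exp (theta_inf M) (right_block q v) = right_block q (lin_exp (theta_inf M) v)"
  "pairing (lin_exp (theta_inf M) v) (lin_exp (theta_inf M) w) = pairing v w"
proof -
  show "lin_exp (theta_inf M) (sign_block v) = sign_block (lin_exp (theta_inf M) v)"
    by (rule lin_exp_intertwine[OF theta_inf_linear block_linear(2), symmetric]) (rule theta_inf_commutes(1)[symmetric])
  show "lin_exp (theta_inf M) (right_block q v) = right_block q (lin_exp (theta_inf M) v)"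
    by (rule lin_exp_intertwine[OF theta_inf_linear block_linear(1), symmetric]) (rule theta_inf_commutes(2)[symmetric])
  show "pairing (lin_exp (theta_inf M) v) (lin_exp (theta_inf M) w) = pairing v w"
    by (rule lin_exp_preserves_bilinear[where \<beta> = pairing, OF theta_inf_linear
          pairing_bilinear[unfolded bilinear_conv_bounded_bilinear] theta_inf_pairing])
qed

context octonion_coordinates
begin

lemma spin_det_coordinates:
  "spin_det cp \<rho> = (km (fst (fst \<rho>)) \<bullet> km (fst (fst \<rho>))) * (kp (snd (snd \<rho>)) \<bullet> kp (snd (snd \<rho>)))
     + (km (fst (snd \<rho>)) \<bullet> km (fst (snd \<rho>))) * (kp (snd (fst \<rho>)) \<bullet> kp (snd (fst \<rho>)))
     - 2 * (omul (kp (snd (fst \<rho>))) (O.conj (km (fst (fst \<rho>)))) \<bullet> omul (kp (snd (snd \<rho>))) (O.conj (km (fst (snd \<rho>)))))"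
  by (simp add: spin_det_expand km_inner kp_inner kv_sp[symmetric] kv_inner)

definition quat_entries :: "('m \<times> 'p) \<times> ('m \<times> 'p) \<Rightarrow> bool" where
  "quat_entries \<rho> \<longleftrightarrow> snd (km (fst (fst \<rho>))) = 0 \<and> snd (kp (snd (fst \<rho>))) = 0 \<and>
     snd (km (fst (snd \<rho>))) = 0 \<and> snd (kp (snd (snd \<rho>))) = 0"

definition entries :: "('m \<times> 'p) \<times> ('m \<times> 'p) \<Rightarrow> quat^2^2" where
  "entries \<rho> = mat2 (fst (km (fst (fst \<rho>)))) (fst (km (fst (snd \<rho>)))) (fst (kp (snd (fst \<rho>)))) (fst (kp (snd (snd \<rho>))))"

lemma spin_det_entries: assumes "quat_entries \<rho>" shows "spin_det cp \<rho> = qdet (entries \<rho>)"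
proof -
  have 1: "x \<bullet> x = fst x \<bullet> fst x" if "snd x = 0" for x :: octonion using that by (simp add: inner_prod_def[of x])
  have 2: "omul x (O.conj y) = (qmul (fst x) (qcnj (fst y)), 0)" if "snd x = 0" "snd y = 0" for x y
    using that by (cases x; cases y) (simp add: O_conj omul.simps)
  show ?thesis
    using assms unfolding quat_entries_def
    by (simp add: spin_det_coordinates 1 2 qdet_def entries_def)
qed

text \<open>An element of the Lie algebra of Spin(9,1) is determined by its action on vectors.\<close>

definition sq_deriv :: "('m \<times> 'p \<Rightarrow> 'm \<times> 'p) \<Rightarrow> 'm \<times> 'p \<Rightarrow> vec91" where
  "sq_deriv X \<psi> = (2 * (fst \<psi> \<bullet> fst (X \<psi>)), 2 *\<^sub>R (sp (fst (X \<psi>)) (snd \<psi>) + sp (fst \<psi>) (snd (X \<psi>))), 2 * (snd \<psi> \<bullet> snd (X \<psi>)))"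

lemma derived_vector_rep_sq:
  assumes X: "X \<in> spin91_algebra cp cm" and A: "derived_vector_rep cp X A"
  shows "A (sq \<psi>) = sq_deriv X \<psi>"
proof -
  have lin: "linear X" and grp: "\<And>t. lin_exp (\<lambda>\<psi>. t *\<^sub>R X \<psi>) \<in> Spin91 cp cm"
    using X by (auto simp: spin91_algebra_def)
  let ?e = "\<lambda>t. lin_exp (\<lambda>\<psi>. t *\<^sub>R X \<psi>) \<psi>"
  have e0: "?e 0 = \<psi>" by simp
  have d: "(?e has_derivative (\<lambda>t. t *\<^sub>R X \<psi>)) (at 0)"
    using lin_exp_has_vector_derivative[OF lin, of \<psi> 0] by (simp add: has_vector_derivative_def)
  note d1 = has_derivative_fst[OF d] and d2 = has_derivative_snd[OF d]
  have "((\<lambda>t. sq (?e t)) has_derivative (\<lambda>t. t *\<^sub>R sq_deriv X \<psi>)) (at 0)"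
    unfolding sq_def
    by (rule has_derivative_eq_rhs[OF has_derivative_Pair[OF has_derivative_inner[OF d1 d1] has_derivative_Pair[OF
            has_derivative_scaleR_right[OF bounded_bilinear.FDERIV[OF bounded_bilinear_sp d1 d2]]
            has_derivative_inner[OF d2 d2]]]])
      (simp add: sq_deriv_def fun_eq_iff inner_commute sp_simps algebra_simps)
  then have "((\<lambda>t. sq (?e t)) has_vector_derivative sq_deriv X \<psi>) (at 0)"
    by (simp add: has_vector_derivative_def)
  moreover have "((\<lambda>t. sq (?e t)) has_vector_derivative A (sq \<psi>)) (at 0)"
    using A[unfolded derived_vector_rep_def, rule_format, of "sq \<psi>"] unfolding vector_rep_sq[OF grp] .
  ultimately show ?thesis by (rule vector_derivative_unique_at[symmetric])
qed

lemma sq_deriv_zero: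
  assumes Y: "linear Y" and z: "\<And>\<psi>. sq_deriv Y \<psi> = 0"
  shows "Y \<psi> = 0"
proof -
  have z1: "fst \<psi> \<bullet> fst (Y \<psi>) = 0" and z2: "sp (fst (Y \<psi>)) (snd \<psi>) + sp (fst \<psi>) (snd (Y \<psi>)) = 0"
    and z3: "snd \<psi> \<bullet> snd (Y \<psi>) = 0" for \<psi>
    using z[of \<psi>] by (auto simp: sq_deriv_def zero_prod_def)
  have split: "Y (m, p) = Y (m, 0) + Y (0, p)" for m p using linear_add[OF Y, of "(m, 0)" "(0, p)"] by simp
  have "m \<bullet> fst (Y (0, p)) = 0" for m p using z1[of "(m, p)"] z1[of "(m, 0)"] by (simp add: split[of m p] inner_add)
  from this[of "fst (Y (0, p))" p for p] have b: "fst (Y (0, p)) = 0" for p by simp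
  have "p \<bullet> snd (Y (m, 0)) = 0" for m p using z3[of "(m, p)"] z3[of "(0, p)"] by (simp add: split[of m p] inner_add)
  from this[of "snd (Y (m, 0))" m for m] have c: "snd (Y (m, 0)) = 0" for m by simp
  define \<alpha> where "\<alpha> x = km (fst (Y (inv_into UNIV km x, 0)))" for x
  define \<delta> where "\<delta> y = kp (snd (Y (0, inv_into UNIV kp y)))" for y
  have rel: "omul y (O.conj (\<alpha> x)) + omul (\<delta> y) (O.conj x) = 0" for x y
  proof -
    let ?m = "inv_into UNIV km x" and ?p = "inv_into UNIV kp y"
    have Ymp: "fst (Y (?m, ?p)) = fst (Y (?m, 0))" "snd (Y (?m, ?p)) = snd (Y (0, ?p))"
      unfolding split[of ?m ?p] fst_add snd_add b c by simp_all
    have "kv (sp (fst (Y (?m, ?p))) ?p + sp ?m (snd (Y (?m, ?p)))) = 0"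
      using z2[of "(?m, ?p)"] unfolding fst_conv snd_conv by (simp only: kv_simps)
    then show ?thesis unfolding Ymp by (simp add: kv_simps kv_sp \<alpha>_def \<delta>_def)
  qed
  define k where "k = \<alpha> oone"
  have c1: "k \<bullet> oone = 0"
    using z1[of "(inv_into UNIV km oone, 0)"] by (simp add: k_def \<alpha>_def km_inner[symmetric, of "inv_into UNIV km oone"] inner_commute)
  have cc: "O.conj k = - k" using c1 by (rule O.conj_imaginary)
  have u1: "O.conj oone = oone" by (simp add: O.conj_def scaleR_2)
  have \<delta>: "\<delta> y = omul y k" for y using rel[of y oone] using cc by (simp add: k_def u1)
  have conj\<alpha>: "O.conj (\<alpha> x) = - omul k (O.conj x)" for x using rel[of oone x] by (simp add: \<delta> add_eq_0_iff2)
  have \<alpha>: "\<alpha> x = omul x k" for x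
    using arg_cong[OF conj\<alpha>[of x], of O.conj] by (simp add: O.conj_mult O.conj_minus cc)
  have "omul (omul y k) (O.conj x) = omul y (omul k (O.conj x))" for x y
    using rel[of y x] by (simp add: \<delta> conj\<alpha>)
  from this[of _ "O.conj z" for z] have "omul (omul y k) z = omul y (omul k z)" for y z by simp
  then have "k = 0" by (intro O.nucleus_imaginary_zero[OF _ c1]) auto
  then have "\<alpha> (km m) = 0" "\<delta> (kp p) = 0" for m p using \<alpha> \<delta> by simp_all
  then have "km (fst (Y (m, 0))) = 0" "kp (snd (Y (0, p))) = 0" for m p by (simp_all add: \<alpha>_def \<delta>_def)
  then have "fst (Y (m, 0)) = 0" "snd (Y (0, p)) = 0" for m p
    using km_inv(1)[of "fst (Y (m, 0))"] km_inv(1)[of 0] kp_inv(1)[of "snd (Y (0, p))"] kp_inv(1)[of 0]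
    by (simp_all add: km_simps kp_simps)
  then show ?thesis using split[of "fst \<psi>" "snd \<psi>"] b c by (simp add: prod_eq_iff)
qed

end

lemma sign_block_fixed:
  assumes "sign_block v = v"
  shows "snd (fst v) = 0" "snd (snd v) = 0"
proof -
  have "snd (fst v) = - snd (fst v)" "snd (snd v) = - snd (snd v)"
    using arg_cong[OF assms, of "\<lambda>v. snd (fst v)"] arg_cong[OF assms, of "\<lambda>v. snd (snd v)"]
    by (simp_all only: sign_block_def fst_conv snd_conv)
  then show "snd (fst v) = 0" "snd (snd v) = 0" by (blast intro: self_neg_zero)+
qed

context octonion_coordinates
begin

definition \<Theta>_inf :: "quat^2^2 \<Rightarrow> 'm \<times> 'p \<Rightarrow> 'm \<times> 'p" where "\<Theta>_inf M = \<zeta>' \<circ> theta_inf M \<circ> \<zeta>"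

lemma \<Theta>_inf_linear: "linear (\<Theta>_inf M)"
  unfolding \<Theta>_inf_def by (intro linear_compose \<zeta>_linear theta_inf_linear \<zeta>'_linear)

lemma \<Theta>_inf_components: "km (fst (\<Theta>_inf M \<psi>)) = fst (theta_inf M (\<zeta> \<psi>))" "kp (snd (\<Theta>_inf M \<psi>)) = snd (theta_inf M (\<zeta> \<psi>))"
  using \<zeta>_inv(2)[of "theta_inf M (\<zeta> \<psi>)"] by (simp_all add: \<Theta>_inf_def \<zeta>_def \<zeta>'_def)

text \<open>The infinitesimal action of a quaternionic matrix on vectors.  Conversely every element of
  \<open>so(W)\<close> arises like this.\<close>

lemma so_W_structure:
  assumes A: "A \<in> so_algebra W"
  obtains \<alpha> u w S where "kv u = (fst (kv u), 0)" "kv w = (fst (kv w), 0)" "linear S"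
    "\<And>x y. S x \<bullet> y + x \<bullet> S y = 0" "\<And>b. snd (kv b) = 0 \<Longrightarrow> snd (kv (S b)) = 0" "\<And>b. fst (kv b) = 0 \<Longrightarrow> S b = 0"
    "\<And>a b c. A (a, b, c) = (\<alpha> * a + (b \<bullet> w) / 2, a *\<^sub>R u + S b + c *\<^sub>R w, (b \<bullet> u) / 2 - \<alpha> * c)"
proof -
  have lin: "linear A" and skew: "\<And>f g. vec_form (A f) g + vec_form f (A g) = 0" and im: "\<And>f. f \<in> W \<Longrightarrow> A f \<in> W"
    and kill: "\<And>f. (\<forall>w\<in>W. vec_form f w = 0) \<Longrightarrow> A f = 0"
    using A unfolding so_algebra_def by blast+
  obtain \<alpha> u \<gamma> where Au: "A (1, 0, 0) = (\<alpha>, u, \<gamma>)" by (metis surj_pair)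
  obtain \<beta> w \<delta> where Aw: "A (0, 0, 1) = (\<beta>, w, \<delta>)" by (metis surj_pair)
  have g0: "\<gamma> = 0" using skew[of "(1, 0, 0)" "(1, 0, 0)"] by (simp add: Au)
  have b0: "\<beta> = 0" using skew[of "(0, 0, 1)" "(0, 0, 1)"] by (simp add: Aw)
  have d: "\<delta> = - \<alpha>" using skew[of "(1, 0, 0)" "(0, 0, 1)"] by (simp add: Au Aw)
  define S where "S b = fst (snd (A (0, b, 0)))" for b
  have Ab: "A (0, b, 0) = ((b \<bullet> w) / 2, S b, (b \<bullet> u) / 2)" for b
  proof -
    obtain x y z where xyz: "A (0, b, 0) = (x, y, z)" by (metis surj_pair)
    have "z = (b \<bullet> u) / 2" using skew[of "(0, b, 0)" "(1, 0, 0)"] by (simp add: Au xyz)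
    moreover have "x = (b \<bullet> w) / 2" using skew[of "(0, b, 0)" "(0, 0, 1)"] by (simp add: Aw xyz)
    ultimately show ?thesis by (simp add: S_def xyz)
  qed
  have W0: "(1, 0, 0) \<in> W" "(0, 0, 1) \<in> W" by (simp_all add: W_iff kv_simps)
  have u0: "kv u = (fst (kv u), 0)" using im[OF W0(1)] by (simp add: Au W_iff prod_eq_iff)
  have w0: "kv w = (fst (kv w), 0)" using im[OF W0(2)] by (simp add: Aw W_iff prod_eq_iff)
  have Slin: "linear S"
  proof (rule linearI)
    show "S (x + y) = S x + S y" for x y using linear_add[OF lin, of "(0, x, 0)" "(0, y, 0)"] by (simp add: S_def)
    show "S (c *\<^sub>R x) = c *\<^sub>R S x" for c x using linear_cmul[OF lin, of c "(0, x, 0)"] by (simp add: S_def)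
  qed
  have Sskew: "S x \<bullet> y + x \<bullet> S y = 0" for x y using skew[of "(0, x, 0)" "(0, y, 0)"] by (simp add: Ab)
  have S0: "snd (kv (S b)) = 0" if "snd (kv b) = 0" for b
    using im[of "(0, b, 0)"] that by (simp add: Ab W_iff)
  have S1: "S b = 0" if "fst (kv b) = 0" for b
    using kill[of "(0, b, 0)"] that by (simp add: W_orthogonal Ab zero_prod_def)
  have "A (a, b, c) = (\<alpha> * a + (b \<bullet> w) / 2, a *\<^sub>R u + S b + c *\<^sub>R w, (b \<bullet> u) / 2 - \<alpha> * c)" for a b c
  proof -
    have "(a, b, c) = a *\<^sub>R (1, 0, 0) + (0, b, 0) + c *\<^sub>R (0, 0, 1)" by simp
    then have "A (a, b, c) = a *\<^sub>R A (1, 0, 0) + A (0, b, 0) + c *\<^sub>R A (0, 0, 1)"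
      by (simp only: linear_add[OF lin] linear_cmul[OF lin])
    then show ?thesis by (simp add: Au Aw Ab g0 b0 d)
  qed
  with u0 w0 Slin Sskew S0 S1 show ?thesis by (rule that)
qed

lemma so_W_lift:
  assumes A: "A \<in> so_algebra W"
  shows "\<exists>M. \<forall>\<psi>. A (sq \<psi>) = sq_deriv (\<Theta>_inf M) \<psi>"
proof -
  obtain \<alpha> u w S where u: "kv u = (fst (kv u), 0)" and w: "kv w = (fst (kv w), 0)" and S: "linear S"
    "\<And>x y. S x \<bullet> y + x \<bullet> S y = 0" "\<And>b. snd (kv b) = 0 \<Longrightarrow> snd (kv (S b)) = 0" "\<And>b. fst (kv b) = 0 \<Longrightarrow> S b = 0"
    and Aeq: "\<And>a b c. A (a, b, c) = (\<alpha> * a + (b \<bullet> w) / 2, a *\<^sub>R u + S b + c *\<^sub>R w, (b \<bullet> u) / 2 - \<alpha> * c)"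
    using so_W_structure[OF A] by metis
  let ?u = "fst (kv u)" and ?w = "fst (kv w)"
  define s where "s y = fst (kv (S (inv_into UNIV kv (y, 0))))" for y
  have kvi: "inv_into UNIV kv (x + y) = inv_into UNIV kv x + inv_into UNIV kv y"
      "inv_into UNIV kv (c *\<^sub>R x) = c *\<^sub>R inv_into UNIV kv x" for x y c
    using linear_add[OF linear_inv_into[OF kv_linear kv_bij]] linear_cmul[OF linear_inv_into[OF kv_linear kv_bij]] by auto
  have slin: "linear s"
  proof (rule linearI)
    show "s (x + y) = s x + s y" for x y
      using kvi(1)[of "(x, 0)" "(y, 0)"] by (simp add: s_def linear_add[OF S(1)] kv_simps)
    show "s (c *\<^sub>R x) = c *\<^sub>R s x" for c x
      using kvi(2)[of c "(x, 0)"] by (simp add: s_def linear_cmul[OF S(1)] kv_simps)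
  qed
  have kvS: "kv (S (inv_into UNIV kv (y, 0))) = (s y, 0)" for y
    using S(3)[of "inv_into UNIV kv (y, 0)"] by (simp add: s_def prod_eq_iff)
  have sskew: "s x \<bullet> y + x \<bullet> s y = 0" for x y
    using S(2)[of "inv_into UNIV kv (x, 0)" "inv_into UNIV kv (y, 0)"] by (simp add: kv_inner[symmetric] kvS)
  obtain r q where r: "r \<bullet> qone = 0" and q: "q \<bullet> qone = 0" and rq: "\<And>y. s y = qmul r y - qmul y q"
    using quaternion_rotation_algebra[OF slin sskew] by metis
  have kvS': "kv (S b) = (qmul r (fst (kv b)) - qmul (fst (kv b)) q, 0)" for b
  proof -
    let ?b0 = "inv_into UNIV kv (fst (kv b), 0)" and ?b1 = "inv_into UNIV kv (0, snd (kv b))"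
    have "kv b = kv (?b0 + ?b1)" by (simp add: kv_simps)
    then have "b = ?b0 + ?b1" using kv_inv(1) by metis
    then have "S b = S ?b0 + S ?b1" using linear_add[OF S(1)] by metis
    also have "S ?b1 = 0" by (rule S(4)) simp
    finally show ?thesis by (simp add: kvS rq)
  qed
  have rc: "qcnj r = - r" "qcnj q = - q" using r q Q.conj_imaginary by (simp_all add: Q_conj)
  define M where "M = mat2 ((\<alpha>/2) *\<^sub>R qone + q) ((1/2) *\<^sub>R qcnj ?w) ((1/2) *\<^sub>R ?u) (- (\<alpha>/2) *\<^sub>R qone + r)"
  have "A (sq \<psi>) = sq_deriv (\<Theta>_inf M) \<psi>" for \<psi>
  proof -
    obtain m0 m1 p0 p1 where z: "\<zeta> \<psi> = ((m0, m1), (p0, p1))" by (metis surj_pair)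
    then have km: "km (fst \<psi>) = (m0, m1)" and kp: "kp (snd \<psi>) = (p0, p1)" by (simp_all add: \<zeta>_def)
    obtain m0' m1' p0' p1' where th: "theta_inf M (\<zeta> \<psi>) = ((m0', m1'), (p0', p1'))" by (metis surj_pair)
    have km': "km (fst (\<Theta>_inf M \<psi>)) = (m0', m1')" and kp': "kp (snd (\<Theta>_inf M \<psi>)) = (p0', p1')"
      by (simp_all add: \<Theta>_inf_components th)
    have e: "m0' = (\<alpha>/2) *\<^sub>R m0 + qmul q m0 + (1/2) *\<^sub>R qmul (qcnj ?w) p0"
      "m1' = (1/2) *\<^sub>R qmul p1 (qcnj ?w) + (\<alpha>/2) *\<^sub>R m1 - qmul m1 r"
      "p0' = (1/2) *\<^sub>R qmul ?u m0 - (\<alpha>/2) *\<^sub>R p0 + qmul r p0"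
      "p1' = (1/2) *\<^sub>R qmul m1 ?u - (\<alpha>/2) *\<^sub>R p1 - qmul p1 q"
      using th unfolding theta_inf_def Let_def z M_def by (auto simp: qmul_distrib algebra_simps)
    have im: "x \<bullet> qmul q x = 0" "x \<bullet> qmul x r = 0" "x \<bullet> qmul r x = 0" "x \<bullet> qmul x q = 0" for x
      using inner_qmul_left[of q x x] inner_qmul_left[of r x x] inner_qmul_right[of x q x] inner_qmul_right[of x r x]
      by (simp_all add: rc inner_commute)
    let ?y = "qmul p0 (qcnj m0) + qmul (qcnj m1) p1" and ?z = "qmul p1 m0 - qmul m1 p0"
    have ysp: "kv (sp (fst \<psi>) (snd \<psi>)) = (?y, ?z)" by (simp add: kv_sp km kp O_conj omul.simps)
    have 1: "2 * (fst \<psi> \<bullet> fst (\<Theta>_inf M \<psi>)) = \<alpha> * (fst \<psi> \<bullet> fst \<psi>) + sp (fst \<psi>) (snd \<psi>) \<bullet> w"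
    proof -
      have "m0 \<bullet> qmul (qcnj ?w) p0 = qmul p0 (qcnj m0) \<bullet> ?w" "m1 \<bullet> qmul p1 (qcnj ?w) = qmul (qcnj m1) p1 \<bullet> ?w"
        using inner_qmul_left[of "?w" m0 p0] inner_qmul_right[of "?w" m0 p0] inner_qmul_left[of m1 ?w p1] inner_qmul_right[of m1 ?w p1]
        by (simp_all add: inner_commute)
      then show ?thesis
        by (simp add: km_inner[symmetric] kv_inner[symmetric] km km' ysp) (subst w, simp add: e inner_add inner_diff im algebra_simps)
    qed
    have 3: "2 * (snd \<psi> \<bullet> snd (\<Theta>_inf M \<psi>)) = sp (fst \<psi>) (snd \<psi>) \<bullet> u - \<alpha> * (snd \<psi> \<bullet> snd \<psi>)"
    proof -
      have "p0 \<bullet> qmul ?u m0 = qmul p0 (qcnj m0) \<bullet> ?u" "p1 \<bullet> qmul m1 ?u = qmul (qcnj m1) p1 \<bullet> ?u"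
        using inner_qmul_right[of ?u m0 p0] inner_qmul_left[of m1 ?u p1]
        by (simp_all add: inner_commute)
      then show ?thesis
        by (simp add: kp_inner[symmetric] kv_inner[symmetric] kp kp' ysp) (subst u, simp add: e inner_add inner_diff im algebra_simps)
    qed
    have 2: "2 *\<^sub>R (sp (fst (\<Theta>_inf M \<psi>)) (snd \<psi>) + sp (fst \<psi>) (snd (\<Theta>_inf M \<psi>)))
       = (fst \<psi> \<bullet> fst \<psi>) *\<^sub>R u + S (2 *\<^sub>R sp (fst \<psi>) (snd \<psi>)) + (snd \<psi> \<bullet> snd \<psi>) *\<^sub>R w" (is "?L = ?R")
    proof -
      have "kv ?L = kv ?R"
        apply (simp add: kv_simps kv_sp linear_cmul[OF S(1)] kvS')
        apply (subst u, subst w)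
        apply (simp add: kv_sp km kp km' kp' km_inner[symmetric] kp_inner[symmetric] O_conj omul.simps e qmul_distrib qmul_assoc rc algebra_simps scaleR_2)
        done
      then show ?thesis using kv_inv(1) by metis
    qed
    show ?thesis
      unfolding sq_deriv_def 1 2 3 unfolding sq_def Aeq by (simp add: algebra_simps)
  qed
  then show ?thesis by blast
qed

lemma spin_det_base: "spin_det cp (base_point \<phi>1m \<phi>2p) = 1"
  using km_inner[of \<phi>1m \<phi>1m] kp_inner[of \<phi>2p \<phi>2p]
  by (simp add: base_point_def spin_det_expand sp_simps km_unit kp_unit)

lemma exp_in_image:
  assumes X: "X \<in> spin91_algebra cp cm" and A: "A \<in> so_algebra W" "derived_vector_rep cp X A"
  shows "\<exists>M. qdet M = 1 \<and> lin_exp X = \<Theta> M"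
proof -
  have linX: "linear X" and grp: "lin_exp (\<lambda>\<psi>. 1 *\<^sub>R X \<psi>) \<in> Spin91 cp cm"
    using X unfolding spin91_algebra_def by blast+
  obtain L where L: "\<And>\<psi>. A (sq \<psi>) = sq_deriv (\<Theta>_inf L) \<psi>" using so_W_lift[OF A(1)] by blast
  have "X \<psi> - \<Theta>_inf L \<psi> = 0" for \<psi>
  proof (rule sq_deriv_zero[of "\<lambda>\<psi>. X \<psi> - \<Theta>_inf L \<psi>"])
    show "linear (\<lambda>\<psi>. X \<psi> - \<Theta>_inf L \<psi>)" by (rule linear_compose_sub[OF linX \<Theta>_inf_linear])
    show "sq_deriv (\<lambda>\<psi>. X \<psi> - \<Theta>_inf L \<psi>) \<psi> = 0" for \<psi>
    proof -
      have "sq_deriv (\<lambda>\<psi>. X \<psi> - \<Theta>_inf L \<psi>) \<psi> = sq_deriv X \<psi> - sq_deriv (\<Theta>_inf L) \<psi>"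
        by (simp add: sq_deriv_def inner_diff sp_simps algebra_simps)
      then show ?thesis using derived_vector_rep_sq[OF X A(2), of \<psi>] L[of \<psi>] by simp
    qed
  qed
  then have XL: "X = \<Theta>_inf L" by (simp add: fun_eq_iff del: split_paired_All)
  let ?g = "lin_exp (theta_inf L)"
  have gX: "\<zeta> (lin_exp X \<psi>) = ?g (\<zeta> \<psi>)" for \<psi>
    by (rule lin_exp_intertwine[OF linX \<zeta>_linear]) (simp add: XL \<Theta>_inf_def)
  define M where "M = mat2 (fst (fst (?g (oone, 0)))) (fst (fst (?g (0, oone)))) (fst (snd (?g (oone, 0)))) (fst (snd (?g (0, oone))))"
  have z: "\<zeta> (\<phi>1m, 0) = (oone, 0)" "\<zeta> (0, \<phi>2p) = (0, oone)" by (simp_all add: \<zeta>_def km_unit kp_unit km_simps kp_simps)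
  have det: "qdet M = 1"
  proof -
    let ?\<rho> = "act (lin_exp X) (mat 1) (base_point \<phi>1m \<phi>2p)"
    have r: "?\<rho> = (lin_exp X (\<phi>1m, 0), lin_exp X (0, \<phi>2p))" by (simp add: base_point_def)
    have c: "(km (fst (lin_exp X (\<phi>1m, 0))), kp (snd (lin_exp X (\<phi>1m, 0)))) = ?g (oone, 0)"
      "(km (fst (lin_exp X (0, \<phi>2p))), kp (snd (lin_exp X (0, \<phi>2p)))) = ?g (0, oone)"
      using gX[of "(\<phi>1m, 0)"] gX[of "(0, \<phi>2p)"] by (simp_all add: z) (simp_all add: \<zeta>_def)
    have fx: "sign_block (oone, 0) = (oone, 0)" "sign_block (0, oone) = (0, oone)"
      unfolding pair_units by (simp_all add: sign_block_def)
    have "sign_block (?g (oone, 0)) = ?g (oone, 0)" "sign_block (?g (0, oone)) = ?g (0, oone)"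
      using lin_exp_theta_inf(1)[of L "(oone, 0)"] lin_exp_theta_inf(1)[of L "(0, oone)"] unfolding fx by simp_all
    note s = sign_block_fixed[OF this(1)] sign_block_fixed[OF this(2)]
    have "quat_entries ?\<rho>" unfolding quat_entries_def r using s c by (simp add: prod_eq_iff[of "_ :: octonion \<times> octonion"])
    moreover have "entries ?\<rho> = M" unfolding entries_def r M_def using c by (simp add: prod_eq_iff[of "_ :: octonion \<times> octonion"])
    moreover have "spin_det cp ?\<rho> = 1"
      using spin_det_act[of "lin_exp X" "mat 1" "base_point \<phi>1m \<phi>2p"] grp spin_det_base by simp
    ultimately show ?thesis using spin_det_entries by metis
  qed
  have "?g = theta M"
    using theta_characterisation[OF lin_exp_linear[OF theta_inf_linear] lin_exp_theta_inf] det unfolding M_def by metis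
  then have "lin_exp X = \<Theta> M"
    using gX \<zeta>_inv(1) unfolding \<Theta>_def fun_eq_iff o_apply by metis
  with det show ?thesis by blast
qed

lemma \<Theta>_inverse: assumes "qdet M = 1" shows "qdet (qadj M) = 1" "\<Theta> M \<circ> \<Theta> (qadj M) = id" "\<Theta> (qadj M) \<circ> \<Theta> M = id"
proof -
  show a: "qdet (qadj M) = 1"
    using qdet_mult[of M "qadj M"] qadj_left_right(2)[OF assms] assms qdet_elementary(1)[of 0]
    by (simp add: qmat_one_def qE_def)
  show "\<Theta> M \<circ> \<Theta> (qadj M) = id" "\<Theta> (qadj M) \<circ> \<Theta> M = id"
    using \<Theta>_mult[OF assms a] \<Theta>_mult[OF a assms] qadj_left_right[OF assms] \<Theta>_one by simp_all
qed

text \<open>One inclusion lifts every infinitesimal rotation of \<open>R\<^sup>5\<^sup>,\<^sup>1\<close> to a quaternionic matrix and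
  exponentiates; the other one writes a quaternionic matrix as a product of elementary ones, which
  are exponentials.\<close>

theorem G_eq: "G = \<Theta> ` {M. qdet M = 1}"
proof
  show "\<Theta> ` {M. qdet M = 1} \<subseteq> G" using \<Theta>_in_G by blast
  have "subgroup (\<Theta> ` {M. qdet M = 1}) general_linear"
  proof (rule GL.subgroupI)
    show "\<Theta> ` {M. qdet M = 1} \<subseteq> carrier general_linear"
      using \<Theta>_linear o_bij[OF \<Theta>_inverse(3) \<Theta>_inverse(2)] by auto
    show "\<Theta> ` {M. qdet M = 1} \<noteq> {}" using qdet_elementary(1) by blast
    fix g assume "g \<in> \<Theta> ` {M. qdet M = 1}"
    then obtain M where M: "g = \<Theta> M" "qdet M = 1" by blast
    have "inv\<^bsub>general_linear\<^esub> (\<Theta> M) = \<Theta> (qadj M)"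
      using \<Theta>_inverse(2,3)[OF M(2)] by (intro general_linear_inv(2) \<Theta>_linear) (simp_all add: fun_eq_iff del: split_paired_All)
    then show "inv\<^bsub>general_linear\<^esub> g \<in> \<Theta> ` {M. qdet M = 1}" using \<Theta>_inverse(1)[OF M(2)] M(1) by simp
    fix h assume "h \<in> \<Theta> ` {M. qdet M = 1}"
    then obtain N where N: "h = \<Theta> N" "qdet N = 1" by blast
    show "g \<otimes>\<^bsub>general_linear\<^esub> h \<in> \<Theta> ` {M. qdet M = 1}"
      using \<Theta>_mult[OF M(2) N(2)] M N by (auto simp: qdet_mult intro!: image_eqI[of _ _ "M \<star> N"])
  qed
  then show "G \<subseteq> \<Theta> ` {M. qdet M = 1}"
    unfolding G_def by (rule GL.generate_subgroup_incl[rotated]) (use exp_in_image in blast)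
qed

end

lemma continuous_on_mat2:
  fixes a b c d :: "'x::topological_space \<Rightarrow> 'a::{zero,topological_space}"
  assumes "continuous_on S a" "continuous_on S b" "continuous_on S c" "continuous_on S d"
  shows "continuous_on S (\<lambda>x. mat2 (a x) (b x) (c x) (d x))"
proof -
  have "mat2 (a x) (b x) (c x) (d x) = (\<chi> i. \<chi> j. if i = 1 then (if j = 1 then a x else b x) else (if j = 1 then c x else d x))" for x
    by (simp add: mat2_eq_iff)
  moreover have "continuous_on S (\<lambda>x. if i = 1 then (if j = 1 then a x else b x) else (if j = 1 then c x else d x))" for i j :: 2
    using assms by (cases "i = 1"; cases "j = 1") auto
  ultimately show ?thesis by (simp add: continuous_on_vec_lambda)
qed

lemma continuous_on_linear:
  fixes h :: "'a::euclidean_space \<Rightarrow> 'b::real_normed_vector" and f :: "'x::topological_space \<Rightarrow> 'a"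
  shows "linear h \<Longrightarrow> continuous_on S f \<Longrightarrow> continuous_on S (\<lambda>x. h (f x))"
  by (rule bounded_linear.continuous_on[OF linear_imp_bounded])

lemmas continuous_on_qmul = bounded_bilinear.continuous_on[OF qmul_bilinear[unfolded bilinear_conv_bounded_bilinear]]
lemmas continuous_on_qcnj = continuous_on_linear[OF qcnj_linear]

lemma continuous_on_entry: "continuous_on S f \<Longrightarrow> continuous_on S (\<lambda>x. f x $ i $ j)"
  for f :: "'x::topological_space \<Rightarrow> 'a::real_normed_vector^'n^'m"
  by (intro continuous_on_component)

lemma continuous_on_qadj: "continuous_on S qadj"
  unfolding qadj_def Let_def
  by (intro continuous_on_mat2 continuous_on_diff continuous_on_scaleR continuous_on_inner continuous_on_qmul
      continuous_on_qcnj continuous_on_entry continuous_on_id[unfolded id_def])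

lemma continuous_on_theta: "continuous_on S (\<lambda>M. theta M v)"
  unfolding theta_def Let_def
  by (intro continuous_on_Pair continuous_on_diff continuous_on_add continuous_on_qmul continuous_on_const
      continuous_on_entry continuous_on_qadj continuous_on_id[unfolded id_def])

definition oct_sign :: "octonion \<Rightarrow> octonion" where "oct_sign x = (fst x, - snd x)"

lemma oct_sign_simps: "oct_sign (omul x y) = omul (oct_sign x) (oct_sign y)" "oct_sign (O.conj x) = O.conj (oct_sign x)"
    "oct_sign x \<bullet> oct_sign y = x \<bullet> y" "oct_sign (oct_sign x) = x" "oct_sign oone = oone"
proof -
  obtain x0 x1 where x: "x = (x0, x1)" by (cases x)
  obtain y0 y1 where y: "y = (y0, y1)" by (cases y)
  show "oct_sign (omul x y) = omul (oct_sign x) (oct_sign y)" "oct_sign (O.conj x) = O.conj (oct_sign x)"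
    "oct_sign x \<bullet> oct_sign y = x \<bullet> y" "oct_sign (oct_sign x) = x"
    by (simp_all add: x y oct_sign_def omul.simps O_conj)
  show "oct_sign oone = oone" by (simp add: oct_sign_def oone_def)
qed

lemma oct_sign_linear: "linear oct_sign"
  by (rule linearI) (simp_all add: oct_sign_def)

lemma sign_block_oct_sign: "sign_block v = (oct_sign (fst v), oct_sign (snd v))"
  by (simp add: sign_block_def oct_sign_def)

context octonion_coordinates
begin

lemma G_subset: "G \<subseteq> Spin91 cp cm"
  unfolding G_def
proof (rule GL.generate_subgroup_incl[OF _ Spin91_subgroup], clarify)
  fix X assume "X \<in> spin91_algebra cp cm"
  then have "\<forall>t. lin_exp (\<lambda>\<psi>. t *\<^sub>R X \<psi>) \<in> Spin91 cp cm" unfolding spin91_algebra_def by blast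
  from spec[OF this, of 1] show "lin_exp X \<in> Spin91 cp cm" by simp
qed

lemma \<Theta>_Spin91: "qdet M = 1 \<Longrightarrow> \<Theta> M \<in> Spin91 cp cm"
  using G_subset \<Theta>_in_G by blast

lemma \<Theta>_base:
  "\<zeta> (\<Theta> M (\<phi>1m, 0)) = ((M$1$1, 0), (M$2$1, 0))" "\<zeta> (\<Theta> M (0, \<phi>2p)) = ((M$1$2, 0), (M$2$2, 0))"
proof -
  have "\<zeta> (\<phi>1m, 0) = (oone, 0)" "\<zeta> (0, \<phi>2p) = (0, oone)" by (simp_all add: \<zeta>_def km_unit kp_unit km_simps kp_simps)
  then show "\<zeta> (\<Theta> M (\<phi>1m, 0)) = ((M$1$1, 0), (M$2$1, 0))" "\<zeta> (\<Theta> M (0, \<phi>2p)) = ((M$1$2, 0), (M$2$2, 0))"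
    unfolding \<Theta>_def o_apply by (simp_all only: \<zeta>_inv pair_units) (simp_all add: theta_def Let_def)
qed

definition pt :: "quat^2^2 \<Rightarrow> ('m \<times> 'p) \<times> ('m \<times> 'p)" where "pt M = act (\<Theta> M) (mat 1) (base_point \<phi>1m \<phi>2p)"

lemma pt: "pt M = (\<zeta>' ((M$1$1, 0), (M$2$1, 0)), \<zeta>' ((M$1$2, 0), (M$2$2, 0)))"
  using \<zeta>_inv(1)[of "\<Theta> M (\<phi>1m, 0)"] \<zeta>_inv(1)[of "\<Theta> M (0, \<phi>2p)"]
  by (simp add: pt_def base_point_def \<Theta>_base)

lemma \<zeta>'_comps: "km (fst (\<zeta>' v)) = fst v" "kp (snd (\<zeta>' v)) = snd v"
  by (simp_all add: \<zeta>'_def)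

lemma entries_pt: "entries (pt M) = M" "quat_entries (pt M)"
  by (simp_all add: pt entries_def quat_entries_def \<zeta>'_comps mat2_eq_iff)

lemma pt_entries: "quat_entries \<rho> \<Longrightarrow> pt (entries \<rho>) = \<rho>"
proof -
  assume q: "quat_entries \<rho>"
  have "((fst (km (fst \<psi>)), 0), (fst (kp (snd \<psi>)), 0)) = \<zeta> \<psi>" if "snd (km (fst \<psi>)) = 0" "snd (kp (snd \<psi>)) = 0" for \<psi>
    using that by (simp add: \<zeta>_def prod_eq_iff)
  from this[of "fst \<rho>"] this[of "snd \<rho>"] q show ?thesis
    by (simp add: pt entries_def quat_entries_def)
qed

lemma pt_mult: "qdet M = 1 \<Longrightarrow> qdet N = 1 \<Longrightarrow> act (\<Theta> M) (mat 1) (pt N) = pt (M \<star> N)"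
  by (simp add: pt_def \<Theta>_mult)

text \<open>A quaternionic matrix of determinant 1 is reached from the base point by the group element that it
  defines itself.\<close>

lemma orbit_eq: "{act h (mat 1) (base_point \<phi>1m \<phi>2p) |h. h \<in> G} = {\<rho>. quat_entries \<rho> \<and> spin_det cp \<rho> = 1}"
    "{act h (mat 1) (base_point \<phi>1m \<phi>2p) |h. h \<in> G} = pt ` {M. qdet M = 1}"
proof -
  show 1: "{act h (mat 1) (base_point \<phi>1m \<phi>2p) |h. h \<in> G} = pt ` {M. qdet M = 1}"
    unfolding G_eq pt_def by blast
  show "{act h (mat 1) (base_point \<phi>1m \<phi>2p) |h. h \<in> G} = {\<rho>. quat_entries \<rho> \<and> spin_det cp \<rho> = 1}"
    unfolding 1
  proof (intro equalityI subsetI)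
    show "\<rho> \<in> {\<rho>. quat_entries \<rho> \<and> spin_det cp \<rho> = 1}" if "\<rho> \<in> pt ` {M. qdet M = 1}" for \<rho>
      using that spin_det_entries[OF entries_pt(2)] entries_pt by auto
    show "\<rho> \<in> pt ` {M. qdet M = 1}" if "\<rho> \<in> {\<rho>. quat_entries \<rho> \<and> spin_det cp \<rho> = 1}" for \<rho>
      using that spin_det_entries[of \<rho>] pt_entries[of \<rho>] by (intro image_eqI[of _ _ "entries \<rho>"]) auto
  qed
qed

text \<open>The octonion automorphism that fixes the quaternions and negates their complement, applied to all
  entries of a matrix.\<close>

definition refl :: "('m \<times> 'p) \<times> ('m \<times> 'p) \<Rightarrow> ('m \<times> 'p) \<times> ('m \<times> 'p)" where
  "refl \<rho> = (\<zeta>' (sign_block (\<zeta> (fst \<rho>))), \<zeta>' (sign_block (\<zeta> (snd \<rho>))))"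

lemma refl_linear: "linear refl"
  by (rule linearI)
    (simp_all add: refl_def linear_add[OF \<zeta>_linear] linear_cmul[OF \<zeta>_linear] linear_add[OF \<zeta>'_linear]
      linear_cmul[OF \<zeta>'_linear] linear_add[OF block_linear(2)] linear_cmul[OF block_linear(2)])

lemma refl_involution: "refl (refl \<rho>) = \<rho>"
  by (simp add: refl_def sign_block_def)

lemma refl_fixed: "refl \<rho> = \<rho> \<longleftrightarrow> quat_entries \<rho>"
proof -
  have b: "\<zeta>' (sign_block (\<zeta> \<psi>)) = \<psi> \<longleftrightarrow> snd (km (fst \<psi>)) = 0 \<and> snd (kp (snd \<psi>)) = 0" for \<psi>
  proof
    assume "\<zeta>' (sign_block (\<zeta> \<psi>)) = \<psi>"
    then have "sign_block (\<zeta> \<psi>) = \<zeta> \<psi>" using \<zeta>_inv(2) by metis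
    from sign_block_fixed[OF this] show "snd (km (fst \<psi>)) = 0 \<and> snd (kp (snd \<psi>)) = 0" by (simp add: \<zeta>_def)
  next
    assume "snd (km (fst \<psi>)) = 0 \<and> snd (kp (snd \<psi>)) = 0"
    then have "sign_block (\<zeta> \<psi>) = \<zeta> \<psi>" by (simp add: sign_block_def \<zeta>_def prod_eq_iff)
    then show "\<zeta>' (sign_block (\<zeta> \<psi>)) = \<psi>" by simp
  qed
  show ?thesis unfolding refl_def quat_entries_def by (simp add: prod_eq_iff[of _ \<rho>] b)
qed

lemma spin_det_refl: "spin_det cp (refl \<rho>) = spin_det cp \<rho>"
proof -
  have c: "km (fst (\<zeta>' (sign_block (\<zeta> \<psi>)))) = oct_sign (km (fst \<psi>))" "kp (snd (\<zeta>' (sign_block (\<zeta> \<psi>)))) = oct_sign (kp (snd \<psi>))" for \<psi>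
    by (simp_all add: \<zeta>'_comps sign_block_oct_sign \<zeta>_def)
  show ?thesis
    unfolding spin_det_coordinates refl_def fst_conv snd_conv c
    by (simp only: oct_sign_simps(1,2)[symmetric] oct_sign_simps(3))
qed

lemma dim_quat_entries: "dim {\<rho>. refl \<rho> = \<rho>} = 16"
proof -
  define j where "j = (\<lambda>((a, c), (b, d)). (\<zeta>' ((a, 0 :: quat), (c, 0 :: quat)), \<zeta>' ((b, 0 :: quat), (d, 0 :: quat))))"
  have jl: "linear j"
    by (rule linearI) (auto simp: j_def linear_add[OF \<zeta>'_linear, symmetric] linear_cmul[OF \<zeta>'_linear, symmetric] split: prod.splits)
  have ji: "inj j"
  proof (rule injI)
    fix x y :: "(quat \<times> quat) \<times> (quat \<times> quat)" assume "j x = j y"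
    moreover obtain a c b d where x: "x = ((a, c), (b, d))" by (metis surj_pair)
    moreover obtain a' c' b' d' where y: "y = ((a', c'), (b', d'))" by (metis surj_pair)
    ultimately have "\<zeta>' ((a, 0), (c, 0)) = \<zeta>' ((a', 0), (c', 0))" "\<zeta>' ((b, 0), (d, 0)) = \<zeta>' ((b', 0), (d', 0))"
      unfolding j_def by auto
    from arg_cong[OF this(1), of \<zeta>] arg_cong[OF this(2), of \<zeta>] show "x = y" by (simp add: x y)
  qed
  have "range j = {\<rho>. refl \<rho> = \<rho>}"
  proof (intro equalityI subsetI)
    show "\<rho> \<in> {\<rho>. refl \<rho> = \<rho>}" if "\<rho> \<in> range j" for \<rho>
      using that unfolding mem_Collect_eq refl_fixed by (auto simp: j_def quat_entries_def \<zeta>'_comps split: prod.splits)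
    show "\<rho> \<in> range j" if "\<rho> \<in> {\<rho>. refl \<rho> = \<rho>}" for \<rho>
    proof -
      have "\<rho> = pt (entries \<rho>)" using that pt_entries unfolding mem_Collect_eq refl_fixed by simp
      then have "\<rho> = j ((entries \<rho> $1$1, entries \<rho> $2$1), (entries \<rho> $1$2, entries \<rho> $2$2))"
        unfolding pt j_def by simp
      then show ?thesis by blast
    qed
  qed
  moreover have "dim (range j) = dim (UNIV :: ((quat \<times> quat) \<times> (quat \<times> quat)) set)"
    by (rule dim_image_eq[OF jl]) (use ji in simp)
  ultimately show ?thesis by simp
qed

subsection \<open>Translates of the orbit\<close>

context
  fixes g :: "'m \<times> 'p \<Rightarrow> 'm \<times> 'p" and A :: "real^2^2"
  assumes g: "g \<in> Spin91 cp cm" and det: "det A = 1"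
begin

definition orb :: "(('m \<times> 'p) \<times> ('m \<times> 'p)) set" where
  "orb = act g A ` {act h (mat 1) (base_point \<phi>1m \<phi>2p) |h. h \<in> G}"

definition Tinv where "Tinv = (SOME S. \<forall>\<rho>. S (act g A \<rho>) = \<rho> \<and> act g A (S \<rho>) = \<rho>)"

lemma Tinv: "Tinv (act g A \<rho>) = \<rho>" "act g A (Tinv \<rho>) = \<rho>"
  using someI_ex[OF act_SL2R(3)[OF g det]] by (auto simp: Tinv_def simp del: split_paired_All)

lemma Tinv_linear: "linear Tinv"
proof (rule linearI)
  note T = act_SL2R(2)[OF g det]
  show "Tinv (x + y) = Tinv x + Tinv y" for x y
    using Tinv(1)[of "Tinv x + Tinv y"] by (simp add: linear_add[OF T] Tinv(2))
  show "Tinv (c *\<^sub>R x) = c *\<^sub>R Tinv x" for c x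
    using Tinv(1)[of "c *\<^sub>R Tinv x"] by (simp add: linear_cmul[OF T] Tinv(2))
qed

definition \<sigma> where "\<sigma> \<rho> = act g A (refl (Tinv \<rho>))"

lemma \<sigma>_linear: "linear \<sigma>"
  unfolding \<sigma>_def using linear_compose[OF linear_compose[OF Tinv_linear refl_linear] act_SL2R(2)[OF g det]]
  by (simp add: o_def)

lemma orb_fixed_level: "orb = {x. \<sigma> x = x \<and> spin_det cp x = 1}"
proof (intro equalityI subsetI)
  fix x assume "x \<in> orb"
  then obtain \<rho> where "x = act g A \<rho>" "quat_entries \<rho>" "spin_det cp \<rho> = 1" unfolding orb_def orbit_eq(1) by blast
  then show "x \<in> {x. \<sigma> x = x \<and> spin_det cp x = 1}"
    using act_SL2R(1)[OF g det] by (simp add: \<sigma>_def Tinv refl_fixed[THEN iffD2])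
next
  fix x assume x: "x \<in> {x. \<sigma> x = x \<and> spin_det cp x = 1}"
  then have "Tinv (act g A (refl (Tinv x))) = Tinv x" by (simp add: \<sigma>_def)
  then have "quat_entries (Tinv x)" by (simp add: Tinv refl_fixed)
  moreover have "spin_det cp (Tinv x) = 1" using act_SL2R(1)[OF g det, of "Tinv x"] x by (simp add: Tinv)
  ultimately show "x \<in> orb" unfolding orb_def orbit_eq(1) using Tinv(2)[of x] by (intro image_eqI[of _ _ "Tinv x"]) auto
qed

lemma orb_submanifold: "smooth_submanifold 15 orb"
  unfolding orb_fixed_level
proof (rule submanifold_fixed_level[OF \<sigma>_linear])
  have S: "{x. \<sigma> x = x} = act g A ` {\<rho>. refl \<rho> = \<rho>}"
  proof (intro equalityI subsetI)
    fix x assume "x \<in> {x. \<sigma> x = x}"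
    then have "Tinv (act g A (refl (Tinv x))) = Tinv x" by (simp add: \<sigma>_def)
    then show "x \<in> act g A ` {\<rho>. refl \<rho> = \<rho>}" using Tinv(2)[of x] by (intro image_eqI[of _ _ "Tinv x"]) (auto simp: Tinv)
  next
    fix x assume "x \<in> act g A ` {\<rho>. refl \<rho> = \<rho>}"
    then obtain \<rho> where \<rho>: "refl \<rho> = \<rho>" "x = act g A \<rho>" by blast
    then show "x \<in> {x. \<sigma> x = x}" by (simp only: \<sigma>_def Tinv mem_Collect_eq)
  qed
  have d: "dim (act g A ` {\<rho>. refl \<rho> = \<rho>}) = dim {\<rho>. refl \<rho> = \<rho>}"
    by (rule dim_image_eq[OF act_SL2R(2)[OF g det]], rule inj_on_inverseI, rule Tinv(1))
  show "dim {x. \<sigma> x = x} = Suc 15" unfolding S d dim_quat_entries by simp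
qed

lemma orb_totally_geodesic: "totally_geodesic (SL2O cp) (SL2O_metric cp) orb"
proof -
  interpret S: symmetric_quartic "spin_det cp" \<sigma>
  proof (rule symmetric_quartic.intro[OF homogeneous_quartic_axioms], rule symmetric_quartic_axioms.intro)
    show "linear \<sigma>" by (rule \<sigma>_linear)
    show "\<sigma> (\<sigma> x) = x" for x by (simp add: \<sigma>_def Tinv refl_involution)
    show "spin_det cp (\<sigma> x) = spin_det cp x" for x
      using act_SL2R(1)[OF g det, of "Tinv x"] by (simp add: \<sigma>_def act_SL2R(1)[OF g det] spin_det_refl Tinv)
  qed
  have "totally_geodesic {x. spin_det cp x = 1} (hessian (\<lambda>x. ln (spin_det cp x))) {x. \<sigma> x = x \<and> spin_det cp x = 1}"
  proof (rule S.totally_geodesic_fixed)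
    fix p w
    assume p: "p \<in> {x. \<sigma> x = x \<and> spin_det cp x = 1}" and w: "df p w = 0"
      "\<And>z. df p z = 0 \<Longrightarrow> hessian (\<lambda>x. ln (spin_det cp x)) p w z = 0"
    obtain h where h: "h \<in> G" "p = act g A (act h (mat 1) (base_point \<phi>1m \<phi>2p))"
      using p unfolding orb_fixed_level[symmetric] orb_def by blast
    have p2: "p = act (g \<circ> h) A (base_point \<phi>1m \<phi>2p)"
      unfolding h(2) using act_comp[OF Spin91_linear[OF g], of A h "mat 1"] by simp
    have n: "norm \<phi>1m = 1" "norm \<phi>2p = 1"
      using km_inner[of \<phi>1m \<phi>1m] kp_inner[of \<phi>2p \<phi>2p] by (simp_all add: norm_eq_1 km_unit kp_unit)
    have "g \<circ> h \<in> Spin91 cp cm" using Spin91_comp[OF g] G_subset h(1) by blast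
    from nondegenerate_orbit[OF n this det p2 w] show "w = 0" .
  qed
  then show ?thesis unfolding orb_fixed_level SL2O_def SL2O_metric_def .
qed

definition gi where "gi = inv_into UNIV g"

lemma gi: "g (gi \<psi>) = \<psi>" "gi (g \<psi>) = \<psi>" "linear g" "linear gi" "gi \<in> Spin91 cp cm"
proof -
  show l: "linear g" by (rule Spin91_linear[OF g])
  show "g (gi \<psi>) = \<psi>" "gi (g \<psi>) = \<psi>" using Spin91_bij[OF g] by (simp_all add: gi_def bij_is_inj bij_is_surj surj_f_inv_f)
  show "linear gi" unfolding gi_def by (rule linear_inv_into[OF l Spin91_bij[OF g]])
  show "gi \<in> Spin91 cp cm"
    using subgroup.m_inv_closed[OF Spin91_subgroup g] general_linear_inv_apply[OF l Spin91_bij[OF g]] by (simp add: gi_def)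
qed

definition \<Theta>g where "\<Theta>g M = g \<circ> \<Theta> M \<circ> gi"

lemma K_eq: "conjugate_group g G = \<Theta>g ` {M. qdet M = 1}"
  unfolding conjugate_group_def G_eq \<Theta>g_def gi_def by blast

lemma \<Theta>g_mult: "qdet M = 1 \<Longrightarrow> qdet N = 1 \<Longrightarrow> \<Theta>g (M \<star> N) = \<Theta>g M \<circ> \<Theta>g N"
  by (simp add: \<Theta>g_def fun_eq_iff \<Theta>_mult gi del: split_paired_All)

lemma \<Theta>g_linear: "linear (\<Theta>g M)"
  unfolding \<Theta>g_def using gi by (intro linear_compose \<Theta>_linear)

lemma \<Theta>g_one: "\<Theta>g qmat_one = id"
  by (simp add: \<Theta>g_def \<Theta>_one fun_eq_iff gi del: split_paired_All)

lemma \<Theta>g_pt: "act (\<Theta>g M) (mat 1) (act g A (pt N)) = act g A (act (\<Theta> M) (mat 1) (pt N))"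
  using act_comp[OF \<Theta>g_linear, of M "mat 1" g A "pt N"] act_comp[OF gi(3), of A "\<Theta> M" "mat 1" "pt N"]
  by (simp add: \<Theta>g_def o_def gi del: split_paired_All act_mat_1)

lemma orb_pt: "orb = (\<lambda>M. act g A (pt M)) ` {M. qdet M = 1}"
  unfolding orb_def orbit_eq(2) by (simp add: image_image)

definition \<Theta>i where "\<Theta>i k = entries (gi (k (g (\<phi>1m, 0))), gi (k (g (0, \<phi>2p))))"

lemma \<Theta>i: "\<Theta>i (\<Theta>g M) = M"
  using entries_pt(1)[of M] by (simp add: \<Theta>i_def \<Theta>g_def gi pt_def base_point_def)

lemma \<Theta>g_homeomorphism: "homeomorphism {M. qdet M = 1} (conjugate_group g G) \<Theta>g \<Theta>i"
proof (rule homeomorphismI)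
  show "continuous_on {M. qdet M = 1} \<Theta>g"
  proof (rule continuous_on_coordinatewise_then_product)
    fix \<psi>
    have "continuous_on {M. qdet M = 1} (\<lambda>M. g (\<zeta>' (theta M (\<zeta> (gi \<psi>)))))"
      by (intro continuous_on_linear[OF gi(3)] continuous_on_linear[OF \<zeta>'_linear] continuous_on_theta)
    then show "continuous_on {M. qdet M = 1} (\<lambda>M. \<Theta>g M \<psi>)" by (simp add: \<Theta>g_def \<Theta>_def)
  qed
  have ev: "continuous_on (conjugate_group g G) (\<lambda>k. gi (k \<psi>))" for \<psi>
    by (intro continuous_on_linear[OF gi(4)] continuous_on_subset[OF continuous_on_product_coordinates]) simp
  show "continuous_on (conjugate_group g G) \<Theta>i"
    unfolding \<Theta>i_def entries_def fst_conv snd_conv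
    by (intro continuous_on_mat2 continuous_on_fst continuous_on_linear[OF km_linear]
        continuous_on_linear[OF kp_linear] continuous_on_snd ev)
qed (use \<Theta>i K_eq in auto)

theorem orb_copy: "SL2H_copy cp cm (conjugate_group g G) orb"
  unfolding SL2H_copy_def
proof (intro conjI ballI)
  show sub: "conjugate_group g G \<subseteq> Spin91 cp cm"
    unfolding K_eq \<Theta>g_def using g gi(5) \<Theta>_Spin91 by (auto intro!: Spin91_comp)
  have inv: "qdet M = 1 \<Longrightarrow> inv\<^bsub>general_linear\<^esub> (\<Theta>g M) = \<Theta>g (qadj M)" for M
    using \<Theta>g_mult[of M "qadj M"] \<Theta>g_mult[of "qadj M" M] \<Theta>_inverse(1)[of M] qadj_left_right[of M] \<Theta>g_one
    by (intro general_linear_inv(2) \<Theta>g_linear) (simp_all add: fun_eq_iff del: split_paired_All)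
  show "subgroup (conjugate_group g G) general_linear"
  proof (rule GL.subgroupI)
    show "conjugate_group g G \<subseteq> carrier general_linear"
      using sub subgroup.subset[OF Spin91_subgroup] by blast
    show "conjugate_group g G \<noteq> {}" unfolding K_eq using qdet_elementary(1) by blast
    fix a assume "a \<in> conjugate_group g G"
    then obtain M where M: "a = \<Theta>g M" "qdet M = 1" unfolding K_eq by blast
    then show "inv\<^bsub>general_linear\<^esub> a \<in> conjugate_group g G" unfolding K_eq using inv \<Theta>_inverse(1) by auto
    fix b assume "b \<in> conjugate_group g G"
    then obtain N where N: "b = \<Theta>g N" "qdet N = 1" unfolding K_eq by blast
    show "a \<otimes>\<^bsub>general_linear\<^esub> b \<in> conjugate_group g G"
      unfolding K_eq using M N \<Theta>g_mult[of M N] by (auto simp: qdet_mult intro!: image_eqI[of _ _ "M \<star> N"])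
  qed
  show "topological_group_iso SL2H (general_linear\<lparr>carrier := conjugate_group g G\<rparr>)"
    unfolding topological_group_iso_def
  proof (intro exI conjI)
    show "homeomorphism (carrier SL2H) (carrier (general_linear\<lparr>carrier := conjugate_group g G\<rparr>)) \<Theta>g \<Theta>i"
      using \<Theta>g_homeomorphism by (simp add: SL2H_carrier)
    have "bij_betw \<Theta>g {M. qdet M = 1} (conjugate_group g G)"
      unfolding K_eq by (rule bij_betw_imageI) (auto intro: inj_on_inverseI \<Theta>i)
    then show "\<Theta>g \<in> iso SL2H (general_linear\<lparr>carrier := conjugate_group g G\<rparr>)"
      unfolding iso_def hom_def by (auto simp: SL2H_carrier SL2H_mult K_eq \<Theta>g_mult general_linear_def)
  qed
  show "orb \<noteq> {}" unfolding orb_pt using qdet_elementary(1) by blast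
  show "orb \<subseteq> SL2O cp" unfolding orb_fixed_level SL2O_def by blast
  fix p assume "p \<in> orb"
  then obtain M where M: "p = act g A (pt M)" "qdet M = 1" unfolding orb_pt by blast
  {
    fix k assume "k \<in> conjugate_group g G"
    then obtain N where N: "k = \<Theta>g N" "qdet N = 1" unfolding K_eq by blast
    show "act k (mat 1) p \<in> orb"
      unfolding orb_pt M N \<Theta>g_pt pt_mult[OF N(2) M(2)] using M(2) N(2) by (auto simp: qdet_mult)
  }
  fix q assume "q \<in> orb"
  then obtain N where N: "q = act g A (pt N)" "qdet N = 1" unfolding orb_pt by blast
  note Mi = \<Theta>_inverse(1)[OF M(2)] qadj_left_right[OF M(2)]
  show "\<exists>!k. k \<in> conjugate_group g G \<and> act k (mat 1) p = q"
  proof (rule ex1I[of _ "\<Theta>g (N \<star> qadj M)"], rule conjI)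
    have d: "qdet (N \<star> qadj M) = 1" using N(2) Mi(1) by (simp add: qdet_mult)
    then show "\<Theta>g (N \<star> qadj M) \<in> conjugate_group g G" unfolding K_eq by blast
    show "act (\<Theta>g (N \<star> qadj M)) (mat 1) p = q"
      unfolding M N \<Theta>g_pt pt_mult[OF d M(2)] by (simp add: qmat_assoc Mi)
    fix k assume k: "k \<in> conjugate_group g G \<and> act k (mat 1) p = q"
    then obtain L where L: "k = \<Theta>g L" "qdet L = 1" unfolding K_eq by blast
    have "act g A (pt (L \<star> M)) = act g A (pt N)"
      using k unfolding M N L \<Theta>g_pt pt_mult[OF L(2) M(2)] by blast
    then have "pt (L \<star> M) = pt N" using Tinv(1) by metis
    then have "L \<star> M = N" using entries_pt(1) by metis
    then have "L = N \<star> qadj M" using qmat_assoc[of L M "qadj M"] Mi by simp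
    then show "k = \<Theta>g (N \<star> qadj M)" using L by simp
  qed
qed

lemma orb_point: "act g A (base_point \<phi>1m \<phi>2p) \<in> orb"
proof -
  have "base_point \<phi>1m \<phi>2p = pt qmat_one" by (simp add: pt_def \<Theta>_one)
  moreover have "qdet qmat_one = 1" using qdet_elementary(1)[of 0] by (simp add: qE_def qmat_one_def)
  ultimately show ?thesis unfolding orb_pt by auto
qed

end

end

declare qmul.simps [simp del] qcnj.simps [simp del] omul.simps [simp del]

section \<open>Existence of octonionic coordinates\<close>

context half_spin
begin

context
  fixes \<phi>1m :: 'm and \<phi>2p :: 'p
  assumes n1: "norm \<phi>1m = 1" and n2: "norm \<phi>2p = 1"
begin

definition base_e where "base_e = sp \<phi>1m \<phi>2p"
definition vec_of where "vec_of \<beta> = sp \<phi>1m (cp base_e \<beta>)"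
text \<open>A product of octonions on the negative half-spinors, with unit \<open>\<phi>1m\<close>, made of Clifford multiplications.\<close>

definition prd where "prd \<beta> \<gamma> = - cm base_e (cp (vec_of \<beta>) \<gamma>)"

lemma n11: "\<phi>1m \<bullet> \<phi>1m = 1" "\<phi>2p \<bullet> \<phi>2p = 1" "\<phi>1m \<noteq> 0" "\<phi>2p \<noteq> 0"
  using n1 n2 by (auto simp: dot_square_norm)

lemma sp_unit: "cp (sp \<phi>1m \<phi>) \<phi>1m = \<phi>"
proof -
  obtain a where a: "cp a \<phi>1m = \<phi>" using surj_cp[OF n11(3)] by blast
  then have "sp \<phi>1m \<phi> = a" using sp_cp[of \<phi>1m a] by (simp add: n11)
  with a show ?thesis by simp
qed

lemma base_e: "cp base_e \<phi>1m = \<phi>2p" "base_e \<bullet> base_e = 1" "cm base_e (cp base_e \<gamma>) = - \<gamma>" "cp base_e (cm base_e \<phi>) = - \<phi>"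
proof -
  show 1: "cp base_e \<phi>1m = \<phi>2p" by (simp add: base_e_def sp_unit)
  show 2: "base_e \<bullet> base_e = 1" using inner_cp_same[of base_e \<phi>1m \<phi>1m] by (simp add: 1 n11)
  show "cm base_e (cp base_e \<gamma>) = - \<gamma>" "cp base_e (cm base_e \<phi>) = - \<phi>" by (simp_all add: cm_cp cp_cm 2)
qed

lemma vec_of: "cp (vec_of \<beta>) \<phi>1m = cp base_e \<beta>" "vec_of (- cm base_e (cp x \<phi>1m)) = x"
proof -
  show "cp (vec_of \<beta>) \<phi>1m = cp base_e \<beta>" by (simp add: vec_of_def sp_unit)
  show "vec_of (- cm base_e (cp x \<phi>1m)) = x" by (simp add: vec_of_def cp_simps base_e sp_cp n11)
qed

lemma vec_of_linear: "linear vec_of"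
  by (rule linearI) (simp_all add: vec_of_def cp_simps sp_simps)

lemma norm_vec_of: "norm (vec_of \<beta>) = norm \<beta>"
  using norm_cp[of "vec_of \<beta>" \<phi>1m] norm_cp[of base_e \<beta>] base_e(2)[folded norm_eq_1] by (simp add: vec_of n1)

lemma prd_composition: "composition_algebra prd \<phi>1m"
proof
  show "bilinear prd"
    unfolding bilinear_def
    by (intro conjI allI linearI; simp add: prd_def linear_add[OF vec_of_linear] linear_cmul[OF vec_of_linear] cp_simps cm_simps)
  show "prd \<phi>1m x = x" for x
  proof -
    have "vec_of \<phi>1m = base_e" using vec_of(2)[of base_e] by (simp add: base_e(3))
    then show ?thesis by (simp add: prd_def base_e)
  qed
  show "prd x \<phi>1m = x" for x by (simp add: prd_def vec_of base_e)
  show "norm (prd x y) = norm x * norm y" for x y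
    using base_e(2)[folded norm_eq_1] by (simp add: prd_def norm_cm norm_cp norm_vec_of)
  show "\<phi>1m \<noteq> 0" by (rule n11)
qed

lemma coordinates_exist:
  assumes fr: "composition_algebra.quat_frame \<phi>1m i j"
  shows "\<exists>km. (\<forall>m. km m \<in> H0 \<longleftrightarrow> m \<in> range (composition_algebra.quat_map prd \<phi>1m i j)) \<and>
    octonion_coordinates cp cm km (\<lambda>p. km (- cm base_e p)) (\<lambda>x. km (- cm base_e (cp x \<phi>1m))) \<phi>1m \<phi>2p"
proof -
  interpret P: composition_algebra prd \<phi>1m by (rule prd_composition)
  obtain \<alpha> where \<alpha>: "linear \<alpha>" "bij \<alpha>" "\<And>x y. \<alpha> x \<bullet> \<alpha> y = x \<bullet> y" "\<And>x y. \<alpha> (omul x y) = prd (\<alpha> x) (\<alpha> y)"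
    "\<alpha> oone = \<phi>1m" "\<And>p. \<alpha> (p, 0) = P.quat_map i j p"
    using P.oct_map_exists[OF fr dims(1)] by metis
  define km where "km = inv_into UNIV \<alpha>"
  have k: "\<alpha> (km m) = m" "km (\<alpha> x) = x" for m x
    using \<alpha>(2) by (simp_all add: km_def bij_is_inj bij_is_surj surj_f_inv_f)
  have kl: "linear km" unfolding km_def by (rule linear_inv_into[OF \<alpha>(1,2)])
  have ki: "km m \<bullet> km m' = m \<bullet> m'" for m m' using \<alpha>(3)[of "km m" "km m'"] by (simp add: k)
  have kp: "km (prd m m') = omul (km m) (km m')" for m m' using \<alpha>(4)[of "km m" "km m'"] k by metis
  have H: "km m \<in> H0 \<longleftrightarrow> m \<in> range (P.quat_map i j)" for m
  proof
    assume "km m \<in> H0"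
    then obtain p where "km m = (p, 0)" by (auto simp: H0_def)
    then have "m = P.quat_map i j p" using k(1)[of m] \<alpha>(6)[of p] by simp
    then show "m \<in> range (P.quat_map i j)" by blast
  next
    assume "m \<in> range (P.quat_map i j)"
    then obtain p where "m = \<alpha> (p, 0)" by (auto simp: \<alpha>(6))
    then show "km m \<in> H0" by (simp add: k H0_def)
  qed
  have "octonion_coordinates cp cm km (\<lambda>p. km (- cm base_e p)) (\<lambda>x. km (- cm base_e (cp x \<phi>1m))) \<phi>1m \<phi>2p"
  proof (rule octonion_coordinates.intro[OF half_spin_axioms], rule octonion_coordinates_axioms.intro)
    show "linear km" by (rule kl)
    show "linear (\<lambda>p. km (- cm base_e p))"
      by (rule linearI) (simp_all add: linear_add[OF kl] linear_cmul[OF kl] linear_neg[OF kl] linear_diff[OF kl] cm_simps)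
    show "linear (\<lambda>x. km (- cm base_e (cp x \<phi>1m)))"
      by (rule linearI) (simp_all add: linear_add[OF kl] linear_cmul[OF kl] linear_neg[OF kl] linear_diff[OF kl] cm_simps cp_simps)
    show "km m \<bullet> km m' = m \<bullet> m'" for m m' by (rule ki)
    show "km (- cm base_e p) \<bullet> km (- cm base_e p') = p \<bullet> p'" for p p' by (simp add: ki inner_cm_same base_e)
    show "km (- cm base_e (cp x \<phi>1m)) \<bullet> km (- cm base_e (cp y \<phi>1m)) = x \<bullet> y" for x y
      by (simp add: ki inner_cm_same base_e inner_cp_vectors n11)
    show "km (- cm base_e (cp x m)) = omul (km (- cm base_e (cp x \<phi>1m))) (km m)" for x m
      unfolding kp[symmetric] prd_def vec_of ..
    show "km \<phi>1m = oone" using k(2)[of oone] \<alpha>(5) by simp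
    then show "km (- cm base_e \<phi>2p) = oone" using base_e(3)[of \<phi>1m] by (simp add: base_e(1))
  qed
  with H show ?thesis by blast
qed

text \<open>An octonion lies in every quaternion subalgebra that contains its imaginary part.\<close>

lemma coordinates_through:
  "\<exists>km kp kv. octonion_coordinates cp cm km kp kv \<phi>1m \<phi>2p \<and> kp \<phi> \<in> H0"
proof -
  interpret P: composition_algebra prd \<phi>1m by (rule prd_composition)
  define \<beta> where "\<beta> = - cm base_e \<phi>"
  define b where "b = \<beta> - (\<beta> \<bullet> \<phi>1m) *\<^sub>R \<phi>1m"
  have "b \<bullet> \<phi>1m = 0" by (simp add: b_def inner_diff n11)
  then obtain i j where fr: "P.quat_frame i j" and bi: "b = norm b *\<^sub>R i" using P.quat_frame_extend[OF dims(1)] by blast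
  have "\<beta> = P.quat_map i j (Complex (\<beta> \<bullet> \<phi>1m) (norm b), 0)"
    unfolding P.quat_map_def using bi by (simp add: b_def)
  then have "\<beta> \<in> range (P.quat_map i j)" by blast
  moreover obtain km where "\<forall>m. km m \<in> H0 \<longleftrightarrow> m \<in> range (P.quat_map i j)"
    "octonion_coordinates cp cm km (\<lambda>p. km (- cm base_e p)) (\<lambda>x. km (- cm base_e (cp x \<phi>1m))) \<phi>1m \<phi>2p"
    using coordinates_exist[OF fr] by blast
  ultimately show ?thesis unfolding \<beta>_def by blast
qed

section \<open>Transitivity\<close>

definition reachable where "reachable \<rho> \<longleftrightarrow> (\<exists>g\<in>Spin91 cp cm. \<exists>A. det A = 1 \<and> act g A (base_point \<phi>1m \<phi>2p) = \<rho>)"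

lemma reachable_back:
  assumes g: "g \<in> Spin91 cp cm" and A: "det A = 1" and r: "reachable (act g A \<rho>)"
  shows "reachable \<rho>"
proof -
  obtain h C where h: "h \<in> Spin91 cp cm" "det C = 1" "act h C (base_point \<phi>1m \<phi>2p) = act g A \<rho>"
    using r unfolding reachable_def by blast
  obtain A' where A': "A' ** A = mat 1" using A invertible_det_nz[of A] by (auto simp: invertible_def)
  have dA': "det A' = 1" using arg_cong[OF A', of det] A by (simp add: det_mul)
  let ?gi = "inv_into UNIV g"
  have gi: "?gi \<in> Spin91 cp cm" "?gi \<circ> g = id"
    using subgroup.m_inv_closed[OF Spin91_subgroup g] general_linear_inv_apply[OF Spin91_linear[OF g] Spin91_bij[OF g]]
      Spin91_bij[OF g] by (auto simp: bij_is_inj)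
  have "act (?gi \<circ> h) (A' ** C) (base_point \<phi>1m \<phi>2p) = act ?gi A' (act g A \<rho>)"
    unfolding h(3)[symmetric] act_comp[OF Spin91_linear[OF gi(1)]] ..
  also have "\<dots> = \<rho>" by (simp add: act_comp[OF Spin91_linear[OF gi(1)]] gi(2) A')
  finally show ?thesis
    unfolding reachable_def using Spin91_comp[OF gi(1) h(1)] dA' h(2) by (metis det_mul mult_1)
qed

lemma reachable_back1: "g \<in> Spin91 cp cm \<Longrightarrow> reachable (g \<psi>, g \<theta>) \<Longrightarrow> reachable (\<psi>, \<theta>)"
  using reachable_back[of g "mat 1" "(\<psi>, \<theta>)"] by simp

lemma spin_det_pair: "g \<in> Spin91 cp cm \<Longrightarrow> spin_det cp (g \<psi>, g \<theta>) = spin_det cp (\<psi>, \<theta>)"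
  using spin_det_act[of g "mat 1" "(\<psi>, \<theta>)"] by simp

definition spW where "spW x = spE x \<circ> spF x \<circ> spE x"

lemma spW: "norm x = 1 \<Longrightarrow> spW x (m, p) = (cm x p, cp x m)" "spW x \<in> Spin91 cp cm"
proof -
  show "spW x \<in> Spin91 cp cm" unfolding spW_def by (intro Spin91_comp spE_Spin91 spF_Spin91)
  assume "norm x = 1"
  then have "x \<bullet> x = 1" by (simp add: dot_square_norm)
  then show "spW x (m, p) = (cm x p, cp x m)"
    by (simp add: spW_def spE_def spF_def cm_simps cp_simps cm_cp cp_cm)
qed

text \<open>An octonion lies in a quaternion subalgebra, and the copy of SL(2,H) attached to that subalgebra already
  connects the two points.\<close>

lemma reachable_final: assumes "norm \<phi> = 1" shows "reachable ((\<phi>1m, 0), (0, \<phi>))"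
proof -
  obtain km kp kv where c: "octonion_coordinates cp cm km kp kv \<phi>1m \<phi>2p" "kp \<phi> \<in> H0"
    using coordinates_through by blast
  interpret C: octonion_coordinates cp cm km kp kv \<phi>1m \<phi>2p by (rule c(1))
  have pp: "\<phi> \<bullet> \<phi> = 1" using assms by (simp add: dot_square_norm)
  have "C.quat_entries ((\<phi>1m, 0), (0, \<phi>))"
    using c(2) C.H0_iff[of "kp \<phi>"] by (simp add: C.quat_entries_def C.km_unit C.km_simps C.kp_simps oone_def)
  moreover have "spin_det cp ((\<phi>1m, 0), (0, \<phi>)) = 1" by (simp add: spin_det_expand sp_simps n11 pp)
  ultimately obtain h where h: "h \<in> C.G" "((\<phi>1m, 0), (0, \<phi>)) = act h (mat 1) (base_point \<phi>1m \<phi>2p)"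
    using C.orbit_eq(1) by blast
  have "h \<in> Spin91 cp cm" using C.G_subset h(1) by blast
  then show ?thesis
    unfolding reachable_def by (intro bexI[of _ h] exI[of _ "mat 1"] conjI det_I h(2)[symmetric])
qed

text \<open>A product of two unit vectors moves the first spinor to \<open>\<phi>1m\<close>.\<close>

lemma reachable_units: assumes "norm m = 1" "norm p = 1" shows "reachable ((m, 0), (0, p))"
proof -
  have e: "norm base_e = 1" using base_e(2) by (simp add: norm_eq_1)
  let ?n = "cp base_e m"
  have n: "norm ?n = 1" using assms e by (simp add: norm_cp)
  then have "?n \<noteq> 0" by auto
  then obtain y where y: "cm y ?n = \<phi>1m" using surj_cm by blast
  have ny: "norm y = 1" using norm_cm[of y ?n] n n1 by (simp add: y)
  have "reachable ((\<phi>1m, 0), (0, cp y (cm base_e p)))"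
    by (rule reachable_final) (simp add: norm_cp norm_cm e ny assms)
  then have "reachable (spW y (0, ?n), spW y (cm base_e p, 0))" by (simp add: spW(1)[OF ny] y cm_simps cp_simps)
  then have "reachable ((0, ?n), (cm base_e p, 0))" by (rule reachable_back1[OF spW(2)])
  then have "reachable (spW base_e (m, 0), spW base_e (0, p))" by (simp add: spW(1)[OF e] cm_simps cp_simps)
  then show ?thesis by (rule reachable_back1[OF spW(2)])
qed

text \<open>As in Gaussian elimination, the generators of Spin(9,1) clear the entries off the diagonal, and a diagonal
  matrix in \<open>SL(2,R)\<close> makes the two remaining spinors unit vectors.\<close>

theorem transitive: assumes "spin_det cp \<rho> = 1" shows "reachable \<rho>"
proof -
  have diag: "reachable ((m, 0), (0, p))" if d: "spin_det cp ((m, 0), (0, p)) = 1" for m p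
  proof -
    have d2: "(norm m * norm p)\<^sup>2 = 1" using d by (simp add: spin_det_expand sp_simps power_mult_distrib power2_norm_eq_inner)
    have "0 \<le> norm m * norm p" by simp
    with d2 have mp: "norm m * norm p = 1" unfolding power2_eq_1_iff by linarith
    then have m0: "norm m \<noteq> 0" by auto
    define A :: "real^2^2" where "A = mat2 (1 / norm m) 0 0 (norm m)"
    have "det A = 1" using m0 by (simp add: det_2 A_def)
    moreover have "reachable (act id A ((m, 0), (0, p)))"
      using reachable_units[of "m /\<^sub>R norm m" "norm m *\<^sub>R p"] m0 mp by (simp add: act_def A_def divide_inverse)
    moreover have "id \<in> Spin91 cp cm" using subgroup.one_closed[OF Spin91_subgroup] by simp
    ultimately show ?thesis using reachable_back by blast
  qed
  have left: "reachable ((m, q), (n, p))" if d: "spin_det cp ((m, q), (n, p)) = 1" and m: "m \<noteq> 0" for m q n p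
  proof -
    obtain a where a: "cp a m = - q" using surj_cp[OF m] by blast
    define p' where "p' = p + cp a n"
    have "spin_det cp (spE a (m, q), spE a (n, p)) = 1" using spin_det_pair[OF spE_Spin91] d by simp
    then have d1: "spin_det cp ((m, 0), (n, p')) = 1" by (simp add: spE_def a p'_def)
    have "p' \<noteq> 0" using d1 by (auto simp: spin_det_expand sp_simps)
    then obtain b where b: "cm b p' = - n" using surj_cm by blast
    have "spin_det cp (spF b (m, 0), spF b (n, p')) = 1" using spin_det_pair[OF spF_Spin91] d1 by simp
    then have "reachable ((m, 0), (0, p'))" using diag[of m p'] by (simp add: spF_def b cm_simps)
    then have "reachable (spF b (m, 0), spF b (n, p'))" by (simp add: spF_def b cm_simps)
    then have "reachable ((m, 0), (n, p'))" by (rule reachable_back1[OF spF_Spin91])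
    then have "reachable (spE a (m, q), spE a (n, p))" by (simp add: spE_def a p'_def)
    then show ?thesis by (rule reachable_back1[OF spE_Spin91])
  qed
  obtain m q n p where \<rho>: "\<rho> = ((m, q), (n, p))" by (metis surj_pair)
  show ?thesis
  proof (cases "m = 0")
    case False
    then show ?thesis using left assms \<rho> by blast
  next
    case True
    have "q \<noteq> 0" using assms by (auto simp: \<rho> True spin_det_expand sp_simps)
    then obtain a where a: "cm a q = \<phi>1m" using surj_cm by blast
    have "spin_det cp (spF a (m, q), spF a (n, p)) = 1" using spin_det_pair[OF spF_Spin91] assms \<rho> by simp
    then have "reachable (spF a (m, q), spF a (n, p))"
      using left[of \<phi>1m q] n11 by (simp add: spF_def a True \<rho>)
    then show ?thesis unfolding \<rho> by (rule reachable_back1[OF spF_Spin91])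
  qed
qed

end

end

section \<open>Quaternion subalgebras and the identification with the octonions\<close>

lemma norm_preserving_inner:
  fixes f :: "'a::real_inner \<Rightarrow> 'b::real_inner"
  assumes "linear f" "\<And>x. norm (f x) = norm x"
  shows "f x \<bullet> f y = x \<bullet> y"
proof -
  have s: "f z \<bullet> f z = z \<bullet> z" for z using assms(2)[of z] by (simp add: norm_eq)
  show ?thesis using s[of "x + y"] s[of x] s[of y]
    by (simp add: linear_add[OF assms(1)] inner_add inner_commute)
qed

context octonion_coordinates
begin

text \<open>The automorphism with fixed space the standard quaternions is a product of four unit vectors,
  hence lies in the stabiliser of the base spinors.\<close>

definition unit_vec where "unit_vec s = inv_into UNIV kv (0 :: quat, s)"

definition pair_prod where "pair_prod x y = (\<lambda>(\<phi>m, \<phi>p). (cm x (cp y \<phi>m), cp x (cm y \<phi>p)))"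

definition involution where
  "involution = pair_prod (unit_vec qone) (unit_vec (\<i>, 0)) \<circ> pair_prod (unit_vec (0, 1)) (unit_vec (0, \<i>))"

lemma involution:
  shows "involution \<in> Spin8 cp cm"
    and "km (fst (involution (m, p))) = oct_sign (km m)" "kp (snd (involution (m, p))) = oct_sign (kp p)"
proof -
  have u: "norm (unit_vec s) = norm s" for s
    using kv_inner[of "unit_vec s" "unit_vec s"] by (simp add: unit_vec_def norm_eq_sqrt_inner)
  have mem: "pair_prod x y \<in> Spin8 cp cm" if "norm x = 1" "norm y = 1" for x y
    unfolding Spin8_def pair_prod_def by (rule generate.incl) (use that in blast)
  have "norm qone = 1" "norm (\<i>, 0 :: complex) = 1" "norm (0 :: complex, 1 :: complex) = 1" "norm (0 :: complex, \<i>) = 1"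
    by (simp_all add: norm_Pair qone_def)
  then have "norm (unit_vec qone) = 1" "norm (unit_vec (\<i>, 0)) = 1" "norm (unit_vec (0, 1)) = 1" "norm (unit_vec (0, \<i>)) = 1"
    by (simp_all only: u)
  from generate.eng[OF mem[OF this(1,2), unfolded Spin8_def] mem[OF this(3,4), unfolded Spin8_def]]
  show "involution \<in> Spin8 cp cm"
    unfolding involution_def Spin8_def general_linear_simps .
  have v: "O.conj (0, s) = - (0, s)" "kv (unit_vec s) = (0, s)" for s by (simp_all add: unit_vec_def O_conj)
  have cm': "km (cm (unit_vec s) p) = omul (0, s) (kp p)" "kp (cp (unit_vec s) m) = omul (0, s) (km m)" for s p m
    by (simp_all only: km_cm kp_cp v O.mult_minus_left minus_minus)
  have q: "omul (0, qone) (omul (0, (\<i>, 0)) (omul (0, (0, 1)) (omul (0, (0, \<i>)) x))) = oct_sign x" for x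
    by (cases x) (auto simp: omul.simps qmul.simps qcnj.simps oct_sign_def qone_def complex_eq_iff)
  show "km (fst (involution (m, p))) = oct_sign (km m)" "kp (snd (involution (m, p))) = oct_sign (kp p)"
    by (simp_all add: involution_def pair_prod_def cm' q)
qed

lemma involution_fixed: "fst (involution (m, 0)) = m \<longleftrightarrow> km m \<in> H0"
proof -
  have "fst (involution (m, 0)) = m \<longleftrightarrow> oct_sign (km m) = km m"
    using involution(2)[of m 0] km_inv(1) by metis
  also have "\<dots> \<longleftrightarrow> snd (km m) = 0"
  proof
    assume "oct_sign (km m) = km m"
    from arg_cong[OF this, of snd] have "snd (km m) = - snd (km m)" by (simp add: oct_sign_def)
    then show "snd (km m) = 0" by (rule self_neg_zero)
  next
    assume "snd (km m) = 0"
    then show "oct_sign (km m) = km m" by (simp add: oct_sign_def prod_eq_iff)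
  qed
  finally show ?thesis by (simp add: H0_iff)
qed

lemma identification_closed:
  assumes \<iota>: "octonion_identification cp cm \<phi>1m \<phi>2p \<iota>" and m: "km m \<in> H0" "km m' \<in> H0"
  shows "\<exists>n. \<iota> n = omul (\<iota> m) (\<iota> m') \<and> km n \<in> H0"
proof -
  have "involution (\<phi>1m, 0) = (\<phi>1m, 0)" "involution (0, \<phi>2p) = (0, \<phi>2p)"
  proof -
    have z: "involution (\<phi>1m, 0) = \<zeta>' (\<zeta> (involution (\<phi>1m, 0)))" "involution (0, \<phi>2p) = \<zeta>' (\<zeta> (involution (0, \<phi>2p)))" by simp_all
    have s: "oct_sign 0 = 0" "oct_sign oone = oone" using linear_0[OF oct_sign_linear] oct_sign_simps(5) by simp_all
    have "\<zeta> (involution (\<phi>1m, 0)) = \<zeta> (\<phi>1m, 0)" "\<zeta> (involution (0, \<phi>2p)) = \<zeta> (0, \<phi>2p)"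
      by (simp_all add: \<zeta>_def involution km_unit kp_unit km_simps kp_simps s)
    with z show "involution (\<phi>1m, 0) = (\<phi>1m, 0)" "involution (0, \<phi>2p) = (0, \<phi>2p)" by simp_all
  qed
  then obtain \<alpha> where \<alpha>: "octonion_automorphism \<alpha>" "\<And>\<phi>. \<iota> (fst (involution (\<phi>, 0))) = \<alpha> (\<iota> \<phi>)"
    using \<iota> involution(1) unfolding octonion_identification_def by blast
  have b: "bij \<iota>" using \<iota> by (simp add: octonion_identification_def)
  obtain n where n: "\<iota> n = omul (\<iota> m) (\<iota> m')" using bij_is_surj[OF b] by (metis surjD)
  have "\<alpha> (\<iota> m) = \<iota> m" "\<alpha> (\<iota> m') = \<iota> m'" using \<alpha>(2) m involution_fixed by metis+
  then have "\<alpha> (\<iota> n) = \<iota> n" using \<alpha>(1) unfolding n octonion_automorphism_def by metis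
  then have "fst (involution (n, 0)) = n" using \<alpha>(2)[of n] b by (simp add: bij_def inj_eq)
  then show ?thesis using n involution_fixed by blast
qed

lemma R51_eq:
  assumes \<iota>: "linear \<iota>" "\<And>x y. \<iota> x \<bullet> \<iota> y = x \<bullet> y" "\<iota> \<phi>1m = oone" and H: "\<And>m. \<iota> m \<in> H \<longleftrightarrow> km m \<in> H0"
  shows "R51 cp \<phi>1m \<phi>2p \<iota> H = W"
proof -
  let ?e = "sp \<phi>1m \<phi>2p"
  have ke: "kv ?e = oone" by (simp add: kv_sp km_unit kp_unit O.conj_def scaleR_2)
  have im: "\<iota> \<beta> \<in> imaginary_part H \<longleftrightarrow> km \<beta> \<in> H0 \<and> \<beta> \<bullet> \<phi>1m = 0" for \<beta>
    using \<iota>(2)[of \<beta> \<phi>1m] by (simp add: imaginary_part_def H \<iota>(3))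
  have c: "cp v \<phi>1m = cp ?e \<beta> \<longleftrightarrow> kv v = km \<beta>" for v \<beta>
  proof -
    have "cp v \<phi>1m = cp ?e \<beta> \<longleftrightarrow> kp (cp v \<phi>1m) = kp (cp ?e \<beta>)" using kp_inv(1) by metis
    then show ?thesis by (simp add: kp_cp ke km_unit)
  qed
  have o: "snd oone = 0" by (simp add: oone_def)
  show ?thesis
  proof (intro equalityI subsetI)
    fix f assume "f \<in> R51 cp \<phi>1m \<phi>2p \<iota> H"
    then obtain a v s c' \<beta> where f: "f = (a, v + s *\<^sub>R ?e, c')" "kv v = km \<beta>" "km \<beta> \<in> H0"
      unfolding R51_def Let_def c im by blast
    then show "f \<in> W" by (simp add: W_iff kv_simps ke H0_iff o)
  next
    fix f assume "f \<in> W"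
    then obtain a b c' where f: "f = (a, b, c')" "snd (kv b) = 0" by (cases f) (auto simp: W_iff)
    define v where "v = b - (b \<bullet> ?e) *\<^sub>R ?e"
    have ee: "?e \<bullet> ?e = 1" using kv_inner[of ?e ?e] by (simp add: ke)
    have "v \<bullet> ?e = 0" by (simp add: v_def inner_diff ee)
    moreover define \<beta> where "\<beta> = inv_into UNIV km (kv v)"
    have k: "km \<beta> = kv v" by (simp add: \<beta>_def)
    moreover have "snd (kv v) = 0" using f by (simp add: v_def kv_simps ke o)
    then have "km \<beta> \<in> H0" by (simp add: k H0_iff)
    moreover have "\<beta> \<bullet> \<phi>1m = 0"
      using \<open>v \<bullet> ?e = 0\<close> by (simp add: km_inner[symmetric] k km_unit kv_inner[symmetric] ke)
    moreover have "b = v + (b \<bullet> ?e) *\<^sub>R ?e" by (simp add: v_def)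
    ultimately show "f \<in> R51 cp \<phi>1m \<phi>2p \<iota> H"
      unfolding R51_def Let_def c im f(1)
      by (intro CollectI exI[of _ a] exI[of _ v] exI[of _ "b \<bullet> ?e"] exI[of _ c'] exI[of _ \<beta>] conjI) auto
  qed
qed

end

context half_spin
begin

text \<open>The preimages under \<open>\<iota>\<close> of two generators of the subalgebra generate a quaternion subalgebra of
  spinors.  In coordinates adapted to the latter, its image under \<open>\<iota>\<close> contains the two generators and
  their product.  So the image contains the given subalgebra, and both have dimension 4.\<close>

theorem adapted_coordinates:
  assumes n: "norm \<phi>1m = 1" "norm \<phi>2p = 1" and \<iota>: "octonion_identification cp cm \<phi>1m \<phi>2p \<iota>"
    and H: "quaternion_subalgebra H"
  shows "\<exists>km. octonion_coordinates cp cm km (\<lambda>p. km (- cm (sp \<phi>1m \<phi>2p) p)) (\<lambda>x. km (- cm (sp \<phi>1m \<phi>2p) (cp x \<phi>1m))) \<phi>1m \<phi>2p \<and>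
    (\<forall>m. \<iota> m \<in> H \<longleftrightarrow> km m \<in> H0)"
proof -
  interpret P: composition_algebra "prd \<phi>1m \<phi>2p" \<phi>1m by (rule prd_composition[OF n])
  have lin: "linear \<iota>" and b: "bij \<iota>" and u: "\<iota> \<phi>1m = oone"
    using \<iota> by (auto simp: octonion_identification_def)
  have inn: "\<iota> x \<bullet> \<iota> y = x \<bullet> y" for x y
    by (rule norm_preserving_inner[OF lin]) (use \<iota> in \<open>simp add: octonion_identification_def\<close>)
  obtain i' j' where fr': "O.quat_frame i' j'" and H': "H = range (O.quat_map i' j')"
    using H quaternion_subalgebra_iff by blast
  obtain i j where ij: "i' = \<iota> i" "j' = \<iota> j" using bij_is_surj[OF b] by (metis surjD)
  have nrm: "norm (\<iota> x) = norm x" for x using inn[of x x] by (simp add: norm_eq)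
  have fr: "P.quat_frame i j"
    using fr' inn[of i \<phi>1m] inn[of j \<phi>1m] unfolding O.quat_frame_def P.quat_frame_def by (simp add: ij nrm u inn)
  obtain km where km: "\<forall>m. km m \<in> H0 \<longleftrightarrow> m \<in> range (P.quat_map i j)"
    and oc: "octonion_coordinates cp cm km (\<lambda>p. km (- cm (base_e \<phi>1m \<phi>2p) p)) (\<lambda>x. km (- cm (base_e \<phi>1m \<phi>2p) (cp x \<phi>1m))) \<phi>1m \<phi>2p"
    using coordinates_exist[OF n fr] by blast
  interpret C: octonion_coordinates cp cm km "\<lambda>p. km (- cm (base_e \<phi>1m \<phi>2p) p)" "\<lambda>x. km (- cm (base_e \<phi>1m \<phi>2p) (cp x \<phi>1m))" \<phi>1m \<phi>2p
    by (rule oc)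
  define V where "V = \<iota> ` range (P.quat_map i j)"
  have Vsub: "subspace V" unfolding V_def
    by (intro linear_subspace_image lin P.quat_map_linear subspace_UNIV)
  have mem: "\<iota> m \<in> V \<longleftrightarrow> km m \<in> H0" for m
    unfolding V_def using km b by (auto simp: bij_def inj_eq)
  have "\<phi>1m \<in> range (P.quat_map i j)" "i \<in> range (P.quat_map i j)" "j \<in> range (P.quat_map i j)"
    using P.quat_map_simps[of i j] by (metis rangeI)+
  then have kH: "km \<phi>1m \<in> H0" "km i \<in> H0" "km j \<in> H0" using km by blast+
  then have in_V: "oone \<in> V" "i' \<in> V" "j' \<in> V" using mem by (auto simp: ij u[symmetric])
  moreover have "omul i' j' \<in> V"
  proof -
    obtain n where "\<iota> n = omul i' j'" "km n \<in> H0" using C.identification_closed[OF \<iota> kH(2,3)] by (auto simp: ij)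
    then show ?thesis using mem[of n] by simp
  qed
  ultimately have "H \<subseteq> V" unfolding H' by (intro O.range_quat_map_subset[OF Vsub])
  moreover have "dim V = 4"
    unfolding V_def using dim_image_eq[OF lin, of "range (P.quat_map i j)"] P.dim_range_quat_map[OF fr] b
    by (simp add: bij_def inj_on_def)
  moreover have "dim H = 4" unfolding H' by (rule O.dim_range_quat_map[OF fr'])
  moreover have "subspace H" unfolding H' by (intro linear_subspace_image O.quat_map_linear subspace_UNIV)
  ultimately have "H = V" using subspace_dim_equal[of H V] Vsub by simp
  then show ?thesis using mem oc unfolding base_e_def[OF n] by blast
qed

end

section \<open>Inverses and adjoints of bounded operators\<close>

definition invertible_op :: "('a::euclidean_space \<Rightarrow>\<^sub>L 'a) set" where
  "invertible_op = {A. \<exists>B. A o\<^sub>L B = id_blinfun \<and> B o\<^sub>L A = id_blinfun}"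

definition op_inv :: "('a::euclidean_space \<Rightarrow>\<^sub>L 'a) \<Rightarrow> 'a \<Rightarrow>\<^sub>L 'a" where
  "op_inv A = (SOME B. A o\<^sub>L B = id_blinfun \<and> B o\<^sub>L A = id_blinfun)"

lemma op_inv: assumes "A \<in> invertible_op" shows "A o\<^sub>L op_inv A = id_blinfun" "op_inv A o\<^sub>L A = id_blinfun"
  using someI_ex[of "\<lambda>B. A o\<^sub>L B = id_blinfun \<and> B o\<^sub>L A = id_blinfun"] assms
  unfolding invertible_op_def op_inv_def by blast+

lemma blinfun_comp_assoc: "(A o\<^sub>L B) o\<^sub>L C = A o\<^sub>L (B o\<^sub>L C)"
  by (rule blinfun_eqI) simp

lemma blinfun_comp_id [simp]: "A o\<^sub>L id_blinfun = A" "id_blinfun o\<^sub>L A = A"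
  by (rule blinfun_eqI, simp)+

lemma op_inv_cancel: assumes "A \<in> invertible_op"
  shows "A o\<^sub>L (op_inv A o\<^sub>L C) = C" "op_inv A o\<^sub>L (A o\<^sub>L C) = C"
  using op_inv[OF assms] by (simp_all flip: blinfun_comp_assoc)

lemma op_inv_unique: assumes "A o\<^sub>L B = id_blinfun" "B o\<^sub>L A = id_blinfun" shows "A \<in> invertible_op" "op_inv A = B"
proof -
  show a: "A \<in> invertible_op" unfolding invertible_op_def using assms by blast
  have "op_inv A = op_inv A o\<^sub>L (A o\<^sub>L B)" by (simp add: assms)
  then show "op_inv A = B" by (simp add: op_inv_cancel[OF a])
qed

lemma injective_invertible:
  assumes "\<And>x. blinfun_apply A x = 0 \<Longrightarrow> x = 0" shows "A \<in> invertible_op"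
proof -
  have "linear (blinfun_apply A)" by (simp add: blinfun.bounded_linear_right bounded_linear.linear)
  moreover have "inj (blinfun_apply A)" unfolding linear_injective_0[OF calculation] using assms by blast
  ultimately obtain f where f: "linear f" "\<And>x. f (A x) = x" "\<And>x. A (f x) = x"
    using linear_injective_isomorphism by metis
  have "bounded_linear f" using f(1) by (rule linear_imp_bounded)
  then have "A o\<^sub>L Blinfun f = id_blinfun" "Blinfun f o\<^sub>L A = id_blinfun"
    by (auto intro!: blinfun_eqI simp: bounded_linear_Blinfun_apply f)
  then show ?thesis by (rule op_inv_unique(1))
qed

lemma invertible_comp:
  assumes "A \<in> invertible_op" "B \<in> invertible_op" shows "A o\<^sub>L B \<in> invertible_op"
  by (rule op_inv_unique(1)[of _ "op_inv B o\<^sub>L op_inv A"]) (simp_all add: blinfun_comp_assoc op_inv_cancel assms op_inv)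

lemma open_invertible_op: "open (invertible_op :: ('a::euclidean_space \<Rightarrow>\<^sub>L 'a) set)"
  unfolding open_dist
proof
  fix A :: "'a \<Rightarrow>\<^sub>L 'a" assume A: "A \<in> invertible_op"
  let ?B = "op_inv A"
  have "A' \<in> invertible_op" if d: "dist A' A < 1 / (norm ?B + 1)" for A'
  proof (rule injective_invertible)
    fix x assume x: "blinfun_apply A' x = 0"
    have "x = ?B (A x)" using op_inv(2)[OF A] by (metis blinfun_apply_blinfun_compose id_blinfun.rep_eq)
    also have "A x = (A - A') x" by (simp add: blinfun.diff_left x)
    finally have "norm x \<le> norm ?B * (norm (A - A') * norm x)"
      using norm_blinfun[of ?B "(A - A') x"] norm_blinfun[of "A - A'" x]
      by (metis mult_left_mono norm_ge_zero order_trans)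
    moreover have "norm ?B * norm (A - A') < 1"
    proof -
      have "norm ?B * norm (A - A') \<le> (norm ?B + 1) * norm (A - A')" by (intro mult_right_mono) auto
      also have "\<dots> < 1" using d by (simp add: dist_norm norm_minus_commute pos_less_divide_eq add_nonneg_pos mult.commute)
      finally show ?thesis .
    qed
    ultimately show "x = 0"
    proof -
      assume le: "norm x \<le> norm ?B * (norm (A - A') * norm x)" and lt: "norm ?B * norm (A - A') < 1"
      show "x = 0"
      proof (rule ccontr)
        assume "x \<noteq> 0"
        then have "(norm ?B * norm (A - A')) * norm x < 1 * norm x" using lt by (intro mult_strict_right_mono) auto
        with le show False by (simp add: mult.assoc)
      qed
    qed
  qed
  moreover have "0 < 1 / (norm ?B + 1)" by (simp add: add_nonneg_pos)
  ultimately show "\<exists>e>0. \<forall>y. dist y A < e \<longrightarrow> y \<in> invertible_op" by blast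
qed

lemma norm_comp3: "norm (B o\<^sub>L (X o\<^sub>L C)) \<le> norm B * (norm X * norm C)"
  by (rule order_trans[OF norm_blinfun_compose mult_left_mono[OF norm_blinfun_compose norm_ge_zero]])

lemma op_inv_derivative:
  fixes A :: "'a::euclidean_space \<Rightarrow>\<^sub>L 'a"
  assumes A: "A \<in> invertible_op"
  shows "(op_inv has_derivative (\<lambda>V. - (op_inv A o\<^sub>L (V o\<^sub>L op_inv A)))) (at A)"
proof -
  let ?B = "op_inv A"
  obtain e where e: "0 < e" "\<And>y. dist y A < e \<Longrightarrow> y \<in> invertible_op"
    using open_invertible_op A unfolding open_dist by blast
  define \<delta> where "\<delta> = min e (1 / (2 * (norm ?B + 1)))"
  have \<delta>: "0 < \<delta>" using e by (simp add: \<delta>_def add_nonneg_pos)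
  note dl = bounded_bilinear.diff_left[OF bounded_bilinear_blinfun_compose]
    and dr = bounded_bilinear.diff_right[OF bounded_bilinear_blinfun_compose]
  show ?thesis
  proof (rule has_derivativeI_sandwich[OF \<delta>, where H = "\<lambda>y. 2 * norm ?B ^ 3 * norm (y - A)"])
    show "bounded_linear (\<lambda>V. - (?B o\<^sub>L (V o\<^sub>L ?B)))"
      by (intro bounded_linear_minus bounded_linear_compose[OF
            bounded_bilinear.bounded_linear_right[OF bounded_bilinear_blinfun_compose]]
          bounded_bilinear.bounded_linear_left[OF bounded_bilinear_blinfun_compose])
    have "((\<lambda>y. 2 * norm ?B ^ 3 * norm (y - A)) \<longlongrightarrow> 2 * norm ?B ^ 3 * norm (A - A)) (at A)"
      by (intro tendsto_intros)
    then show "((\<lambda>y. 2 * norm ?B ^ 3 * norm (y - A)) \<longlongrightarrow> 0) (at A)" by simp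
    fix y assume y: "y \<noteq> A" "dist y A < \<delta>"
    have yi: "y \<in> invertible_op" using e y by (simp add: \<delta>_def)
    let ?C = "op_inv y"
    have CB: "?C - ?B = ?B o\<^sub>L ((A - y) o\<^sub>L ?C)"
      by (simp add: dl dr op_inv_cancel[OF A] op_inv[OF yi])
    have "norm (y - A) \<le> 1 / (2 * (norm ?B + 1))" using y by (simp add: \<delta>_def dist_norm)
    then have "norm ?B * norm (y - A) \<le> norm ?B * (1 / (2 * (norm ?B + 1)))" by (intro mult_left_mono) auto
    also have "\<dots> \<le> 1 / 2"
    proof -
      have "0 < 2 * (norm ?B + 1)" by (simp add: add_nonneg_pos)
      then show ?thesis unfolding times_divide_eq_right by (subst pos_divide_le_eq) auto
    qed
    finally have half: "norm ?B * norm (y - A) \<le> 1 / 2" .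
    have diff: "norm (?C - ?B) \<le> norm ?B * norm (y - A) * norm ?C"
      unfolding CB using norm_comp3[of ?B "A - y" ?C] by (simp add: norm_minus_commute mult.assoc)
    also have "\<dots> \<le> 1 / 2 * norm ?C" by (intro mult_right_mono half) auto
    finally have "norm ?C \<le> 2 * norm ?B" using norm_triangle_ineq2[of ?C ?B] by linarith
    then have d2: "norm (?C - ?B) \<le> norm ?B * norm (y - A) * (2 * norm ?B)"
      by (intro order_trans[OF diff] mult_left_mono) auto
    have "?C - ?B - - (?B o\<^sub>L ((y - A) o\<^sub>L ?B)) = ?B o\<^sub>L ((A - y) o\<^sub>L (?C - ?B))"
      by (simp add: dl dr op_inv_cancel[OF A] op_inv[OF A] op_inv[OF yi])
    then have "norm (?C - ?B - - (?B o\<^sub>L ((y - A) o\<^sub>L ?B))) \<le> norm ?B * (norm (y - A) * norm (?C - ?B))"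
      using norm_comp3[of ?B "A - y" "?C - ?B"] by (simp add: norm_minus_commute)
    also have "\<dots> \<le> norm ?B * (norm (y - A) * (norm ?B * norm (y - A) * (2 * norm ?B)))"
      by (intro mult_left_mono d2) auto
    also have "\<dots> = (2 * norm ?B ^ 3 * norm (y - A)) * norm (y - A)"
      by (simp add: power3_eq_cube)
    finally show "norm (?C - ?B - - (?B o\<^sub>L ((y - A) o\<^sub>L ?B))) / norm (y - A) \<le> 2 * norm ?B ^ 3 * norm (y - A)"
      using y by (simp add: pos_divide_le_eq)
  qed
qed

lemma smooth_on_op_inv:
  assumes "open U" "smooth_on U F" "\<And>x. x \<in> U \<Longrightarrow> F x \<in> invertible_op"
  shows "smooth_on U (\<lambda>x. op_inv (F x))"
proof (rule smooth_onI)
  fix k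
  have "Ck_on k U F" by (rule smooth_onD[OF assms(2)])
  then show "Ck_on k U (\<lambda>x. op_inv (F x))"
  proof (induction k)
    case 0
    have "continuous_on invertible_op (op_inv :: ('b \<Rightarrow>\<^sub>L 'b) \<Rightarrow> _)"
      using op_inv_derivative has_derivative_continuous by (metis continuous_at_imp_continuous_on)
    then have "continuous_on U (\<lambda>x. op_inv (F x))"
      using 0 assms(3) by (intro continuous_on_compose2[of invertible_op op_inv U F]) auto
    then show ?case by simp
  next
    case (Suc k)
    have d: "((\<lambda>x. op_inv (F x)) has_derivative
        (\<lambda>v. - (op_inv (F x) o\<^sub>L (frechet_derivative F (at x) v o\<^sub>L op_inv (F x))))) (at x)" if "x \<in> U" for x
      by (rule has_derivative_compose[OF Ck_on_SucD(1)[OF Suc.prems that] op_inv_derivative[OF assms(3)[OF that]]])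
    note IH = Suc.IH[OF Ck_on_Suc_imp[OF Suc.prems]]
    have "Ck_on k U (\<lambda>x. - (op_inv (F x) o\<^sub>L (frechet_derivative F (at x) v o\<^sub>L op_inv (F x))))" for v
      by (intro Ck_on_linear[OF assms(1) bounded_linear_minus[OF bounded_linear_ident]]
          Ck_on_bilinear[OF assms(1) bounded_bilinear_blinfun_compose] IH Ck_on_SucD(2)[OF Suc.prems])
    with d show ?case by (intro Ck_on_SucI[OF assms(1)])
  qed
qed

definition op_adj :: "('a::euclidean_space \<Rightarrow>\<^sub>L 'b::euclidean_space) \<Rightarrow> 'b \<Rightarrow>\<^sub>L 'a" where
  "op_adj T = Blinfun (adjoint (blinfun_apply T))"

lemma op_adj: "x \<bullet> op_adj T y = T x \<bullet> y"
proof -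
  have l: "linear (blinfun_apply T)" by (simp add: blinfun.bounded_linear_right bounded_linear.linear)
  then have "blinfun_apply (op_adj T) = adjoint (blinfun_apply T)"
    unfolding op_adj_def by (intro bounded_linear_Blinfun_apply linear_imp_bounded adjoint_linear)
  then show ?thesis using adjoint_works[OF l] by simp
qed

lemma op_adj_bounded_linear: "bounded_linear (op_adj :: ('a::euclidean_space \<Rightarrow>\<^sub>L 'b::euclidean_space) \<Rightarrow> _)"
proof (rule bounded_linear_intro[where K = 1])
  fix S T :: "'a \<Rightarrow>\<^sub>L 'b" and c :: real
  show "op_adj (S + T) = op_adj S + op_adj T"
    by (rule blinfun_eqI, rule vector_eq_ldot[THEN iffD1]) (simp add: op_adj blinfun.add_left inner_add)
  show "op_adj (c *\<^sub>R T) = c *\<^sub>R op_adj T"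
    by (rule blinfun_eqI, rule vector_eq_ldot[THEN iffD1]) (simp add: op_adj blinfun.scaleR_left)
  show "norm (op_adj T) \<le> norm T * 1"
  proof (rule norm_blinfun_bound)
    fix y
    have "norm (op_adj T y) * norm (op_adj T y) = T (op_adj T y) \<bullet> y"
      by (simp add: op_adj[symmetric] dot_square_norm power2_eq_square)
    also have "\<dots> \<le> norm (T (op_adj T y)) * norm y" by (rule norm_cauchy_schwarz)
    also have "\<dots> \<le> (norm T * norm (op_adj T y)) * norm y" by (intro mult_right_mono norm_blinfun) auto
    finally have le: "norm (op_adj T y) * norm (op_adj T y) \<le> (norm T * norm y) * norm (op_adj T y)" by (simp add: ac_simps)
    show "norm (op_adj T y) \<le> norm T * 1 * norm y"
    proof (cases "norm (op_adj T y) = 0")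
      case False
      then have "0 < norm (op_adj T y)" by simp
      from mult_right_le_imp_le[OF le this] show ?thesis by simp
    qed simp
  qed simp
qed

lemma one_plus_invertible: "id_blinfun + (op_adj T o\<^sub>L T) \<in> invertible_op"
proof (rule injective_invertible)
  fix x assume "blinfun_apply (id_blinfun + (op_adj T o\<^sub>L T)) x = 0"
  then have "x \<bullet> (x + op_adj T (T x)) = 0" by (simp add: blinfun.add_left)
  then have "x \<bullet> x + T x \<bullet> T x = 0" by (simp add: inner_add op_adj)
  then show "x = 0" by (metis add_nonneg_eq_0_iff inner_eq_zero_iff inner_ge_zero)
qed

section \<open>The manifold of quaternion subalgebras\<close>

definition in1 :: "quat \<Rightarrow>\<^sub>L octonion" where "in1 = Blinfun (\<lambda>p. (p, 0))"
definition in2 :: "quat \<Rightarrow>\<^sub>L octonion" where "in2 = Blinfun (\<lambda>p. (0, p))"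
definition pr1 :: "octonion \<Rightarrow>\<^sub>L quat" where "pr1 = Blinfun fst"
definition pr2 :: "octonion \<Rightarrow>\<^sub>L quat" where "pr2 = Blinfun snd"

lemma in_pr_apply [simp]: "in1 p = (p, 0)" "in2 p = (0, p)" "pr1 x = fst x" "pr2 x = snd x"
  unfolding in1_def in2_def pr1_def pr2_def
  by (subst bounded_linear_Blinfun_apply; (rule linear_imp_bounded, rule linearI)?; simp)+

definition block where "block a P b = a o\<^sub>L (P o\<^sub>L b)"
abbreviation "P11 P \<equiv> block pr1 P in1"
abbreviation "P12 P \<equiv> block pr1 P in2"
abbreviation "P21 P \<equiv> block pr2 P in1"
abbreviation "P22 P \<equiv> block pr2 P in2"

lemma block_bounded_linear: "bounded_linear (\<lambda>P. block a P b)"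
  unfolding block_def
  by (intro bounded_linear_compose[OF bounded_bilinear.bounded_linear_right[OF bounded_bilinear_blinfun_compose]]
     bounded_bilinear.bounded_linear_left[OF bounded_bilinear_blinfun_compose])

lemma block_apply: "block a P b x = a (P (b x))"
  by (simp add: block_def)

definition assemble :: "(quat \<Rightarrow>\<^sub>L quat) \<Rightarrow> (quat \<Rightarrow>\<^sub>L quat) \<Rightarrow> (quat \<Rightarrow>\<^sub>L quat) \<Rightarrow> (quat \<Rightarrow>\<^sub>L quat) \<Rightarrow> octonion \<Rightarrow>\<^sub>L octonion" where
  "assemble A B C D = block in1 A pr1 + block in1 B pr2 + block in2 C pr1 + block in2 D pr2"

lemma assemble_apply: "assemble A B C D x = (A (fst x) + B (snd x), C (fst x) + D (snd x))"
  by (simp add: assemble_def block_apply blinfun.add_left)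

lemma blocks_assemble [simp]:
  "P11 (assemble A B C D) = A" "P12 (assemble A B C D) = B" "P21 (assemble A B C D) = C" "P22 (assemble A B C D) = D"
  by (rule blinfun_eqI, simp add: block_apply assemble_apply)+

lemma assemble_blocks: "assemble (P11 P) (P12 P) (P21 P) (P22 P) = P"
proof (rule blinfun_eqI)
  fix x
  have "P x = P (fst x, 0) + P (0, snd x)" by (simp flip: blinfun.add_right)
  then show "assemble (P11 P) (P12 P) (P21 P) (P22 P) x = P x"
    by (simp add: assemble_apply block_apply prod_eq_iff)
qed

lemma apply_blocks:
  fixes P :: "octonion \<Rightarrow>\<^sub>L octonion"
  shows "P (u, w) = (P11 P u + P12 P w, P21 P u + P22 P w)"
  using assemble_apply[of "P11 P" "P12 P" "P21 P" "P22 P" "(u, w)"] by (simp add: assemble_blocks)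

lemma smooth_on_assemble:
  assumes "open U" "smooth_on U A" "smooth_on U B" "smooth_on U C" "smooth_on U D"
  shows "smooth_on U (\<lambda>x. assemble (A x) (B x) (C x) (D x))"
  unfolding assemble_def
  by (intro smooth_on_add assms smooth_on_linear[OF _ block_bounded_linear])

definition qi :: quat where "qi = (\<i>, 0)"
definition qj :: quat where "qj = (0, 1)"
definition qk :: quat where "qk = (0, \<i>)"

lemma qijk: "qi \<bullet> qi = 1" "qj \<bullet> qj = 1" "qk \<bullet> qk = 1" "qi \<bullet> qk = 0" "qj \<bullet> qk = 0" "qone \<bullet> qk = 0"
    "qi \<bullet> qj = 0" "qj \<bullet> qi = 0" "qone \<bullet> qi = 0" "qone \<bullet> qj = 0" "qk \<bullet> qi = 0" "qk \<bullet> qj = 0" "qi \<bullet> qone = 0" "qj \<bullet> qone = 0"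
    "norm qk = 1"
    "qmul qi qj = qk" "qcnj qi = - qi" "qcnj qj = - qj"
  by (simp_all add: qi_def qj_def qk_def qone_def inner_prod_def inner_complex_def norm_Pair qmul.simps qcnj.simps)

lemmas quat_expand' = quat_expand[folded qi_def qj_def qk_def]
lemmas quat_linear_eq' = quat_linear_eq[folded qi_def qj_def qk_def]

text \<open>A graph over the standard quaternions that contains \<open>(i, s)\<close> and \<open>(j, t)\<close> and is a subalgebra also
  contains their product; its value at \<open>k\<close> is therefore the following function of \<open>s\<close> and \<open>t\<close>.\<close>

definition gam :: "quat \<Rightarrow> quat \<Rightarrow> real" where "gam s t = qmul (qcnj t) s \<bullet> qk"

definition slope_k :: "quat \<Rightarrow> quat \<Rightarrow> quat" where
  "slope_k s t = (1 / (1 - gam s t)) *\<^sub>R (qmul t qi - qmul s qj + (qmul (qcnj t) s \<bullet> qi) *\<^sub>R s + (qmul (qcnj t) s \<bullet> qj) *\<^sub>R t)"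

text \<open>The linear map that sends \<open>k\<close> to \<open>y\<close> and vanishes on its orthogonal complement.\<close>

definition rank_k :: "quat \<Rightarrow> quat \<Rightarrow>\<^sub>L quat" where "rank_k y = Blinfun (\<lambda>x. (x \<bullet> qk) *\<^sub>R y)"

lemma rank_k_apply: "rank_k y x = (x \<bullet> qk) *\<^sub>R y"
proof -
  have "bounded_linear (\<lambda>x. (x \<bullet> qk) *\<^sub>R y)"
    by (intro linear_imp_bounded linearI; simp add: inner_add_left scaleR_add_left)
  then show ?thesis unfolding rank_k_def by (simp only: bounded_linear_Blinfun_apply)
qed

lemma rank_k_bounded_linear: "bounded_linear rank_k"
proof (rule bounded_linear_intro[where K = 1])
  show "rank_k (x + y) = rank_k x + rank_k y" for x y
    by (rule blinfun_eqI) (simp add: rank_k_apply blinfun.add_left scaleR_add_right)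
  show "rank_k (c *\<^sub>R x) = c *\<^sub>R rank_k x" for c x
    by (rule blinfun_eqI) (simp add: rank_k_apply blinfun.scaleR_left)
  show "norm (rank_k y) \<le> norm y * 1" for y
  proof (rule norm_blinfun_bound)
    show "norm (rank_k y x) \<le> norm y * 1 * norm x" for x
      using mult_left_mono[of "\<bar>x \<bullet> qk\<bar>" "norm x" "norm y"] Cauchy_Schwarz_ineq2[of x qk]
      by (simp add: rank_k_apply qijk mult.commute)
  qed simp
qed

lemma bounded_bilinear_qmul: "bounded_bilinear qmul"
  using qmul_bilinear by (simp add: bilinear_conv_bounded_bilinear)

lemma smooth_on_gam:
  assumes "open U" "smooth_on U s" "smooth_on U t"
  shows "smooth_on U (\<lambda>x. gam (s x) (t x))"
  unfolding gam_def
  by (intro smooth_on_bilinear[OF _ bounded_bilinear_inner] smooth_on_bilinear[OF _ bounded_bilinear_qmul]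
      smooth_on_linear[OF _ linear_imp_bounded[OF qcnj_linear]] smooth_on_const assms)

lemma smooth_on_slope_k:
  assumes "open U" "smooth_on U s" "smooth_on U t" "\<And>x. x \<in> U \<Longrightarrow> gam (s x) (t x) < 1"
  shows "smooth_on U (\<lambda>x. slope_k (s x) (t x))"
  unfolding slope_k_def
  by (intro smooth_on_scaleR smooth_on_divide smooth_on_add smooth_on_diff smooth_on_gam
      smooth_on_bilinear[OF _ bounded_bilinear_inner] smooth_on_bilinear[OF _ bounded_bilinear_qmul]
      smooth_on_linear[OF _ linear_imp_bounded[OF qcnj_linear]] smooth_on_const assms)
    (use assms(4) in force)

definition slope :: "(octonion \<Rightarrow>\<^sub>L octonion) \<Rightarrow> quat \<Rightarrow>\<^sub>L quat" where "slope P = P21 P o\<^sub>L op_inv (P11 P)"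

definition gr_dom where "gr_dom = {P. P11 P \<in> invertible_op \<and> gam (slope P qi) (slope P qj) < 1}"
definition gr_img where "gr_img = {Q. P11 Q + id_blinfun \<in> invertible_op \<and> gam (P21 Q qi) (P21 Q qj) < 1}"

text \<open>The chart replaces the blocks of an operator by their deviations from those of the projection onto the
  graph of its slope, and the slope by its deviation at \<open>k\<close> from the slope of a subalgebra.
  It is therefore linear on the projections onto quaternion subalgebras: their images are the
  operators in \<open>gr_lin\<close> below.\<close>

definition chart where "chart P = (let A = P11 P; T = slope P in
   assemble (((id_blinfun + (op_adj T o\<^sub>L T)) o\<^sub>L A) - id_blinfun) (P12 P - (A o\<^sub>L op_adj T))
     (T - rank_k (slope_k (T qi) (T qj))) (P22 P - (P21 P o\<^sub>L op_adj T)))"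

definition unslope where "unslope Q = P21 Q + rank_k (slope_k (P21 Q qi) (P21 Q qj))"

definition unchart where "unchart Q = (let T = unslope Q; A = op_inv (id_blinfun + (op_adj T o\<^sub>L T)) o\<^sub>L (P11 Q + id_blinfun) in
   assemble A (P12 Q + (A o\<^sub>L op_adj T)) (T o\<^sub>L A) (P22 Q + ((T o\<^sub>L A) o\<^sub>L op_adj T)))"

lemma smooth_on_block: "open U \<Longrightarrow> smooth_on U (\<lambda>P. block a P b)"
  by (intro smooth_on_bounded_linear block_bounded_linear)

lemma smooth_on_comp: "open U \<Longrightarrow> smooth_on U F \<Longrightarrow> smooth_on U G \<Longrightarrow> smooth_on U (\<lambda>x. F x o\<^sub>L G x)"
  by (rule smooth_on_bilinear[OF _ bounded_bilinear_blinfun_compose])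

lemma smooth_on_eval: "open U \<Longrightarrow> smooth_on U F \<Longrightarrow> smooth_on U (\<lambda>x. blinfun_apply (F x) v)"
  by (rule smooth_on_linear[OF _ blinfun.bounded_linear_left])

lemma open_gr: "open gr_dom" "open gr_img"
proof -
  have c: "continuous_on S (\<lambda>P. block a P b)" for S and a :: "octonion \<Rightarrow>\<^sub>L quat" and b :: "quat \<Rightarrow>\<^sub>L octonion"
    by (rule linear_continuous_on[OF block_bounded_linear])
  let ?D = "(\<lambda>P. P11 P) -` invertible_op"
  have D: "open ?D" by (rule open_vimage[OF open_invertible_op c])
  have "smooth_on ?D slope"
    unfolding slope_def by (intro smooth_on_comp smooth_on_block smooth_on_op_inv D) auto
  then have "continuous_on ?D (\<lambda>P. gam (slope P qi) (slope P qj))"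
    by (intro smooth_on_imp_continuous_on smooth_on_gam smooth_on_eval D)
  from continuous_open_preimage[OF this D, of "{..<1}"] show "open gr_dom"
    by (simp add: gr_dom_def vimage_def Int_def)
  have "open ((\<lambda>Q. P11 Q + id_blinfun) -` invertible_op)"
    by (rule open_vimage[OF open_invertible_op]) (intro continuous_on_add c continuous_on_const)
  moreover have "open ((\<lambda>Q. gam (P21 Q qi) (P21 Q qj)) -` {..<1})"
    by (rule open_vimage) (intro open_lessThan smooth_on_imp_continuous_on smooth_on_gam smooth_on_eval smooth_on_block open_UNIV)+
  ultimately have "open ((\<lambda>Q. P11 Q + id_blinfun) -` invertible_op \<inter> (\<lambda>Q. gam (P21 Q qi) (P21 Q qj)) -` {..<1})"
    by (rule open_Int)
  then show "open gr_img" by (simp add: gr_img_def vimage_def Int_def)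
qed

lemma smooth_chart: "smooth_on gr_dom chart"
proof -
  have s: "smooth_on gr_dom slope"
    unfolding slope_def by (intro smooth_on_comp smooth_on_block smooth_on_op_inv open_gr) (auto simp: gr_dom_def)
  show ?thesis
    unfolding chart_def Let_def
    by (intro smooth_on_assemble smooth_on_diff smooth_on_comp smooth_on_add smooth_on_const smooth_on_block
        smooth_on_linear[OF _ op_adj_bounded_linear] smooth_on_linear[OF _ rank_k_bounded_linear]
        smooth_on_slope_k smooth_on_eval s open_gr) (auto simp: gr_dom_def)
qed

lemma smooth_unchart: "smooth_on gr_img unchart"
proof -
  have s: "smooth_on gr_img unslope"
    unfolding unslope_def
    by (intro smooth_on_add smooth_on_block smooth_on_linear[OF _ rank_k_bounded_linear] smooth_on_slope_k smooth_on_eval open_gr)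
      (auto simp: gr_img_def)
  show ?thesis
    unfolding unchart_def Let_def
    by (intro smooth_on_assemble smooth_on_add smooth_on_comp smooth_on_op_inv smooth_on_const smooth_on_block
        smooth_on_linear[OF _ op_adj_bounded_linear] s open_gr one_plus_invertible)
qed

lemma slope_comp: "P11 P \<in> invertible_op \<Longrightarrow> slope P o\<^sub>L P11 P = P21 P"
  by (simp add: slope_def blinfun_comp_assoc op_inv)

lemma rank_k_values: "rank_k y qi = 0" "rank_k y qj = 0" "rank_k y qone = 0" "rank_k y qk = y"
  by (simp_all add: rank_k_apply qijk)

lemma unchart_chart: assumes "P \<in> gr_dom" shows "chart P \<in> gr_img" "unchart (chart P) = P"
proof -
  have i: "P11 P \<in> invertible_op" and g: "gam (slope P qi) (slope P qj) < 1" using assms by (auto simp: gr_dom_def)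
  let ?T = "slope P"
  have b: "P11 (chart P) + id_blinfun = (id_blinfun + (op_adj ?T o\<^sub>L ?T)) o\<^sub>L P11 P"
    "P12 (chart P) = P12 P - (P11 P o\<^sub>L op_adj ?T)" "P21 (chart P) = ?T - rank_k (slope_k (?T qi) (?T qj))"
    "P22 (chart P) = P22 P - (P21 P o\<^sub>L op_adj ?T)"
    by (simp_all add: chart_def Let_def)
  have e: "P21 (chart P) qi = ?T qi" "P21 (chart P) qj = ?T qj" by (simp_all add: b blinfun.diff_left rank_k_values)
  show "chart P \<in> gr_img"
    unfolding gr_img_def mem_Collect_eq b(1) e using invertible_comp[OF one_plus_invertible i] g by blast
  have T: "unslope (chart P) = ?T" unfolding unslope_def e by (simp add: b)
  have "unchart (chart P) = assemble (P11 P) (P12 P) (P21 P) (P22 P)"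
    unfolding unchart_def Let_def T b by (simp add: op_inv_cancel[OF one_plus_invertible] slope_comp[OF i])
  then show "unchart (chart P) = P" by (simp add: assemble_blocks)
qed

lemma op_inv_invertible: "A \<in> invertible_op \<Longrightarrow> op_inv A \<in> invertible_op"
  using op_inv_unique(1)[of "op_inv A" A] op_inv by blast

lemma chart_unchart: assumes "Q \<in> gr_img" shows "unchart Q \<in> gr_dom" "chart (unchart Q) = Q"
proof -
  have i: "P11 Q + id_blinfun \<in> invertible_op" and g: "gam (P21 Q qi) (P21 Q qj) < 1" using assms by (auto simp: gr_img_def)
  let ?T = "unslope Q"
  let ?A = "op_inv (id_blinfun + (op_adj ?T o\<^sub>L ?T)) o\<^sub>L (P11 Q + id_blinfun)"
  have A: "?A \<in> invertible_op" by (intro invertible_comp op_inv_invertible one_plus_invertible i)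
  have b: "P11 (unchart Q) = ?A" "P12 (unchart Q) = P12 Q + (?A o\<^sub>L op_adj ?T)" "P21 (unchart Q) = ?T o\<^sub>L ?A"
    "P22 (unchart Q) = P22 Q + ((?T o\<^sub>L ?A) o\<^sub>L op_adj ?T)"
    by (simp_all add: unchart_def Let_def)
  have T: "slope (unchart Q) = ?T" unfolding slope_def b blinfun_comp_assoc[of ?T ?A] op_inv(1)[OF A] by simp
  have e: "?T qi = P21 Q qi" "?T qj = P21 Q qj" by (simp_all add: unslope_def blinfun.add_left rank_k_values)
  show "unchart Q \<in> gr_dom" unfolding gr_dom_def mem_Collect_eq T e b(1) using A g by blast
  have "chart (unchart Q) = assemble (P11 Q) (P12 Q) (P21 Q) (P22 Q)"
    unfolding chart_def Let_def T b e op_inv_cancel(1)[OF one_plus_invertible] by (simp add: unslope_def)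
  then show "chart (unchart Q) = Q" by (simp add: assemble_blocks)
qed

definition gr_lin where "gr_lin = {Q. P11 Q = 0 \<and> P12 Q = 0 \<and> P22 Q = 0 \<and> P21 Q qone = 0 \<and> P21 Q qk = 0}"

lemma gr_lin: "subspace gr_lin" "dim gr_lin = 8"
proof -
  note bl = linear_add[OF bounded_linear.linear[OF block_bounded_linear]] linear_cmul[OF bounded_linear.linear[OF block_bounded_linear]]
    linear_0[OF bounded_linear.linear[OF block_bounded_linear]]
  show "subspace gr_lin"
    unfolding subspace_def gr_lin_def by (auto simp: bl blinfun.add_left blinfun.scaleR_left)
  define r where "r st = Blinfun (\<lambda>x. (x \<bullet> qi) *\<^sub>R fst st + (x \<bullet> qj) *\<^sub>R snd st)" for st :: "quat \<times> quat"
  have ra: "r st x = (x \<bullet> qi) *\<^sub>R fst st + (x \<bullet> qj) *\<^sub>R snd st" for st x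
  proof -
    have "bounded_linear (\<lambda>x. (x \<bullet> qi) *\<^sub>R y + (x \<bullet> qj) *\<^sub>R z)" for y z :: quat
      by (intro linear_imp_bounded linearI) (simp_all add: inner_add_left scaleR_add_left scaleR_add_right)
    then show ?thesis unfolding r_def by (simp only: bounded_linear_Blinfun_apply)
  qed
  define f where "f st = assemble 0 0 (r st) 0" for st
  have fl: "linear f"
    by (rule linearI; rule blinfun_eqI)
      (simp_all add: f_def assemble_apply ra blinfun.add_left blinfun.scaleR_left algebra_simps)
  have fi: "inj f"
  proof (rule injI)
    fix x y assume "f x = f y"
    then have "P21 (f x) = P21 (f y)" by (rule arg_cong)
    then have "r x = r y" unfolding f_def blocks_assemble .
    then have "r x qi = r y qi" "r x qj = r y qj" by simp_all
    then show "x = y" by (simp add: ra qijk prod_eq_iff[of x y])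
  qed
  have rng: "range f = gr_lin"
  proof (intro equalityI subsetI)
    fix Q assume "Q \<in> range f"
    then obtain st where Q: "Q = f st" by blast
    have "r st qone = 0" "r st qk = 0" by (simp_all only: ra qijk scaleR_zero_left add_0_left)
    then show "Q \<in> gr_lin" unfolding Q f_def gr_lin_def mem_Collect_eq blocks_assemble by (intro conjI refl)
  next
    fix Q assume Q: "Q \<in> gr_lin"
    have "P21 Q x = r (P21 Q qi, P21 Q qj) x" for x
      by (rule quat_linear_eq'[of "blinfun_apply (P21 Q)" "blinfun_apply (r (P21 Q qi, P21 Q qj))"])
        (use Q in \<open>simp_all add: gr_lin_def ra qijk blinfun.bounded_linear_right bounded_linear.linear\<close>)
    then have "P21 Q = r (P21 Q qi, P21 Q qj)" by (rule blinfun_eqI)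
    then have "Q = f (P21 Q qi, P21 Q qj)"
      using assemble_blocks[of Q] Q by (simp add: f_def gr_lin_def)
    then show "Q \<in> range f" by blast
  qed
  have "independent (f ` Basis)"
    by (rule linear_independent_injective_image[OF fl independent_Basis]) (use fi inj_on_subset in blast)
  moreover have "span (f ` Basis) = span gr_lin"
    using linear_span_image[OF fl, of Basis] rng \<open>subspace gr_lin\<close> by (simp add: span_eq_iff[THEN iffD2])
  ultimately have "dim gr_lin = card (f ` Basis)" by (intro dim_eq_card) auto
  also have "\<dots> = card (Basis :: (quat \<times> quat) set)" by (rule card_image) (use fi inj_on_subset in blast)
  finally show "dim gr_lin = 8" by simp
qed

lemma quaternion_subalgebra_facts:
  assumes "quaternion_subalgebra H"
  shows "subspace H" "dim H = 4" "oone \<in> H" "\<And>x y. x \<in> H \<Longrightarrow> y \<in> H \<Longrightarrow> omul x y \<in> H"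
proof -
  obtain i j where fr: "O.quat_frame i j" and H: "H = range (O.quat_map i j)" using assms quaternion_subalgebra_iff by blast
  show "subspace H" unfolding H by (intro linear_subspace_image O.quat_map_linear subspace_UNIV)
  show "dim H = 4" unfolding H by (rule O.dim_range_quat_map[OF fr])
  show "oone \<in> H" unfolding H using O.quat_map_simps(1)[of i j] by (metis rangeI)
  show "omul x y \<in> H" if "x \<in> H" "y \<in> H" for x y
    using that unfolding H by (auto simp flip: O.quat_map_mult[OF fr])
qed

text \<open>Orthonormalising the two imaginary elements does not leave \<open>H\<close>, so \<open>H\<close> contains a quaternionic frame
  together with its product, and the span of these with the unit is all of \<open>H\<close> for dimension reasons.\<close>

lemma quaternion_subalgebra_generated:
  assumes H: "subspace H" "dim H = 4" and u: "oone \<in> H" and x: "x \<in> H" "x \<bullet> oone = 0" "x \<noteq> 0"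
    and y: "y \<in> H" "y \<bullet> oone = 0" "\<And>c. y \<noteq> c *\<^sub>R x" and xy: "omul x y \<in> H"
  shows "quaternion_subalgebra H"
proof -
  define i where "i = x /\<^sub>R norm x"
  define z where "z = y - (y \<bullet> i) *\<^sub>R i"
  have "z \<noteq> 0" using y(3)[of "(y \<bullet> i) / norm x"] by (auto simp: z_def i_def divide_inverse)
  define j where "j = z /\<^sub>R norm z"
  have ii: "norm i = 1" "i \<bullet> i = 1" "i \<bullet> oone = 0" "i \<in> H"
    using x H(1) by (simp_all add: i_def subspace_scale dot_square_norm power2_eq_square)
  have zz: "z \<bullet> oone = 0" "i \<bullet> z = 0" "z \<in> H"
    using y ii H(1) by (auto simp: z_def inner_diff inner_commute intro!: subspace_diff subspace_scale)
  have fr: "O.quat_frame i j"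
    using ii zz \<open>z \<noteq> 0\<close> by (simp add: O.quat_frame_def j_def)
  have "omul i z = (1 / norm x) *\<^sub>R omul x y + (y \<bullet> i) *\<^sub>R oone"
    using O.imaginary_square[OF ii(3)] ii(2) by (simp add: z_def O.mult_diff_right) (simp add: i_def divide_inverse)
  then have "omul i z \<in> H" using H(1) u xy by (simp add: subspace_add subspace_scale)
  then have "omul i j \<in> H" using H(1) by (simp add: j_def subspace_scale)
  then have "range (O.quat_map i j) \<subseteq> H"
    using ii zz H(1) u by (intro O.range_quat_map_subset) (auto simp: j_def subspace_scale)
  moreover have "subspace (range (O.quat_map i j))" by (intro linear_subspace_image O.quat_map_linear subspace_UNIV)
  ultimately have "H = range (O.quat_map i j)"
    using subspace_dim_equal[of "range (O.quat_map i j)" H] H O.dim_range_quat_map[OF fr] by simp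
  then show ?thesis using fr quaternion_subalgebra_iff by blast
qed

definition graph_of :: "(quat \<Rightarrow>\<^sub>L quat) \<Rightarrow> octonion set" where "graph_of T = range (\<lambda>x. (x, T x))"

lemma graph_of: "subspace (graph_of T)" "dim (graph_of T) = 4"
proof -
  have l: "linear (\<lambda>x. (x, T x))" by (rule linearI) (simp_all add: blinfun.add_right blinfun.scaleR_right)
  show "subspace (graph_of T)" unfolding graph_of_def by (intro linear_subspace_image l subspace_UNIV)
  show "dim (graph_of T) = 4"
  proof -
    have "inj (\<lambda>x. (x, T x))" by (rule inj_on_inverseI[of _ fst]) (rule fst_conv)
    then have "dim (graph_of T) = dim (UNIV :: quat set)"
      unfolding graph_of_def by (intro dim_image_eq[OF l]) (rule inj_on_subset[OF _ subset_UNIV])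
    then show ?thesis by simp
  qed
qed

lemma product_in_graph:
  "omul (qi, s) (qj, t) = (qk - qmul (qcnj t) s, qmul t qi - qmul s qj)"
  by (simp add: omul.simps qijk)

text \<open>The product of \<open>(i, T i)\<close> and \<open>(j, T j)\<close> has a first component whose coefficient at \<open>k\<close> is positive by
  hypothesis, so the condition that the product lies on the graph can be solved for \<open>T k\<close>.\<close>

lemma graph_slope:
  fixes T :: "quat \<Rightarrow>\<^sub>L quat"
  assumes g: "gam (T qi) (T qj) < 1" and one: "T qone = 0"
  shows "T (qk - qmul (qcnj (T qj)) (T qi)) = qmul (T qj) qi - qmul (T qi) qj \<longleftrightarrow> T qk = slope_k (T qi) (T qj)"
proof -
  let ?s = "T qi" and ?t = "T qj"
  let ?p = "qmul (qcnj ?t) ?s"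
  have "T ?p = (?p \<bullet> qi) *\<^sub>R ?s + (?p \<bullet> qj) *\<^sub>R ?t + gam ?s ?t *\<^sub>R T qk"
    by (subst quat_expand') (simp add: blinfun.add_right blinfun.scaleR_right one gam_def)
  then have e: "T (qk - ?p) = (1 - gam ?s ?t) *\<^sub>R T qk - ((?p \<bullet> qi) *\<^sub>R ?s + (?p \<bullet> qj) *\<^sub>R ?t)"
    by (simp add: blinfun.diff_right algebra_simps)
  have "T (qk - ?p) = qmul ?t qi - qmul ?s qj \<longleftrightarrow>
      (1 - gam ?s ?t) *\<^sub>R T qk = qmul ?t qi - qmul ?s qj + (?p \<bullet> qi) *\<^sub>R ?s + (?p \<bullet> qj) *\<^sub>R ?t"
    unfolding e by (simp only: diff_eq_eq add.assoc)
  also have "\<dots> \<longleftrightarrow> T qk = slope_k ?s ?t"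
  proof
    assume "(1 - gam ?s ?t) *\<^sub>R T qk = qmul ?t qi - qmul ?s qj + (?p \<bullet> qi) *\<^sub>R ?s + (?p \<bullet> qj) *\<^sub>R ?t"
    from arg_cong[OF this, of "\<lambda>v. (1 / (1 - gam ?s ?t)) *\<^sub>R v"] show "T qk = slope_k ?s ?t"
      using g by (simp only: slope_k_def scaleR_scaleR) simp
  next
    assume "T qk = slope_k ?s ?t"
    then show "(1 - gam ?s ?t) *\<^sub>R T qk = qmul ?t qi - qmul ?s qj + (?p \<bullet> qi) *\<^sub>R ?s + (?p \<bullet> qj) *\<^sub>R ?t"
      using g by (simp only: slope_k_def scaleR_scaleR) simp
  qed
  finally show ?thesis .
qed

lemma graph_subalgebra:
  fixes T :: "quat \<Rightarrow>\<^sub>L quat"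
  assumes g: "gam (T qi) (T qj) < 1"
  shows "quaternion_subalgebra (graph_of T) \<longleftrightarrow> T qone = 0 \<and> T qk = slope_k (T qi) (T qj)"
proof
  assume H: "quaternion_subalgebra (graph_of T)"
  note f = quaternion_subalgebra_facts[OF H]
  have one: "T qone = 0" using f(3) by (auto simp: graph_of_def oone_def)
  have "omul (qi, T qi) (qj, T qj) \<in> graph_of T" by (rule f(4)) (auto simp: graph_of_def)
  then have "T (qk - qmul (qcnj (T qj)) (T qi)) = qmul (T qj) qi - qmul (T qi) qj"
    unfolding product_in_graph by (auto simp: graph_of_def)
  then show "T qone = 0 \<and> T qk = slope_k (T qi) (T qj)" using graph_slope[of T, OF g one] one by blast
next
  assume T: "T qone = 0 \<and> T qk = slope_k (T qi) (T qj)"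
  then have p: "T (qk - qmul (qcnj (T qj)) (T qi)) = qmul (T qj) qi - qmul (T qi) qj"
    using graph_slope[of T, OF g] by blast
  show "quaternion_subalgebra (graph_of T)"
  proof (rule quaternion_subalgebra_generated[OF graph_of, of _ "(qi, T qi)" "(qj, T qj)"])
    show "oone \<in> graph_of T" using T by (auto simp: graph_of_def oone_def intro!: image_eqI[of _ _ qone])
    show "(qi, T qi) \<in> graph_of T" "(qj, T qj) \<in> graph_of T" by (auto simp: graph_of_def)
    show "(qi, T qi) \<bullet> oone = 0" "(qj, T qj) \<bullet> oone = 0" by (simp_all add: oone_def qijk)
    show "(qi, T qi) \<noteq> 0" by (auto simp: qi_def zero_prod_def)
    show "(qj, T qj) \<noteq> c *\<^sub>R (qi, T qi)" for c by (auto simp: qi_def qj_def)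
    show "omul (qi, T qi) (qj, T qj) \<in> graph_of T"
      unfolding product_in_graph p[symmetric] by (auto simp: graph_of_def)
  qed
qed

definition projects_onto :: "(octonion \<Rightarrow>\<^sub>L octonion) \<Rightarrow> octonion set \<Rightarrow> bool" where
  "projects_onto P H \<longleftrightarrow> (\<forall>x. P x \<in> H \<and> (\<forall>y\<in>H. (x - P x) \<bullet> y = 0))"

lemma projects_onto_fix: assumes "subspace H" "projects_onto P H" "h \<in> H" shows "P h = h"
proof -
  have "P h \<in> H" using assms(2) unfolding projects_onto_def by blast
  then have "h - P h \<in> H" by (rule subspace_diff[OF assms(1,3)])
  then have "(h - P h) \<bullet> (h - P h) = 0" using assms(2) unfolding projects_onto_def by blast
  then show ?thesis by simp
qed

lemma projects_onto_graph:
  assumes i: "P11 P \<in> invertible_op" and H: "subspace H" "dim H = 4" and P: "projects_onto P H"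
  shows "H = graph_of (slope P)"
proof -
  have "graph_of (slope P) \<subseteq> H"
  proof
    fix x assume "x \<in> graph_of (slope P)"
    then obtain h where x: "x = (h, slope P h)" by (auto simp: graph_of_def)
    let ?u = "op_inv (P11 P) h"
    have "P11 P ?u = h" using op_inv(1)[OF i] by (metis blinfun_apply_blinfun_compose id_blinfun.rep_eq)
    then have "P (?u, 0) = x" unfolding apply_blocks x by (simp add: slope_def)
    then show "x \<in> H" using P unfolding projects_onto_def by metis
  qed
  then show ?thesis using subspace_dim_equal[of "graph_of (slope P)" H] graph_of[of "slope P"] H by simp
qed

text \<open>The orthogonal projection onto the graph of \<open>T\<close> has the blocks \<open>A\<close>, \<open>A T*\<close>, \<open>T A\<close> and
  \<open>T A T*\<close> with \<open>A = (1 + T* T)\<close> inverted.\<close>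

lemma graph_projection:
  fixes T :: "quat \<Rightarrow>\<^sub>L quat"
  assumes i: "P11 P \<in> invertible_op" and T: "T = slope P"
  shows "projects_onto P (graph_of T) \<longleftrightarrow>
    (id_blinfun + (op_adj T o\<^sub>L T)) o\<^sub>L P11 P = id_blinfun \<and> P12 P = P11 P o\<^sub>L op_adj T \<and> P22 P = P21 P o\<^sub>L op_adj T"
    (is "_ \<longleftrightarrow> ?M o\<^sub>L ?A = _ \<and> _ \<and> _")
proof
  have C: "P21 P u = T (P11 P u)" for u using slope_comp[OF i] unfolding T by (metis blinfun_apply_blinfun_compose)
  {
    assume P: "projects_onto P (graph_of T)"
    have m: "snd (P x) = T (fst (P x))" for x
    proof -
      have "P x \<in> graph_of T" using P unfolding projects_onto_def by blast
      then obtain h where "P x = (h, T h)" unfolding graph_of_def by blast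
      then show ?thesis by simp
    qed
    have o: "(x - P x) \<bullet> (h, T h) = 0" for x h using P unfolding projects_onto_def graph_of_def by blast
    have D: "P22 P w = T (P12 P w)" for w using m[of "(0, w)"] by (simp add: apply_blocks)
    have MA: "?M o\<^sub>L ?A = id_blinfun"
    proof (rule blinfun_eqI, rule vector_eq_ldot[THEN iffD1], rule allI)
      fix u h
      show "h \<bullet> (?M o\<^sub>L ?A) u = h \<bullet> id_blinfun u"
        using o[of "(u, 0)" h] by (simp add: apply_blocks C blinfun.add_left inner_add inner_diff op_adj inner_commute)
    qed
    have MB: "?M o\<^sub>L P12 P = op_adj T"
    proof (rule blinfun_eqI, rule vector_eq_ldot[THEN iffD1], rule allI)
      fix w h
      show "h \<bullet> (?M o\<^sub>L P12 P) w = h \<bullet> op_adj T w"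
        using o[of "(0, w)" h] by (simp add: apply_blocks D blinfun.add_left inner_add inner_diff op_adj inner_commute)
    qed
    have "op_inv ?M = ?A" using op_inv_cancel(2)[OF one_plus_invertible, of T ?A] MA by simp
    then have B: "P12 P = ?A o\<^sub>L op_adj T" using op_inv_cancel(2)[OF one_plus_invertible, of T "P12 P"] MB by simp
    have "P22 P = P21 P o\<^sub>L op_adj T" by (rule blinfun_eqI) (simp add: D B C)
    with MA B show "?M o\<^sub>L ?A = id_blinfun \<and> P12 P = ?A o\<^sub>L op_adj T \<and> P22 P = P21 P o\<^sub>L op_adj T" by blast
  }
  assume *: "?M o\<^sub>L ?A = id_blinfun \<and> P12 P = ?A o\<^sub>L op_adj T \<and> P22 P = P21 P o\<^sub>L op_adj T"
  have M: "P11 P v + op_adj T (T (P11 P v)) = v" for v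
    using arg_cong[OF conjunct1[OF *], of "\<lambda>F. blinfun_apply F v"] by (simp add: blinfun.add_left)
  have Puw: "P (u, w) = (P11 P (u + op_adj T w), T (P11 P (u + op_adj T w)))" for u w
    using * by (simp add: apply_blocks C blinfun.add_right)
  show "projects_onto P (graph_of T)"
    unfolding projects_onto_def
  proof (intro allI conjI ballI)
    fix x :: octonion
    obtain u w where x: "x = (u, w)" by (cases x)
    show "P x \<in> graph_of T" unfolding x Puw graph_of_def by blast
    fix y assume "y \<in> graph_of T"
    then obtain h where y: "y = (h, T h)" by (auto simp: graph_of_def)
    define v where "v = u + op_adj T w"
    have "h \<bullet> (P11 P v + op_adj T (T (P11 P v))) = h \<bullet> v" by (simp add: M)
    then have "h \<bullet> P11 P v + T h \<bullet> T (P11 P v) = h \<bullet> u + T h \<bullet> w"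
      by (simp add: inner_add op_adj v_def)
    then show "(x - P x) \<bullet> y = 0"
      unfolding x Puw y v_def[symmetric] by (simp add: inner_diff inner_commute)
  qed
qed

lemma chart_image:
  assumes P: "P \<in> gr_dom"
  shows "P \<in> orthogonal_projections {H. quaternion_subalgebra H} \<longleftrightarrow> chart P \<in> gr_lin"
proof -
  have i: "P11 P \<in> invertible_op" and g: "gam (slope P qi) (slope P qj) < 1" using P by (auto simp: gr_dom_def)
  let ?T = "slope P"
  have "P \<in> orthogonal_projections {H. quaternion_subalgebra H} \<longleftrightarrow> (\<exists>H. quaternion_subalgebra H \<and> projects_onto P H)"
    unfolding orthogonal_projections_def projects_onto_def by blast
  also have "\<dots> \<longleftrightarrow> quaternion_subalgebra (graph_of ?T) \<and> projects_onto P (graph_of ?T)"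
    using projects_onto_graph[OF i] quaternion_subalgebra_facts(1,2) by metis
  also have "\<dots> \<longleftrightarrow> chart P \<in> gr_lin"
    unfolding graph_subalgebra[of ?T, OF g] graph_projection[OF i refl]
    by (auto simp: gr_lin_def chart_def Let_def blinfun.diff_left rank_k_values)
  finally show ?thesis .
qed

text \<open>Octonion automorphisms act on the set of quaternion subalgebras; it suffices to find a chart near the
  standard one.\<close>

lemma transport_projection:
  assumes \<alpha>: "linear \<alpha>" "\<And>x y. \<alpha> x \<bullet> \<alpha> y = x \<bullet> y" and \<beta>: "linear \<beta>" "\<And>x. \<beta> (\<alpha> x) = x" "\<And>x. \<alpha> (\<beta> x) = x"
    and mult: "\<And>x y. \<beta> (omul x y) = omul (\<beta> x) (\<beta> y)" "\<beta> oone = oone"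
    and K: "quaternion_subalgebra K" "projects_onto X K"
  shows "quaternion_subalgebra (\<beta> ` K)" "projects_onto (block (Blinfun \<beta>) X (Blinfun \<alpha>)) (\<beta> ` K)"
proof -
  obtain f where f: "linear f" "inj f" "f qone = oone" "\<And>x y. f (qmul x y) = omul (f x) (f y)" "K = range f"
    using K(1) unfolding quaternion_subalgebra_def by blast
  have "inj \<beta>" using \<beta>(3) by (rule inj_on_inverseI)
  then show "quaternion_subalgebra (\<beta> ` K)"
    unfolding quaternion_subalgebra_def
    by (intro exI[of _ "\<beta> \<circ> f"] conjI linear_compose f(1) \<beta>(1) inj_compose f(2)) (auto simp: f mult image_image)
  have app: "blinfun_apply (Blinfun \<alpha>) = \<alpha>" "blinfun_apply (Blinfun \<beta>) = \<beta>"
    using \<alpha>(1) \<beta>(1) by (simp_all add: bounded_linear_Blinfun_apply linear_imp_bounded)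
  show "projects_onto (block (Blinfun \<beta>) X (Blinfun \<alpha>)) (\<beta> ` K)"
    unfolding projects_onto_def block_apply app
  proof (intro allI conjI ballI)
    fix x
    show "\<beta> (X (\<alpha> x)) \<in> \<beta> ` K" using K(2) unfolding projects_onto_def by blast
    fix y assume "y \<in> \<beta> ` K"
    then obtain k where k: "k \<in> K" "y = \<beta> k" by blast
    have "(x - \<beta> (X (\<alpha> x))) \<bullet> y = \<alpha> (x - \<beta> (X (\<alpha> x))) \<bullet> \<alpha> y" by (simp only: \<alpha>(2))
    also have "\<dots> = (\<alpha> x - X (\<alpha> x)) \<bullet> k" by (simp only: k(2) linear_diff[OF \<alpha>(1)] \<beta>(3))
    also have "\<dots> = 0" using K(2) k(1) unfolding projects_onto_def by blast
    finally show "(x - \<beta> (X (\<alpha> x))) \<bullet> y = 0" .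
  qed
qed

theorem quaternion_grassmannian: "smooth_submanifold 8 (orthogonal_projections {H. quaternion_subalgebra H})"
  unfolding smooth_submanifold_def
proof
  let ?S = "orthogonal_projections {H. quaternion_subalgebra H}"
  have S: "X \<in> ?S \<longleftrightarrow> (\<exists>H. quaternion_subalgebra H \<and> projects_onto X H)" for X
    unfolding orthogonal_projections_def projects_onto_def by blast
  fix P assume "P \<in> ?S"
  then obtain H where H: "quaternion_subalgebra H" "projects_onto P H" unfolding S by blast
  obtain i j where fr: "O.quat_frame i j" and Hij: "H = range (O.quat_map i j)" using H(1) quaternion_subalgebra_iff by blast
  have d8: "DIM(octonion) = 8" by simp
  obtain \<alpha> where \<alpha>: "linear \<alpha>" "bij \<alpha>" "\<And>x y. \<alpha> x \<bullet> \<alpha> y = x \<bullet> y" "\<And>x y. \<alpha> (omul x y) = omul (\<alpha> x) (\<alpha> y)"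
    "\<alpha> oone = oone" "\<And>p. \<alpha> (p, 0) = O.quat_map i j p"
  proof (rule O.oct_map_exists[OF fr d8])
    fix \<alpha> :: "octonion \<Rightarrow> octonion"
    assume "linear \<alpha>" "bij \<alpha>" "\<And>x y. \<alpha> x \<bullet> \<alpha> y = x \<bullet> y" "\<And>x y. \<alpha> (omul x y) = omul (\<alpha> x) (\<alpha> y)"
      "\<alpha> oone = oone" "\<And>p. \<alpha> (p, 0) = O.quat_map i j p"
    from that[OF this] show thesis .
  qed
  define \<beta> where "\<beta> = inv_into UNIV \<alpha>"
  have inv: "\<beta> (\<alpha> x) = x" "\<alpha> (\<beta> x) = x" for x
    using \<alpha>(2) by (simp_all add: \<beta>_def bij_is_inj bij_is_surj surj_f_inv_f)
  have \<beta>: "linear \<beta>" unfolding \<beta>_def by (rule linear_inv_into[OF \<alpha>(1,2)])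
  have \<beta>i: "\<beta> x \<bullet> \<beta> y = x \<bullet> y" for x y using \<alpha>(3)[of "\<beta> x" "\<beta> y"] by (simp add: inv)
  have \<beta>m: "\<beta> (omul x y) = omul (\<beta> x) (\<beta> y)" for x y using \<alpha>(4)[of "\<beta> x" "\<beta> y"] inv by metis
  have \<beta>1: "\<beta> oone = oone" using inv(1)[of oone] \<alpha>(5) by simp
  let ?a = "Blinfun \<alpha>" and ?b = "Blinfun \<beta>"
  have app: "blinfun_apply ?a = \<alpha>" "blinfun_apply ?b = \<beta>"
    using \<alpha>(1) \<beta> by (simp_all add: bounded_linear_Blinfun_apply linear_imp_bounded)
  define c where "c X = block ?b X ?a" for X
  define c' where "c' X = block ?a X ?b" for X
  have cc: "c (c' X) = X" "c' (c X) = X" for X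
    by (rule blinfun_eqI, simp add: c_def c'_def block_apply app inv)+
  have cl: "bounded_linear c" "bounded_linear c'" unfolding c_def c'_def by (rule block_bounded_linear)+
  have cS: "X \<in> ?S \<Longrightarrow> c X \<in> ?S" for X
    unfolding S c_def using transport_projection[OF \<alpha>(1,3) \<beta> inv \<beta>m \<beta>1] by blast
  have c'S: "X \<in> ?S \<Longrightarrow> c' X \<in> ?S" for X
    unfolding S c'_def using transport_projection[OF \<beta> \<beta>i \<alpha>(1) inv(2,1) \<alpha>(4,5)] by blast
  define U where "U = c -` gr_dom"
  have oU: "open U" unfolding U_def by (rule open_vimage[OF open_gr(1) linear_continuous_on[OF cl(1)]])
  have cP: "c P (p, 0) = (p, 0)" for p
  proof (rule projects_onto_fix)
    show "projects_onto (c P) (\<beta> ` H)"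
      unfolding c_def by (rule transport_projection(2)[OF \<alpha>(1,3) \<beta> inv \<beta>m \<beta>1 H])
    show "subspace (\<beta> ` H)" by (rule linear_subspace_image[OF \<beta> quaternion_subalgebra_facts(1)[OF H(1)]])
    have "\<beta> (O.quat_map i j p) = (p, 0)" using inv(1)[of "(p, 0)"] \<alpha>(6)[of p] by simp
    then show "(p, 0) \<in> \<beta> ` H" unfolding Hij by (metis imageI rangeI)
  qed
  have "P11 (c P) = id_blinfun" "P21 (c P) = 0" by (rule blinfun_eqI, simp add: block_apply cP)+
  then have "c P \<in> gr_dom"
    using op_inv_unique(1)[of id_blinfun id_blinfun]
    by (simp add: gr_dom_def slope_def gam_def bounded_bilinear.zero_left[OF bounded_bilinear_blinfun_compose])
  then have PU: "P \<in> U" by (simp add: U_def)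
  have s1: "smooth_on U (\<lambda>X. chart (c X))"
    by (rule smooth_on_precompose[OF open_gr(1) oU cl(1) _ smooth_chart]) (simp add: U_def)
  have s2: "smooth_on gr_img (\<lambda>Y. c' (unchart Y))"
    by (rule smooth_on_linear[OF open_gr(2) cl(2) smooth_unchart])
  have UV: "chart (c X) \<in> gr_img" "c' (unchart (chart (c X))) = X" if "X \<in> U" for X
    using unchart_chart[of "c X"] that by (simp_all add: U_def cc)
  have VU: "c' (unchart Y) \<in> U" "chart (c (c' (unchart Y))) = Y" if "Y \<in> gr_img" for Y
    using chart_unchart[OF that] by (simp_all add: U_def cc)
  have hom: "homeomorphism U gr_img (\<lambda>X. chart (c X)) (\<lambda>Y. c' (unchart Y))"
    by (rule homeomorphismI) (use s1 s2 UV VU in \<open>auto intro: smooth_on_imp_continuous_on\<close>)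
  have img: "(\<lambda>X. chart (c X)) ` (U \<inter> ?S) = gr_img \<inter> gr_lin"
  proof (intro equalityI subsetI)
    fix Y assume "Y \<in> (\<lambda>X. chart (c X)) ` (U \<inter> ?S)"
    then obtain X where X: "X \<in> U" "X \<in> ?S" "Y = chart (c X)" by blast
    then show "Y \<in> gr_img \<inter> gr_lin" using UV(1)[of X] chart_image[of "c X"] cS[of X] by (simp add: U_def)
  next
    fix Y assume Y: "Y \<in> gr_img \<inter> gr_lin"
    then have "unchart Y \<in> ?S" using chart_image[of "unchart Y"] chart_unchart[of Y] by simp
    then show "Y \<in> (\<lambda>X. chart (c X)) ` (U \<inter> ?S)"
      using VU[of Y] Y c'S by (intro image_eqI[of _ _ "c' (unchart Y)"]) auto
  qed
  show "\<exists>U V \<Phi> \<Psi> L. open U \<and> P \<in> U \<and> open V \<and> homeomorphism U V \<Phi> \<Psi> \<and> smooth_on U \<Phi> \<and> smooth_on V \<Psi> \<and>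
       subspace (L :: (octonion \<Rightarrow>\<^sub>L octonion) set) \<and> dim L = 8 \<and> \<Phi> ` (U \<inter> ?S) = V \<inter> L"
    using oU PU open_gr(2) hom s1 s2 gr_lin img
    by - (rule exI[of _ U], rule exI[of _ gr_img], rule exI[of _ "\<lambda>X. chart (c X)"],
        rule exI[of _ "\<lambda>Y. c' (unchart Y)"], rule exI[of _ gr_lin], intro conjI)
qed

section \<open>Families of copies of SL(2,H)\<close>

context octonion_coordinates
begin

lemma orbit_base_eq:
  assumes \<iota>: "octonion_identification cp cm \<phi>1m \<phi>2p \<iota>" and H: "\<And>m. \<iota> m \<in> H \<longleftrightarrow> km m \<in> H0"
  shows "Spin51 cp cm \<phi>1m \<phi>2p \<iota> H = G"
    and "orbit_base cp cm \<phi>1m \<phi>2p \<iota> H = {act h (mat 1) (base_point \<phi>1m \<phi>2p) |h. h \<in> G}"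
proof -
  have lin: "linear \<iota>" and u: "\<iota> \<phi>1m = oone" and nrm: "\<And>x. norm (\<iota> x) = norm x"
    using \<iota> by (auto simp: octonion_identification_def)
  have "R51 cp \<phi>1m \<phi>2p \<iota> H = W"
    by (rule R51_eq[OF lin norm_preserving_inner[OF lin nrm] u H])
  then show "Spin51 cp cm \<phi>1m \<phi>2p \<iota> H = G" by (simp only: Spin51_def G_def)
  then show "orbit_base cp cm \<phi>1m \<phi>2p \<iota> H = {act h (mat 1) (base_point \<phi>1m \<phi>2p) |h. h \<in> G}"
    by (simp only: orbit_base_def)
qed

text \<open>The orbit remembers the subalgebra: its points whose first column is that of the base point and
  whose last entry is 1 have an arbitrary element of the subalgebra as remaining entry.\<close>

lemma unipotent_in_orbit:
  "((\<phi>1m, 0), (m, \<phi>2p)) \<in> {act h (mat 1) (base_point \<phi>1m \<phi>2p) |h. h \<in> G} \<longleftrightarrow> km m \<in> H0"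
proof -
  have "spin_det cp ((\<phi>1m, 0), (m, \<phi>2p)) = 1"
    unfolding spin_det_coordinates by (simp add: km_unit kp_unit linear_0[OF kp_linear] O.mult_zero_left)
  moreover have "snd oone = 0" by (simp add: oone_def)
  then have "quat_entries ((\<phi>1m, 0), (m, \<phi>2p)) \<longleftrightarrow> km m \<in> H0"
    by (simp add: quat_entries_def km_unit kp_unit linear_0[OF kp_linear] H0_iff)
  ultimately show ?thesis unfolding orbit_eq by simp
qed

end

context half_spin
begin

lemma orbit_base_copy:
  assumes n: "norm \<phi>1m = 1" "norm \<phi>2p = 1" and \<iota>: "octonion_identification cp cm \<phi>1m \<phi>2p \<iota>"
    and H: "quaternion_subalgebra H" and g: "g \<in> Spin91 cp cm" and A: "det A = 1"
  defines "N \<equiv> act g A ` orbit_base cp cm \<phi>1m \<phi>2p \<iota> H"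
    and "K \<equiv> conjugate_group g (Spin51 cp cm \<phi>1m \<phi>2p \<iota> H)"
  shows "act g A (base_point \<phi>1m \<phi>2p) \<in> N \<and> smooth_submanifold 15 N \<and> SL2H_copy cp cm K N \<and>
      totally_geodesic (SL2O cp) (SL2O_metric cp) N"
proof -
  obtain km where oc: "octonion_coordinates cp cm km (\<lambda>p. km (- cm (sp \<phi>1m \<phi>2p) p)) (\<lambda>x. km (- cm (sp \<phi>1m \<phi>2p) (cp x \<phi>1m))) \<phi>1m \<phi>2p"
    and km: "\<And>m. \<iota> m \<in> H \<longleftrightarrow> km m \<in> H0"
    using adapted_coordinates[OF n \<iota> H] by blast
  interpret C: octonion_coordinates cp cm km "\<lambda>p. km (- cm (sp \<phi>1m \<phi>2p) p)" "\<lambda>x. km (- cm (sp \<phi>1m \<phi>2p) (cp x \<phi>1m))" \<phi>1m \<phi>2p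
    by (rule oc)
  have N: "N = C.orb g A" and K: "K = conjugate_group g C.G"
    unfolding N_def K_def C.orb_def[OF g A] C.orbit_base_eq[OF \<iota> km] by (rule refl)+
  show ?thesis
    unfolding N K using C.orb_point[OF g A] C.orb_submanifold[OF g A] C.orb_copy[OF g A] C.orb_totally_geodesic[OF g A] by blast
qed

lemma unipotent_in_orbit_base:
  assumes n: "norm \<phi>1m = 1" "norm \<phi>2p = 1" and \<iota>: "octonion_identification cp cm \<phi>1m \<phi>2p \<iota>"
    and H: "quaternion_subalgebra H"
  shows "((\<phi>1m, 0), (m, \<phi>2p)) \<in> orbit_base cp cm \<phi>1m \<phi>2p \<iota> H \<longleftrightarrow> \<iota> m \<in> H"
proof -
  obtain km where oc: "octonion_coordinates cp cm km (\<lambda>p. km (- cm (sp \<phi>1m \<phi>2p) p)) (\<lambda>x. km (- cm (sp \<phi>1m \<phi>2p) (cp x \<phi>1m))) \<phi>1m \<phi>2p"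
    and km: "\<And>m. \<iota> m \<in> H \<longleftrightarrow> km m \<in> H0"
    using adapted_coordinates[OF n \<iota> H] by blast
  interpret C: octonion_coordinates cp cm km "\<lambda>p. km (- cm (sp \<phi>1m \<phi>2p) p)" "\<lambda>x. km (- cm (sp \<phi>1m \<phi>2p) (cp x \<phi>1m))" \<phi>1m \<phi>2p
    by (rule oc)
  show ?thesis unfolding C.orbit_base_eq(2)[OF \<iota> km] C.unipotent_in_orbit by (simp only: km)
qed

lemma inj_on_orbits:
  assumes n: "norm \<phi>1m = 1" "norm \<phi>2p = 1" and \<iota>: "octonion_identification cp cm \<phi>1m \<phi>2p \<iota>"
    and g: "g \<in> Spin91 cp cm" and A: "det A = 1"
  shows "inj_on (\<lambda>H. act g A ` orbit_base cp cm \<phi>1m \<phi>2p \<iota> H) {H. quaternion_subalgebra H}"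
proof (rule inj_onI)
  fix H H' assume "H \<in> {H. quaternion_subalgebra H}" "H' \<in> {H. quaternion_subalgebra H}"
    and eq: "act g A ` orbit_base cp cm \<phi>1m \<phi>2p \<iota> H = act g A ` orbit_base cp cm \<phi>1m \<phi>2p \<iota> H'"
  then have H: "quaternion_subalgebra H" "quaternion_subalgebra H'" by simp_all
  obtain T where "\<And>\<rho>. T (act g A \<rho>) = \<rho>" using act_SL2R(3)[OF g A] by blast
  then have "inj (act g A)" by (rule inj_on_inverseI)
  with eq have e: "orbit_base cp cm \<phi>1m \<phi>2p \<iota> H = orbit_base cp cm \<phi>1m \<phi>2p \<iota> H'" by (simp only: inj_image_eq_iff)
  have "\<iota> m \<in> H \<longleftrightarrow> \<iota> m \<in> H'" for m
    unfolding unipotent_in_orbit_base[OF n \<iota> H(1), symmetric] unipotent_in_orbit_base[OF n \<iota> H(2), symmetric] e by (rule refl)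
  moreover have "surj \<iota>" using \<iota> by (simp add: octonion_identification_def bij_def)
  ultimately show "H = H'" by (metis subsetI subset_antisym surjD)
qed

end

theorem proposition5:
  fixes cp :: "real^8 \<Rightarrow> 'm::euclidean_space \<Rightarrow> 'p::euclidean_space"
    and cm :: "real^8 \<Rightarrow> 'p \<Rightarrow> 'm"
    and \<phi>1m :: 'm and \<phi>2p :: 'p
    and \<iota> :: "'m \<Rightarrow> octonion"
  assumes "half_spin_clifford cp cm"
    and "norm \<phi>1m = 1" and "norm \<phi>2p = 1"
    and "octonion_identification cp cm \<phi>1m \<phi>2p \<iota>"
  shows "smooth_submanifold 8 (orthogonal_projections {H. quaternion_subalgebra H}) \<and>
    (\<forall>\<rho>\<in>SL2O cp.
      (\<exists>g\<in>Spin91 cp cm. \<exists>A. det A = 1 \<and> act g A (base_point \<phi>1m \<phi>2p) = \<rho>) \<and>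
      (\<forall>g\<in>Spin91 cp cm. \<forall>A. det A = 1 \<and> act g A (base_point \<phi>1m \<phi>2p) = \<rho> \<longrightarrow>
        (\<forall>H. quaternion_subalgebra H \<longrightarrow>
          (let N = act g A ` orbit_base cp cm \<phi>1m \<phi>2p \<iota> H;
               K = conjugate_group g (Spin51 cp cm \<phi>1m \<phi>2p \<iota> H)
           in \<rho> \<in> N \<and> smooth_submanifold 15 N \<and> SL2H_copy cp cm K N \<and>
              totally_geodesic (SL2O cp) (SL2O_metric cp) N)) \<and>
        inj_on (\<lambda>H. act g A ` orbit_base cp cm \<phi>1m \<phi>2p \<iota> H) {H. quaternion_subalgebra H}))"
proof (intro conjI ballI allI impI)
  interpret half_spin cp cm by (rule half_spin.intro[OF assms(1)])
  note n = assms(2,3) and \<iota> = assms(4)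
  show "smooth_submanifold 8 (orthogonal_projections {H. quaternion_subalgebra H})"
    by (rule quaternion_grassmannian)
  fix \<rho> assume "\<rho> \<in> SL2O cp"
  then have "spin_det cp \<rho> = 1" by (simp add: SL2O_def)
  from transitive[OF n this] show "\<exists>g\<in>Spin91 cp cm. \<exists>A. det A = 1 \<and> act g A (base_point \<phi>1m \<phi>2p) = \<rho>"
    unfolding reachable_def[OF n] .
  fix g and A :: "real^2^2"
  assume g: "g \<in> Spin91 cp cm" and A: "det A = 1 \<and> act g A (base_point \<phi>1m \<phi>2p) = \<rho>"
  show "inj_on (\<lambda>H. act g A ` orbit_base cp cm \<phi>1m \<phi>2p \<iota> H) {H. quaternion_subalgebra H}"
    by (rule inj_on_orbits[OF n \<iota> g conjunct1[OF A]])
  fix H assume H: "quaternion_subalgebra H"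
  show "let N = act g A ` orbit_base cp cm \<phi>1m \<phi>2p \<iota> H; K = conjugate_group g (Spin51 cp cm \<phi>1m \<phi>2p \<iota> H)
      in \<rho> \<in> N \<and> smooth_submanifold 15 N \<and> SL2H_copy cp cm K N \<and> totally_geodesic (SL2O cp) (SL2O_metric cp) N"
    using orbit_base_copy[OF n \<iota> H g conjunct1[OF A]] unfolding conjunct2[OF A] Let_def .
qed

end
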